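(* Let $d\ge5$, and let $\mathfrak F$ be the (oriented) wired uniform spanning forest of the hypercubic lattice $\mathbb Z^d$, with $\mathfrak P(0)$ denoting the past of the origin in $\mathfrak F$. Then there exist constants $0<c\le C<\infty$, depending only on $d$, such that for every $R\ge1$, $$cR^{-2}\le\mathbb P\bigl(\mathrm{diam}_{\mathrm{ext}}(\mathfrak P(0))\ge R\bigr)\le CR^{-2}.$$
   Context: Here $\mathbb Z^d$ is the nearest-neighbour lattice with unit conductances. Wired uniform spanning forest (WUSF): let $(V_n)$ be an increasing sequence of finite sets of vertices with union $\mathbb Z^d$, and let $G_n^*$ be obtained from $\mathbb Z^d$ by contracting the complement of $V_n$ to a single vertex $\partial_n$ and deleting the resulting self-loops at $\partial_n$. Orient the uniformly random spanning tree of $G_n^*$ towards $\partial_n$. The oriented WUSF is the weak limit of these random oriented trees (it exists and does not depend on the exhaustion); almost surely every vertex has exactly one outgoing edge in it. The past $\mathfrak P(v)$ of $v$ is the subgraph of $\mathfrak F$ induced by $v$ together with all vertices $u$ in the same tree as $v$ such that every edge of the path from $u$ to $v$ in $\mathfrak F$ is oriented in the direction of $v$. $\mathrm{diam}_{\mathrm{ext}}(K)$ is the supremal graph distance in $\mathbb Z^d$ between two vertices of $K$. *)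

theory Defs
  imports "HOL-Probability.Probability" "Graph_Theory.Graph_Theory"
begin

text \<open>
  Undirected multigraphs are encoded by digraphs whose arcs are pairs and whose arc set is closed
  under \<^const>\<open>prod.swap\<close>: an undirected edge is a pair \<open>{a, prod.swap a}\<close> of opposite arcs.
  The pair only names the arc; after a contraction the end points of \<open>a\<close> are given by the
  fields \<^const>\<open>tail\<close> and \<^const>\<open>head\<close>, so that parallel edges remain distinct.
\<close>

definition lattice :: "(int ^ 'd, (int ^ 'd) \<times> (int ^ 'd)) pre_digraph" where
  "lattice = \<lparr>verts = UNIV,
              arcs = {(x, y). (\<Sum>i\<in>UNIV. \<bar>x $ i - y $ i\<bar>) = 1},
              tail = fst, head = snd\<rparr>"

definition contract :: "'v set \<Rightarrow> 'v \<Rightarrow> 'v option" where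
  "contract W x = (if x \<in> W then Some x else None)"

text \<open>The vertex \<^const>\<open>None\<close> is the boundary vertex to which the complement of \<open>W\<close> is contracted.
  The arcs with both end points outside \<open>W\<close> are the self-loops that are deleted.\<close>

definition wired :: "('v, 'v \<times> 'v) pre_digraph \<Rightarrow> 'v set \<Rightarrow> ('v option, 'v \<times> 'v) pre_digraph" where
  "wired G W = \<lparr>verts = insert None (Some ` W),
                arcs = {a \<in> arcs G. tail G a \<in> W \<or> head G a \<in> W},
                tail = contract W \<circ> tail G, head = contract W \<circ> head G\<rparr>"

text \<open>The predicate \<^const>\<open>tree\<close> of the imported library forbids all directed cycles and hence the
  closed walk along an arc and back, which is not a cycle of the undirected graph.\<close>

definition undirected_spanning_tree ::
    "('a, 'v \<times> 'v) pre_digraph \<Rightarrow> ('a, 'v \<times> 'v) pre_digraph \<Rightarrow> bool" where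
  "undirected_spanning_tree T G \<longleftrightarrow>
     spanning T G \<and> prod.swap ` arcs T = arcs T \<and> Digraph_Component.connected T \<and>
     \<not> (\<exists>p. pre_digraph.cycle T p \<and> (\<forall>a \<in> set p. prod.swap a \<notin> set p))"

text \<open>An arc of a tree points towards the root \<open>r\<close> iff the path from its tail to \<open>r\<close> starts
  with this arc.\<close>

definition orient_towards :: "'a \<Rightarrow> ('a, 'b) pre_digraph \<Rightarrow> 'b set" where
  "orient_towards r T = {a \<in> arcs T. \<exists>p. pre_digraph.apath T (tail T a) (a # p) r}"

text \<open>A configuration \<open>\<omega>\<close> is the indicator function of a set of oriented edges; the type
  \<open>'v \<times> 'v \<Rightarrow> bool\<close> carries the product topology.\<close>

definition oriented_UST_wired ::
    "('v, 'v \<times> 'v) pre_digraph \<Rightarrow> 'v set \<Rightarrow> ('v \<times> 'v \<Rightarrow> bool) pmf" where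
  "oriented_UST_wired G W =
     map_pmf (\<lambda>T a. a \<in> orient_towards None T)
       (pmf_of_set {T. undirected_spanning_tree T (wired G W)})"

definition exhaustion :: "('v, 'e) pre_digraph \<Rightarrow> (nat \<Rightarrow> 'v set) \<Rightarrow> bool" where
  "exhaustion G V \<longleftrightarrow> (\<forall>n. finite (V n)) \<and> incseq V \<and> (\<Union>n. V n) = verts G"

definition weak_limit :: "(nat \<Rightarrow> 'a::topological_space pmf) \<Rightarrow> 'a measure \<Rightarrow> bool" where
  "weak_limit P M \<longleftrightarrow> prob_space M \<and> sets M = sets borel \<and>
     (\<forall>f :: 'a \<Rightarrow> real. continuous_on UNIV f \<longrightarrow> bounded (range f) \<longrightarrow>
        (\<lambda>n. measure_pmf.expectation (P n) f) \<longlonglongrightarrow> (LINT \<omega>|M. f \<omega>))"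

definition oriented_WUSF ::
    "('v, 'v \<times> 'v) pre_digraph \<Rightarrow> ('v \<times> 'v \<Rightarrow> bool) measure \<Rightarrow> bool" where
  "oriented_WUSF G M \<longleftrightarrow>
     (\<exists>V. exhaustion G V \<and> weak_limit (\<lambda>n. oriented_UST_wired G (V n)) M)"

definition config_graph :: "('v \<times> 'v \<Rightarrow> bool) \<Rightarrow> ('v, 'v \<times> 'v) pre_digraph" where
  "config_graph \<omega> = \<lparr>verts = UNIV, arcs = {a. \<omega> a}, tail = fst, head = snd\<rparr>"

text \<open>The path \<open>p\<close> from \<open>u\<close> to \<open>v\<close> is a path of the underlying undirected graph; its arcs are
  traversed from \<open>u\<close> to \<open>v\<close>, so \<open>set p \<subseteq> arcs F\<close> says that they are all oriented towards \<open>v\<close>.\<close>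

definition past :: "('v, 'v \<times> 'v) pre_digraph \<Rightarrow> 'v \<Rightarrow> ('v, 'v \<times> 'v) pre_digraph" where
  "past F v =
     F \<restriction> {u. \<exists>p. pre_digraph.apath (with_proj (mk_symmetric F)) u p v \<and> set p \<subseteq> arcs F}"

definition graph_dist :: "('v, 'e) pre_digraph \<Rightarrow> 'v \<Rightarrow> 'v \<Rightarrow> ereal" where
  "graph_dist G = wf_digraph.\<mu> G (\<lambda>_. 1)"

definition diam_ext :: "('v, 'e) pre_digraph \<Rightarrow> ('v, 'f) pre_digraph \<Rightarrow> ereal" where
  "diam_ext G K = (SUP u \<in> verts K. SUP v \<in> verts K. graph_dist G u v)"

end

theory Submission
  imports Defs
begin

text \<open>Spanning trees of the wired graph on \<open>W\<close> are the same as acyclic successor functions defined on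
  all of \<open>W\<close>. Deleting the out-edges of the vertices of a path shows that the probability of seeing
  that path is a ratio of forest counts, which increases with the volume and can be compared with
  Green functions.

  Upper bound: given an exploration of the branches that start at the boundary, each path into the
  root survives only if the branches avoid it. In dimension at least five two disjoint branches can
  be placed on either side with positive probability, so the probability that the past has height
  \<open>n\<close> satisfies a decay inequality and is of order \<open>1 / n\<close>. Killing the walk at rate \<open>1 / n\<close>
  gives exponential tails for displacements of paths of length \<open>n\<close>, and a recursion over scales
  turns the bound for the height into \<open>C / R\<^sup>2\<close> for the extrinsic radius.

  Lower bound: by translation invariance of the limiting path probabilities, the expected number of
  descendants of \<open>0\<close> at distance at least \<open>R\<close> and at most \<open>n\<close> generations away equals the expected
  number of the first \<open>n\<close> ancestors of \<open>0\<close> at distance at least \<open>R\<close>, which is of order \<open>R\<^sup>2\<close> when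
  \<open>n\<close> is a large multiple of \<open>R\<^sup>2\<close>; the second moment is of order \<open>n\<^sup>3\<close>.\<close>

section \<open>Paths in successor functions\<close>

text \<open>No random walk is ever constructed: hitting probabilities are expectations over finite
  forests, and harmonicity with a maximum principle replaces the walk. All estimates are uniform in
  the finite volume, with a root outside it; only this uniformity lets a bound be reapplied to the
  forest that is left after a path has been revealed. Two obstacles shape the upper bound. A union
  bound over the vertices of a tall path only shows that the height probability at
  \<open>3 * n\<close> is at most a constant times that at \<open>n\<close>. The branches from the
  boundary supply the missing decay: they destroy a path at a rate that is large when its Green
  energy is small, and above four dimensions the bubble sum is finite, so the energy of a path of
  length \<open>n\<close> is typically of order \<open>n\<close>. The clock of this exploration
  imitates in finite volume the Poisson clock of the interlacement Aldous-Broder algorithm. Second,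
  a plain recursion over scales for the extrinsic radius multiplies the constant at each step; a
  factor exponentially small in \<open>R / sqrt n\<close> in the induction hypothesis pays for
  that.\<close>

definition steps :: "('a \<Rightarrow> 'a option) \<Rightarrow> 'a rel" where
  "steps F = {(v, w). F v = Some w}"

definition leads :: "('a \<Rightarrow> 'a option) \<Rightarrow> 'a \<Rightarrow> 'a \<Rightarrow> bool" where
  "leads F x y \<longleftrightarrow> (x, y) \<in> (steps F)\<^sup>*"

text \<open>The target stays outside the list: it is usually a root, and \<open>set xs\<close> is
  then precisely the set of vertices whose successors the path prescribes.\<close>

fun chain :: "('a \<Rightarrow> 'a option) \<Rightarrow> 'a list \<Rightarrow> 'a \<Rightarrow> bool" where
  "chain F [] u = True"
| "chain F (x # xs) u = (F x = Some (hd (xs @ [u])) \<and> chain F xs u)"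

fun ext :: "('a \<Rightarrow> 'a option) \<Rightarrow> 'a list \<Rightarrow> 'a \<Rightarrow> 'a \<Rightarrow> 'a option" where
  "ext F [] u = F"
| "ext F (x # xs) u = (ext F xs u)(x \<mapsto> hd (xs @ [u]))"

lemma steps_upd: "F y = None \<Longrightarrow> steps (F(y \<mapsto> w)) = insert (y, w) (steps F)"
  by (auto simp: steps_def split: if_splits)

lemma leads_refl [simp, intro]: "leads F x x"
  by (simp add: leads_def)

lemma leads_step: "F x = Some y \<Longrightarrow> leads F y z \<Longrightarrow> leads F x z"
  unfolding leads_def steps_def by (metis (mono_tags, lifting) case_prodI converse_rtrancl_into_rtrancl mem_Collect_eq)

lemma leads_trans: "leads F x y \<Longrightarrow> leads F y z \<Longrightarrow> leads F x z"
  unfolding leads_def by simp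

lemma leads_unfold: "leads F x y \<longleftrightarrow> x = y \<or> (\<exists>z. F x = Some z \<and> leads F z y)"
proof
  assume "leads F x y"
  then show "x = y \<or> (\<exists>z. F x = Some z \<and> leads F z y)"
    unfolding leads_def by (cases rule: converse_rtranclE) (auto simp: steps_def)
qed (auto intro: leads_step)

lemma leads_None: "F x = None \<Longrightarrow> leads F x y \<longleftrightarrow> x = y"
  by (subst leads_unfold) auto

text \<open>Successors are unique, so of two walks from the same vertex one is an initial segment of
  the other. This orders two vertices that lie on a common branch.\<close>

lemma leads_linear: "leads F x y \<Longrightarrow> leads F x z \<Longrightarrow> leads F y z \<or> leads F z y"
  unfolding leads_def
proof (induction arbitrary: z rule: converse_rtrancl_induct)
  case base
  then show ?case by auto
next
  case (step x x')
  from step.prems show ?case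
  proof (cases rule: converse_rtranclE)
    case base
    then show ?thesis using step.hyps by (meson converse_rtrancl_into_rtrancl)
  next
    case (step x'')
    then show ?thesis using \<open>(x, x') \<in> steps F\<close> step.IH unfolding steps_def by auto
  qed
qed

lemma leads_terminal_unique:
  assumes "leads F x u" "leads F x y" "F u = None" "F y = None"
  shows "u = y"
  using leads_linear[OF assms(1,2)] assms(3,4) by (auto simp: leads_None)

text \<open>A walk that uses the new edge may be shortened to use it once: the old walk up to the
  first visit of \<open>y\<close>, the edge, and the old walk after its last use.\<close>

lemma leads_upd:
  assumes "F y = None"
  shows "leads (F(y \<mapsto> w)) x u \<longleftrightarrow> leads F x u \<or> (leads F x y \<and> leads F w u)"
  unfolding leads_def steps_upd[of F, OF assms] by (auto simp: rtrancl_insert)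

lemma chain_append: "chain F (ys @ xs) u \<longleftrightarrow> chain F ys (hd (xs @ [u])) \<and> chain F xs u"
  by (induction ys) (auto simp: hd_append)

lemma chain_snoc: "chain F (xs @ [z]) u \<longleftrightarrow> chain F xs z \<and> F z = Some u"
  by (auto simp: chain_append)

lemma chain_leads_hd: "chain F xs u \<Longrightarrow> leads F (hd (xs @ [u])) u"
  by (induction xs) (auto intro: leads_step)

lemma chain_leads: "chain F xs u \<Longrightarrow> x \<in> set xs \<Longrightarrow> leads F x u"
proof (induction xs)
  case (Cons a xs)
  then show ?case using chain_leads_hd[of F xs u] leads_step[of F a] by auto
qed simp

lemma leads_chainE:
  assumes "leads F x u"
  obtains xs where "chain F xs u" "hd (xs @ [u]) = x"
proof -
  from assms have "\<exists>xs. chain F xs u \<and> hd (xs @ [u]) = x"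
    unfolding leads_def
  proof (induction rule: converse_rtrancl_induct)
    case base
    then show ?case by (intro exI[of _ "[]"]) auto
  next
    case (step y z)
    then obtain xs where "chain F xs u" "hd (xs @ [u]) = z" by blast
    then show ?case using step.hyps by (intro exI[of _ "y # xs"]) (auto simp: steps_def)
  qed
  then show ?thesis using that by blast
qed

text \<open>The start determines the walk, and the missing successor of \<open>u\<close> determines
  where it stops. Hence in a sum of indicators \<open>chain F xs u\<close> over paths with a common
  start at most one term is nonzero.\<close>

lemma chain_unique:
  assumes "F u = None" "chain F xs u" "chain F ys u" "hd (xs @ [u]) = hd (ys @ [u])"
  shows "xs = ys"
  using assms(2-)
proof (induction xs arbitrary: ys)
  case Nil
  show ?case
  proof (cases ys)
    case (Cons y zs)
    with Nil have "F u = Some (hd (zs @ [u]))" by simp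
    with assms(1) show ?thesis by simp
  qed simp
next
  case (Cons x xs)
  show ?case
  proof (cases ys)
    case Nil
    with Cons.prems have "F u = Some (hd (xs @ [u]))" by simp
    with assms(1) show ?thesis by simp
  next
    case ys: (Cons y zs)
    then have "x = y" and "hd (xs @ [u]) = hd (zs @ [u])" using Cons.prems by simp_all
    then show ?thesis using Cons.IH[of zs] Cons.prems ys by simp
  qed
qed

lemma acyclic_leads:
  assumes "acyclic (steps F)" "F x = Some z"
  shows "\<not> leads F z x"
proof
  assume "leads F z x"
  with assms(2) have "(x, x) \<in> (steps F)\<^sup>+"
    unfolding leads_def by (metis (mono_tags, lifting) case_prodI mem_Collect_eq rtrancl_into_trancl2 steps_def)
  with assms(1) show False by (auto simp: acyclic_def)
qed

lemma chain_distinct: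
  assumes "acyclic (steps F)" "chain F xs u"
  shows "distinct (xs @ [u])"
  using assms(2)
proof (induction xs)
  case (Cons x xs)
  have "\<not> leads F (hd (xs @ [u])) x" using acyclic_leads[OF assms(1)] Cons.prems by auto
  moreover have "leads F (hd (xs @ [u])) y" if "y \<in> set (xs @ [u])" for y
  proof -
    from that obtain as bs where ab: "xs @ [u] = as @ y # bs" by (meson split_list)
    have "chain F (as @ butlast (y # bs)) u"
    proof -
      have "as @ butlast (y # bs) = xs" using ab by (metis butlast_append butlast_snoc list.distinct(1))
      then show ?thesis using Cons.prems by simp
    qed
    then have "chain F as (hd (butlast (y # bs) @ [u]))" by (simp add: chain_append)
    moreover have "hd (butlast (y # bs) @ [u]) = y"
      using ab by (cases bs rule: rev_cases) (auto simp: butlast_append)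
    ultimately have "chain F as y" by simp
    then have "leads F (hd (as @ [y])) y" by (rule chain_leads_hd)
    moreover have "hd (as @ [y]) = hd (xs @ [u])" unfolding ab by (cases as) auto
    ultimately show ?thesis by simp
  qed
  ultimately show ?case using Cons by auto
qed simp

lemma ext_notin: "v \<notin> set xs \<Longrightarrow> ext F xs u v = F v"
  by (induction xs) auto

lemma ext_snoc: "z \<notin> set ys \<Longrightarrow> ext F (ys @ [z]) u = (ext F ys z)(z \<mapsto> u)"
  by (induction ys) (auto simp: fun_eq_iff hd_append)

lemma chain_cong: "chain F xs u \<Longrightarrow> (\<And>x. x \<in> set xs \<Longrightarrow> G x = F x) \<Longrightarrow> chain G xs u"
  by (induction xs) auto

lemma chain_ext: "distinct xs \<Longrightarrow> chain (ext F xs u) xs u"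
proof (induction xs)
  case (Cons x xs)
  have "chain ((ext F xs u)(x \<mapsto> hd (xs @ [u]))) xs u"
    by (rule chain_cong[of "ext F xs u"]) (use Cons in auto)
  then show ?case by (simp add: fun_upd_def)
qed simp

text \<open>Every vertex of the attached path ends at \<open>u\<close>, so a branch that ends at the
  other root \<open>y\<close> cannot meet it; conversely the vertices of \<open>xs\<close> are roots
  of \<open>F\<close> and lie on no branch to \<open>y\<close>. Attaching the path leaves all events
  about \<open>y\<close> unchanged.\<close>

lemma leads_ext:
  assumes "distinct xs" "u \<notin> set xs" "y \<notin> set xs" "y \<noteq> u" "F u = None" "F y = None" "\<And>x. x \<in> set xs \<Longrightarrow> F x = None"
  shows "leads (ext F xs u) v y \<longleftrightarrow> leads F v y"
proof
  assume "leads (ext F xs u) v y"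
  then obtain zs where zs: "chain (ext F xs u) zs y" "hd (zs @ [y]) = v" by (rule leads_chainE)
  have "set zs \<inter> set xs = {}"
  proof (rule ccontr)
    assume "set zs \<inter> set xs \<noteq> {}"
    then obtain a where "a \<in> set zs" "a \<in> set xs" by blast
    then have "leads (ext F xs u) a y" "leads (ext F xs u) a u"
      using chain_leads[OF zs(1)] chain_leads[OF chain_ext[OF assms(1)]] by auto
    then have "y = u" by (rule leads_terminal_unique) (use assms in \<open>auto simp: ext_notin\<close>)
    with assms show False by simp
  qed
  then have "chain F zs y" by (intro chain_cong[OF zs(1)]) (metis disjoint_iff ext_notin)
  then show "leads F v y" using chain_leads_hd zs(2) by metis
next
  assume "leads F v y"
  then obtain zs where zs: "chain F zs y" "hd (zs @ [y]) = v" by (rule leads_chainE)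
  have "set zs \<inter> set xs = {}"
  proof (rule ccontr)
    assume "set zs \<inter> set xs \<noteq> {}"
    then obtain a where a: "a \<in> set zs" "a \<in> set xs" by blast
    then have "leads F a y" using chain_leads[OF zs(1)] by auto
    with a assms show False by (auto simp: leads_None)
  qed
  then have "chain (ext F xs u) zs y" by (intro chain_cong[OF zs(1)]) (metis disjoint_iff ext_notin)
  then show "leads (ext F xs u) v y" using chain_leads_hd zs(2) by metis
qed

section \<open>Weighted rooted forests and hitting probabilities\<close>

fun link :: "('a \<Rightarrow> 'a set) \<Rightarrow> 'a list \<Rightarrow> 'a \<Rightarrow> bool" where
  "link nb [] u = True"
| "link nb (x # xs) u = (hd (xs @ [u]) \<in> nb x \<and> link nb xs u)"

lemma link_append: "link nb (ys @ xs) u \<longleftrightarrow> link nb ys (hd (xs @ [u])) \<and> link nb xs u"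
  by (induction ys) (auto simp: hd_append)

text \<open>\<open>escape\<close> says that no nonempty finite set is closed under taking
  neighbours. It provides spanning forests in every finite volume and the strict inequality in the
  maximum principle.\<close>

locale regular_graph =
  fixes nb :: "'a \<Rightarrow> 'a set" and dg :: nat
  assumes finite_nb [simp]: "finite (nb x)"
    and card_nb: "card (nb x) = dg"
    and dg_pos: "dg > 0"
    and nb_sym: "y \<in> nb x \<Longrightarrow> x \<in> nb y"
    and escape: "finite S \<Longrightarrow> S \<noteq> {} \<Longrightarrow> \<exists>y\<in>S. \<exists>w\<in>nb y. w \<notin> S"
begin

definition forests :: "'a set \<Rightarrow> ('a \<Rightarrow> 'a option) set" where
  "forests V = {F. (\<forall>v. v \<notin> V \<longrightarrow> F v = None) \<and> (\<forall>v w. F v = Some w \<longrightarrow> w \<in> nb v) \<and> acyclic (steps F)}"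

text \<open>A vertex of \<open>V\<close> without successor is killed, with weight \<open>\<kappa>\<close>; all vertices outside \<open>V\<close> are
  roots. For \<open>\<kappa> = 0\<close> only the functions defined on all of \<open>V\<close> count.\<close>

definition wt :: "real \<Rightarrow> 'a set \<Rightarrow> ('a \<Rightarrow> 'a option) \<Rightarrow> real" where
  "wt \<kappa> V F = (\<Prod>v\<in>V. if F v = None then \<kappa> else 1)"

definition wsum :: "real \<Rightarrow> 'a set \<Rightarrow> (('a \<Rightarrow> 'a option) \<Rightarrow> real) \<Rightarrow> real" where
  "wsum \<kappa> V f = (\<Sum>F\<in>forests V. wt \<kappa> V F * f F)"

abbreviation Z :: "real \<Rightarrow> 'a set \<Rightarrow> real" where
  "Z \<kappa> V \<equiv> wsum \<kappa> V (\<lambda>_. 1)"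

definition ex :: "real \<Rightarrow> 'a set \<Rightarrow> (('a \<Rightarrow> 'a option) \<Rightarrow> real) \<Rightarrow> real" where
  "ex \<kappa> V f = wsum \<kappa> V f / Z \<kappa> V"

text \<open>By Wilson's algorithm \<open>hit \<kappa> V u x\<close> is the probability that the random walk from \<open>x\<close>, killed in
  \<open>V\<close> with weight \<open>\<kappa>\<close>, exits \<open>V\<close> at \<open>u\<close>, and \<open>ratio \<kappa> V X\<close> is the determinant of the Green function
  of \<open>V\<close> restricted to \<open>X\<close>.\<close>

definition hit :: "real \<Rightarrow> 'a set \<Rightarrow> 'a \<Rightarrow> 'a \<Rightarrow> real" where
  "hit \<kappa> V u x = ex \<kappa> V (\<lambda>F. of_bool (leads F x u))"

definition ratio :: "real \<Rightarrow> 'a set \<Rightarrow> 'a set \<Rightarrow> real" where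
  "ratio \<kappa> V X = Z \<kappa> (V - X) / Z \<kappa> V"

definition paths :: "'a set \<Rightarrow> 'a \<Rightarrow> 'a list set" where
  "paths V u = {xs. distinct xs \<and> set xs \<subseteq> V \<and> link nb xs u}"

section \<open>Cutting a vertex or a path out of a forest\<close>

lemma forestsD:
  assumes "F \<in> forests V"
  shows "v \<notin> V \<Longrightarrow> F v = None" "F v = Some w \<Longrightarrow> w \<in> nb v" "acyclic (steps F)"
  using assms by (auto simp: forests_def)

lemma finite_forests [simp]:
  assumes "finite V"
  shows "finite (forests V)"
proof (rule finite_subset)
  show "forests V \<subseteq> (\<Union>A\<in>Pow V. {m. dom m = A \<and> ran m \<subseteq> (\<Union>v\<in>V. nb v)})"
  proof
    fix F assume F: "F \<in> forests V"
    have "dom F \<in> Pow V" "ran F \<subseteq> (\<Union>v\<in>V. nb v)"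
      using forestsD[OF F] by (auto simp: dom_def ran_def) (metis option.distinct(1))+
    then show "F \<in> (\<Union>A\<in>Pow V. {m. dom m = A \<and> ran m \<subseteq> (\<Union>v\<in>V. nb v)})" by blast
  qed
  show "finite (\<Union>A\<in>Pow V. {m. dom m = A \<and> ran m \<subseteq> (\<Union>v\<in>V. nb v)})"
    using assms by (intro finite_UN_I finite_set_of_finite_maps) (auto intro: finite_subset)
qed

lemma forests_insert_step:
  assumes "F \<in> forests (V - {y})" "w \<in> nb y" "\<not> leads F w y" "y \<in> V"
  shows "F(y \<mapsto> w) \<in> forests V"
proof -
  have "F y = None" using forestsD(1)[OF assms(1)] by simp
  then have "acyclic (steps (F(y \<mapsto> w)))"
    using assms by (simp add: steps_upd acyclic_insert forests_def leads_def)
  then show ?thesis using assms by (auto simp: forests_def)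
qed

lemma forests_Diff_subset: "F \<in> forests (V - X) \<Longrightarrow> F \<in> forests V"
  by (auto simp: forests_def)

lemma forests_remove:
  assumes "F \<in> forests V"
  shows "F(y := None) \<in> forests (V - {y})"
proof -
  have "steps (F(y := None)) \<subseteq> steps F" by (auto simp: steps_def split: if_splits)
  then have "acyclic (steps (F(y := None)))" using assms acyclic_subset by (auto simp: forests_def)
  then show ?thesis using assms by (auto simp: forests_def)
qed

lemma forests_remove_leads:
  assumes "F \<in> forests V" "F y = Some w"
  shows "\<not> leads (F(y := None)) w y"
proof
  assume "leads (F(y := None)) w y"
  then have "leads ((F(y := None))(y \<mapsto> w)) w y" by (subst leads_upd) auto
  then have "leads F w y" using assms(2) by (simp add: fun_upd_idem)
  then show False using acyclic_leads[OF forestsD(3)[OF assms(1)] assms(2)] by simp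
qed

text \<open>Acyclicity restricts only the edge put back at \<open>y\<close>: its end must not
  already lead to \<open>y\<close>. So forests on \<open>V\<close> fibre over forests in which
  \<open>y\<close> is a root.\<close>

lemma forests_cut:
  assumes "y \<in> V"
  shows "bij_betw (\<lambda>(F, c). F(y := c))
    (SIGMA F:forests (V - {y}). insert None (Some ` {w \<in> nb y. \<not> leads F w y})) (forests V)"
proof (rule bij_betwI[where g = "\<lambda>F. (F(y := None), F y)"])
  show "(\<lambda>(F, c). F(y := c)) \<in>
    (SIGMA F:forests (V - {y}). insert None (Some ` {w \<in> nb y. \<not> leads F w y})) \<rightarrow> forests V"
  proof clarsimp
    fix F c assume F: "F \<in> forests (V - {y})" and c: "c = None \<or> c \<in> Some ` {w \<in> nb y. \<not> leads F w y}"
    show "F(y := c) \<in> forests V"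
    proof (cases c)
      case None
      have "F y = None" using forestsD(1)[OF F] by simp
      then have "F(y := c) = F" using None by auto
      then show ?thesis using F forests_Diff_subset by simp
    next
      case (Some w)
      then show ?thesis using c F assms by (auto intro: forests_insert_step)
    qed
  qed
  show "(\<lambda>F. (F(y := None), F y)) \<in> forests V \<rightarrow>
    (SIGMA F:forests (V - {y}). insert None (Some ` {w \<in> nb y. \<not> leads F w y}))"
  proof
    fix F assume F: "F \<in> forests V"
    have "F y = None \<or> F y \<in> Some ` {w \<in> nb y. \<not> leads (F(y := None)) w y}"
      using forestsD(2)[OF F] forests_remove_leads[OF F] by (cases "F y") auto
    then show "(F(y := None), F y) \<in> (SIGMA F:forests (V - {y}). insert None (Some ` {w \<in> nb y. \<not> leads F w y}))"
      using forests_remove[OF F] by auto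
  qed
  fix p assume "p \<in> (SIGMA F:forests (V - {y}). insert None (Some ` {w \<in> nb y. \<not> leads F w y}))"
  then obtain F c where p: "p = (F, c)" and F: "F \<in> forests (V - {y})" by auto
  have "F y = None" using forestsD(1)[OF F] by simp
  then show "(\<lambda>F. (F(y := None), F y)) ((\<lambda>(F, c). F(y := c)) p) = p"
    by (auto simp: p)
next
  fix F assume "F \<in> forests V"
  show "(\<lambda>(F, c). F(y := c)) (F(y := None), F y) = F" by auto
qed

lemma wsum_cut:
  assumes "finite V" "y \<in> V"
  shows "wsum \<kappa> V f = wsum \<kappa> (V - {y})
    (\<lambda>F. \<kappa> * f F + (\<Sum>w\<in>nb y. of_bool (\<not> leads F w y) * f (F(y \<mapsto> w))))"
proof -
  let ?C = "\<lambda>F. insert None (Some ` {w \<in> nb y. \<not> leads F w y})"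
  have wt: "wt \<kappa> V (F(y := c)) = (if c = None then \<kappa> else 1) * wt \<kappa> (V - {y}) F" for F c
    unfolding wt_def using assms by (subst prod.remove[of V y]) (auto intro!: prod.cong)
  have "wsum \<kappa> V f = (\<Sum>(F, c)\<in>Sigma (forests (V - {y})) ?C. wt \<kappa> V (F(y := c)) * f (F(y := c)))"
    unfolding wsum_def
    by (subst sum.reindex_bij_betw[OF forests_cut[OF assms(2)], symmetric]) (simp add: case_prod_beta)
  also have "\<dots> = (\<Sum>F\<in>forests (V - {y}). \<Sum>c\<in>?C F. wt \<kappa> V (F(y := c)) * f (F(y := c)))"
    using assms by (subst sum.Sigma) auto
  also have "\<dots> = wsum \<kappa> (V - {y})
    (\<lambda>F. \<kappa> * f F + (\<Sum>w\<in>nb y. of_bool (\<not> leads F w y) * f (F(y \<mapsto> w))))"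
    unfolding wsum_def
  proof (rule sum.cong)
    fix F assume "F \<in> forests (V - {y})"
    then have Fy: "F y = None" using forestsD(1) by blast
    then have F: "F(y := None) = F" by auto
    have "(\<Sum>c\<in>?C F. wt \<kappa> V (F(y := c)) * f (F(y := c))) =
       \<kappa> * wt \<kappa> (V - {y}) F * f F + (\<Sum>w | w \<in> nb y \<and> \<not> leads F w y. wt \<kappa> (V - {y}) F * f (F(y \<mapsto> w)))"
      unfolding wt by (subst sum.insert) (auto simp: sum.reindex F)
    also have "(\<Sum>w | w \<in> nb y \<and> \<not> leads F w y. wt \<kappa> (V - {y}) F * f (F(y \<mapsto> w))) =
      (\<Sum>w\<in>nb y. of_bool (\<not> leads F w y) * (wt \<kappa> (V - {y}) F * f (F(y \<mapsto> w))))"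
      by (intro sum.mono_neutral_cong_left) auto
    finally have *: "(\<Sum>c\<in>?C F. wt \<kappa> V (F(y := c)) * f (F(y := c))) =
      \<kappa> * wt \<kappa> (V - {y}) F * f F +
      (\<Sum>w\<in>nb y. of_bool (\<not> leads F w y) * (wt \<kappa> (V - {y}) F * f (F(y \<mapsto> w))))" .
    show "(\<Sum>c\<in>?C F. wt \<kappa> V (F(y := c)) * f (F(y := c))) = wt \<kappa> (V - {y}) F *
      (\<kappa> * f F + (\<Sum>w\<in>nb y. of_bool (\<not> leads F w y) * f (F(y \<mapsto> w))))"
      unfolding * by (simp only: distrib_left sum_distrib_left mult.left_commute mult.commute mult.assoc)
  qed simp
  finally show ?thesis .
qed

lemma wsum_cong: "(\<And>F. F \<in> forests V \<Longrightarrow> f F = f' F) \<Longrightarrow> wsum \<kappa> V f = wsum \<kappa> V f'"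
  unfolding wsum_def by (intro sum.cong) auto

lemma wsum_add: "wsum \<kappa> V (\<lambda>F. f F + f' F) = wsum \<kappa> V f + wsum \<kappa> V f'"
  unfolding wsum_def by (simp add: algebra_simps sum.distrib)

lemma wsum_diff: "wsum \<kappa> V (\<lambda>F. f F - f' F) = wsum \<kappa> V f - wsum \<kappa> V f'"
  unfolding wsum_def by (simp add: algebra_simps sum_subtractf)

lemma wsum_cmult: "wsum \<kappa> V (\<lambda>F. c * f F) = c * wsum \<kappa> V f"
  unfolding wsum_def by (simp add: algebra_simps sum_distrib_left)

lemma wsum_sum: "wsum \<kappa> V (\<lambda>F. \<Sum>i\<in>I. f i F) = (\<Sum>i\<in>I. wsum \<kappa> V (f i))"
  unfolding wsum_def by (simp add: sum_distrib_left) (rule sum.swap)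

lemma wt_nonneg: "\<kappa> \<ge> 0 \<Longrightarrow> wt \<kappa> V F \<ge> 0"
  unfolding wt_def by (intro prod_nonneg) auto

lemma wsum_mono: "\<kappa> \<ge> 0 \<Longrightarrow> (\<And>F. F \<in> forests V \<Longrightarrow> f F \<le> f' F) \<Longrightarrow> wsum \<kappa> V f \<le> wsum \<kappa> V f'"
  unfolding wsum_def by (intro sum_mono mult_left_mono wt_nonneg) auto

text \<open>The path is removed from its last vertex. The edge from \<open>z\<close> to the root
  \<open>u\<close> cannot close a cycle, so fixing it imposes no condition on the rest; then
  \<open>z\<close> is a root of the smaller volume and takes the place of \<open>u\<close>. What
  remains is an unconditioned weighted forest on \<open>V - set xs\<close>: the spatial Markov
  property behind all later estimates.\<close>

lemma wsum_chain:
  assumes "finite V" "xs \<in> paths V u" "u \<notin> V"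
  shows "wsum \<kappa> V (\<lambda>F. of_bool (chain F xs u) * f F) = wsum \<kappa> (V - set xs) (\<lambda>F. f (ext F xs u))"
  using assms
proof (induction xs arbitrary: V u f rule: rev_induct)
  case Nil
  then show ?case by simp
next
  case (snoc z ys)
  have z: "z \<in> V" "z \<notin> set ys" "z \<noteq> u" "u \<in> nb z" and ys: "ys \<in> paths (V - {z}) z"
    using snoc.prems by (auto simp: paths_def link_append)
  have "wsum \<kappa> V (\<lambda>F. of_bool (chain F (ys @ [z]) u) * f F) = wsum \<kappa> (V - {z})
    (\<lambda>F. \<kappa> * (of_bool (chain F (ys @ [z]) u) * f F) +
      (\<Sum>w\<in>nb z. of_bool (\<not> leads F w z) * (of_bool (chain (F(z \<mapsto> w)) (ys @ [z]) u) * f (F(z \<mapsto> w)))))"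
    using snoc.prems z by (intro wsum_cut) auto
  also have "\<dots> = wsum \<kappa> (V - {z}) (\<lambda>F. of_bool (chain F ys z) * f (F(z \<mapsto> u)))"
  proof (rule wsum_cong)
    fix F assume F: "F \<in> forests (V - {z})"
    then have Fz: "F z = None" and Fu: "F u = None" using forestsD(1) \<open>u \<notin> V\<close> by auto
    have ch: "chain (F(z \<mapsto> w)) (ys @ [z]) u \<longleftrightarrow> w = u \<and> chain F ys z" for w
    proof -
      have "chain (F(z \<mapsto> w)) ys z \<longleftrightarrow> chain F ys z"
        using z(2) by (auto elim!: chain_cong)
      then show ?thesis by (auto simp: chain_snoc)
    qed
    have "(\<Sum>w\<in>nb z. of_bool (\<not> leads F w z) * (of_bool (chain (F(z \<mapsto> w)) (ys @ [z]) u) * f (F(z \<mapsto> w)))) =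
      (\<Sum>w\<in>nb z. if w = u then of_bool (chain F ys z) * f (F(z \<mapsto> u)) else 0)"
      using z(3) by (intro sum.cong) (auto simp: ch leads_None[of F u, OF Fu])
    also have "\<dots> = of_bool (chain F ys z) * f (F(z \<mapsto> u))" using z(4) by simp
    finally show "\<kappa> * (of_bool (chain F (ys @ [z]) u) * f F) +
      (\<Sum>w\<in>nb z. of_bool (\<not> leads F w z) * (of_bool (chain (F(z \<mapsto> w)) (ys @ [z]) u) * f (F(z \<mapsto> w)))) =
      of_bool (chain F ys z) * f (F(z \<mapsto> u))"
      using Fz by (simp add: chain_snoc)
  qed
  also have "\<dots> = wsum \<kappa> (V - {z} - set ys) (\<lambda>F. f ((ext F ys z)(z \<mapsto> u)))"
    using snoc.prems ys by (intro snoc.IH[of "V - {z}" z "\<lambda>F. f (F(z \<mapsto> u))"]) auto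
  also have "V - {z} - set ys = V - set (ys @ [z])" by auto
  finally show ?case by (simp only: ext_snoc[OF z(2)])
qed

end

section \<open>Normalized expectations and their expansion over simple paths\<close>

context regular_graph
begin

text \<open>At \<kappa> = 0 this is the existence of a spanning forest: the volume is emptied at
  vertices that have a neighbour outside, and the edge to that neighbour is always
  admissible.\<close>

lemma Z_pos:
  assumes "finite V" "\<kappa> \<ge> 0"
  shows "Z \<kappa> V > 0"
  using assms(1)
proof (induction "card V" arbitrary: V)
  case 0
  then have V: "V = {}" by simp
  have "forests {} = {\<lambda>_. None}" by (auto simp: forests_def steps_def acyclic_def)
  then show ?case by (simp add: V wsum_def wt_def)
next
  case (Suc n)
  then have "V \<noteq> {}" by auto
  then obtain y w where yw: "y \<in> V" "w \<in> nb y" "w \<notin> V" using escape[OF \<open>finite V\<close>] by blast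
  have "0 < Z \<kappa> (V - {y})" using Suc yw by simp
  also have "\<dots> \<le> wsum \<kappa> (V - {y}) (\<lambda>F. \<kappa> * 1 + (\<Sum>w\<in>nb y. of_bool (\<not> leads F w y) * 1))"
  proof (rule wsum_mono[OF assms(2)])
    fix F assume "F \<in> forests (V - {y})"
    then have "F w = None" using forestsD(1) yw by blast
    then have "\<not> leads F w y" using yw by (auto simp: leads_None)
    then have "1 \<le> (\<Sum>w\<in>nb y. of_bool (\<not> leads F w y) :: real)"
      using yw member_le_sum[of w "nb y" "\<lambda>w. of_bool (\<not> leads F w y) :: real"] by simp
    then show "1 \<le> \<kappa> * 1 + (\<Sum>w\<in>nb y. of_bool (\<not> leads F w y) * 1 :: real)" using assms(2) by simp
  qed
  also have "\<dots> = Z \<kappa> V" using wsum_cut[of V y \<kappa> "\<lambda>_. 1"] Suc yw by simp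
  finally show ?case .
qed

lemma ex_cong: "(\<And>F. F \<in> forests V \<Longrightarrow> f F = f' F) \<Longrightarrow> ex \<kappa> V f = ex \<kappa> V f'"
  unfolding ex_def by (metis wsum_cong)

lemma ex_add: "ex \<kappa> V (\<lambda>F. f F + f' F) = ex \<kappa> V f + ex \<kappa> V f'"
  by (simp add: ex_def wsum_add add_divide_distrib)

lemma ex_diff: "ex \<kappa> V (\<lambda>F. f F - f' F) = ex \<kappa> V f - ex \<kappa> V f'"
  by (simp add: ex_def wsum_diff diff_divide_distrib)

lemma ex_cmult: "ex \<kappa> V (\<lambda>F. c * f F) = c * ex \<kappa> V f"
  by (simp add: ex_def wsum_cmult)

lemma ex_sum: "ex \<kappa> V (\<lambda>F. \<Sum>i\<in>I. f i F) = (\<Sum>i\<in>I. ex \<kappa> V (f i))"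
  by (simp add: ex_def wsum_sum sum_divide_distrib)

lemma ex_const:
  assumes "finite V" "\<kappa> \<ge> 0"
  shows "ex \<kappa> V (\<lambda>_. c) = c"
  using Z_pos[OF assms] wsum_cmult[of \<kappa> V c "\<lambda>_. 1"] by (simp add: ex_def)

lemma ex_mono:
  assumes "finite V" "\<kappa> \<ge> 0" "\<And>F. F \<in> forests V \<Longrightarrow> f F \<le> f' F"
  shows "ex \<kappa> V f \<le> ex \<kappa> V f'"
  unfolding ex_def using assms Z_pos[of V \<kappa>] by (intro divide_right_mono wsum_mono) auto

lemma ex_nonneg:
  assumes "finite V" "\<kappa> \<ge> 0" "\<And>F. F \<in> forests V \<Longrightarrow> 0 \<le> f F"
  shows "0 \<le> ex \<kappa> V f"
  using ex_mono[of V \<kappa> "\<lambda>_. 0" f] assms by (simp add: ex_const)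

lemma ex_le_1:
  assumes "finite V" "\<kappa> \<ge> 0"
  shows "ex \<kappa> V (\<lambda>F. of_bool (P F)) \<le> 1"
  using ex_mono[of V \<kappa> "\<lambda>F. of_bool (P F)" "\<lambda>_. 1"] assms by (simp add: ex_const)

lemma ex_cut:
  assumes "finite V" "\<kappa> \<ge> 0" "y \<in> V"
  shows "ex \<kappa> V f = ratio \<kappa> V {y} * ex \<kappa> (V - {y})
    (\<lambda>F. \<kappa> * f F + (\<Sum>w\<in>nb y. of_bool (\<not> leads F w y) * f (F(y \<mapsto> w))))"
  using Z_pos[of V \<kappa>] Z_pos[of "V - {y}" \<kappa>] assms
  by (simp add: ex_def ratio_def wsum_cut[OF assms(1,3), of \<kappa> f])

lemma ex_chain:
  assumes "finite V" "\<kappa> \<ge> 0" "xs \<in> paths V u" "u \<notin> V"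
  shows "ex \<kappa> V (\<lambda>F. of_bool (chain F xs u) * f F) =
    ratio \<kappa> V (set xs) * ex \<kappa> (V - set xs) (\<lambda>F. f (ext F xs u))"
  using Z_pos[of V \<kappa>] Z_pos[of "V - set xs" \<kappa>] assms
  by (simp add: ex_def ratio_def wsum_chain[OF assms(1,3,4), of \<kappa> f])

lemma ratio_nonneg: "finite V \<Longrightarrow> \<kappa> \<ge> 0 \<Longrightarrow> 0 < ratio \<kappa> V X"
  unfolding ratio_def using Z_pos[of V \<kappa>] Z_pos[of "V - X" \<kappa>] by simp

lemma finite_paths [simp]: "finite V \<Longrightarrow> finite (paths V u)"
  by (rule finite_subset[OF _ finite_subset_distinct[of V]]) (auto simp: paths_def)

lemma chain_in_paths:
  assumes "F \<in> forests V" "chain F xs u"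
  shows "xs \<in> paths V u"
proof -
  have V: "a \<in> V" if "F a = Some b" for a b
    using that forestsD(1)[OF assms(1), of a] by auto
  have "set xs \<subseteq> V \<and> link nb xs u" using assms(2)
    by (induction xs) (auto intro: V forestsD(2)[OF assms(1)])
  then show ?thesis using chain_distinct[OF forestsD(3)[OF assms(1)] assms(2)] by (simp add: paths_def)
qed

definition pathsf :: "'a set \<Rightarrow> 'a \<Rightarrow> 'a \<Rightarrow> 'a list set" where
  "pathsf V x u = {xs \<in> paths V u. hd (xs @ [u]) = x}"

lemma finite_pathsf [simp]: "finite V \<Longrightarrow> finite (pathsf V x u)"
  by (simp add: pathsf_def)

lemma sum_chain_pathsf:
  assumes "finite V" "F \<in> forests V" "chain F ys u" "hd (ys @ [u]) = x" "u \<notin> V"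
  shows "(\<Sum>xs\<in>pathsf V x u. of_bool (chain F xs u) * c xs) = (c ys :: real)"
proof -
  have ys: "ys \<in> pathsf V x u" using assms chain_in_paths by (auto simp: pathsf_def)
  have "(\<Sum>xs\<in>pathsf V x u. of_bool (chain F xs u) * c xs) = (\<Sum>xs\<in>pathsf V x u. if xs = ys then c ys else 0)"
  proof (rule sum.cong)
    fix xs assume "xs \<in> pathsf V x u"
    then have "hd (xs @ [u]) = hd (ys @ [u])" using assms by (simp add: pathsf_def)
    then have "chain F xs u \<longleftrightarrow> xs = ys"
      using chain_unique[OF _ _ assms(3)] forestsD(1)[OF assms(2,5)] assms(3) by metis
    then show "of_bool (chain F xs u) * c xs = (if xs = ys then c ys else 0)" by (cases "xs = ys") simp_all
  qed simp
  also have "\<dots> = c ys" using ys assms(1) by simp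
  finally show ?thesis .
qed

lemma of_bool_leads_sum:
  assumes "finite V" "F \<in> forests V" "u \<notin> V"
  shows "of_bool (leads F x u) = (\<Sum>xs\<in>pathsf V x u. of_bool (chain F xs u) :: real)"
proof (cases "leads F x u")
  case True
  then obtain ys where "chain F ys u" "hd (ys @ [u]) = x" by (rule leads_chainE)
  then show ?thesis using True sum_chain_pathsf[OF assms(1,2), of ys u x "\<lambda>_. 1"] assms(3) by simp
next
  case False
  have "\<not> chain F xs u" if "xs \<in> pathsf V x u" for xs
    using False that chain_leads_hd[of F xs u] by (auto simp: pathsf_def)
  then show ?thesis using False by (subst sum.neutral) auto
qed

text \<open>The events that \<open>x\<close> reaches \<open>u\<close> along different simple paths
  are disjoint, and each of them leaves an unconditioned forest on the complement of its
  path.\<close>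

lemma ex_leads_paths:
  assumes "finite V" "\<kappa> \<ge> 0" "u \<notin> V"
  shows "ex \<kappa> V (\<lambda>F. of_bool (leads F x u) * f F) =
    (\<Sum>xs\<in>pathsf V x u. ratio \<kappa> V (set xs) * ex \<kappa> (V - set xs) (\<lambda>F. f (ext F xs u)))"
proof -
  have "ex \<kappa> V (\<lambda>F. of_bool (leads F x u) * f F) =
      ex \<kappa> V (\<lambda>F. \<Sum>xs\<in>pathsf V x u. of_bool (chain F xs u) * f F)"
    by (rule ex_cong) (simp add: of_bool_leads_sum[OF assms(1) _ assms(3)] sum_distrib_right)
  also have "\<dots> = (\<Sum>xs\<in>pathsf V x u. ratio \<kappa> V (set xs) * ex \<kappa> (V - set xs) (\<lambda>F. f (ext F xs u)))"
    unfolding ex_sum by (intro sum.cong refl ex_chain assms) (auto simp: pathsf_def)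
  finally show ?thesis .
qed

section \<open>Hitting probabilities: harmonicity, comparison, monotonicity in the volume\<close>

lemma hit_refl [simp]: "finite V \<Longrightarrow> \<kappa> \<ge> 0 \<Longrightarrow> hit \<kappa> V u u = 1"
  by (simp add: hit_def ex_const)

lemma hit_outside:
  assumes "x \<notin> V" "x \<noteq> u"
  shows "hit \<kappa> V u x = 0"
proof -
  have "hit \<kappa> V u x = ex \<kappa> V (\<lambda>_. 0)"
    unfolding hit_def by (rule ex_cong) (use assms in \<open>auto simp: leads_None forestsD(1)\<close>)
  then show ?thesis by (simp add: ex_def wsum_def)
qed

lemma hit_nonneg: "finite V \<Longrightarrow> \<kappa> \<ge> 0 \<Longrightarrow> 0 \<le> hit \<kappa> V u x"
  unfolding hit_def by (intro ex_nonneg) auto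

lemma hit_le_1: "finite V \<Longrightarrow> \<kappa> \<ge> 0 \<Longrightarrow> hit \<kappa> V u x \<le> 1"
  unfolding hit_def by (rule ex_le_1)

text \<open>The loop-erased expansion of a hitting probability: a simple path is weighted by the
  Green determinant of its vertex set.\<close>

lemma hit_paths:
  assumes "finite V" "\<kappa> \<ge> 0" "u \<notin> V"
  shows "hit \<kappa> V u x = (\<Sum>xs\<in>pathsf V x u. ratio \<kappa> V (set xs))"
  using ex_leads_paths[OF assms, of x "\<lambda>_. 1"] assms by (simp add: hit_def ex_const)

text \<open>Cutting at \<open>z\<close> turns both sides into sums over forests in which
  \<open>z\<close> is a root. Sending \<open>z\<close> to \<open>w2\<close> adds to the event at
  \<open>w\<close> the case that \<open>w\<close> leads to \<open>z\<close> and \<open>w2\<close> to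
  \<open>u\<close>; acyclicity removes the case that \<open>w2\<close> leads to \<open>z\<close> and
  \<open>w\<close> to \<open>u\<close>. Summed over both neighbours these cancel, and
  \<open>dg + \<kappa>\<close> copies of the number of neighbours that lead to \<open>u\<close>
  remain.\<close>

lemma hit_harmonic:
  fixes \<kappa> :: real
  assumes "finite V" "\<kappa> \<ge> 0" "z \<in> V" "u \<notin> V"
  shows "(dg + \<kappa>) * hit \<kappa> V u z = (\<Sum>w\<in>nb z. hit \<kappa> V u w)"
proof -
  have zu: "z \<noteq> u" using assms by auto
  let ?a = "\<lambda>F w. of_bool (leads F w u) :: real" and ?b = "\<lambda>F w. of_bool (leads F w z) :: real"
  have ab: "?a F w * ?b F w = 0" and Fz: "F z = None" and Fu: "F u = None" if "F \<in> forests (V - {z})" for F w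
  proof -
    show Fz: "F z = None" and Fu: "F u = None" using forestsD(1)[OF that] assms by auto
    show "?a F w * ?b F w = 0" using leads_terminal_unique[of F w u z] Fz Fu zu by auto
  qed
  have 1: "wsum \<kappa> V (\<lambda>F. ?a F z) = wsum \<kappa> (V - {z}) (\<lambda>F. \<Sum>w\<in>nb z. ?a F w)"
    unfolding wsum_cut[OF assms(1,3), of \<kappa> "\<lambda>F. ?a F z"]
  proof (rule wsum_cong)
    fix F assume F: "F \<in> forests (V - {z})"
    have "of_bool (\<not> leads F w z) * ?a (F(z \<mapsto> w)) z = ?a F w" for w
      using ab[OF F, of w] zu by (auto simp: leads_upd[of F z, OF Fz[OF F]] leads_None[of F z, OF Fz[OF F]])
    then show "\<kappa> * ?a F z + (\<Sum>w\<in>nb z. of_bool (\<not> leads F w z) * ?a (F(z \<mapsto> w)) z) = (\<Sum>w\<in>nb z. ?a F w)"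
      using zu by (simp add: leads_None[of F z, OF Fz[OF F]])
  qed
  have "(\<Sum>w\<in>nb z. wsum \<kappa> V (\<lambda>F. ?a F w)) = wsum \<kappa> V (\<lambda>F. \<Sum>w\<in>nb z. ?a F w)"
    by (rule wsum_sum[symmetric])
  also have "\<dots> = wsum \<kappa> (V - {z}) (\<lambda>F. (dg + \<kappa>) * (\<Sum>w\<in>nb z. ?a F w))"
    unfolding wsum_cut[OF assms(1,3), of \<kappa> "\<lambda>F. \<Sum>w\<in>nb z. ?a F w"]
  proof (rule wsum_cong)
    fix F assume F: "F \<in> forests (V - {z})"
    have upd: "?a (F(z \<mapsto> w2)) w = ?a F w + ?b F w * ?a F w2" for w w2
      using ab[OF F, of w] by (auto simp: leads_upd[of F z, OF Fz[OF F]])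
    have "(\<Sum>w2\<in>nb z. of_bool (\<not> leads F w2 z) * (\<Sum>w\<in>nb z. ?a (F(z \<mapsto> w2)) w)) =
      (\<Sum>w2\<in>nb z. \<Sum>w\<in>nb z. ?a F w - ?b F w2 * ?a F w + ?b F w * ?a F w2)"
      unfolding sum_distrib_left upd
    proof (intro sum.cong refl)
      fix w w2
      show "of_bool (\<not> leads F w2 z) * (?a F w + ?b F w * ?a F w2) = ?a F w - ?b F w2 * ?a F w + ?b F w * ?a F w2"
        using ab[OF F, of w2] by auto
    qed
    also have "\<dots> = dg * (\<Sum>w\<in>nb z. ?a F w) - (\<Sum>w2\<in>nb z. \<Sum>w\<in>nb z. ?b F w2 * ?a F w)
        + (\<Sum>w2\<in>nb z. \<Sum>w\<in>nb z. ?b F w * ?a F w2)"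
      by (simp only: sum.distrib sum_subtractf sum_constant card_nb)
    also have "(\<Sum>w2\<in>nb z. \<Sum>w\<in>nb z. ?b F w2 * ?a F w) = (\<Sum>w2\<in>nb z. \<Sum>w\<in>nb z. ?b F w * ?a F w2)"
      by (rule sum.swap)
    finally show "\<kappa> * (\<Sum>w\<in>nb z. ?a F w) +
      (\<Sum>w2\<in>nb z. of_bool (\<not> leads F w2 z) * (\<Sum>w\<in>nb z. ?a (F(z \<mapsto> w2)) w)) =
      (dg + \<kappa>) * (\<Sum>w\<in>nb z. ?a F w)"
      by (simp only: algebra_simps)
  qed
  also have "\<dots> = (dg + \<kappa>) * wsum \<kappa> V (\<lambda>F. ?a F z)" by (simp only: wsum_cmult 1)
  finally show ?thesis by (simp add: hit_def ex_def sum_divide_distrib[symmetric])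
qed

text \<open>The admissible edges out of \<open>y\<close> are the \<open>dg\<close> edges minus those
  whose end already leads back to \<open>y\<close>. The last factor is the Schur complement that
  relates two successive minors of the Laplacian.\<close>

lemma Z_cut:
  fixes \<kappa> :: real
  assumes "finite V" "\<kappa> \<ge> 0" "y \<in> V"
  shows "Z \<kappa> V = Z \<kappa> (V - {y}) * (\<kappa> + dg - (\<Sum>w\<in>nb y. hit \<kappa> (V - {y}) y w))"
proof -
  have "Z \<kappa> V = wsum \<kappa> (V - {y}) (\<lambda>F. (\<kappa> + dg) * 1 - (\<Sum>w\<in>nb y. of_bool (leads F w y)))"
    unfolding wsum_cut[OF assms(1,3), of \<kappa> "\<lambda>_. 1"]
  proof (rule wsum_cong)
    fix F
    have "(\<Sum>w\<in>nb y. of_bool (\<not> leads F w y) * 1) = (\<Sum>w\<in>nb y. 1 - of_bool (leads F w y) :: real)"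
      by (intro sum.cong) auto
    then show "\<kappa> * 1 + (\<Sum>w\<in>nb y. of_bool (\<not> leads F w y) * 1) = (\<kappa> + dg) * 1 - (\<Sum>w\<in>nb y. of_bool (leads F w y))"
      by (simp add: sum_subtractf card_nb)
  qed
  also have "\<dots> = (\<kappa> + dg) * Z \<kappa> (V - {y}) - (\<Sum>w\<in>nb y. wsum \<kappa> (V - {y}) (\<lambda>F. of_bool (leads F w y)))"
    by (simp only: wsum_diff wsum_cmult wsum_sum)
  also have "(\<Sum>w\<in>nb y. wsum \<kappa> (V - {y}) (\<lambda>F. of_bool (leads F w y))) =
      Z \<kappa> (V - {y}) * (\<Sum>w\<in>nb y. hit \<kappa> (V - {y}) y w)"
    using Z_pos[of "V - {y}" \<kappa>] assms by (simp add: hit_def ex_def sum_distrib_left)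
  finally show ?thesis by (simp only: algebra_simps)
qed

lemma ratio_singleton:
  fixes \<kappa> :: real
  assumes "finite V" "\<kappa> \<ge> 0" "y \<in> V"
  shows "ratio \<kappa> V {y} = 1 / (\<kappa> + dg - (\<Sum>w\<in>nb y. hit \<kappa> (V - {y}) y w))"
    and "\<kappa> + dg - (\<Sum>w\<in>nb y. hit \<kappa> (V - {y}) y w) > 0"
proof -
  have "0 < Z \<kappa> V" "0 < Z \<kappa> (V - {y})" using Z_pos assms by auto
  then show "\<kappa> + dg - (\<Sum>w\<in>nb y. hit \<kappa> (V - {y}) y w) > 0"
    using Z_cut[OF assms] by (metis zero_less_mult_pos)
  then show "ratio \<kappa> V {y} = 1 / (\<kappa> + dg - (\<Sum>w\<in>nb y. hit \<kappa> (V - {y}) y w))"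
    using \<open>0 < Z \<kappa> (V - {y})\<close> by (simp add: ratio_def Z_cut[OF assms])
qed

text \<open>A positive maximum is attained on a finite set inside \<open>V\<close>;
  \<open>escape\<close> finds a vertex of that set with a neighbour where \<open>f\<close> is
  strictly smaller, against subharmonicity.\<close>

lemma max_principle:
  fixes \<kappa> :: real
  assumes "finite V" "\<kappa> \<ge> 0"
    and sub: "\<And>x. x \<in> V \<Longrightarrow> (dg + \<kappa>) * f x \<le> (\<Sum>w\<in>nb x. f w)"
    and out: "\<And>x. x \<notin> V \<Longrightarrow> f x \<le> 0"
  shows "f x \<le> (0::real)"
proof (rule ccontr)
  assume "\<not> f x \<le> 0"
  then have x: "x \<in> V" "f x > 0" using out by force+
  define M where "M = Max (f ` V)"
  have M: "f y \<le> M" if "y \<in> V" for y using that assms(1) by (simp add: M_def)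
  have Mpos: "M > 0" using M[OF x(1)] x by simp
  have M': "f y \<le> M" for y using M out[of y] Mpos by (cases "y \<in> V") auto
  define S where "S = {y \<in> V. f y = M}"
  have "M \<in> f ` V" unfolding M_def using x assms(1) by (intro Max_in) auto
  then have "S \<noteq> {}" "finite S" using assms(1) by (auto simp: S_def)
  then obtain y w where yw: "y \<in> S" "w \<in> nb y" "w \<notin> S" using escape by blast
  have fw: "f w < M" using yw M'[of w] out[of w] Mpos by (cases "w \<in> V") (auto simp: S_def)
  have "(\<Sum>v\<in>nb y. f v) < (\<Sum>v\<in>nb y. M)" using yw fw M' by (intro sum_strict_mono_ex1) auto
  also have "\<dots> \<le> (dg + \<kappa>) * M" using Mpos assms(2) by (simp add: card_nb algebra_simps)
  finally show False using sub[of y] yw by (simp add: S_def)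
qed

lemma hit_le_super:
  fixes \<kappa> :: real and f :: "'a \<Rightarrow> real"
  assumes "finite V" "\<kappa> \<ge> 0" "u \<notin> V"
    and f: "\<And>x. f x \<ge> 0" "f u \<ge> 1" "\<And>x. (\<Sum>w\<in>nb x. f w) \<le> dg * f x"
  shows "hit \<kappa> V u x \<le> f x"
proof -
  have "hit \<kappa> V u x - f x \<le> 0"
  proof (rule max_principle[OF assms(1,2)])
    fix x assume x: "x \<in> V"
    have "(\<Sum>w\<in>nb x. f w) \<le> (dg + \<kappa>) * f x"
      using f(3)[of x] mult_nonneg_nonneg[OF assms(2) f(1)[of x]] by (simp add: algebra_simps)
    then show "(dg + \<kappa>) * (hit \<kappa> V u x - f x) \<le> (\<Sum>w\<in>nb x. hit \<kappa> V u w - f w)"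
      unfolding right_diff_distrib hit_harmonic[OF assms(1,2) x assms(3)] sum_subtractf by simp
  next
    fix x assume "x \<notin> V"
    then show "hit \<kappa> V u x - f x \<le> 0"
      using f(1)[of x] f(2) assms(1,2) by (cases "x = u") (auto simp: hit_outside)
  qed
  then show ?thesis by simp
qed

lemma hit_mono:
  assumes "finite V'" "\<kappa> \<ge> 0" "V \<subseteq> V'" "u \<notin> V'"
  shows "hit \<kappa> V u x \<le> hit \<kappa> V' u x"
proof -
  have fin: "finite V" using assms finite_subset by blast
  have "hit \<kappa> V u x - hit \<kappa> V' u x \<le> 0"
  proof (rule max_principle[OF fin assms(2)])
    fix x assume x: "x \<in> V"
    then have "x \<in> V'" "u \<notin> V" using assms by auto
    then show "(dg + \<kappa>) * (hit \<kappa> V u x - hit \<kappa> V' u x) \<le> (\<Sum>w\<in>nb x. hit \<kappa> V u w - hit \<kappa> V' u w)"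
      unfolding right_diff_distrib sum_subtractf
      using hit_harmonic[OF fin assms(2) x, of u] hit_harmonic[OF assms(1,2), of x u] assms(4) by simp
  next
    fix x assume "x \<notin> V"
    then show "hit \<kappa> V u x - hit \<kappa> V' u x \<le> 0"
      using hit_nonneg[OF assms(1,2), of u x] assms fin by (cases "x = u") (auto simp: hit_outside)
  qed
  then show ?thesis by simp
qed

lemma ratio_insert:
  assumes "finite V" "\<kappa> \<ge> 0"
  shows "ratio \<kappa> V (insert y X) = ratio \<kappa> V X * ratio \<kappa> (V - X) {y}"
proof -
  have "V - insert y X = V - X - {y}" by auto
  then show ?thesis using Z_pos[of "V - X" \<kappa>] assms by (simp add: ratio_def)
qed

text \<open>In a larger volume the neighbours of \<open>y\<close> return to \<open>y\<close> more
  often, so the denominator in \<open>ratio_singleton\<close> decreases: Green functions grow with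
  the domain.\<close>

lemma ratio_mono_singleton:
  assumes "finite V'" "\<kappa> \<ge> 0" "V \<subseteq> V'" "y \<in> V"
  shows "ratio \<kappa> V {y} \<le> ratio \<kappa> V' {y}"
proof -
  have fin: "finite V" and y: "y \<in> V'" using finite_subset[of V V'] assms by auto
  have "(\<Sum>w\<in>nb y. hit \<kappa> (V - {y}) y w) \<le> (\<Sum>w\<in>nb y. hit \<kappa> (V' - {y}) y w)"
    using assms by (intro sum_mono hit_mono) auto
  then show ?thesis
    using ratio_singleton[OF fin assms(2,4)] ratio_singleton[OF assms(1,2) y]
    by (auto intro!: divide_left_mono)
qed

lemma ratio_mono:
  assumes "finite V'" "\<kappa> \<ge> 0" "V \<subseteq> V'" "X \<subseteq> V"
  shows "ratio \<kappa> V X \<le> ratio \<kappa> V' X"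
proof -
  have fin: "finite V" "finite X"
    using finite_subset[of V V'] finite_subset[of X V'] assms by auto
  show ?thesis using fin(2) assms(4)
  proof (induction X)
    case empty
    then show ?case using Z_pos[OF fin(1) assms(2)] Z_pos[OF assms(1,2)] by (simp add: ratio_def)
  next
    case (insert y X)
    have "ratio \<kappa> (V - X) {y} \<le> ratio \<kappa> (V' - X) {y}"
      using insert assms by (intro ratio_mono_singleton) auto
    then show ?case unfolding ratio_insert[OF assms(1,2)] ratio_insert[OF fin(1) assms(2)]
      using insert assms fin ratio_nonneg[of "V - X" \<kappa> "{y}"] ratio_nonneg[of "V'" \<kappa> X]
      by (intro mult_mono) auto
  qed
qed

text \<open>Summation by parts against \<open>hit\<close>, which is harmonic in \<open>V\<close> and
  vanishes outside \<open>insert u V\<close>. The boundary terms are only estimated; since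
  \<open>\<psi>\<close> is nonnegative they have the right sign.\<close>

lemma green_parts:
  fixes \<kappa> :: real
  assumes "finite V" "\<kappa> \<ge> 0" "u \<notin> V" and \<psi>: "\<And>x. \<psi> x \<ge> 0"
  shows "(\<Sum>x\<in>insert u V. hit \<kappa> V u x * ((dg + \<kappa>) * \<psi> x - (\<Sum>y\<in>nb x. \<psi> y))) \<le> (dg + \<kappa>) * \<psi> u"
proof -
  let ?U = "insert u V" and ?h = "hit \<kappa> V u"
  have h0: "?h x \<ge> 0" for x using hit_nonneg assms by simp
  have finU: "finite ?U" using assms by simp
  have "(\<Sum>y\<in>V. \<psi> y * ((dg + \<kappa>) * ?h y)) = (\<Sum>y\<in>V. \<psi> y * (\<Sum>x\<in>nb y. ?h x))"
    using hit_harmonic[OF assms(1,2) _ assms(3)] by (intro sum.cong) auto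
  also have "\<dots> = (\<Sum>y\<in>V. \<psi> y * (\<Sum>x\<in>?U. of_bool (x \<in> nb y) * ?h x))"
  proof (rule sum.cong)
    fix y
    have "(\<Sum>x\<in>nb y. ?h x) = (\<Sum>x\<in>nb y \<inter> ?U. ?h x)"
      by (rule sum.mono_neutral_right) (auto simp: hit_outside)
    also have "\<dots> = (\<Sum>x\<in>?U. of_bool (x \<in> nb y) * ?h x)"
      by (rule sum.mono_neutral_cong_left[OF finU]) auto
    finally show "\<psi> y * (\<Sum>x\<in>nb y. ?h x) = \<psi> y * (\<Sum>x\<in>?U. of_bool (x \<in> nb y) * ?h x)" by simp
  qed simp
  also have "\<dots> \<le> (\<Sum>y\<in>?U. \<psi> y * (\<Sum>x\<in>?U. of_bool (x \<in> nb y) * ?h x))"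
    using finU h0 \<psi> by (intro sum_mono2) (auto intro!: mult_nonneg_nonneg sum_nonneg)
  also have "\<dots> = (\<Sum>y\<in>?U. \<Sum>x\<in>?U. ?h x * (of_bool (y \<in> nb x) * \<psi> y))"
    using nb_sym by (auto simp: sum_distrib_left intro!: sum.cong)
  also have "\<dots> = (\<Sum>x\<in>?U. ?h x * (\<Sum>y\<in>?U. of_bool (y \<in> nb x) * \<psi> y))"
    by (subst sum.swap) (simp add: sum_distrib_left)
  also have "\<dots> \<le> (\<Sum>x\<in>?U. ?h x * (\<Sum>y\<in>nb x. \<psi> y))"
  proof (intro sum_mono mult_left_mono h0)
    fix x
    have "(\<Sum>y\<in>?U. of_bool (y \<in> nb x) * \<psi> y) = (\<Sum>y\<in>nb x \<inter> ?U. \<psi> y)"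
      by (rule sum.mono_neutral_cong_right[OF finU]) auto
    also have "\<dots> \<le> (\<Sum>y\<in>nb x. \<psi> y)" using \<psi> by (intro sum_mono2) auto
    finally show "(\<Sum>y\<in>?U. of_bool (y \<in> nb x) * \<psi> y) \<le> (\<Sum>y\<in>nb x. \<psi> y)" .
  qed
  finally have le: "(\<Sum>y\<in>V. \<psi> y * ((dg + \<kappa>) * ?h y)) \<le> (\<Sum>x\<in>?U. ?h x * (\<Sum>y\<in>nb x. \<psi> y))" .
  have "(\<Sum>x\<in>?U. ?h x * ((dg + \<kappa>) * \<psi> x - (\<Sum>y\<in>nb x. \<psi> y))) =
    (\<Sum>x\<in>?U. \<psi> x * ((dg + \<kappa>) * ?h x)) - (\<Sum>x\<in>?U. ?h x * (\<Sum>y\<in>nb x. \<psi> y))"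
    unfolding sum_subtractf[symmetric] by (intro sum.cong) (auto simp: algebra_simps)
  also have "\<dots> \<le> (dg + \<kappa>) * \<psi> u" using le assms by (simp add: algebra_simps)
  finally show ?thesis .
qed

text \<open>A constant test function in \<open>green_parts\<close>. The left side counts expected
  descendants of \<open>u\<close> in \<open>X\<close>, so killing at rate \<kappa> limits the size
  of the past to order \<open>1 / \<kappa>\<close>.\<close>

lemma sum_hit_le:
  fixes \<kappa> :: real
  assumes "finite V" "\<kappa> > 0" "u \<notin> V" "finite X"
  shows "(\<Sum>x\<in>X. hit \<kappa> V u x) \<le> (dg + \<kappa>) / \<kappa>"
proof -
  have "(\<Sum>x\<in>X. hit \<kappa> V u x) = (\<Sum>x\<in>X \<inter> insert u V. hit \<kappa> V u x)"
    using assms by (intro sum.mono_neutral_right) (auto simp: hit_outside)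
  also have "\<dots> \<le> (\<Sum>x\<in>insert u V. hit \<kappa> V u x)"
    using assms by (intro sum_mono2) (auto simp: hit_nonneg)
  also have "\<kappa> * \<dots> \<le> dg + \<kappa>"
    using green_parts[of V \<kappa> u "\<lambda>_. 1"] assms by (simp add: card_nb sum_distrib_left distrib_left mult.commute)
  then have "(\<Sum>x\<in>insert u V. hit \<kappa> V u x) \<le> (dg + \<kappa>) / \<kappa>"
    using assms by (simp add: field_simps)
  finally show ?thesis .
qed

end

section \<open>Green function bounds\<close>

lemma leads_both_iff:
  assumes "F u = None"
  shows "leads F w z \<and> leads F w u \<longleftrightarrow> leads F w z \<and> leads F z u"
  using leads_linear[of F w z u] leads_trans[of F w z u] assms by (auto simp: leads_None)

lemma chain_set_iff:
  assumes "chain F xs u" "hd (xs @ [u]) = x" "F u = None"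
  shows "y \<in> set xs \<or> y = u \<longleftrightarrow> leads F x y"
  using assms
proof (induction xs arbitrary: x)
  case Nil
  then show ?case by (auto simp: leads_None)
next
  case (Cons a xs)
  have "leads F x y \<longleftrightarrow> x = y \<or> leads F (hd (xs @ [u])) y"
    using Cons.prems by (subst leads_unfold) auto
  moreover have "y \<in> set xs \<or> y = u \<longleftrightarrow> leads F (hd (xs @ [u])) y" using Cons by simp
  ultimately show ?case using Cons.prems by auto
qed

section \<open>Functionals of a single branch\<close>

context regular_graph
begin

text \<open>At most one summand survives in a forest: this is \<open>q\<close> evaluated at the
  branch from \<open>w\<close> to \<open>u\<close>, and 0 when there is none. The form as a sum lets
  expectations be expanded over paths.\<close>

definition pathsum :: "'a set \<Rightarrow> 'a \<Rightarrow> 'a \<Rightarrow> ('a list \<Rightarrow> real) \<Rightarrow> ('a \<Rightarrow> 'a option) \<Rightarrow> real" where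
  "pathsum V w u q F = (\<Sum>xs\<in>pathsf V w u. of_bool (chain F xs u) * q xs)"

lemma pathsum_eq:
  assumes "finite V" "F \<in> forests V" "u \<notin> V" "\<And>xs. chain F xs u \<Longrightarrow> hd (xs @ [u]) = w \<Longrightarrow> q xs = c"
  shows "pathsum V w u q F = of_bool (leads F w u) * c"
proof (cases "leads F w u")
  case True
  then obtain ys where "chain F ys u" "hd (ys @ [u]) = w" by (rule leads_chainE)
  then show ?thesis using True sum_chain_pathsf[OF assms(1,2), of ys u w q] assms(3,4)
    by (simp add: pathsum_def)
next
  case False
  have "\<not> chain F xs u" if "xs \<in> pathsf V w u" for xs
    using False that chain_leads_hd[of F xs u] by (auto simp: pathsf_def)
  then show ?thesis using False unfolding pathsum_def by (subst sum.neutral) auto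
qed

lemma pathsum_leads:
  assumes "finite V" "F \<in> forests V" "u \<notin> V" "z \<noteq> u"
  shows "pathsum V w u (\<lambda>xs. of_bool (z \<in> set xs)) F = of_bool (leads F w u) * of_bool (leads F w z)"
  using assms chain_set_iff[of F _ u w z] forestsD(1)[OF assms(2,3)] by (intro pathsum_eq) auto

lemma ex_pathsum:
  assumes "finite V" "\<kappa> \<ge> 0" "u \<notin> V"
  shows "ex \<kappa> V (pathsum V w u q) = (\<Sum>xs\<in>pathsf V w u. ratio \<kappa> V (set xs) * q xs)"
proof -
  have "ex \<kappa> V (pathsum V w u q) = (\<Sum>xs\<in>pathsf V w u. ex \<kappa> V (\<lambda>F. of_bool (chain F xs u) * q xs))"
    unfolding pathsum_def ex_sum by simp
  also have "\<dots> = (\<Sum>xs\<in>pathsf V w u. ratio \<kappa> V (set xs) * q xs)"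
  proof (rule sum.cong)
    fix xs assume "xs \<in> pathsf V w u"
    then show "ex \<kappa> V (\<lambda>F. of_bool (chain F xs u) * q xs) = ratio \<kappa> V (set xs) * q xs"
      using assms ex_const[of "V - set xs" \<kappa> "q xs"]
      by (subst ex_chain) (auto simp: pathsf_def)
  qed simp
  finally show ?thesis .
qed

text \<open>A branch to \<open>y\<close> is disjoint from the revealed branch to \<open>u\<close>;
  given the latter it is a hitting event in the volume without it.\<close>

lemma ex_pathsum_joint:
  assumes "finite V" "\<kappa> \<ge> 0" "u \<notin> V" "y \<notin> V" "y \<noteq> u"
  shows "ex \<kappa> V (\<lambda>F. pathsum V w u q F * of_bool (leads F x y)) =
    (\<Sum>xs\<in>pathsf V w u. ratio \<kappa> V (set xs) * q xs * hit \<kappa> (V - set xs) y x)"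
proof -
  have "ex \<kappa> V (\<lambda>F. pathsum V w u q F * of_bool (leads F x y)) =
      (\<Sum>xs\<in>pathsf V w u. ex \<kappa> V (\<lambda>F. of_bool (chain F xs u) * (q xs * of_bool (leads F x y))))"
    unfolding pathsum_def sum_distrib_right ex_sum by (simp add: mult.assoc)
  also have "\<dots> = (\<Sum>xs\<in>pathsf V w u. ratio \<kappa> V (set xs) * q xs * hit \<kappa> (V - set xs) y x)"
  proof (rule sum.cong)
    fix xs assume "xs \<in> pathsf V w u"
    then have xs: "xs \<in> paths V u" "distinct xs" "set xs \<subseteq> V" by (auto simp: pathsf_def paths_def)
    have "ex \<kappa> V (\<lambda>F. of_bool (chain F xs u) * (q xs * of_bool (leads F x y))) =
      ratio \<kappa> V (set xs) * ex \<kappa> (V - set xs) (\<lambda>F. q xs * of_bool (leads (ext F xs u) x y))"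
      using xs assms by (intro ex_chain) auto
    also have "ex \<kappa> (V - set xs) (\<lambda>F. q xs * of_bool (leads (ext F xs u) x y)) =
      ex \<kappa> (V - set xs) (\<lambda>F. q xs * of_bool (leads F x y))"
    proof (rule ex_cong)
      fix F assume F: "F \<in> forests (V - set xs)"
      have "leads (ext F xs u) x y \<longleftrightarrow> leads F x y"
        using assms xs forestsD(1)[OF F] by (intro leads_ext) auto
      then show "q xs * of_bool (leads (ext F xs u) x y) = q xs * of_bool (leads F x y)" by simp
    qed
    finally show "ex \<kappa> V (\<lambda>F. of_bool (chain F xs u) * (q xs * of_bool (leads F x y))) =
      ratio \<kappa> V (set xs) * q xs * hit \<kappa> (V - set xs) y x"
      by (simp add: ex_cmult hit_def mult.assoc)
  qed simp
  finally show ?thesis .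
qed

text \<open>The bound \<open>B\<close> is demanded in all smaller volumes because the volume left by
  the revealed path is arbitrary.\<close>

lemma ex_pathsum_joint_le:
  assumes "finite V" "\<kappa> \<ge> 0" "u \<notin> V" "y \<notin> V" "y \<noteq> u" "\<And>xs. q xs \<ge> 0"
    and B: "\<And>W. W \<subseteq> V \<Longrightarrow> (\<Sum>x\<in>X. c x * hit \<kappa> W y x) \<le> B"
  shows "(\<Sum>x\<in>X. c x * ex \<kappa> V (\<lambda>F. pathsum V w u q F * of_bool (leads F x y))) \<le> B * ex \<kappa> V (pathsum V w u q)"
proof -
  have "(\<Sum>x\<in>X. c x * ex \<kappa> V (\<lambda>F. pathsum V w u q F * of_bool (leads F x y))) =
    (\<Sum>xs\<in>pathsf V w u. ratio \<kappa> V (set xs) * q xs * (\<Sum>x\<in>X. c x * hit \<kappa> (V - set xs) y x))"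
    unfolding ex_pathsum_joint[OF assms(1-5)] sum_distrib_left
    by (subst sum.swap) (simp add: mult_ac)
  also have "\<dots> \<le> (\<Sum>xs\<in>pathsf V w u. ratio \<kappa> V (set xs) * q xs * B)"
    using assms ratio_nonneg[OF assms(1,2)] by (intro sum_mono mult_left_mono B) (auto simp: less_imp_le)
  also have "\<dots> = B * ex \<kappa> V (pathsum V w u q)"
    unfolding ex_pathsum[OF assms(1-3)] sum_distrib_left by (simp add: mult_ac)
  finally show ?thesis .
qed

lemma ex_cut_le:
  assumes "finite V" "\<kappa> \<ge> 0" "y \<in> V"
    and f0: "\<And>F. F \<in> forests (V - {y}) \<Longrightarrow> f F \<le> 0"
    and f1: "\<And>F w. F \<in> forests (V - {y}) \<Longrightarrow> w \<in> nb y \<Longrightarrow> \<not> leads F w y \<Longrightarrow> f (F(y \<mapsto> w)) \<le> f' w F"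
    and f': "\<And>F w. F \<in> forests (V - {y}) \<Longrightarrow> 0 \<le> f' w F"
  shows "ex \<kappa> V f \<le> ratio \<kappa> V {y} * (\<Sum>w\<in>nb y. ex \<kappa> (V - {y}) (f' w))"
proof -
  have "ex \<kappa> (V - {y}) (\<lambda>F. \<kappa> * f F + (\<Sum>w\<in>nb y. of_bool (\<not> leads F w y) * f (F(y \<mapsto> w)))) \<le>
    ex \<kappa> (V - {y}) (\<lambda>F. \<Sum>w\<in>nb y. f' w F)"
  proof (rule ex_mono)
    fix F assume F: "F \<in> forests (V - {y})"
    have "\<kappa> * f F \<le> 0" using f0[OF F] assms(2) by (simp add: mult_nonneg_nonpos)
    moreover have "(\<Sum>w\<in>nb y. of_bool (\<not> leads F w y) * f (F(y \<mapsto> w))) \<le> (\<Sum>w\<in>nb y. f' w F)"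
      using f1[OF F] f'[OF F] by (intro sum_mono) auto
    ultimately show "\<kappa> * f F + (\<Sum>w\<in>nb y. of_bool (\<not> leads F w y) * f (F(y \<mapsto> w))) \<le> (\<Sum>w\<in>nb y. f' w F)"
      by linarith
  qed (use assms in auto)
  then show ?thesis
    unfolding ex_cut[OF assms(1-3), of f] ex_sum
    using ratio_nonneg[OF assms(1,2), of "{y}"] by (intro mult_left_mono) auto
qed

lemma paths_nonempty_eq:
  assumes "u \<notin> V"
  shows "paths V u - {[]} = (\<Union>x\<in>V. pathsf V x u)"
proof
  show "paths V u - {[]} \<subseteq> (\<Union>x\<in>V. pathsf V x u)"
  proof
    fix xs assume xs: "xs \<in> paths V u - {[]}"
    then have "hd xs \<in> V" by (auto simp: paths_def neq_Nil_conv)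
    with xs show "xs \<in> (\<Union>x\<in>V. pathsf V x u)" by (auto simp: pathsf_def)
  qed
qed (use assms in \<open>auto simp: pathsf_def\<close>)

lemma sum_paths:
  assumes "finite V" "u \<notin> V"
  shows "(\<Sum>xs\<in>paths V u - {[]}. f xs) = (\<Sum>x\<in>V. \<Sum>xs\<in>pathsf V x u. (f xs :: real))"
  unfolding paths_nonempty_eq[OF assms(2)] using assms
  by (intro sum.UNION_disjoint) (auto simp: pathsf_def)

lemma sum_paths_hd:
  assumes "finite V" "\<kappa> \<ge> 0" "u \<notin> V"
  shows "(\<Sum>xs\<in>paths V u - {[]}. ratio \<kappa> V (set xs) * q (hd xs)) = (\<Sum>x\<in>V. q x * hit \<kappa> V u x)"
  unfolding sum_paths[OF assms(1,3)] hit_paths[OF assms] sum_distrib_left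
proof (intro sum.cong refl)
  fix x xs assume "x \<in> V" "xs \<in> pathsf V x u"
  then have "hd xs = x" using assms(3) by (cases xs) (auto simp: pathsf_def)
  then show "ratio \<kappa> V (set xs) * q (hd xs) = q x * ratio \<kappa> V (set xs)" by simp
qed

end

text \<open>\<open>g\<close> is a majorant of hitting probabilities, namely a superharmonic kernel
  with value 1 on the diagonal; \<open>gap\<close> measures its strictness there and bounds escape
  from below. \<open>\<phi>\<close> is a supersolution with source \<open>g\<close> and so dominates
  the convolution of the Green function with \<open>g\<close>. Its boundedness is the finiteness of
  the bubble sum, a condition of dimension above four.\<close>

locale transient_graph = regular_graph nb dg
  for nb :: "'a \<Rightarrow> 'a set" and dg :: nat +
  fixes g \<phi> :: "'a \<Rightarrow> 'a \<Rightarrow> real" and gap \<Phi> :: real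
  assumes g_nonneg: "0 \<le> g x y"
    and g_diag: "g x x = 1"
    and g_sym: "g x y = g y x"
    and g_super: "(\<Sum>w\<in>nb x. g w y) \<le> dg * g x y"
    and gap_pos: "gap > 0"
    and g_gap: "(\<Sum>w\<in>nb y. g w y) \<le> dg - gap"
    and \<phi>_nonneg: "0 \<le> \<phi> x y"
    and \<phi>_le: "\<phi> x y \<le> \<Phi>"
    and \<phi>_super: "(\<Sum>w\<in>nb x. \<phi> w y) + g x y \<le> dg * \<phi> x y"
begin

section \<open>Comparison with the kernel and with killed forests\<close>

lemma \<Phi>_nonneg: "0 \<le> \<Phi>"
  using \<phi>_nonneg \<phi>_le order_trans by blast

lemma hit_le_g:
  assumes "finite V" "\<kappa> \<ge> 0" "u \<notin> V"
  shows "hit \<kappa> V u x \<le> g x u"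
  using assms by (intro hit_le_super) (auto simp: g_nonneg g_diag g_super)

lemma ratio_le:
  assumes "finite V" "\<kappa> \<ge> 0" "y \<in> V"
  shows "ratio \<kappa> V {y} \<le> 1 / gap"
proof -
  have "(\<Sum>w\<in>nb y. hit \<kappa> (V - {y}) y w) \<le> (\<Sum>w\<in>nb y. g w y)"
    using assms by (intro sum_mono hit_le_g) auto
  then have "gap \<le> \<kappa> + dg - (\<Sum>w\<in>nb y. hit \<kappa> (V - {y}) y w)" using g_gap[of y] assms by linarith
  then show ?thesis unfolding ratio_singleton(1)[OF assms] using gap_pos by (intro divide_left_mono) auto
qed

lemma ratio_ge:
  fixes \<kappa> :: real
  assumes "finite V" "\<kappa> \<ge> 0" "y \<in> V"
  shows "1 / (dg + \<kappa>) \<le> ratio \<kappa> V {y}"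
proof -
  have "0 \<le> (\<Sum>w\<in>nb y. hit \<kappa> (V - {y}) y w)" using assms by (intro sum_nonneg hit_nonneg) auto
  then show ?thesis unfolding ratio_singleton(1)[OF assms] using ratio_singleton(2)[OF assms] dg_pos assms
    by (intro divide_left_mono) auto
qed

definition C1 :: real where "C1 = (1 + dg * \<Phi>) / gap"

lemma C1_nonneg: "0 \<le> C1"
  unfolding C1_def using gap_pos \<Phi>_nonneg by simp

text \<open>The difference of the two hitting probabilities has the source
  \<open>\<kappa> * hit\<close>, at most \<open>\<kappa> * g\<close>, and the supersolution
  \<open>\<kappa> * \<phi>\<close> absorbs it. So killing changes hitting probabilities by at most a
  multiple of \<kappa>, uniformly in the volume.\<close>

lemma hit_massive:
  fixes \<kappa> :: real
  assumes "finite V" "\<kappa> \<ge> 0" "u \<notin> V"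
  shows "hit 0 V u x \<le> hit \<kappa> V u x + \<kappa> * \<Phi>"
proof -
  have "hit 0 V u x - hit \<kappa> V u x - \<kappa> * \<phi> x u \<le> 0"
  proof (rule max_principle[of V 0 "\<lambda>x. hit 0 V u x - hit \<kappa> V u x - \<kappa> * \<phi> x u"])
    fix x assume x: "x \<in> V"
    have "dg * hit 0 V u x = (\<Sum>w\<in>nb x. hit 0 V u w)"
      using hit_harmonic[of V 0 x u] assms x by simp
    moreover have "dg * hit \<kappa> V u x + \<kappa> * hit \<kappa> V u x = (\<Sum>w\<in>nb x. hit \<kappa> V u w)"
      using hit_harmonic[OF assms(1,2) x assms(3)] by (simp add: algebra_simps)
    moreover have "\<kappa> * ((\<Sum>w\<in>nb x. \<phi> w u) + g x u) \<le> \<kappa> * (dg * \<phi> x u)"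
      using \<phi>_super assms by (intro mult_left_mono) auto
    moreover have "\<kappa> * hit \<kappa> V u x \<le> \<kappa> * g x u"
      using assms hit_le_g by (intro mult_left_mono) auto
    ultimately show "(real dg + 0) * (hit 0 V u x - hit \<kappa> V u x - \<kappa> * \<phi> x u) \<le>
        (\<Sum>w\<in>nb x. hit 0 V u w - hit \<kappa> V u w - \<kappa> * \<phi> w u)"
      unfolding sum_subtractf sum_distrib_left[symmetric] by (simp add: algebra_simps)
  next
    fix x assume "x \<notin> V"
    then show "hit 0 V u x - hit \<kappa> V u x - \<kappa> * \<phi> x u \<le> 0"
      using assms \<phi>_nonneg[of x u] by (cases "x = u") (auto simp: hit_outside)
  qed (use assms in auto)
  moreover have "\<kappa> * \<phi> x u \<le> \<kappa> * \<Phi>" using assms \<phi>_le by (intro mult_left_mono) auto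
  ultimately show ?thesis by linarith
qed

lemma ratio_massive_singleton:
  assumes "finite V" "\<kappa> \<ge> 0" "y \<in> V"
  shows "ratio 0 V {y} \<le> (1 + C1 * \<kappa>) * ratio \<kappa> V {y}"
proof -
  let ?a = "dg - (\<Sum>w\<in>nb y. hit 0 (V - {y}) y w)"
  let ?b = "\<kappa> + dg - (\<Sum>w\<in>nb y. hit \<kappa> (V - {y}) y w)"
  have r0: "ratio 0 V {y} = 1 / ?a" "?a > 0" using ratio_singleton[of V 0 y] assms by auto
  have r: "ratio \<kappa> V {y} = 1 / ?b" "?b > 0" using ratio_singleton[OF assms] by auto
  have "1 / ?a \<le> 1 / gap" using ratio_le[of V 0 y] assms r0 by simp
  then have ga: "gap \<le> ?a" using gap_pos r0(2) by (simp add: field_simps)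
  have "(\<Sum>w\<in>nb y. hit 0 (V - {y}) y w) \<le> (\<Sum>w\<in>nb y. hit \<kappa> (V - {y}) y w + \<kappa> * \<Phi>)"
    using assms by (intro sum_mono hit_massive) auto
  also have "\<dots> = (\<Sum>w\<in>nb y. hit \<kappa> (V - {y}) y w) + dg * (\<kappa> * \<Phi>)"
    by (simp add: sum.distrib card_nb)
  finally have "?b \<le> ?a + \<kappa> * (1 + dg * \<Phi>)" by (simp add: algebra_simps)
  also have "\<kappa> * (1 + dg * \<Phi>) = gap * (C1 * \<kappa>)" using gap_pos by (simp add: C1_def)
  also have "\<dots> \<le> ?a * (C1 * \<kappa>)" using ga C1_nonneg assms by (intro mult_right_mono) auto
  finally have "?b \<le> (1 + C1 * \<kappa>) * ?a" by (simp add: algebra_simps)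
  moreover have "1 / a \<le> c * (1 / b)" if "0 < a" "0 < b" "b \<le> c * a" for a b c :: real
    using that by (simp add: field_simps)
  ultimately show ?thesis unfolding r0(1) r(1) using r0(2) r(2) by blast
qed

text \<open>Each vertex of the path costs at most the factor \<open>1 + C1 * \<kappa>\<close>. With
  \<kappa> = 1/n a path of length of order \<open>n\<close> loses only a constant, so its weight may
  be replaced by the killed one, whose sum over all paths is controlled by
  \<open>1 / \<kappa>\<close>.\<close>

lemma ratio_massive:
  assumes "finite V" "\<kappa> \<ge> 0" "X \<subseteq> V"
  shows "ratio 0 V X \<le> exp (C1 * \<kappa> * card X) * ratio \<kappa> V X"
proof -
  have "finite X" using assms finite_subset by auto
  then show ?thesis using assms(3)
  proof (induction X)
    case empty
    then show ?case using Z_pos[of V 0] Z_pos[of V \<kappa>] assms by (simp add: ratio_def)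
  next
    case (insert y X)
    have "ratio 0 (V - X) {y} \<le> (1 + C1 * \<kappa>) * ratio \<kappa> (V - X) {y}"
      using insert assms by (intro ratio_massive_singleton) auto
    also have "\<dots> \<le> exp (C1 * \<kappa>) * ratio \<kappa> (V - X) {y}"
      using assms ratio_nonneg[of "V - X" \<kappa> "{y}"] exp_ge_add_one_self[of "C1 * \<kappa>"]
      by (intro mult_right_mono) auto
    finally have 1: "ratio 0 (V - X) {y} \<le> exp (C1 * \<kappa>) * ratio \<kappa> (V - X) {y}" .
    have "ratio 0 V (insert y X) = ratio 0 V X * ratio 0 (V - X) {y}"
      using assms by (intro ratio_insert) auto
    also have "\<dots> \<le> (exp (C1 * \<kappa> * card X) * ratio \<kappa> V X) * (exp (C1 * \<kappa>) * ratio \<kappa> (V - X) {y})"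
      using insert assms ratio_nonneg[of "V - X" 0 "{y}"] ratio_nonneg[of V \<kappa> X]
      by (intro mult_mono 1) auto
    also have "\<dots> = exp (C1 * \<kappa> * card (insert y X)) * ratio \<kappa> V (insert y X)"
    proof -
      have "C1 * \<kappa> * card (insert y X) = C1 * \<kappa> * card X + C1 * \<kappa>"
        using insert by (simp add: distrib_left)
      then have "exp (C1 * \<kappa> * card (insert y X)) = exp (C1 * \<kappa> * card X) * exp (C1 * \<kappa>)"
        by (simp only: exp_add)
      then show ?thesis unfolding ratio_insert[OF assms(1,2)] by (simp only: mult_ac)
    qed
    finally show ?case .
  qed
qed

end

section \<open>Two paths into the same root\<close>

context regular_graph
begin

lemma pathsum_one:
  assumes "finite V" "F \<in> forests V" "u \<notin> V"
  shows "pathsum V w u (\<lambda>_. 1) F = of_bool (leads F w u)"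
  using pathsum_eq[OF assms, of w "\<lambda>_. 1" 1] by simp

lemma ex_pathsum_one:
  assumes "finite V" "u \<notin> V"
  shows "ex \<kappa> V (pathsum V w u (\<lambda>_. 1)) = hit \<kappa> V u w"
  unfolding hit_def by (rule ex_cong) (simp add: pathsum_one assms)

text \<open>Given the branch from \<open>w\<close> to \<open>u\<close>, the branch of
  \<open>x\<close> lives in a smaller volume, where its chance to end at \<open>y\<close> is
  smaller.\<close>

lemma negative_correlation:
  assumes "finite V" "\<kappa> \<ge> 0" "u \<notin> V" "y \<notin> V" "y \<noteq> u"
  shows "ex \<kappa> V (\<lambda>F. of_bool (leads F w u) * of_bool (leads F x y)) \<le> hit \<kappa> V y x * hit \<kappa> V u w"
proof -
  have "ex \<kappa> V (\<lambda>F. of_bool (leads F w u) * of_bool (leads F x y)) =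
    (\<Sum>x\<in>{x}. 1 * ex \<kappa> V (\<lambda>F. pathsum V w u (\<lambda>_. 1) F * of_bool (leads F x y)))"
    by simp (rule ex_cong, simp add: pathsum_one assms)
  also have "\<dots> \<le> hit \<kappa> V y x * ex \<kappa> V (pathsum V w u (\<lambda>_. 1))"
    using assms by (intro ex_pathsum_joint_le) (auto intro!: hit_mono)
  finally show ?thesis using assms by (simp add: ex_pathsum_one)
qed

end

section \<open>Energy of a branch\<close>

context transient_graph
begin

text \<open>Energy of the counting measure on the path for the kernel \<open>g\<close>. The squared
  number of vertices divided by it bounds the capacity of the path from below, up to
  constants.\<close>

definition energy :: "'a list \<Rightarrow> real" where
  "energy xs = (\<Sum>y\<in>set xs. \<Sum>z\<in>set xs. g y z)"

lemma energy_nonneg: "0 \<le> energy xs"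
  unfolding energy_def by (intro sum_nonneg g_nonneg)

text \<open>The bubble at \<open>u\<close>: testing \<open>green_parts\<close> with
  \<open>\<phi>\<close> turns the product of two kernels into the constant
  \<open>\<Phi>\<close>.\<close>

lemma sum_hit_g:
  fixes \<kappa> :: real
  assumes "finite V" "\<kappa> \<ge> 0" "u \<notin> V" "finite X"
  shows "(\<Sum>w\<in>X. hit \<kappa> V u w * g w u) \<le> (dg + \<kappa>) * \<Phi>"
proof -
  have "(\<Sum>w\<in>X. hit \<kappa> V u w * g w u) = (\<Sum>w\<in>X \<inter> insert u V. hit \<kappa> V u w * g w u)"
    using assms by (intro sum.mono_neutral_right) (auto simp: hit_outside)
  also have "\<dots> \<le> (\<Sum>w\<in>insert u V. hit \<kappa> V u w * g w u)"
    using assms by (intro sum_mono2) (auto intro!: mult_nonneg_nonneg hit_nonneg g_nonneg)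
  also have "\<dots> \<le> (\<Sum>w\<in>insert u V. hit \<kappa> V u w * ((dg + \<kappa>) * \<phi> w u - (\<Sum>y\<in>nb w. \<phi> y u)))"
  proof (intro sum_mono mult_left_mono hit_nonneg assms)
    fix w
    show "g w u \<le> (dg + \<kappa>) * \<phi> w u - (\<Sum>y\<in>nb w. \<phi> y u)"
      using \<phi>_super[of u w] mult_nonneg_nonneg[OF assms(2) \<phi>_nonneg[of w u]] by (simp add: distrib_right)
  qed
  also have "\<dots> \<le> (dg + \<kappa>) * \<phi> u u"
    using assms \<phi>_nonneg by (intro green_parts) auto
  also have "\<dots> \<le> (dg + \<kappa>) * \<Phi>" using assms \<phi>_le by (intro mult_left_mono) auto
  finally show ?thesis .
qed

text \<open>Cut at \<open>z\<close>: the branch of \<open>w\<close> through \<open>z\<close> to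
  \<open>u\<close> splits into a branch from \<open>w\<close> to \<open>z\<close> and one from a
  neighbour of \<open>z\<close> to \<open>u\<close>. They lie in different trees, so negative
  correlation separates them, and harmonicity carries out the sum over the neighbour.\<close>

lemma two_step:
  fixes \<kappa> :: real
  assumes "finite V" "\<kappa> \<ge> 0" "z \<in> V" "u \<notin> V"
  shows "ex \<kappa> V (\<lambda>F. of_bool (leads F w z) * of_bool (leads F w u)) \<le>
    1 / gap * (hit \<kappa> (V - {z}) z w * ((dg + \<kappa>) * hit \<kappa> V u z))"
proof -
  let ?V = "V - {z}"
  have "z \<noteq> u" using assms by auto
  have fin: "finite ?V" using assms by simp
  have "ex \<kappa> V (\<lambda>F. of_bool (leads F w z) * of_bool (leads F w u)) \<le>
    ratio \<kappa> V {z} * (\<Sum>w2\<in>nb z. ex \<kappa> ?V (\<lambda>F. of_bool (leads F w2 u) * of_bool (leads F w z)))"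
  proof (rule ex_cut_le[OF assms(1-3)])
    fix F assume F: "F \<in> forests ?V"
    have Fz: "F z = None" and Fu: "F u = None" using forestsD(1)[OF F] assms by auto
    have excl: "\<not> (leads F w z \<and> leads F w u)"
      using leads_terminal_unique[of F w z u] Fz Fu \<open>z \<noteq> u\<close> by auto
    then show "of_bool (leads F w z) * of_bool (leads F w u) \<le> (0::real)" by auto
    fix w2
    show "of_bool (leads (F(z \<mapsto> w2)) w z) * of_bool (leads (F(z \<mapsto> w2)) w u) \<le>
        (of_bool (leads F w2 u) * of_bool (leads F w z) :: real)"
      using excl by (auto simp: leads_upd[of F z, OF Fz])
  qed auto
  also have "\<dots> \<le> 1 / gap * (\<Sum>w2\<in>nb z. hit \<kappa> ?V z w * hit \<kappa> V u w2)"
  proof (intro mult_mono sum_mono ratio_le assms)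
    fix w2
    have "ex \<kappa> ?V (\<lambda>F. of_bool (leads F w2 u) * of_bool (leads F w z)) \<le> hit \<kappa> ?V z w * hit \<kappa> ?V u w2"
      using assms \<open>z \<noteq> u\<close> by (intro negative_correlation) auto
    also have "\<dots> \<le> hit \<kappa> ?V z w * hit \<kappa> V u w2"
      using assms by (intro mult_left_mono hit_mono hit_nonneg) auto
    finally show "ex \<kappa> ?V (\<lambda>F. of_bool (leads F w2 u) * of_bool (leads F w z)) \<le> hit \<kappa> ?V z w * hit \<kappa> V u w2" .
  qed (use gap_pos assms in \<open>auto intro!: sum_nonneg ex_nonneg\<close>)
  also have "\<dots> = 1 / gap * (hit \<kappa> ?V z w * ((dg + \<kappa>) * hit \<kappa> V u z))"
    unfolding sum_distrib_left[symmetric] hit_harmonic[OF assms] by simp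
  finally show ?thesis .
qed

text \<open>Now the cut is at \<open>y\<close>, and the branch from \<open>w\<close> through
  \<open>z\<close> to \<open>u\<close> is revealed before that of \<open>x\<close>. The sum over
  \<open>x\<close> comes last and is at most \<open>(dg + \<kappa>) / \<kappa>\<close> in whatever
  volume is left.\<close>

lemma three_step:
  fixes \<kappa> :: real
  assumes "finite V" "\<kappa> > 0" "y \<in> V" "u \<notin> V" "z \<in> V" "z \<noteq> y"
  shows "(\<Sum>x\<in>V. ex \<kappa> V (\<lambda>F. of_bool (leads F x y \<and> leads F y z \<and> leads F y u))) \<le>
    1 / gap * ((dg + \<kappa>) / \<kappa> * (\<Sum>w\<in>nb y. ex \<kappa> (V - {y}) (\<lambda>F. of_bool (leads F w z) * of_bool (leads F w u))))"
proof -
  let ?V = "V - {y}"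
  have yu: "y \<noteq> u" "z \<noteq> u" and \<kappa>: "\<kappa> \<ge> 0" using assms by auto
  have finV: "finite ?V" and uV: "u \<notin> ?V" using assms by auto
  let ?q = "\<lambda>xs. of_bool (z \<in> set xs) :: real"
  have 1: "ex \<kappa> V (\<lambda>F. of_bool (leads F x y \<and> leads F y z \<and> leads F y u)) \<le>
      1 / gap * (\<Sum>w\<in>nb y. ex \<kappa> ?V (\<lambda>F. pathsum ?V w u ?q F * of_bool (leads F x y)))" (is "?l x \<le> _") for x
  proof -
    have "?l x \<le> ratio \<kappa> V {y} * (\<Sum>w\<in>nb y. ex \<kappa> ?V (\<lambda>F. pathsum ?V w u ?q F * of_bool (leads F x y)))"
    proof (rule ex_cut_le[OF assms(1) \<kappa> assms(3)])
      fix F assume F: "F \<in> forests ?V"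
      have Fy: "F y = None" and Fu: "F u = None" using forestsD(1)[OF F] assms by auto
      show "of_bool (leads F x y \<and> leads F y z \<and> leads F y u) \<le> (0::real)"
        using yu by (simp add: leads_None[of F y, OF Fy])
      fix w
      show "of_bool (leads (F(y \<mapsto> w)) x y \<and> leads (F(y \<mapsto> w)) y z \<and> leads (F(y \<mapsto> w)) y u) \<le>
          pathsum ?V w u ?q F * of_bool (leads F x y)"
        unfolding pathsum_leads[OF finV F uV yu(2)]
        using yu assms(6) by (auto simp: leads_upd[of F y, OF Fy] leads_None[of F y, OF Fy])
      show "0 \<le> pathsum ?V w u ?q F * of_bool (leads F x y)"
        by (simp add: pathsum_def sum_nonneg)
    qed
    also have "\<dots> \<le> 1 / gap * (\<Sum>w\<in>nb y. ex \<kappa> ?V (\<lambda>F. pathsum ?V w u ?q F * of_bool (leads F x y)))"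
      using assms \<kappa> by (intro mult_right_mono ratio_le sum_nonneg ex_nonneg) (auto simp: pathsum_def sum_nonneg)
    finally show ?thesis .
  qed
  have "(\<Sum>x\<in>V. ?l x) \<le> (\<Sum>x\<in>V. 1 / gap * (\<Sum>w\<in>nb y. ex \<kappa> ?V (\<lambda>F. pathsum ?V w u ?q F * of_bool (leads F x y))))"
    by (intro sum_mono 1)
  also have "\<dots> = 1 / gap * (\<Sum>w\<in>nb y. \<Sum>x\<in>V. 1 * ex \<kappa> ?V (\<lambda>F. pathsum ?V w u ?q F * of_bool (leads F x y)))"
    unfolding sum_distrib_left[symmetric] by (subst sum.swap) simp
  also have "\<dots> \<le> 1 / gap * (\<Sum>w\<in>nb y. (dg + \<kappa>) / \<kappa> * ex \<kappa> ?V (pathsum ?V w u ?q))"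
    using gap_pos
  proof (intro mult_left_mono sum_mono ex_pathsum_joint_le)
    fix W assume "W \<subseteq> ?V"
    then show "(\<Sum>x\<in>V. 1 * hit \<kappa> W y x) \<le> (dg + \<kappa>) / \<kappa>"
      using assms sum_hit_le[of W \<kappa> y V] finite_subset[of W V] by auto
  qed (use assms yu in auto)
  also have "(\<Sum>w\<in>nb y. (dg + \<kappa>) / \<kappa> * ex \<kappa> ?V (pathsum ?V w u ?q)) =
     (dg + \<kappa>) / \<kappa> * (\<Sum>w\<in>nb y. ex \<kappa> ?V (\<lambda>F. of_bool (leads F w z) * of_bool (leads F w u)))"
    unfolding sum_distrib_left
    by (intro sum.cong refl arg_cong2[where f = "(*)"] ex_cong)
      (simp add: pathsum_leads[OF finV _ uV yu(2)] mult.commute)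
  finally show ?thesis .
qed

definition pass :: "real \<Rightarrow> 'a set \<Rightarrow> 'a \<Rightarrow> 'a \<Rightarrow> 'a \<Rightarrow> real" where
  "pass \<kappa> V u y z = (\<Sum>x\<in>V. ex \<kappa> V (\<lambda>F. of_bool (leads F x y \<and> leads F y z \<and> leads F y u)))"

lemma pass_same:
  fixes \<kappa> :: real
  assumes "finite V" "\<kappa> > 0" "y \<in> V" "u \<notin> V"
  shows "pass \<kappa> V u y y \<le> 1 / gap * ((dg + \<kappa>) / \<kappa> * ((dg + \<kappa>) * hit \<kappa> V u y))"
proof -
  have "pass \<kappa> V u y y = (\<Sum>x\<in>V. ex \<kappa> V (\<lambda>F. of_bool (leads F x y) * of_bool (leads F x u)))"
    unfolding pass_def
  proof (intro sum.cong refl ex_cong)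
    fix x F assume "F \<in> forests V"
    then have "F u = None" using forestsD(1) assms(4) by blast
    then show "of_bool (leads F x y \<and> leads F y y \<and> leads F y u) =
        (of_bool (leads F x y) * of_bool (leads F x u) :: real)"
      using leads_both_iff[of F u x y] by auto
  qed
  also have "\<dots> \<le> (\<Sum>x\<in>V. 1 / gap * (hit \<kappa> (V - {y}) y x * ((dg + \<kappa>) * hit \<kappa> V u y)))"
    using assms by (intro sum_mono two_step) auto
  also have "\<dots> = 1 / gap * ((\<Sum>x\<in>V. hit \<kappa> (V - {y}) y x) * ((dg + \<kappa>) * hit \<kappa> V u y))"
    by (simp only: sum_distrib_left sum_distrib_right)
  also have "\<dots> \<le> 1 / gap * ((dg + \<kappa>) / \<kappa> * ((dg + \<kappa>) * hit \<kappa> V u y))"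
    using assms gap_pos hit_nonneg[of V \<kappa> u y]
    by (intro mult_left_mono mult_right_mono sum_hit_le) auto
  finally show ?thesis .
qed

lemma pass_diff:
  fixes \<kappa> :: real
  assumes "finite V" "\<kappa> > 0" "y \<in> V" "u \<notin> V" "z \<in> V" "z \<noteq> y"
  shows "pass \<kappa> V u y z \<le> 1 / gap * ((dg + \<kappa>) / \<kappa> * ((dg + \<kappa>) * hit \<kappa> V u z)) *
    (1 / gap * (\<Sum>w\<in>nb y. hit \<kappa> (V - {z}) z w))"
proof -
  have \<kappa>: "\<kappa> \<ge> 0" using assms by simp
  have "pass \<kappa> V u y z \<le> 1 / gap * ((dg + \<kappa>) / \<kappa> *
      (\<Sum>w\<in>nb y. ex \<kappa> (V - {y}) (\<lambda>F. of_bool (leads F w z) * of_bool (leads F w u))))"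
    unfolding pass_def by (rule three_step[OF assms])
  also have "\<dots> \<le> 1 / gap * ((dg + \<kappa>) / \<kappa> *
      (\<Sum>w\<in>nb y. 1 / gap * (hit \<kappa> (V - {z}) z w * ((dg + \<kappa>) * hit \<kappa> V u z))))"
  proof (intro mult_left_mono sum_mono)
    fix w
    have "ex \<kappa> (V - {y}) (\<lambda>F. of_bool (leads F w z) * of_bool (leads F w u)) \<le>
        1 / gap * (hit \<kappa> (V - {y} - {z}) z w * ((dg + \<kappa>) * hit \<kappa> (V - {y}) u z))"
      using assms by (intro two_step) auto
    also have "\<dots> \<le> 1 / gap * (hit \<kappa> (V - {z}) z w * ((dg + \<kappa>) * hit \<kappa> V u z))"
      using assms gap_pos by (intro mult_left_mono mult_mono hit_mono mult_nonneg_nonneg hit_nonneg) auto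
    finally show "ex \<kappa> (V - {y}) (\<lambda>F. of_bool (leads F w z) * of_bool (leads F w u)) \<le>
        1 / gap * (hit \<kappa> (V - {z}) z w * ((dg + \<kappa>) * hit \<kappa> V u z))" .
  qed (use gap_pos assms in auto)
  also have "\<dots> = 1 / gap * ((dg + \<kappa>) / \<kappa> * ((dg + \<kappa>) * hit \<kappa> V u z)) *
    (1 / gap * (\<Sum>w\<in>nb y. hit \<kappa> (V - {z}) z w))"
    by (simp only: sum_distrib_left[symmetric] sum_distrib_right[symmetric] mult_ac)
  finally show ?thesis .
qed

lemma sum_nb_hit_g:
  fixes \<kappa> :: real
  assumes "finite V" "\<kappa> \<ge> 0" "z \<notin> V" "finite Y"
  shows "(\<Sum>y\<in>Y. (\<Sum>w\<in>nb y. hit \<kappa> V z w) * g y z) \<le> dg * ((dg + \<kappa>) * \<Phi>)"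
proof -
  let ?X = "\<Union>y\<in>Y. nb y"
  have finX: "finite ?X" using assms by simp
  have "(\<Sum>y\<in>Y. (\<Sum>w\<in>nb y. hit \<kappa> V z w) * g y z) = (\<Sum>y\<in>Y. \<Sum>w\<in>?X. of_bool (w \<in> nb y) * hit \<kappa> V z w * g y z)"
    unfolding sum_distrib_right
    by (intro sum.cong refl sum.mono_neutral_cong_left[OF finX]) auto
  also have "\<dots> = (\<Sum>w\<in>?X. hit \<kappa> V z w * (\<Sum>y\<in>Y. of_bool (w \<in> nb y) * g y z))"
    by (subst sum.swap) (simp add: sum_distrib_left mult_ac)
  also have "\<dots> \<le> (\<Sum>w\<in>?X. hit \<kappa> V z w * (dg * g w z))"
  proof (intro sum_mono mult_left_mono hit_nonneg assms)
    fix w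
    have "(\<Sum>y\<in>Y. of_bool (w \<in> nb y) * g y z) = (\<Sum>y\<in>nb w \<inter> Y. g y z)"
      using nb_sym by (intro sum.mono_neutral_cong_right assms) auto
    also have "\<dots> \<le> (\<Sum>y\<in>nb w. g y z)" using g_nonneg by (intro sum_mono2) auto
    also have "\<dots> \<le> dg * g w z" by (rule g_super)
    finally show "(\<Sum>y\<in>Y. of_bool (w \<in> nb y) * g y z) \<le> dg * g w z" .
  qed
  also have "\<dots> = dg * (\<Sum>w\<in>?X. hit \<kappa> V z w * g w z)" by (simp add: sum_distrib_left mult_ac)
  also have "\<dots> \<le> dg * ((dg + \<kappa>) * \<Phi>)" using assms finX by (intro mult_left_mono sum_hit_g) auto
  finally show ?thesis .
qed

text \<open>The left side is the expected energy of the branches to \<open>u\<close>, summed over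
  all starting points. One factor \<open>(dg + \<kappa>) / \<kappa>\<close> counts the starting
  points, the other one the positions of \<open>z\<close>; the sum over \<open>y\<close> at fixed
  \<open>z\<close> is a bubble and costs a constant. So the order is the square of
  \<open>1 / \<kappa>\<close>.\<close>

lemma sum_paths_energy:
  fixes \<kappa> :: real
  assumes "finite V" "\<kappa> > 0" "u \<notin> V"
  shows "(\<Sum>xs\<in>paths V u - {[]}. ratio \<kappa> V (set xs) * energy xs) \<le>
    2 * (1 / gap * ((dg + \<kappa>) / \<kappa> * (dg + \<kappa>))) * (1 + 1 / gap * (dg * ((dg + \<kappa>) * \<Phi>))) * ((dg + \<kappa>) / \<kappa>)"
proof -
  have \<kappa>: "\<kappa> \<ge> 0" using assms by simp
  let ?A = "\<lambda>F x y z. of_bool (leads F x y \<and> leads F y z \<and> leads F y u) :: real"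
  let ?K = "1 / gap * ((dg + \<kappa>) / \<kappa> * (dg + \<kappa>))"
  have K0: "?K \<ge> 0" using gap_pos assms by simp
  \<comment> \<open>Two vertices of a branch are met in one order or the other. Keeping both terms
    counts the diagonal twice, which is harmless.\<close>
  have pw: "pathsum V x u energy F \<le> (\<Sum>y\<in>V. \<Sum>z\<in>V. g y z * (?A F x y z + ?A F x z y))"
    if F: "F \<in> forests V" for F x
  proof -
    have Fu: "F u = None" using forestsD(1)[OF F assms(3)] .
    let ?c = "\<Sum>y\<in>V. \<Sum>z\<in>V. g y z * (of_bool (leads F x y) * of_bool (leads F x z))"
    have "pathsum V x u energy F = of_bool (leads F x u) * ?c"
    proof (rule pathsum_eq[OF assms(1) F assms(3)])
      fix xs assume xs: "chain F xs u" "hd (xs @ [u]) = x"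
      have sub: "set xs \<subseteq> V" using chain_in_paths[OF F xs(1)] by (simp add: paths_def)
      have iff: "y \<in> set xs \<longleftrightarrow> leads F x y" if "y \<in> V" for y
        using chain_set_iff[OF xs Fu, of y] that assms(3) by auto
      have "energy xs = (\<Sum>y\<in>V. of_bool (y \<in> set xs) * (\<Sum>z\<in>V. of_bool (z \<in> set xs) * g y z))"
        unfolding energy_def
        by (intro sum.mono_neutral_cong_left[OF assms(1) sub]) (auto intro!: sum.mono_neutral_cong_left[OF assms(1) sub])
      also have "\<dots> = ?c"
        unfolding sum_distrib_left by (intro sum.cong refl) (simp add: iff)
      finally show "energy xs = ?c" .
    qed
    also have "\<dots> \<le> (\<Sum>y\<in>V. \<Sum>z\<in>V. g y z * (?A F x y z + ?A F x z y))"
      unfolding sum_distrib_left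
    proof (intro sum_mono)
      fix y z
      have "of_bool (leads F x u) * (of_bool (leads F x y) * of_bool (leads F x z)) \<le> ?A F x y z + ?A F x z y"
        using leads_linear[of F x y z] leads_both_iff[of F u x y, OF Fu] leads_both_iff[of F u x z, OF Fu] by auto
      then show "of_bool (leads F x u) * (g y z * (of_bool (leads F x y) * of_bool (leads F x z))) \<le>
          g y z * (?A F x y z + ?A F x z y)"
        by (subst mult.left_commute) (rule mult_left_mono[OF _ g_nonneg])
    qed
    finally show ?thesis .
  qed
  have "(\<Sum>xs\<in>paths V u - {[]}. ratio \<kappa> V (set xs) * energy xs) = (\<Sum>x\<in>V. ex \<kappa> V (pathsum V x u energy))"
    unfolding sum_paths[OF assms(1,3)] by (intro sum.cong refl ex_pathsum[symmetric] assms \<kappa>)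
  also have "\<dots> \<le> (\<Sum>x\<in>V. ex \<kappa> V (\<lambda>F. \<Sum>y\<in>V. \<Sum>z\<in>V. g y z * (?A F x y z + ?A F x z y)))"
    by (intro sum_mono ex_mono assms \<kappa> pw)
  also have "\<dots> = (\<Sum>y\<in>V. \<Sum>z\<in>V. g y z * (pass \<kappa> V u y z + pass \<kappa> V u z y))"
    unfolding ex_sum ex_cmult ex_add
    apply (rule trans[OF sum.swap])
    apply (rule sum.cong[OF refl])
    apply (rule trans[OF sum.swap])
    apply (simp only: sum_distrib_left[symmetric] sum.distrib pass_def)
    done
  also have "\<dots> = 2 * (\<Sum>z\<in>V. \<Sum>y\<in>V. g y z * pass \<kappa> V u y z)"
  proof -
    have "(\<Sum>y\<in>V. \<Sum>z\<in>V. g y z * pass \<kappa> V u z y) = (\<Sum>z\<in>V. \<Sum>y\<in>V. g y z * pass \<kappa> V u y z)"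
      by (intro sum.cong refl) (simp add: g_sym)
    moreover have "(\<Sum>y\<in>V. \<Sum>z\<in>V. g y z * pass \<kappa> V u y z) = (\<Sum>z\<in>V. \<Sum>y\<in>V. g y z * pass \<kappa> V u y z)"
      by (rule sum.swap)
    ultimately show ?thesis by (simp only: distrib_left sum.distrib mult_2)
  qed
  also have "(\<Sum>z\<in>V. \<Sum>y\<in>V. g y z * pass \<kappa> V u y z) \<le> ?K * (1 + 1 / gap * (dg * ((dg + \<kappa>) * \<Phi>))) * ((dg + \<kappa>) / \<kappa>)"
  proof -
  have "(\<Sum>z\<in>V. \<Sum>y\<in>V. g y z * pass \<kappa> V u y z) \<le>
    (\<Sum>z\<in>V. ?K * (1 + 1 / gap * (dg * ((dg + \<kappa>) * \<Phi>))) * hit \<kappa> V u z)"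
  proof (intro sum_mono)
    fix z assume z: "z \<in> V"
    let ?h = "hit \<kappa> V u z"
    have h0: "?h \<ge> 0" using assms by (intro hit_nonneg) auto
    have "(\<Sum>y\<in>V. g y z * pass \<kappa> V u y z) = pass \<kappa> V u z z + (\<Sum>y\<in>V - {z}. g y z * pass \<kappa> V u y z)"
      using assms z by (subst sum.remove[of V z]) (auto simp: g_diag)
    also have "\<dots> \<le> ?K * ?h + (\<Sum>y\<in>V - {z}. g y z * (?K * ?h * (1 / gap * (\<Sum>w\<in>nb y. hit \<kappa> (V - {z}) z w))))"
    proof (intro add_mono sum_mono mult_left_mono g_nonneg)
      show "pass \<kappa> V u z z \<le> ?K * ?h"
        using pass_same[OF assms(1,2) z assms(3)] by (simp only: mult.assoc)
      fix y assume "y \<in> V - {z}"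
      then show "pass \<kappa> V u y z \<le> ?K * ?h * (1 / gap * (\<Sum>w\<in>nb y. hit \<kappa> (V - {z}) z w))"
        using pass_diff[OF assms(1,2) _ assms(3) z, of y] by (simp only: mult.assoc) auto
    qed
    also have "(\<Sum>y\<in>V - {z}. g y z * (?K * ?h * (1 / gap * (\<Sum>w\<in>nb y. hit \<kappa> (V - {z}) z w)))) =
      ?K * ?h * (1 / gap * (\<Sum>y\<in>V - {z}. (\<Sum>w\<in>nb y. hit \<kappa> (V - {z}) z w) * g y z))"
    proof -
      have "(\<Sum>y\<in>Y. g y z * (c * (d * s y))) = c * (d * (\<Sum>y\<in>Y. s y * g y z))" for c d s Y
        by (simp add: sum_distrib_left mult_ac)
      then show ?thesis .
    qed
    also have "\<dots> \<le> ?K * ?h * (1 / gap * (dg * ((dg + \<kappa>) * \<Phi>)))"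
      using assms \<kappa> K0 h0 gap_pos by (intro mult_left_mono sum_nb_hit_g) auto
    also have "?K * ?h + ?K * ?h * (1 / gap * (dg * ((dg + \<kappa>) * \<Phi>))) =
        ?K * (1 + 1 / gap * (dg * ((dg + \<kappa>) * \<Phi>))) * ?h"
    proof -
      have "k * h + k * h * t = k * (1 + t) * h" for k h t :: real by (simp add: algebra_simps)
      then show ?thesis .
    qed
    finally show "(\<Sum>y\<in>V. g y z * pass \<kappa> V u y z) \<le> ?K * (1 + 1 / gap * (dg * ((dg + \<kappa>) * \<Phi>))) * ?h"
      by simp
  qed
  also have "(\<Sum>z\<in>V. ?K * (1 + 1 / gap * (dg * ((dg + \<kappa>) * \<Phi>))) * hit \<kappa> V u z) =
      ?K * (1 + 1 / gap * (dg * ((dg + \<kappa>) * \<Phi>))) * (\<Sum>z\<in>V. hit \<kappa> V u z)"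
    by (rule sum_distrib_left[symmetric])
  also have "\<dots> \<le> ?K * (1 + 1 / gap * (dg * ((dg + \<kappa>) * \<Phi>))) * ((dg + \<kappa>) / \<kappa>)"
    using assms K0 gap_pos \<Phi>_nonneg by (intro mult_left_mono sum_hit_le mult_nonneg_nonneg) auto
  finally show ?thesis .
  qed
  finally show ?thesis by (simp only: mult.assoc)
qed

lemma massive_sum:
  assumes "finite V" "\<kappa> \<ge> 0" "A \<subseteq> paths V u" "\<And>xs. xs \<in> A \<Longrightarrow> length xs \<le> m" "\<And>xs. f xs \<ge> 0"
  shows "(\<Sum>xs\<in>A. ratio 0 V (set xs) * f xs) \<le> exp (C1 * \<kappa> * m) * (\<Sum>xs\<in>A. ratio \<kappa> V (set xs) * f xs)"
  unfolding sum_distrib_left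
proof (intro sum_mono)
  fix xs assume xs: "xs \<in> A"
  then have "set xs \<subseteq> V" "card (set xs) \<le> m"
    using assms(3) order.trans[OF card_length assms(4)] by (auto simp: paths_def)
  then have "ratio 0 V (set xs) \<le> exp (C1 * \<kappa> * card (set xs)) * ratio \<kappa> V (set xs)"
    using assms by (intro ratio_massive) auto
  also have "\<dots> \<le> exp (C1 * \<kappa> * m) * ratio \<kappa> V (set xs)"
    using \<open>card (set xs) \<le> m\<close> ratio_nonneg[OF assms(1,2), of "set xs"] C1_nonneg assms(2)
    by (intro mult_right_mono) (auto intro!: mult_left_mono)
  finally show "ratio 0 V (set xs) * f xs \<le> exp (C1 * \<kappa> * m) * (ratio \<kappa> V (set xs) * f xs)"
    using mult_right_mono[OF _ assms(5)[of xs]] by (simp only: mult.assoc[symmetric])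
qed

end

section \<open>Boundary flux and escape probabilities\<close>

context regular_graph
begin

definition bw :: "'a set \<Rightarrow> 'a \<Rightarrow> real" where
  "bw V v = card (nb v - V)"

text \<open>The probability that a walk from \<open>x\<close> leaves \<open>V\<close> without
  meeting \<open>V - W\<close>. It is written through its complement because the exit points inside
  \<open>V\<close> form a finite set.\<close>

definition esc :: "'a set \<Rightarrow> 'a set \<Rightarrow> 'a \<Rightarrow> real" where
  "esc W V x = 1 - (\<Sum>z\<in>V - W. hit 0 W z x)"

lemma bw_nonneg: "0 \<le> bw V v"
  by (simp add: bw_def)

lemma sum_bw_pos:
  assumes "finite V" "V \<noteq> {}"
  shows "0 < (\<Sum>v\<in>V. bw V v)"
proof -
  obtain y w where "y \<in> V" "w \<in> nb y" "w \<notin> V" using escape[OF assms] by blast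
  then have "0 < bw V y" unfolding bw_def using finite_nb[of y] by (auto simp: card_gt_0_iff)
  then show ?thesis using \<open>y \<in> V\<close> assms bw_nonneg by (intro sum_pos2) auto
qed

lemma hit_harmonic0:
  assumes "finite V" "z \<in> V" "u \<notin> V"
  shows "dg * hit 0 V u z = (\<Sum>w\<in>nb z. hit 0 V u w)"
  using hit_harmonic[of V 0 z u] assms by simp

lemma sum_bw:
  fixes f :: "'a \<Rightarrow> real"
  assumes "finite V"
  shows "(\<Sum>v\<in>V. bw V v * f v) = (\<Sum>v\<in>V. dg * f v - (\<Sum>x\<in>nb v \<inter> V. f x))"
proof -
  have bw: "bw V v = real dg - real (card (nb v \<inter> V))" for v
  proof -
    have "card (nb v) = card (nb v - V) + card (nb v \<inter> V)"
      by (metis card_Diff_subset_Int card_mono finite_Int finite_nb inf_le1 le_add_diff_inverse2)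
    then have "real dg = real (card (nb v - V)) + real (card (nb v \<inter> V))"
      by (simp flip: of_nat_add card_nb[of v])
    then show ?thesis by (simp add: bw_def)
  qed
  have "(\<Sum>v\<in>V. \<Sum>x\<in>nb v \<inter> V. f x) = (\<Sum>v\<in>V. \<Sum>x\<in>V. of_bool (x \<in> nb v) * f x)"
    by (intro sum.cong refl sum.mono_neutral_cong_left assms) auto
  also have "\<dots> = (\<Sum>x\<in>V. \<Sum>v\<in>V. of_bool (v \<in> nb x) * f x)"
    by (subst sum.swap) (use nb_sym in \<open>auto intro!: sum.cong\<close>)
  also have "\<dots> = (\<Sum>x\<in>V. card (nb x \<inter> V) * f x)"
    using assms by (intro sum.cong refl) (simp add: sum_distrib_right[symmetric] sum.If_cases Int_commute)
  finally show ?thesis by (simp add: bw sum_subtractf left_diff_distrib)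
qed

text \<open>Summation by parts turns the boundary weights into the Laplacian of \<open>hit\<close>
  on \<open>V\<close>, which vanishes away from \<open>y\<close>. What is left sits at
  \<open>y\<close>, or at the neighbours of \<open>y\<close> when \<open>y\<close> is outside
  \<open>V\<close>, and has mass at most \<open>dg\<close>.\<close>

lemma flux_le:
  assumes "finite V" "W \<subseteq> V" "y \<notin> W"
  shows "(\<Sum>v\<in>V. bw V v * hit 0 W y v) \<le> dg"
proof -
  have fin: "finite W" using assms finite_subset by auto
  let ?h = "hit 0 W y"
  have h0: "?h x \<ge> 0" "?h x \<le> 1" for x using fin hit_nonneg hit_le_1 by auto
  have "(\<Sum>v\<in>V. bw V v * ?h v) = (\<Sum>v\<in>V. dg * ?h v - (\<Sum>x\<in>nb v \<inter> V. ?h x))"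
    by (rule sum_bw[OF assms(1)])
  also have "\<dots> \<le> (\<Sum>v\<in>V. if y \<in> V then (if v = y then real dg else 0) else of_bool (v \<in> nb y))"
  proof (rule sum_mono)
    fix v assume v: "v \<in> V"
    have nn: "0 \<le> (\<Sum>x\<in>nb v \<inter> V. ?h x)" using h0 by (intro sum_nonneg) auto
    show "dg * ?h v - (\<Sum>x\<in>nb v \<inter> V. ?h x) \<le>
        (if y \<in> V then (if v = y then real dg else 0) else of_bool (v \<in> nb y))"
    proof (cases "v \<in> W")
      case True
      then have "v \<noteq> y" using assms by auto
      have 1: "dg * ?h v = (\<Sum>x\<in>nb v. ?h x)" using fin True assms by (intro hit_harmonic0) auto
      have 2: "(\<Sum>x\<in>nb v. ?h x) = (\<Sum>x\<in>nb v \<inter> V. ?h x) + (\<Sum>x\<in>nb v - V. ?h x)"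
        by (subst sum.union_disjoint[symmetric]) (auto intro: sum.cong)
      have 3: "(\<Sum>x\<in>nb v - V. ?h x) = (\<Sum>x\<in>nb v - V. if x = y then 1 else 0)"
        using assms fin by (intro sum.cong) (auto intro!: hit_outside)
      show ?thesis using \<open>v \<noteq> y\<close> nb_sym[of y v] by (auto simp: 1 2 3)
    next
      case False
      show ?thesis
      proof (cases "v = y")
        case True
        have "dg * ?h v \<le> dg" using h0(2)[of v] by (simp add: mult_left_le)
        then have "dg * ?h v - (\<Sum>x\<in>nb v \<inter> V. ?h x) \<le> dg" using nn by linarith
        then show ?thesis using True v by simp
      next
        case vy: False
        then have "?h v = 0" using False by (intro hit_outside)
        then have "dg * ?h v - (\<Sum>x\<in>nb v \<inter> V. ?h x) \<le> 0" using nn by simp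
        also have "0 \<le> (if y \<in> V then (if v = y then real dg else 0) else of_bool (v \<in> nb y))" by simp
        finally show ?thesis .
      qed
    qed
  qed
  also have "\<dots> \<le> dg"
  proof (cases "y \<in> V")
    case False
    have "(\<Sum>v\<in>V. of_bool (v \<in> nb y) :: real) = card (V \<inter> nb y)" using assms by simp
    also have "\<dots> \<le> card (nb y)" by (intro of_nat_mono card_mono) auto
    finally show ?thesis using False by (simp add: card_nb)
  qed (use assms in simp)
  finally show ?thesis .
qed

lemma esc_outside: "x \<notin> V \<Longrightarrow> W \<subseteq> V \<Longrightarrow> esc W V x = 1"
  unfolding esc_def by (subst sum.neutral) (auto intro!: hit_outside)

lemma esc_root:
  assumes "finite V" "W \<subseteq> V" "x \<in> V - W"
  shows "esc W V x = 0"
proof -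
  have "finite W" using assms finite_subset by auto
  then have "(\<Sum>z\<in>V - W. hit 0 W z x) = (\<Sum>z\<in>V - W. if z = x then 1 else 0)"
    using assms by (intro sum.cong) (auto simp: hit_outside)
  then show ?thesis using assms by (simp add: esc_def)
qed

lemma esc_harmonic:
  assumes "finite V" "W \<subseteq> V" "x \<in> W"
  shows "dg * esc W V x = (\<Sum>w\<in>nb x. esc W V w)"
proof -
  have "finite W" using assms finite_subset by auto
  have "(\<Sum>z\<in>V - W. dg * hit 0 W z x) = (\<Sum>z\<in>V - W. \<Sum>w\<in>nb x. hit 0 W z w)"
    using assms \<open>finite W\<close> by (intro sum.cong refl hit_harmonic0) auto
  also have "\<dots> = (\<Sum>w\<in>nb x. \<Sum>z\<in>V - W. hit 0 W z w)" by (rule sum.swap)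
  finally show ?thesis unfolding esc_def right_diff_distrib sum_distrib_left sum_subtractf
    by (simp add: card_nb)
qed

lemma esc_nonneg:
  assumes "finite V" "W \<subseteq> V"
  shows "0 \<le> esc W V x"
proof -
  have "finite W" using assms finite_subset by auto
  have "- esc W V x \<le> 0"
  proof (rule max_principle[of W 0 "\<lambda>x. - esc W V x"])
    fix x assume "x \<in> W"
    then show "(real dg + 0) * - esc W V x \<le> (\<Sum>w\<in>nb x. - esc W V w)"
      using esc_harmonic[OF assms, of x] by (simp add: sum_negf)
  next
    fix x assume "x \<notin> W"
    then show "- esc W V x \<le> 0"
      using esc_outside[of x V W] esc_root[OF assms, of x] assms by (cases "x \<in> V") auto
  qed (use \<open>finite W\<close> in auto)
  then show ?thesis by simp
qed

lemma esc_le_1: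
  assumes "finite V" "W \<subseteq> V"
  shows "esc W V x \<le> 1"
  unfolding esc_def using assms finite_subset[of W V] by (auto intro!: sum_nonneg hit_nonneg)

text \<open>Reversibility: boundary branches flow into \<open>y\<close> at the rate at which walks
  from \<open>y\<close> escape. It is Green's second identity for \<open>hit\<close> and
  \<open>esc\<close>; the double sum inside \<open>V\<close> is antisymmetric and drops out, and on
  the edges leaving \<open>V\<close> the function \<open>esc\<close> is 1.\<close>

lemma flux_eq:
  assumes "finite V" "W \<subseteq> V" "y \<in> V - W"
  shows "(\<Sum>v\<in>V. bw V v * hit 0 W y v) = (\<Sum>w\<in>nb y. esc W V w)"
proof -
  have fin: "finite W" using assms finite_subset by auto
  let ?h = "hit 0 W y" and ?e = "esc W V"
  have anti: "(\<Sum>v\<in>V. \<Sum>x\<in>nb v \<inter> V. ?h v * ?e x - ?h x * ?e v) = 0"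
  proof -
    have "(\<Sum>v\<in>V. \<Sum>x\<in>nb v \<inter> V. ?h v * ?e x) = (\<Sum>v\<in>V. \<Sum>x\<in>V. of_bool (x \<in> nb v) * (?h v * ?e x))"
      by (intro sum.cong refl sum.mono_neutral_cong_left assms) auto
    also have "\<dots> = (\<Sum>v\<in>V. \<Sum>x\<in>V. of_bool (x \<in> nb v) * (?h x * ?e v))"
      by (subst sum.swap) (use nb_sym in \<open>auto intro!: sum.cong\<close>)
    also have "\<dots> = (\<Sum>v\<in>V. \<Sum>x\<in>nb v \<inter> V. ?h x * ?e v)"
      by (intro sum.cong refl sum.mono_neutral_cong_right assms) auto
    finally show ?thesis by (simp add: sum_subtractf)
  qed
  have "(\<Sum>w\<in>nb y. ?e w) = (\<Sum>v\<in>V. if v = y then \<Sum>w\<in>nb y. ?e w else 0)"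
    using assms by simp
  also have "\<dots> = (\<Sum>v\<in>V. ?h v * (\<Sum>x\<in>nb v. ?e x) - ?e v * (\<Sum>x\<in>nb v. ?h x))"
  proof (rule sum.cong)
    fix v assume v: "v \<in> V"
    show "(if v = y then \<Sum>w\<in>nb y. ?e w else 0) = ?h v * (\<Sum>x\<in>nb v. ?e x) - ?e v * (\<Sum>x\<in>nb v. ?h x)"
    proof (cases "v \<in> W")
      case True
      then have "v \<noteq> y" using assms by auto
      then show ?thesis using esc_harmonic[OF assms(1,2) True] hit_harmonic0[OF fin True, of y] assms
        by (simp flip: esc_harmonic[OF assms(1,2) True] hit_harmonic0[OF fin True])
    next
      case False
      then have "?e v = 0" using v assms by (intro esc_root) auto
      then show ?thesis using False fin by (cases "v = y") (auto simp: hit_outside)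
    qed
  qed simp
  also have "\<dots> = (\<Sum>v\<in>V. (\<Sum>x\<in>nb v \<inter> V. ?h v * ?e x - ?h x * ?e v) + (\<Sum>x\<in>nb v - V. ?h v * ?e x - ?h x * ?e v))"
  proof (rule sum.cong)
    fix v
    have "?h v * (\<Sum>x\<in>nb v. ?e x) - ?e v * (\<Sum>x\<in>nb v. ?h x) = (\<Sum>x\<in>nb v. ?h v * ?e x - ?h x * ?e v)"
      by (simp add: sum_distrib_left sum_subtractf mult.commute)
    also have "\<dots> = (\<Sum>x\<in>nb v \<inter> V. ?h v * ?e x - ?h x * ?e v) + (\<Sum>x\<in>nb v - V. ?h v * ?e x - ?h x * ?e v)"
      by (subst sum.union_disjoint[symmetric]) (auto intro: sum.cong)
    finally show "?h v * (\<Sum>x\<in>nb v. ?e x) - ?e v * (\<Sum>x\<in>nb v. ?h x) =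
      (\<Sum>x\<in>nb v \<inter> V. ?h v * ?e x - ?h x * ?e v) + (\<Sum>x\<in>nb v - V. ?h v * ?e x - ?h x * ?e v)" .
  qed simp
  also have "\<dots> = (\<Sum>v\<in>V. \<Sum>x\<in>nb v - V. ?h v * ?e x - ?h x * ?e v)"
    unfolding sum.distrib anti by simp
  also have "\<dots> = (\<Sum>v\<in>V. bw V v * ?h v)"
  proof (intro sum.cong refl)
    fix v
    have "(\<Sum>x\<in>nb v - V. ?h v * ?e x - ?h x * ?e v) = (\<Sum>x\<in>nb v - V. ?h v)"
    proof (rule sum.cong)
      fix x assume "x \<in> nb v - V"
      then have "x \<notin> V" "x \<notin> W" "x \<noteq> y" using assms by auto
      then show "?h v * ?e x - ?h x * ?e v = ?h v" using assms by (simp add: esc_outside hit_outside)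
    qed simp
    then show "(\<Sum>x\<in>nb v - V. ?h v * ?e x - ?h x * ?e v) = bw V v * ?h v" by (simp add: bw_def)
  qed
  finally show ?thesis ..
qed

lemma esc_step:
  assumes "finite V" "W \<subseteq> V" "x \<notin> V - W" "x' \<in> nb x"
  shows "esc W V x' \<le> dg * esc W V x"
proof (cases "x \<in> W")
  case True
  then show ?thesis unfolding esc_harmonic[OF assms(1,2) True]
    using assms by (intro member_le_sum) (auto intro: esc_nonneg)
next
  case False
  then have "x \<notin> V" using assms by auto
  then show ?thesis using esc_outside[of x V W] esc_le_1[OF assms(1,2), of x'] assms dg_pos by simp
qed

text \<open>A one-sided Harnack estimate along a route that avoids the roots in \<open>V\<close>:
  each step costs at most a factor \<open>dg\<close>, so escape from far away implies escape from
  the start.\<close>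

lemma esc_run:
  assumes "finite V" "W \<subseteq> V" "\<And>k. k < m \<Longrightarrow> r k \<notin> V - W" "\<And>k. k < m \<Longrightarrow> r (Suc k) \<in> nb (r k)"
  shows "esc W V (r m) \<le> dg ^ m * esc W V (r 0)"
  using assms(3,4)
proof (induction m)
  case (Suc m)
  have "esc W V (r (Suc m)) \<le> dg * esc W V (r m)" using Suc.prems assms by (intro esc_step) auto
  also have "\<dots> \<le> dg * (dg ^ m * esc W V (r 0))" using Suc by (intro mult_left_mono) auto
  finally show ?case by simp
qed simp

text \<open>The comparison function is set to 0 away from \<open>V \<union> B\<close>: there
  \<open>esc\<close> is 1 while no \<open>hit\<close> compensates it, and the maximum principle asks
  for a sign on the whole complement of \<open>W\<close>.\<close>

lemma exits_ge:
  assumes "finite V" "W \<subseteq> V" "finite B" "\<And>x. x \<in> V \<Longrightarrow> nb x - V \<subseteq> B" "w \<in> W \<union> B" "B \<inter> V = {}"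
  shows "esc W V w \<le> (\<Sum>b\<in>B. hit 0 W b w)"
proof -
  have fin: "finite W" using assms finite_subset by auto
  let ?f = "\<lambda>x. if x \<in> V \<union> B then esc W V x - (\<Sum>b\<in>B. hit 0 W b x) else 0"
  have "?f w \<le> 0"
  proof (rule max_principle[OF fin, of 0 ?f])
    fix x assume x: "x \<in> W"
    have "(\<Sum>b\<in>B. dg * hit 0 W b x) = (\<Sum>b\<in>B. \<Sum>w\<in>nb x. hit 0 W b w)"
      using x assms fin by (intro sum.cong refl hit_harmonic0) auto
    also have "\<dots> = (\<Sum>w\<in>nb x. \<Sum>b\<in>B. hit 0 W b w)" by (rule sum.swap)
    finally have 1: "dg * (esc W V x - (\<Sum>b\<in>B. hit 0 W b x)) = (\<Sum>w\<in>nb x. esc W V w - (\<Sum>b\<in>B. hit 0 W b w))"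
      by (simp add: right_diff_distrib sum_distrib_left sum_subtractf esc_harmonic[OF assms(1,2) x])
    have "(\<Sum>w\<in>nb x. ?f w) = (\<Sum>w\<in>nb x. esc W V w - (\<Sum>b\<in>B. hit 0 W b w))"
      using x assms by (intro sum.cong) auto
    then show "(real dg + 0) * ?f x \<le> (\<Sum>w\<in>nb x. ?f w)" using 1 x assms by auto
  next
    fix x assume x: "x \<notin> W"
    show "?f x \<le> 0"
    proof (cases "x \<in> V")
      case True
      then show ?thesis using x esc_root[OF assms(1,2), of x] fin by (auto intro!: sum_nonneg hit_nonneg)
    next
      case False
      then have "esc W V x = 1" using assms by (intro esc_outside) auto
      moreover have "(\<Sum>b\<in>B. hit 0 W b x) = 1" if "x \<in> B"
      proof -
        have "(\<Sum>b\<in>B. hit 0 W b x) = (\<Sum>b\<in>B. if b = x then 1 else 0)"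
          using x fin by (intro sum.cong) (auto simp: hit_outside)
        then show ?thesis using that assms by simp
      qed
      ultimately show ?thesis using False by auto
    qed
  qed simp
  then show ?thesis using assms by (auto split: if_splits)
qed

text \<open>As a function of the start, the weighted sum of visiting probabilities is subharmonic up
  to the source \<open>dg * G\<close>; hence it stays below \<open>dg * \<psi>\<close>.\<close>

lemma sum_visit:
  fixes G \<psi> :: "'a \<Rightarrow> real"
  assumes "finite W" "\<And>x. 0 \<le> G x" "\<And>x. 0 \<le> \<psi> x" "\<And>x. (\<Sum>w\<in>nb x. \<psi> w) + G x \<le> dg * \<psi> x"
  shows "(\<Sum>z\<in>W. hit 0 (W - {z}) z w * G z) \<le> dg * \<psi> w"
proof -
  let ?U = "\<lambda>w. \<Sum>z\<in>W. hit 0 (W - {z}) z w * G z"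
  have "?U w - dg * \<psi> w \<le> 0"
  proof (rule max_principle[of W 0 "\<lambda>w. ?U w - dg * \<psi> w"])
    fix x assume x: "x \<in> W"
    have "dg * ?U x \<le> (\<Sum>w\<in>nb x. ?U w) + dg * G x"
    proof -
      have "dg * ?U x = (\<Sum>z\<in>W. dg * hit 0 (W - {z}) z x * G z)" by (simp add: sum_distrib_left mult_ac)
      also have "\<dots> \<le> (\<Sum>z\<in>W. (\<Sum>w\<in>nb x. hit 0 (W - {z}) z w) * G z + (if z = x then dg * G x else 0))"
      proof (rule sum_mono)
        fix z assume z: "z \<in> W"
        show "dg * hit 0 (W - {z}) z x * G z \<le>
            (\<Sum>w\<in>nb x. hit 0 (W - {z}) z w) * G z + (if z = x then dg * G x else 0)"
        proof (cases "z = x")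
          case True
          have "0 \<le> (\<Sum>w\<in>nb x. hit 0 (W - {z}) z w) * G z"
            using assms by (intro mult_nonneg_nonneg sum_nonneg hit_nonneg) auto
          then show ?thesis using True assms by simp
        next
          case False
          then show ?thesis using hit_harmonic0[of "W - {z}" x z] assms x by simp
        qed
      qed
      also have "\<dots> = (\<Sum>w\<in>nb x. ?U w) + dg * G x"
        using x assms by (simp add: sum.distrib sum_distrib_right) (subst sum.swap, simp)
      finally show ?thesis .
    qed
    moreover have "dg * ((\<Sum>w\<in>nb x. \<psi> w) + G x) \<le> dg * (dg * \<psi> x)"
      using assms by (intro mult_left_mono) auto
    ultimately show "(real dg + 0) * (?U x - dg * \<psi> x) \<le> (\<Sum>w\<in>nb x. ?U w - dg * \<psi> w)"
      unfolding sum_subtractf sum_distrib_left[symmetric] by (simp add: algebra_simps)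
  next
    fix x assume x: "x \<notin> W"
    have "?U x = 0"
    proof (rule sum.neutral, rule ballI)
      fix z assume "z \<in> W"
      then have "x \<notin> W - {z}" "x \<noteq> z" using x by auto
      then show "hit 0 (W - {z}) z x * G z = 0" by (simp add: hit_outside)
    qed
    then show "?U x - dg * \<psi> x \<le> 0" using assms by simp
  qed (use assms in auto)
  then show ?thesis by simp
qed

end

section \<open>Visits of boundary branches to one and to two vertices\<close>

context transient_graph
begin

lemma visit_le:
  fixes \<kappa> :: real
  assumes "finite W" "\<kappa> \<ge> 0" "z \<in> W"
  shows "ex \<kappa> W (\<lambda>F. of_bool (leads F w z)) \<le> (dg + \<kappa>) / gap * hit \<kappa> (W - {z}) z w"
proof -
  have "ex \<kappa> W (\<lambda>F. of_bool (leads F w z)) \<le> ratio \<kappa> W {z} * ex \<kappa> (W - {z}) (\<lambda>F. (dg + \<kappa>) * of_bool (leads F w z))"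
    unfolding ex_cut[OF assms, of "\<lambda>F. of_bool (leads F w z)"]
  proof (intro mult_left_mono ex_mono)
    fix F assume F: "F \<in> forests (W - {z})"
    then have Fz: "F z = None" using forestsD(1) by blast
    have "leads (F(z \<mapsto> w2)) w z \<longleftrightarrow> leads F w z" for w2 by (auto simp: leads_upd[of F z, OF Fz])
    then have "(\<Sum>w2\<in>nb z. of_bool (\<not> leads F w2 z) * of_bool (leads (F(z \<mapsto> w2)) w z)) \<le>
       (\<Sum>w2\<in>nb z. of_bool (leads F w z) :: real)" by (intro sum_mono) auto
    then show "\<kappa> * of_bool (leads F w z) + (\<Sum>w2\<in>nb z. of_bool (\<not> leads F w2 z) * of_bool (leads (F(z \<mapsto> w2)) w z))
       \<le> (dg + \<kappa>) * of_bool (leads F w z)" by (simp add: card_nb distrib_right)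
  qed (use assms ratio_nonneg[OF assms(1,2), of "{z}"] in auto)
  also have "\<dots> = ratio \<kappa> W {z} * ((dg + \<kappa>) * hit \<kappa> (W - {z}) z w)"
    unfolding ex_cmult hit_def ..
  also have "\<dots> \<le> 1 / gap * ((dg + \<kappa>) * hit \<kappa> (W - {z}) z w)"
    using assms by (intro mult_right_mono ratio_le mult_nonneg_nonneg hit_nonneg) auto
  finally show ?thesis by simp
qed

lemma esc_ge:
  assumes "finite V" "W \<subseteq> V"
  shows "1 - (\<Sum>z\<in>V - W. g x z) \<le> esc W V x"
  unfolding esc_def using assms finite_subset[of W V]
  by (auto intro!: sum_mono hit_le_g)

text \<open>For each order of \<open>y\<close> and \<open>y'\<close> the later vertex is cut first.
  The leg between them costs \<open>g y y'\<close>; the leg from the boundary to the earlier one is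
  summed over its start by \<open>flux_le\<close>, so no factor depends on the volume.\<close>

lemma second_moment:
  assumes "finite V" "y \<in> V" "y' \<in> V"
  shows "(\<Sum>v\<in>V. bw V v * ex 0 V (\<lambda>F. of_bool (leads F v y) * of_bool (leads F v y'))) \<le>
    2 * (dg ^ 3 / gap ^ 2 + dg ^ 2 / gap) * g y y'"
proof (cases "y = y'")
  case True
  have "(\<Sum>v\<in>V. bw V v * ex 0 V (\<lambda>F. of_bool (leads F v y) * of_bool (leads F v y'))) =
    (\<Sum>v\<in>V. bw V v * ex 0 V (\<lambda>F. of_bool (leads F v y)))"
    using True by (intro sum.cong refl arg_cong2[where f = "(*)"] ex_cong) auto
  also have "\<dots> \<le> (\<Sum>v\<in>V. bw V v * (dg / gap * hit 0 (V - {y}) y v))"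
    using visit_le[OF assms(1), of 0 y] assms bw_nonneg by (intro sum_mono mult_left_mono) auto
  also have "\<dots> = dg / gap * (\<Sum>v\<in>V. bw V v * hit 0 (V - {y}) y v)"
    by (simp add: sum_distrib_left mult_ac)
  also have "\<dots> \<le> dg / gap * dg" using gap_pos assms by (intro mult_left_mono flux_le) auto
  also have "\<dots> \<le> 2 * (dg ^ 3 / gap ^ 2 + dg ^ 2 / gap) * g y y'"
  proof -
    have "0 \<le> dg ^ 3 / gap ^ 2" "0 \<le> dg ^ 2 / gap" using gap_pos by simp_all
    moreover have "dg / gap * dg = dg ^ 2 / gap" by (simp add: power2_eq_square)
    moreover have "c \<le> 2 * (a + c)" if "0 \<le> a" "0 \<le> c" for a c :: real using that by simp
    ultimately have "dg / gap * dg \<le> 2 * (dg ^ 3 / gap ^ 2 + dg ^ 2 / gap)" by metis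
    then show ?thesis using True by (simp add: g_diag)
  qed
  finally show ?thesis .
next
  case False
  let ?S = "\<lambda>y y'. (\<Sum>v\<in>V. bw V v * ex 0 V (\<lambda>F. of_bool (leads F v y \<and> leads F y y')))"
  have S: "?S y y' \<le> dg ^ 3 / gap ^ 2 * g y y'" if "y \<in> V" "y' \<in> V" "y \<noteq> y'" for y y'
  proof -
    let ?W = "V - {y'}"
    have e: "ex 0 V (\<lambda>F. of_bool (leads F v y \<and> leads F y y')) \<le>
        dg / gap * (1 / gap * (hit 0 (?W - {y}) y v * (dg * g y y')))" for v
    proof -
      have "ex 0 V (\<lambda>F. of_bool (leads F v y \<and> leads F y y')) =
        ratio 0 V {y'} * ex 0 ?W (\<lambda>F. 0 * of_bool (leads F v y \<and> leads F y y') +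
          (\<Sum>w\<in>nb y'. of_bool (\<not> leads F w y') * of_bool (leads (F(y' \<mapsto> w)) v y \<and> leads (F(y' \<mapsto> w)) y y')))"
        using assms that by (intro ex_cut) auto
      also have "\<dots> \<le> ratio 0 V {y'} * ex 0 ?W (\<lambda>F. real dg * (of_bool (leads F v y) * of_bool (leads F v y')))"
      proof (intro mult_left_mono ex_mono)
        fix F assume F: "F \<in> forests ?W"
        then have Fy: "F y' = None" using forestsD(1) by blast
        have "of_bool (\<not> leads F w y') * of_bool (leads (F(y' \<mapsto> w)) v y \<and> leads (F(y' \<mapsto> w)) y y') \<le>
            (of_bool (leads F v y) * of_bool (leads F v y') :: real)" for w
          using leads_upd[of F y', OF Fy, of w] leads_trans[of F w y y'] leads_trans[of F v y y'] by auto
        then have "(\<Sum>w\<in>nb y'. of_bool (\<not> leads F w y') * of_bool (leads (F(y' \<mapsto> w)) v y \<and> leads (F(y' \<mapsto> w)) y y'))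
            \<le> (\<Sum>w\<in>nb y'. of_bool (leads F v y) * of_bool (leads F v y') :: real)" by (intro sum_mono)
        then show "0 * of_bool (leads F v y \<and> leads F y y') +
          (\<Sum>w\<in>nb y'. of_bool (\<not> leads F w y') * of_bool (leads (F(y' \<mapsto> w)) v y \<and> leads (F(y' \<mapsto> w)) y y')) \<le>
          real dg * (of_bool (leads F v y) * of_bool (leads F v y'))"
          by (simp only: mult_zero_left add_0 sum_constant card_nb)
      qed (use assms ratio_nonneg[of V 0 "{y'}"] in auto)
      also have "\<dots> \<le> 1 / gap * (dg * (1 / gap * (hit 0 (?W - {y}) y v * (dg * hit 0 ?W y' y))))"
      proof -
        have "ex 0 ?W (\<lambda>F. of_bool (leads F v y) * of_bool (leads F v y')) \<le>
            1 / gap * (hit 0 (?W - {y}) y v * (real dg * hit 0 ?W y' y))"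
          using two_step[of ?W 0 y y' v] assms that by simp
        then show ?thesis
          unfolding ex_cmult
          using assms that gap_pos by (intro mult_mono ratio_le mult_left_mono mult_nonneg_nonneg ex_nonneg) auto
      qed
      also have "\<dots> \<le> 1 / gap * (dg * (1 / gap * (hit 0 (?W - {y}) y v * (dg * g y y'))))"
        using assms that gap_pos hit_le_g[of ?W 0 y' y]
        by (intro mult_left_mono) (auto intro!: mult_left_mono hit_nonneg)
      finally show ?thesis by simp
    qed
    have "?S y y' \<le> (\<Sum>v\<in>V. bw V v * (dg / gap * (1 / gap * (hit 0 (?W - {y}) y v * (dg * g y y')))))"
      by (intro sum_mono mult_left_mono e bw_nonneg)
    also have "\<dots> = dg / gap * (1 / gap * (dg * g y y')) * (\<Sum>v\<in>V. bw V v * hit 0 (?W - {y}) y v)"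
      by (simp add: sum_distrib_left mult_ac)
    also have "\<dots> \<le> dg / gap * (1 / gap * (dg * g y y')) * dg"
      using gap_pos assms g_nonneg by (intro mult_left_mono flux_le mult_nonneg_nonneg) auto
    also have "\<dots> = dg ^ 3 / gap ^ 2 * g y y'" by (simp add: power2_eq_square power3_eq_cube)
    finally show ?thesis .
  qed
  have "(\<Sum>v\<in>V. bw V v * ex 0 V (\<lambda>F. of_bool (leads F v y) * of_bool (leads F v y'))) \<le> ?S y y' + ?S y' y"
    unfolding sum.distrib[symmetric] distrib_left[symmetric] ex_add[symmetric]
  proof (intro sum_mono mult_left_mono ex_mono bw_nonneg)
    fix v F
    show "of_bool (leads F v y) * of_bool (leads F v y') \<le>
      (of_bool (leads F v y \<and> leads F y y') + of_bool (leads F v y' \<and> leads F y' y) :: real)"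
      using leads_linear[of F v y y'] by auto
  qed (use assms in auto)
  also have "\<dots> \<le> dg ^ 3 / gap ^ 2 * g y y' + dg ^ 3 / gap ^ 2 * g y y'"
    using add_mono[OF S[of y y'] S[of y' y]] False assms(2,3) g_sym[of y' y] by simp
  also have "\<dots> \<le> 2 * (dg ^ 3 / gap ^ 2 + dg ^ 2 / gap) * g y y'"
  proof -
    have "0 \<le> dg ^ 2 / gap" using gap_pos by simp
    moreover have "a * t + a * t \<le> 2 * (a + c) * t" if "0 \<le> c" "0 \<le> t" for a c t :: real
      using mult_nonneg_nonneg[OF that] by (simp add: algebra_simps)
    ultimately show ?thesis using g_nonneg[of y y'] by blast
  qed
  finally show ?thesis .
qed

end

section \<open>Disjoint branches\<close>

text \<open>The ray offers routes out of a vertex whose price, \<open>dg\<close> per step, does not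
  depend on the volume. \<open>ray_g\<close>: from far out on the positive half the negative half is
  hit with probability at most one half. \<open>ray_\<phi>\<close>: the path of
  \<open>ray y 1\<close> has small expected interaction with a far point of the negative
  half.\<close>

locale transient_ray = transient_graph nb dg g \<phi> gap \<Phi>
  for nb :: "'a \<Rightarrow> 'a set" and dg g \<phi> gap \<Phi> +
  fixes ray :: "'a \<Rightarrow> int \<Rightarrow> 'a"
  assumes ray_0: "ray y 0 = y"
    and ray_nb: "ray y (k + 1) \<in> nb (ray y k)"
    and ray_inj: "ray y j = ray y k \<Longrightarrow> j = k"
    and ray_g: "\<exists>M. \<forall>y N. (\<Sum>k\<le>N. g (ray y (1 + int M)) (ray y (- int k))) \<le> 1 / 2"
    and ray_\<phi>: "\<epsilon> > 0 \<Longrightarrow> \<exists>M\<ge>1. \<forall>y. \<phi> (ray y 1) (ray y (- int M)) \<le> \<epsilon> \<and> g (ray y (- int M)) y \<le> 1 / 4"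
begin

lemma sum_leads_le_1:
  assumes "finite B" "F \<in> forests W" "B \<inter> W = {}"
  shows "(\<Sum>b\<in>B. of_bool (leads F w b)) \<le> (1::real)"
proof (cases "\<exists>b\<in>B. leads F w b")
  case True
  then obtain b where b: "b \<in> B" "leads F w b" by blast
  have "(\<Sum>b'\<in>B. of_bool (leads F w b')) = (\<Sum>b'\<in>B. if b' = b then 1 else 0 :: real)"
  proof (rule sum.cong)
    fix b' assume b': "b' \<in> B"
    have "F b = None" "F b' = None" using forestsD(1)[OF assms(2)] b b' assms(3) by auto
    then have "leads F w b' \<longleftrightarrow> b' = b" using leads_terminal_unique[of F w b b'] b by auto
    then show "of_bool (leads F w b') = (if b' = b then 1 else 0 :: real)" by simp
  qed simp
  then show ?thesis using b assms(1) by simp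
next
  case False
  then show ?thesis by (subst sum.neutral) auto
qed

text \<open>Two disjoint paths leave \<open>y\<close> in opposite directions: the ray on one side carries the path of
  \<open>ray y 1\<close>, and deleting a long stretch of the ray on the other side leaves room for the path
  that enters \<open>y\<close>.\<close>

lemma nonintersection:
  obtains c0 where "c0 > 0"
    "\<And>V y. finite V \<Longrightarrow> y \<in> V \<Longrightarrow> c0 \<le> (\<Sum>v\<in>V. bw V v * ex 0 V (\<lambda>F. of_bool (leads F v y)))"
proof -
  obtain M1 where M1: "\<And>y N. (\<Sum>k\<le>N. g (ray y (1 + int M1)) (ray y (- int k))) \<le> 1 / 2"
    using ray_g by blast
  \<comment> \<open>One half is the escape probability guaranteed after \<open>M1\<close> steps
    along the ray; the power is the price of those steps.\<close>
  define p where "p = 1 / (2 * real dg ^ M1)"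
  have p: "p > 0" using dg_pos by (simp add: p_def)
  \<comment> \<open>Makes the expected interaction of the first path with \<open>c\<close> at most
    \<open>p / 8\<close>; Markov's inequality at level \<open>1 / 4\<close> then spends half of
    \<open>p\<close>.\<close>
  define \<epsilon> where "\<epsilon> = p * gap / (8 * real dg ^ 2)"
  have \<epsilon>: "\<epsilon> > 0" using p gap_pos dg_pos by (simp add: \<epsilon>_def)
  obtain M2 where M2: "M2 \<ge> 1" "\<And>y. \<phi> (ray y 1) (ray y (- int M2)) \<le> \<epsilon>" "\<And>y. g (ray y (- int M2)) y \<le> 1 / 4"
    using ray_\<phi>[OF \<epsilon>] by blast
  \<comment> \<open>From \<open>c\<close> the second walk avoids \<open>y\<close> and the first path
    with probability at least one half, a quarter being lost to each. The power pays for the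
    \<open>M2 - 1\<close> steps between \<open>ray y (- 1)\<close> and \<open>c\<close>.\<close>
  define \<delta> where "\<delta> = 1 / (2 * real dg ^ (M2 - 1))"
  have \<delta>: "\<delta> > 0" using dg_pos by (simp add: \<delta>_def)
  have "1 / dg * (\<delta> * (p / 2)) \<le> (\<Sum>v\<in>V. bw V v * ex 0 V (\<lambda>F. of_bool (leads F v y)))"
    if V: "finite V" and y: "y \<in> V" for V y
  proof -
    define T where "T = (\<lambda>k. ray y (- int k)) ` {1..M2} \<inter> V"
    define W where "W = V - {y}"
    define W1 where "W1 = W - T"
    define w where "w = ray y 1"
    define c where "c = ray y (- int M2)"
    define B where "B = insert w (\<Union>x\<in>V. nb x) - V"
    define G where "G xs = (\<Sum>z\<in>set xs. g z c)" for xs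
    define q where "q xs = (of_bool (set xs \<inter> T = {} \<and> G xs \<le> 1 / 4) :: real)" for xs
    have fin: "finite W" "finite W1" "finite B" and WV: "W \<subseteq> V" "W1 \<subseteq> V" "W1 \<subseteq> W"
      using V by (auto simp: W_def W1_def B_def)
    have w_nb: "w \<in> nb y" using ray_nb[of y 0] by (simp add: w_def ray_0)
    have BV: "B \<inter> V = {}" "\<And>b. b \<in> B \<Longrightarrow> b \<notin> W \<and> b \<notin> W1 \<and> b \<noteq> y" using WV y by (auto simp: B_def)
    have VW: "V - W = {y}" using y by (auto simp: W_def)
    have VW1: "V - W1 = insert y T" using y by (auto simp: W1_def W_def T_def)
    have pos_notin: "ray y (1 + int k) \<notin> V - W1" for k
    proof
      assume "ray y (1 + int k) \<in> V - W1"
      then consider "ray y (1 + int k) = ray y 0" | j where "ray y (1 + int k) = ray y (- int j)"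
        unfolding VW1 by (auto simp: T_def ray_0)
      then show False using ray_inj by cases fastforce+
    qed
    have wT: "w \<notin> insert y T" using pos_notin[of 0] VW1 by (auto simp: w_def T_def y)
    \<comment> \<open>the second path enters \<open>y\<close>, given the first one\<close>
    have inner: "\<delta> \<le> (\<Sum>v\<in>V. bw V v * hit 0 (W - set xs) y v)" if xs: "set xs \<subseteq> W" "q xs = 1" for xs
    proof -
      let ?W = "W - set xs"
      have sub: "?W \<subseteq> V" "y \<in> V - ?W" using WV y by (auto simp: W_def)
      have VW': "V - ?W = insert y (set xs)" using xs WV y by (auto simp: W_def)
      have qx: "set xs \<inter> T = {}" "G xs \<le> 1 / 4" using xs(2) by (auto simp: q_def split: if_splits)
      have "y \<notin> set xs" using xs by (auto simp: W_def)
      have "g c y \<le> 1 / 4" using M2(3)[of y] unfolding c_def .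
      then have "1 / 2 \<le> 1 - (g c y + G xs)" using qx(2) by linarith
      also have "g c y + G xs = (\<Sum>z\<in>V - ?W. g c z)"
      proof -
        have "(\<Sum>z\<in>V - ?W. g c z) = (\<Sum>z\<in>insert y (set xs). g z c)"
          unfolding VW' by (intro sum.cong refl g_sym)
        then show ?thesis using \<open>y \<notin> set xs\<close> g_sym[of c y] by (simp add: G_def)
      qed
      also have "1 - \<dots> \<le> esc ?W V c" by (rule esc_ge[OF V sub(1)])
      also have "esc ?W V c \<le> dg ^ (M2 - 1) * esc ?W V (ray y (- 1))"
      proof -
        let ?r = "\<lambda>k. ray y (- 1 - int k)"
        have "esc ?W V (?r (M2 - 1)) \<le> dg ^ (M2 - 1) * esc ?W V (?r 0)"
        proof (rule esc_run[OF V sub(1)])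
          fix k assume k: "k < M2 - 1"
          show "?r k \<notin> V - ?W"
          proof
            assume a: "?r k \<in> V - ?W"
            have "?r k \<noteq> ray y 0" using ray_inj[of y "- 1 - int k" 0] by auto
            then have "?r k \<in> set xs" using a VW' by (auto simp: ray_0)
            moreover have "?r k \<in> T"
              using a k by (auto simp: T_def intro!: image_eqI[of _ _ "Suc k"])
            ultimately show False using qx by auto
          qed
          have "ray y (- 1 - int (Suc k) + 1) \<in> nb (?r (Suc k))" by (rule ray_nb)
          then show "?r (Suc k) \<in> nb (?r k)" using nb_sym by simp
        qed
        moreover have "?r (M2 - 1) = c" using M2(1) by (simp add: c_def of_nat_diff)
        ultimately show ?thesis by simp
      qed
      finally have "\<delta> \<le> esc ?W V (ray y (- 1))"
        using dg_pos by (simp add: \<delta>_def field_simps)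
      also have "\<dots> \<le> (\<Sum>w\<in>nb y. esc ?W V w)"
      proof -
        have "ray y (- 1 + 1) \<in> nb (ray y (- 1))" by (rule ray_nb)
        then have "ray y (- 1) \<in> nb y" using nb_sym by (simp add: ray_0)
        then show ?thesis using V sub by (intro member_le_sum) (auto intro: esc_nonneg)
      qed
      also have "\<dots> = (\<Sum>v\<in>V. bw V v * hit 0 ?W y v)" using V sub by (intro flux_eq[symmetric]) auto
      finally show ?thesis .
    qed
    \<comment> \<open>the first path escapes and stays away from \<open>c\<close>\<close>
    have outer: "p / 2 \<le> (\<Sum>b\<in>B. \<Sum>xs\<in>pathsf W w b. ratio 0 W (set xs) * q xs)"
    proof -
      have esc1: "p \<le> esc W1 V w"
      proof -
        let ?r = "\<lambda>k. ray y (1 + int k)"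
        have "esc W1 V (?r M1) \<le> dg ^ M1 * esc W1 V (?r 0)"
        proof (rule esc_run[OF V WV(2) pos_notin])
          fix k show "?r (Suc k) \<in> nb (?r k)" using ray_nb[of y "1 + int k"] by (simp add: add.commute)
        qed
        moreover have "1 - (\<Sum>z\<in>V - W1. g (?r M1) z) \<le> esc W1 V (?r M1)" by (rule esc_ge[OF V WV(2)])
        moreover have "(\<Sum>z\<in>V - W1. g (?r M1) z) \<le> 1 / 2"
        proof -
          have "V - W1 \<subseteq> (\<lambda>k. ray y (- int k)) ` {..M2}"
            unfolding VW1 T_def by (auto intro!: image_eqI[of y _ 0] simp: ray_0)
          then have "(\<Sum>z\<in>V - W1. g (?r M1) z) \<le> (\<Sum>z\<in>(\<lambda>k. ray y (- int k)) ` {..M2}. g (?r M1) z)"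
            using g_nonneg by (intro sum_mono2) auto
          also have "\<dots> = (\<Sum>k\<le>M2. g (?r M1) (ray y (- int k)))"
            by (subst sum.reindex) (auto intro!: inj_onI dest!: ray_inj)
          finally show ?thesis using M1[of y M2] by linarith
        qed
        ultimately have "1 / 2 \<le> dg ^ M1 * esc W1 V w" by (simp add: w_def)
        then show ?thesis using dg_pos by (simp add: p_def field_simps)
      qed
      have esc2: "esc W1 V w \<le> (\<Sum>b\<in>B. hit 0 W1 b w)"
      proof (rule exits_ge[OF V WV(2) fin(3)])
        fix x assume "x \<in> V"
        then show "nb x - V \<subseteq> B" by (auto simp: B_def)
      next
        show "w \<in> W1 \<union> B" using wT by (auto simp: B_def W1_def W_def)
        show "B \<inter> V = {}" by (rule BV)
      qed
      have far: "(\<Sum>b\<in>B. \<Sum>xs\<in>pathsf W1 w b. ratio 0 W1 (set xs) * G xs) \<le> p / 8"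
      proof -
        have "(\<Sum>b\<in>B. \<Sum>xs\<in>pathsf W1 w b. ratio 0 W1 (set xs) * G xs) = ex 0 W1 (\<lambda>F. \<Sum>b\<in>B. pathsum W1 w b G F)"
          unfolding ex_sum using fin BV by (intro sum.cong refl ex_pathsum[symmetric]) auto
        also have "\<dots> \<le> ex 0 W1 (\<lambda>F. \<Sum>z\<in>W1. g z c * of_bool (leads F w z))"
        proof (rule ex_mono[OF fin(2)])
          fix F assume F: "F \<in> forests W1"
          let ?s = "\<Sum>z\<in>W1. g z c * of_bool (leads F w z)"
          have "(\<Sum>b\<in>B. pathsum W1 w b G F) = (\<Sum>b\<in>B. of_bool (leads F w b) * ?s)"
          proof (rule sum.cong)
            fix b assume b: "b \<in> B"
            have bW: "b \<notin> W1" using BV b by auto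
            show "pathsum W1 w b G F = of_bool (leads F w b) * ?s"
            proof (rule pathsum_eq[OF fin(2) F bW])
              fix xs assume xs: "chain F xs b" "hd (xs @ [b]) = w"
              have sub: "set xs \<subseteq> W1" using chain_in_paths[OF F xs(1)] by (simp add: paths_def)
              have "z \<in> set xs \<longleftrightarrow> leads F w z" if "z \<in> W1" for z
                using chain_set_iff[OF xs forestsD(1)[OF F bW], of z] that bW by auto
              then show "G xs = ?s" unfolding G_def
                using sub fin by (intro sum.mono_neutral_cong_left) auto
            qed
          qed simp
          also have "\<dots> = (\<Sum>b\<in>B. of_bool (leads F w b)) * ?s" by (simp add: sum_distrib_right)
          also have "\<dots> \<le> 1 * ?s"
            using fin F BV g_nonneg by (intro mult_right_mono sum_leads_le_1[OF fin(3) F] sum_nonneg) auto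
          finally show "(\<Sum>b\<in>B. pathsum W1 w b G F) \<le> ?s" by simp
        qed simp
        also have "\<dots> = (\<Sum>z\<in>W1. g z c * ex 0 W1 (\<lambda>F. of_bool (leads F w z)))"
          by (simp only: ex_sum ex_cmult)
        also have "\<dots> \<le> (\<Sum>z\<in>W1. g z c * (dg / gap * hit 0 (W1 - {z}) z w))"
          using visit_le[OF fin(2), of 0 _ w] g_nonneg by (intro sum_mono mult_left_mono) auto
        also have "\<dots> = dg / gap * (\<Sum>z\<in>W1. hit 0 (W1 - {z}) z w * g z c)"
          by (simp add: sum_distrib_left mult_ac)
        also have "\<dots> \<le> dg / gap * (dg * \<phi> w c)"
          using gap_pos g_nonneg \<phi>_nonneg \<phi>_super fin
          by (intro mult_left_mono sum_visit[of W1 "\<lambda>z. g z c" "\<lambda>z. \<phi> z c"]) auto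
        also have "\<dots> \<le> dg / gap * (dg * \<epsilon>)"
          using gap_pos M2(2)[of y] by (intro mult_left_mono) (auto simp: w_def c_def)
        also have "\<dots> = p / 8" using gap_pos dg_pos by (simp add: \<epsilon>_def power2_eq_square)
        finally show ?thesis .
      qed
      have "p / 2 \<le> p - 4 * (p / 8)" by simp
      also have "\<dots> \<le> (\<Sum>b\<in>B. hit 0 W1 b w) - 4 * (\<Sum>b\<in>B. \<Sum>xs\<in>pathsf W1 w b. ratio 0 W1 (set xs) * G xs)"
        using esc1 esc2 far by linarith
      also have "(\<Sum>b\<in>B. hit 0 W1 b w) = (\<Sum>b\<in>B. \<Sum>xs\<in>pathsf W1 w b. ratio 0 W1 (set xs))"
        using fin BV by (intro sum.cong refl hit_paths) auto
      also have "\<dots> - 4 * (\<Sum>b\<in>B. \<Sum>xs\<in>pathsf W1 w b. ratio 0 W1 (set xs) * G xs) =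
          (\<Sum>b\<in>B. \<Sum>xs\<in>pathsf W1 w b. ratio 0 W1 (set xs) * (1 - 4 * G xs))"
        by (simp add: sum_distrib_left sum_subtractf[symmetric] algebra_simps)
      \<comment> \<open>Markov's inequality in pointwise form: on these paths
        \<open>1 - 4 * G xs\<close> is at most \<open>q xs\<close>. Enlarging \<open>W1\<close> to
        \<open>W\<close> only increases the weights.\<close>
      also have "\<dots> \<le> (\<Sum>b\<in>B. \<Sum>xs\<in>pathsf W1 w b. ratio 0 W (set xs) * q xs)"
      proof (intro sum_mono)
        fix b xs assume "xs \<in> pathsf W1 w b"
        then have sub: "set xs \<subseteq> W1" by (auto simp: pathsf_def paths_def)
        then have T: "set xs \<inter> T = {}" by (auto simp: W1_def)
        have "G xs \<ge> 0" unfolding G_def by (intro sum_nonneg g_nonneg)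
        then have "1 - 4 * G xs \<le> q xs" using T by (auto simp: q_def)
        then have "ratio 0 W1 (set xs) * (1 - 4 * G xs) \<le> ratio 0 W1 (set xs) * q xs"
          using ratio_nonneg[OF fin(2), of 0 "set xs"] by (intro mult_left_mono) auto
        also have "\<dots> \<le> ratio 0 W (set xs) * q xs"
          using fin WV sub by (intro mult_right_mono ratio_mono) (auto simp: q_def)
        finally show "ratio 0 W1 (set xs) * (1 - 4 * G xs) \<le> ratio 0 W (set xs) * q xs" .
      qed
      also have "\<dots> \<le> (\<Sum>b\<in>B. \<Sum>xs\<in>pathsf W w b. ratio 0 W (set xs) * q xs)"
        using fin WV ratio_nonneg[OF fin(1), of 0]
        by (intro sum_mono sum_mono2 finite_pathsf[OF fin(1)]) (auto simp: pathsf_def paths_def q_def less_imp_le)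
      finally show ?thesis .
    qed
    have "\<delta> * (p / 2) \<le> \<delta> * (\<Sum>b\<in>B. \<Sum>xs\<in>pathsf W w b. ratio 0 W (set xs) * q xs)"
      using \<delta> outer by (intro mult_left_mono) auto
    also have "\<dots> = (\<Sum>b\<in>B. \<Sum>xs\<in>pathsf W w b. ratio 0 W (set xs) * q xs * \<delta>)"
      by (simp add: sum_distrib_left mult_ac)
    also have "\<dots> \<le> (\<Sum>b\<in>B. \<Sum>xs\<in>pathsf W w b. ratio 0 W (set xs) * q xs * (\<Sum>v\<in>V. bw V v * hit 0 (W - set xs) y v))"
    proof (intro sum_mono)
      fix b xs assume "xs \<in> pathsf W w b"
      then have sub: "set xs \<subseteq> W" by (auto simp: pathsf_def paths_def)
      show "ratio 0 W (set xs) * q xs * \<delta> \<le> ratio 0 W (set xs) * q xs * (\<Sum>v\<in>V. bw V v * hit 0 (W - set xs) y v)"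
      proof (cases "q xs = 1")
        case True
        then show ?thesis using inner[OF sub True] ratio_nonneg[OF fin(1), of 0 "set xs"]
          by (intro mult_left_mono) auto
      next
        case False
        then have "q xs = 0" by (auto simp: q_def)
        then show ?thesis by simp
      qed
    qed
    also have "\<dots> = (\<Sum>v\<in>V. bw V v * (\<Sum>b\<in>B. \<Sum>xs\<in>pathsf W w b. ratio 0 W (set xs) * q xs * hit 0 (W - set xs) y v))"
    proof -
      have "(\<Sum>b\<in>B. \<Sum>xs\<in>P b. r xs * (\<Sum>v\<in>V. f v * h xs v)) = (\<Sum>v\<in>V. f v * (\<Sum>b\<in>B. \<Sum>xs\<in>P b. r xs * h xs v))"
        for P :: "'a \<Rightarrow> 'a list set" and r :: "'a list \<Rightarrow> real" and f h
      proof -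
        have "(\<Sum>b\<in>B. \<Sum>xs\<in>P b. r xs * (\<Sum>v\<in>V. f v * h xs v)) = (\<Sum>b\<in>B. \<Sum>v\<in>V. \<Sum>xs\<in>P b. f v * (r xs * h xs v))"
          unfolding sum_distrib_left by (intro sum.cong refl, subst sum.swap) (simp add: mult_ac)
        also have "\<dots> = (\<Sum>v\<in>V. \<Sum>b\<in>B. \<Sum>xs\<in>P b. f v * (r xs * h xs v))" by (rule sum.swap)
        finally show ?thesis by (simp only: sum_distrib_left)
      qed
      then show ?thesis .
    qed
    also have "\<dots> = (\<Sum>v\<in>V. bw V v * ex 0 W (\<lambda>F. \<Sum>b\<in>B. pathsum W w b q F * of_bool (leads F v y)))"
      unfolding ex_sum
    proof (intro sum.cong refl arg_cong2[where f = "(*)"])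
      fix v b assume "b \<in> B"
      then show "(\<Sum>xs\<in>pathsf W w b. ratio 0 W (set xs) * q xs * hit 0 (W - set xs) y v) =
          ex 0 W (\<lambda>F. pathsum W w b q F * of_bool (leads F v y))"
        using fin BV by (intro ex_pathsum_joint[symmetric]) (auto simp: W_def)
    qed
    \<comment> \<open>Where both paths exist, the edge from \<open>y\<close> to \<open>w\<close> may
      be added without closing a cycle. The cut formula charges \<open>ratio\<close> at
      \<open>y\<close>, which is at least \<open>1 / dg\<close>.\<close>
    also have "\<dots> \<le> (\<Sum>v\<in>V. bw V v * (dg * ex 0 V (\<lambda>F. of_bool (leads F v y))))"
    proof (intro sum_mono mult_left_mono bw_nonneg)
      fix v
      have "ex 0 W (\<lambda>F. \<Sum>b\<in>B. pathsum W w b q F * of_bool (leads F v y)) \<le>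
        ex 0 W (\<lambda>F. 0 * of_bool (leads F v y) +
          (\<Sum>w\<in>nb y. of_bool (\<not> leads F w y) * of_bool (leads (F(y \<mapsto> w)) v y)))"
      proof (rule ex_mono[OF fin(1)])
        fix F assume F: "F \<in> forests W"
        then have Fy: "F y = None" using forestsD(1)[of F W y] by (auto simp: W_def)
        have pb: "pathsum W w b q F \<le> of_bool (leads F w b)" if "b \<in> B" for b
        proof -
          have "pathsum W w b q F \<le> pathsum W w b (\<lambda>_. 1) F"
            unfolding pathsum_def by (intro sum_mono mult_left_mono) (auto simp: q_def)
          then show ?thesis using pathsum_one[OF fin(1) F] BV that by simp
        qed
        have "(\<Sum>b\<in>B. pathsum W w b q F * of_bool (leads F v y)) \<le> (\<Sum>b\<in>B. of_bool (leads F w b)) * of_bool (leads F v y)"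
          unfolding sum_distrib_right by (intro sum_mono mult_right_mono pb) auto
        also have "\<dots> \<le> of_bool (\<not> leads F w y) * of_bool (leads F v y)"
        proof (intro mult_right_mono)
          show "(\<Sum>b\<in>B. of_bool (leads F w b)) \<le> (of_bool (\<not> leads F w y) :: real)"
          proof (cases "leads F w y")
            case True
            have "\<not> leads F w b" if "b \<in> B" for b
              using leads_terminal_unique[OF True, of b] Fy forestsD(1)[OF F, of b] BV that by auto
            then show ?thesis by (subst sum.neutral) auto
          next
            case False
            then show ?thesis using sum_leads_le_1[OF fin(3) F] BV by auto
          qed
        qed simp
        also have "\<dots> = of_bool (\<not> leads F w y) * of_bool (leads (F(y \<mapsto> w)) v y)"
          by (auto simp: leads_upd[of F y, OF Fy])
        also have "\<dots> \<le> (\<Sum>w\<in>nb y. of_bool (\<not> leads F w y) * of_bool (leads (F(y \<mapsto> w)) v y))"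
          using w_nb by (intro member_le_sum) auto
        finally show "(\<Sum>b\<in>B. pathsum W w b q F * of_bool (leads F v y)) \<le> 0 * of_bool (leads F v y) +
          (\<Sum>w\<in>nb y. of_bool (\<not> leads F w y) * of_bool (leads (F(y \<mapsto> w)) v y))" by simp
      qed simp
      also have "\<dots> \<le> dg * ratio 0 V {y} * \<dots>"
      proof -
        have "1 / dg \<le> ratio 0 V {y}" using ratio_ge[OF V, of 0 y] y by simp
        then have "1 \<le> dg * ratio 0 V {y}" using dg_pos by (simp add: field_simps)
        moreover have "0 \<le> ex 0 W (\<lambda>F. 0 * of_bool (leads F v y) +
          (\<Sum>w\<in>nb y. of_bool (\<not> leads F w y) * of_bool (leads (F(y \<mapsto> w)) v y)))"
          using fin by (intro ex_nonneg) (auto intro: sum_nonneg)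
        ultimately show ?thesis by (simp add: mult_le_cancel_right1)
      qed
      also have "\<dots> = dg * ex 0 V (\<lambda>F. of_bool (leads F v y))"
        using ex_cut[OF V, of 0 y "\<lambda>F. of_bool (leads F v y)"] y by (simp add: W_def mult.assoc)
      finally show "ex 0 W (\<lambda>F. \<Sum>b\<in>B. pathsum W w b q F * of_bool (leads F v y)) \<le>
        dg * ex 0 V (\<lambda>F. of_bool (leads F v y))" .
    qed
    also have "\<dots> = dg * (\<Sum>v\<in>V. bw V v * ex 0 V (\<lambda>F. of_bool (leads F v y)))"
      by (simp add: sum_distrib_left mult_ac)
    finally show ?thesis using dg_pos by (simp add: field_simps)
  qed
  moreover have "1 / dg * (\<delta> * (p / 2)) > 0" using \<delta> p dg_pos by simp
  ultimately show ?thesis using that by blast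
qed

end

section \<open>The height of the past\<close>

definition hgt :: "('a \<Rightarrow> 'a option) \<Rightarrow> 'a \<Rightarrow> nat \<Rightarrow> bool" where
  "hgt F u m \<longleftrightarrow> (\<exists>xs. length xs = m \<and> chain F xs u)"

lemma chain_drop: "chain F zs u \<Longrightarrow> chain F (drop k zs) u"
  using chain_append[of F "take k zs" "drop k zs" u] by simp

lemma hgt_mono: "hgt F u m \<Longrightarrow> k \<le> m \<Longrightarrow> hgt F u k"
  unfolding hgt_def by (metis chain_drop diff_diff_cancel length_drop)

context transient_ray
begin

definition PH :: "'a set \<Rightarrow> 'a \<Rightarrow> nat \<Rightarrow> real" where
  "PH V u m = ex 0 V (\<lambda>F. of_bool (hgt F u m))"

text \<open>A dyadic window of lengths: a path of length at least \<open>2 * n\<close> has exactly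
  \<open>n\<close> nonempty suffixes in it when \<open>n\<close> is positive.\<close>

definition mid :: "'a set \<Rightarrow> 'a \<Rightarrow> nat \<Rightarrow> 'a list set" where
  "mid V u n = {xs \<in> paths V u. n \<le> length xs \<and> length xs < 2 * n}"

lemma finite_mid: "finite V \<Longrightarrow> finite (mid V u n)"
  by (simp add: mid_def)

lemma energy_pos: "xs \<noteq> [] \<Longrightarrow> 0 < energy xs"
proof -
  assume "xs \<noteq> []"
  then have x: "hd xs \<in> set xs" by simp
  have "1 \<le> (\<Sum>z\<in>set xs. g (hd xs) z)"
    using member_le_sum[OF x, of "g (hd xs)"] g_nonneg g_diag by simp
  also have "\<dots> \<le> energy xs" unfolding energy_def
    using member_le_sum[OF x, of "\<lambda>y. \<Sum>z\<in>set xs. g y z"] g_nonneg by (simp add: sum_nonneg)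
  finally show ?thesis by simp
qed

text \<open>Second moment method for the number of vertices of \<open>xs\<close> on a boundary
  branch: \<open>nonintersection\<close> bounds the first moment from below, and
  \<open>second_moment\<close> bounds the second by the energy. Since the boundary weights are not
  normalized, Cauchy-Schwarz enters as \<open>2 * N \<le> s * N * N + 1 / s\<close> on the event
  that \<open>N\<close> is positive.\<close>

lemma hitting:
  obtains c :: real where "c > 0"
    "\<And>V xs. finite V \<Longrightarrow> xs \<noteq> [] \<Longrightarrow> set xs \<subseteq> V \<Longrightarrow> c * (card (set xs))\<^sup>2 / energy xs \<le>
      (\<Sum>v\<in>V. bw V v * ex 0 V (\<lambda>F. of_bool (\<exists>y\<in>set xs. leads F v y)))"
proof -
  obtain c0 where c0: "c0 > 0"
    "\<And>V y. finite V \<Longrightarrow> y \<in> V \<Longrightarrow> c0 \<le> (\<Sum>v\<in>V. bw V v * ex 0 V (\<lambda>F. of_bool (leads F v y)))"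
    by (rule nonintersection) blast
  define B where "B = 2 * (dg ^ 3 / gap ^ 2 + dg ^ 2 / gap)"
  have B: "B > 0" using gap_pos dg_pos by (simp add: B_def add_pos_pos)
  have main: "c0\<^sup>2 / B * (card (set xs))\<^sup>2 / energy xs \<le>
      (\<Sum>v\<in>V. bw V v * ex 0 V (\<lambda>F. of_bool (\<exists>y\<in>set xs. leads F v y)))"
    if V: "finite V" and xs: "xs \<noteq> []" "set xs \<subseteq> V" for V xs
  proof -
    let ?Y = "set xs"
    define N where "N v F = (\<Sum>y\<in>?Y. of_bool (leads F v y) :: real)" for v and F :: "'a \<Rightarrow> 'a option"
    define M where "M f = (\<Sum>v\<in>V. bw V v * ex 0 V (f v))" for f
    let ?H = "M (\<lambda>v F. of_bool (\<exists>y\<in>?Y. leads F v y))"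
    let ?E = "B * energy xs"
    have E: "?E > 0" using B energy_pos[OF xs(1)] by simp
    have A: "c0 * card ?Y \<le> M N"
    proof -
      have "c0 * card ?Y = (\<Sum>y\<in>?Y. c0)" by simp
      also have "\<dots> \<le> (\<Sum>y\<in>?Y. \<Sum>v\<in>V. bw V v * ex 0 V (\<lambda>F. of_bool (leads F v y)))"
        using xs c0(2)[OF V] by (intro sum_mono) auto
      also have "\<dots> = M N" unfolding M_def N_def ex_sum sum_distrib_left by (rule sum.swap)
      finally show ?thesis .
    qed
    have cardY: "card ?Y > 0" using xs by (simp add: card_gt_0_iff)
    have Apos: "M N > 0"
      using A c0(1) cardY by (intro less_le_trans[OF _ A] mult_pos_pos) auto
    have B2: "M (\<lambda>v F. N v F * N v F) \<le> ?E"
    proof -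
      have "M (\<lambda>v F. N v F * N v F) =
        M (\<lambda>v F. \<Sum>y\<in>?Y. \<Sum>y'\<in>?Y. of_bool (leads F v y) * of_bool (leads F v y'))"
        by (simp only: N_def sum_product)
      also have "\<dots> =
        (\<Sum>v\<in>V. \<Sum>y\<in>?Y. \<Sum>y'\<in>?Y. bw V v * ex 0 V (\<lambda>F. of_bool (leads F v y) * of_bool (leads F v y')))"
        unfolding M_def ex_sum sum_distrib_left ..
      also have "\<dots> = (\<Sum>y\<in>?Y. \<Sum>y'\<in>?Y. \<Sum>v\<in>V. bw V v * ex 0 V (\<lambda>F. of_bool (leads F v y) * of_bool (leads F v y')))"
        by (rule trans[OF sum.swap], rule sum.cong[OF refl], rule sum.swap)
      also have "\<dots> \<le> (\<Sum>y\<in>?Y. \<Sum>y'\<in>?Y. B * g y y')"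
        unfolding B_def using xs V by (intro sum_mono second_moment) auto
      also have "\<dots> = ?E" by (simp add: energy_def sum_distrib_left)
      finally show ?thesis .
    qed
    have mono: "M f \<le> M f'" if "\<And>v F. f v F \<le> f' v F" for f f'
      unfolding M_def using V that by (intro sum_mono mult_left_mono ex_mono bw_nonneg) auto
    have lin: "M (\<lambda>v F. a * f v F + b * f' v F) = a * M f + b * M f'" for a b f f'
      unfolding M_def ex_add ex_cmult by (simp add: sum.distrib sum_distrib_left algebra_simps)
    \<comment> \<open>The optimal multiplier, with the second moment replaced by its bound
      \<open>?E\<close>.\<close>
    define s where "s = M N / ?E"
    have s: "s > 0" using Apos E by (simp add: s_def)
    have "2 * M N = M (\<lambda>v F. 2 * N v F + 0 * N v F)" using lin[of 2 N 0 N] by simp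
    also have "\<dots> \<le> M (\<lambda>v F. s * (N v F * N v F) + 1 / s * of_bool (\<exists>y\<in>?Y. leads F v y))"
    proof (rule mono)
      fix v F
      show "2 * N v F + 0 * N v F \<le> s * (N v F * N v F) + 1 / s * of_bool (\<exists>y\<in>?Y. leads F v y)"
      proof (cases "\<exists>y\<in>?Y. leads F v y")
        case True
        have "0 \<le> (s * N v F - 1)\<^sup>2 / s" using s by simp
        also have "\<dots> = s * (N v F * N v F) + 1 / s - 2 * N v F"
          using s by (simp add: power2_eq_square field_simps)
        finally show ?thesis using True by simp
      next
        case False
        then have "N v F = 0" by (simp add: N_def)
        then show ?thesis using False by simp
      qed
    qed
    also have "\<dots> = s * M (\<lambda>v F. N v F * N v F) + 1 / s * ?H" by (rule lin)
    also have "\<dots> \<le> s * ?E + 1 / s * ?H" using B2 s by simp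
    also have "s * ?E = M N"
    proof -
      have "a / b * b = a" if "b > 0" for a b :: real using that by simp
      then show ?thesis unfolding s_def using E by blast
    qed
    finally have "M N \<le> 1 / s * ?H" by linarith
    then have "s * M N \<le> s * (1 / s * ?H)" using s by (intro mult_left_mono) auto
    also have "\<dots> = ?H" using s by simp
    finally have "s * M N \<le> ?H" .
    have "c0\<^sup>2 / B * (card ?Y)\<^sup>2 / energy xs = (c0 * card ?Y) * (c0 * card ?Y) / ?E"
    proof -
      have "c\<^sup>2 / b * k\<^sup>2 / e = (c * k) * (c * k) / (b * e)" for b c k e :: real
        by (simp add: power2_eq_square mult_ac)
      then show ?thesis by simp
    qed
    also have "\<dots> \<le> M N * M N / ?E"
      using A E c0(1) Apos by (intro divide_right_mono mult_mono) auto
    also have "\<dots> = s * M N" by (simp add: s_def)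
    finally show ?thesis using \<open>s * M N \<le> ?H\<close> by (simp add: M_def)
  qed
  have pos: "c0\<^sup>2 / B > 0" using c0 B by simp
  show ?thesis by (rule that[OF pos main])
qed

lemma PH_le_1: "finite V \<Longrightarrow> PH V u m \<le> 1"
  unfolding PH_def by (intro ex_le_1) auto

lemma PH_antimono: "finite V \<Longrightarrow> k \<le> m \<Longrightarrow> PH V u m \<le> PH V u k"
  unfolding PH_def using hgt_mono by (intro ex_mono) auto

text \<open>At \<kappa> = 0 the branch of \<open>v\<close> ends at \<open>u\<close> or at another
  boundary vertex. In the second case no vertex of the branch leads to \<open>u\<close>, so the
  whole past of \<open>u\<close> lies in the forest that is left.\<close>

lemma explore:
  assumes V: "finite V" and u: "u \<notin> V" and v: "v \<in> V"
  defines "B \<equiv> (\<Union>x\<in>V. nb x) - V - {u}"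
  shows "PH V u m \<le> hit 0 V u v + (\<Sum>b\<in>B. \<Sum>xs\<in>pathsf V v b. ratio 0 V (set xs) * PH (V - set xs) u m)"
proof -
  have B: "finite B" "B \<inter> V = {}" "u \<notin> B" using V by (auto simp: B_def)
  let ?S = "\<lambda>F. of_bool (leads F v u) + (\<Sum>b\<in>B. of_bool (leads F v b)) :: real"
  let ?A = "\<lambda>F. of_bool (hgt F u m) :: real"
  \<comment> \<open>Some root is always reached: \<open>esc V V v\<close> is 1 because its sum is
    empty. The defect \<open>1 - ?S\<close> therefore costs nothing in expectation, and adding it
    makes the next inequality true in every forest.\<close>
  have 0: "ex 0 V (\<lambda>F. 1 - ?S F) \<le> 0"
  proof -
    have "1 = esc V V v" by (simp add: esc_def)
    also have "\<dots> \<le> (\<Sum>b\<in>insert u B. hit 0 V b v)"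
      using B V u v by (intro exits_ge) (auto simp: B_def)
    also have "\<dots> = ex 0 V ?S" by (simp only: ex_add ex_sum hit_def sum.insert[OF B(1,3)])
    finally show ?thesis using V by (simp add: ex_diff ex_const)
  qed
  have "PH V u m \<le> ex 0 V (\<lambda>F. of_bool (leads F v u) + (\<Sum>b\<in>B. of_bool (leads F v b) * ?A F) + (1 - ?S F))"
    unfolding PH_def
  proof (rule ex_mono[OF V])
    fix F assume F: "F \<in> forests V"
    have "(\<Sum>b\<in>insert u B. of_bool (leads F v b)) \<le> (1::real)"
      by (rule sum_leads_le_1[OF _ F]) (use B u in auto)
    then have S: "?S F \<le> 1" by (simp only: sum.insert[OF B(1,3)])
    have "(\<Sum>b\<in>B. of_bool (leads F v b) * ?A F) = (\<Sum>b\<in>B. of_bool (leads F v b)) * ?A F"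
      by (simp only: sum_distrib_right)
    moreover have "0 \<le> (of_bool (leads F v u) :: real)" by simp
    moreover have "?A F = 0 \<or> ?A F = 1" by simp
    ultimately show "?A F \<le> of_bool (leads F v u) + (\<Sum>b\<in>B. of_bool (leads F v b) * ?A F) + (1 - ?S F)"
      using S by (elim disjE; simp only: mult_zero_right mult_1_right; linarith)
  qed simp
  also have "\<dots> = hit 0 V u v + (\<Sum>b\<in>B. ex 0 V (\<lambda>F. of_bool (leads F v b) * ?A F)) + ex 0 V (\<lambda>F. 1 - ?S F)"
    unfolding ex_add ex_sum hit_def ..
  also have "\<dots> \<le> hit 0 V u v + (\<Sum>b\<in>B. \<Sum>xs\<in>pathsf V v b. ratio 0 V (set xs) * PH (V - set xs) u m)"
  proof -
    have "ex 0 V (\<lambda>F. of_bool (leads F v b) * ?A F) \<le> (\<Sum>xs\<in>pathsf V v b. ratio 0 V (set xs) * PH (V - set xs) u m)"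
      if b: "b \<in> B" for b
    proof -
      have bV: "b \<notin> V" "b \<noteq> u" using b B by auto
      have "ex 0 V (\<lambda>F. of_bool (leads F v b) * ?A F) =
        (\<Sum>xs\<in>pathsf V v b. ratio 0 V (set xs) * ex 0 (V - set xs) (\<lambda>F. ?A (ext F xs b)))"
        using V bV by (intro ex_leads_paths) auto
      also have "\<dots> \<le> (\<Sum>xs\<in>pathsf V v b. ratio 0 V (set xs) * PH (V - set xs) u m)"
        unfolding PH_def
      proof (intro sum_mono mult_left_mono ex_mono)
        fix xs F assume "xs \<in> pathsf V v b" and F: "F \<in> forests (V - set xs)"
        then have xs: "distinct xs" "set xs \<subseteq> V" by (auto simp: pathsf_def paths_def)
        have "hgt F u m" if h: "hgt (ext F xs b) u m"
        proof -
          from h obtain ys where ys: "length ys = m" "chain (ext F xs b) ys u" by (auto simp: hgt_def)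
          have "y \<notin> set xs" if y: "y \<in> set ys" for y
          proof
            assume "y \<in> set xs"
            then have "leads (ext F xs b) y b" using chain_leads[OF chain_ext[OF xs(1)]] by auto
            moreover have "leads (ext F xs b) y u" using chain_leads[OF ys(2) y] .
            moreover have "b \<notin> set xs" "u \<notin> set xs" using xs bV u by auto
            moreover have "F b = None" "F u = None" using forestsD(1)[OF F] bV u by auto
            moreover have "ext F xs b b = None" "ext F xs b u = None" using calculation by (simp_all add: ext_notin)
            ultimately show False using leads_terminal_unique bV(2) by metis
          qed
          then have "chain F ys u" by (intro chain_cong[OF ys(2)]) (simp add: ext_notin)
          then show ?thesis using ys(1) by (auto simp: hgt_def)
        qed
        then show "?A (ext F xs b) \<le> ?A F" by simp
      qed (use V ratio_nonneg[OF V, of 0] in \<open>auto simp: less_imp_le\<close>)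
      finally show ?thesis .
    qed
    then have "(\<Sum>b\<in>B. ex 0 V (\<lambda>F. of_bool (leads F v b) * ?A F)) \<le>
      (\<Sum>b\<in>B. \<Sum>xs\<in>pathsf V v b. ratio 0 V (set xs) * PH (V - set xs) u m)" by (rule sum_mono)
    then show ?thesis using 0 by linarith
  qed
  finally show ?thesis .
qed

text \<open>A path of length \<open>3 * n\<close> has \<open>n\<close> suffixes in the window, and
  above each there are at least \<open>n\<close> vertices, which form a path into the head of the
  suffix in the remaining forest. Averaging over the suffixes gives the factor \<open>1 / n\<close>.
  Alone this yields no decay, as the weights of the window sum to order \<open>n\<close>.\<close>

lemma PH_union_bound:
  assumes V: "finite V" and u: "u \<notin> V" and n: "n \<ge> 1"
    and q: "\<And>V u. finite V \<Longrightarrow> u \<notin> V \<Longrightarrow> PH V u n \<le> q"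
  shows "PH V u (3 * n) \<le> q / n * (\<Sum>xs\<in>mid V u n. ratio 0 V (set xs))"
proof -
  let ?A = "\<lambda>F xs. of_bool (\<exists>ys. length ys = n \<and> chain F ys (hd xs) \<and> set ys \<inter> set xs = {}) :: real"
  have "n * PH V u (3 * n) = ex 0 V (\<lambda>F. n * of_bool (hgt F u (3 * n)))"
    by (simp add: PH_def ex_cmult)
  also have "\<dots> \<le> ex 0 V (\<lambda>F. \<Sum>xs\<in>mid V u n. of_bool (chain F xs u) * ?A F xs)"
  proof (rule ex_mono[OF V])
    fix F assume F: "F \<in> forests V"
    show "n * of_bool (hgt F u (3 * n)) \<le> (\<Sum>xs\<in>mid V u n. of_bool (chain F xs u) * ?A F xs)"
    proof (cases "hgt F u (3 * n)")
      case True
      then obtain zs where zs: "length zs = 3 * n" "chain F zs u" by (auto simp: hgt_def)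
      let ?d = "\<lambda>m. drop (3 * n - m) zs"
      have dist: "distinct zs" using chain_distinct[OF forestsD(3)[OF F] zs(2)] by simp
      have len: "length (?d m) = m" if "m < 2 * n" for m using zs that by simp
      have inj: "inj_on ?d {n..<2 * n}" by (rule inj_onI) (metis atLeastLessThan_iff len)
      have one: "of_bool (chain F (?d m) u) * ?A F (?d m) = 1" if m: "m \<in> {n..<2 * n}" for m
      proof -
        have "?d m \<noteq> []" using len[of m] m n by auto
        have c1: "chain F (?d m) u" using zs(2) by (rule chain_drop)
        have "chain F (take (3 * n - m) zs) (hd (?d m @ [u]))"
          using zs(2) chain_append[of F "take (3 * n - m) zs" "?d m" u] by simp
        then have "chain F (drop (2 * n - m) (take (3 * n - m) zs)) (hd (?d m))"
          using \<open>?d m \<noteq> []\<close> by (intro chain_drop) (simp add: hd_append)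
        moreover have "length (drop (2 * n - m) (take (3 * n - m) zs)) = n" using zs m by auto
        moreover have "set (drop (2 * n - m) (take (3 * n - m) zs)) \<inter> set (?d m) = {}"
          using set_take_disj_set_drop_if_distinct[OF dist, of "3 * n - m" "3 * n - m"]
            set_drop_subset[of "2 * n - m" "take (3 * n - m) zs"] by blast
        ultimately have "\<exists>ys. length ys = n \<and> chain F ys (hd (?d m)) \<and> set ys \<inter> set (?d m) = {}" by blast
        then show ?thesis using c1 by simp
      qed
      have "real n = (\<Sum>m\<in>{n..<2 * n}. 1)" by simp
      also have "\<dots> = (\<Sum>m\<in>{n..<2 * n}. of_bool (chain F (?d m) u) * ?A F (?d m))"
        using one by (intro sum.cong) auto
      also have "\<dots> = (\<Sum>xs\<in>?d ` {n..<2 * n}. of_bool (chain F xs u) * ?A F xs)"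
        by (subst sum.reindex[OF inj]) (simp add: comp_def)
      also have "\<dots> \<le> (\<Sum>xs\<in>mid V u n. of_bool (chain F xs u) * ?A F xs)"
      proof (rule sum_mono2[OF finite_mid[OF V]])
        show "?d ` {n..<2 * n} \<subseteq> mid V u n"
          using chain_in_paths[OF F chain_drop[OF zs(2)]] len by (auto simp: mid_def)
      qed auto
      finally show ?thesis using True by simp
    qed (auto intro: sum_nonneg)
  qed simp
  also have "\<dots> = (\<Sum>xs\<in>mid V u n. ex 0 V (\<lambda>F. of_bool (chain F xs u) * ?A F xs))" by (rule ex_sum)
  also have "\<dots> \<le> (\<Sum>xs\<in>mid V u n. ratio 0 V (set xs) * q)"
  proof (rule sum_mono)
    fix xs assume "xs \<in> mid V u n"
    then have xs: "xs \<in> paths V u" "set xs \<subseteq> V" "xs \<noteq> []" using n by (auto simp: mid_def paths_def)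
    have "ex 0 V (\<lambda>F. of_bool (chain F xs u) * ?A F xs) =
      ratio 0 V (set xs) * ex 0 (V - set xs) (\<lambda>F. ?A (ext F xs u) xs)"
      using V u xs by (intro ex_chain) auto
    also have "\<dots> \<le> ratio 0 V (set xs) * PH (V - set xs) (hd xs) n"
      unfolding PH_def
    proof (intro mult_left_mono ex_mono)
      fix F
      have "chain F ys (hd xs)" if "chain (ext F xs u) ys (hd xs)" "set ys \<inter> set xs = {}" for ys
        by (rule chain_cong[OF that(1)]) (use that(2) in \<open>metis disjoint_iff ext_notin\<close>)
      then show "?A (ext F xs u) xs \<le> of_bool (hgt F (hd xs) n)"
        by (auto simp: hgt_def)
    qed (use V ratio_nonneg[OF V, of 0 "set xs"] in auto)
    also have "\<dots> \<le> ratio 0 V (set xs) * q"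
      using V xs ratio_nonneg[OF V, of 0 "set xs"] by (intro mult_left_mono q) auto
    finally show "ex 0 V (\<lambda>F. of_bool (chain F xs u) * ?A F xs) \<le> ratio 0 V (set xs) * q" .
  qed
  also have "\<dots> = q * (\<Sum>xs\<in>mid V u n. ratio 0 V (set xs))" by (simp add: sum_distrib_left mult.commute)
  finally show ?thesis using n by (simp add: field_simps)
qed

end

section \<open>The decay inequality and its solution\<close>

context transient_ray
begin

definition rate :: "real \<Rightarrow> 'a list \<Rightarrow> real" where
  "rate c xs = c * (card (set xs))\<^sup>2 / energy xs"

lemma sum_hit_le_1:
  assumes "finite V" "finite B" "B \<inter> V = {}"
  shows "(\<Sum>b\<in>B. hit 0 V b v) \<le> 1"
proof -
  have "(\<Sum>b\<in>B. hit 0 V b v) = ex 0 V (\<lambda>F. \<Sum>b\<in>B. of_bool (leads F v b))" by (simp only: ex_sum hit_def)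
  also have "\<dots> \<le> ex 0 V (\<lambda>_. 1)" using assms sum_leads_le_1 by (intro ex_mono) auto
  finally show ?thesis using assms by (simp add: ex_const)
qed

lemma sum_avoiding_paths_le:
  assumes "finite V" "finite B" "B \<inter> V = {}" "set xs \<subseteq> V"
  shows "(\<Sum>b\<in>B. \<Sum>ys\<in>pathsf V v b. ratio 0 V (set ys) * of_bool (set ys \<inter> set xs = {})) \<le>
    1 - ex 0 V (\<lambda>F. of_bool (\<exists>y\<in>set xs. leads F v y))"
proof -
  have "(\<Sum>b\<in>B. \<Sum>ys\<in>pathsf V v b. ratio 0 V (set ys) * of_bool (set ys \<inter> set xs = {})) =
    ex 0 V (\<lambda>F. \<Sum>b\<in>B. pathsum V v b (\<lambda>ys. of_bool (set ys \<inter> set xs = {})) F)"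
    unfolding ex_sum using assms by (intro sum.cong refl ex_pathsum[symmetric]) auto
  also have "\<dots> \<le> ex 0 V (\<lambda>F. 1 - of_bool (\<exists>y\<in>set xs. leads F v y))"
  proof (rule ex_mono[OF assms(1)])
    fix F assume F: "F \<in> forests V"
    let ?n = "of_bool (\<not> (\<exists>y\<in>set xs. leads F v y)) :: real"
    have "(\<Sum>b\<in>B. pathsum V v b (\<lambda>ys. of_bool (set ys \<inter> set xs = {})) F) = (\<Sum>b\<in>B. of_bool (leads F v b) * ?n)"
    proof (rule sum.cong)
      fix b assume "b \<in> B"
      then have b: "b \<notin> V" using assms by auto
      show "pathsum V v b (\<lambda>ys. of_bool (set ys \<inter> set xs = {})) F = of_bool (leads F v b) * ?n"
      proof (rule pathsum_eq[OF assms(1) F b])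
        fix ys assume "chain F ys b" "hd (ys @ [b]) = v"
        then have "y \<in> set ys \<or> y = b \<longleftrightarrow> leads F v y" for y
          using forestsD(1)[OF F b] by (rule chain_set_iff)
        then have "set ys \<inter> set xs = {} \<longleftrightarrow> \<not> (\<exists>y\<in>set xs. leads F v y)"
          using b assms(4) by blast
        then show "of_bool (set ys \<inter> set xs = {}) = ?n" by simp
      qed
    qed simp
    also have "\<dots> = (\<Sum>b\<in>B. of_bool (leads F v b)) * ?n" by (simp only: sum_distrib_right)
    also have "\<dots> \<le> 1 * ?n" using F assms by (intro mult_right_mono sum_leads_le_1[of B F V]) auto
    also have "1 * ?n = 1 - of_bool (\<exists>y\<in>set xs. leads F v y)" by (simp only: of_bool_not_iff mult_1_left)
    finally show "(\<Sum>b\<in>B. pathsum V v b (\<lambda>ys. of_bool (set ys \<inter> set xs = {})) F) \<le>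
      1 - of_bool (\<exists>y\<in>set xs. leads F v y)" .
  qed simp
  also have "\<dots> = 1 - ex 0 V (\<lambda>F. of_bool (\<exists>y\<in>set xs. leads F v y))"
    using assms by (simp only: ex_diff ex_const)
  finally show ?thesis .
qed

text \<open>Revealing the path from a random boundary edge costs \<open>dg\<close> per unit of time \<open>t\<close> and
  destroys each path \<open>xs\<close> at rate at least \<open>rate c xs\<close>; the total boundary weight of \<open>V\<close> sets the clock.\<close>

lemma PH_decay:
  fixes c q t :: real
  assumes c: "c > 0"
    and hit: "\<And>V xs. finite V \<Longrightarrow> xs \<noteq> [] \<Longrightarrow> set xs \<subseteq> V \<Longrightarrow> rate c xs \<le>
      (\<Sum>v\<in>V. bw V v * ex 0 V (\<lambda>F. of_bool (\<exists>y\<in>set xs. leads F v y)))"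
    and n: "n \<ge> 1" and q0: "q \<ge> 0"
    and q: "\<And>V u. finite V \<Longrightarrow> u \<notin> V \<Longrightarrow> PH V u n \<le> q"
    and "finite V" "u \<notin> V" "t \<ge> 0"
  shows "PH V u (3 * n) \<le> dg * t + q / n * (\<Sum>xs\<in>mid V u n. ratio 0 V (set xs) * exp (- t * rate c xs))"
  using assms(6-)
proof (induction "card V" arbitrary: V t rule: less_induct)
  case less
  note V = \<open>finite V\<close> and u = \<open>u \<notin> V\<close> and t = \<open>t \<ge> 0\<close>
  let ?m = "3 * n"
  let ?S = "\<lambda>V t. \<Sum>xs\<in>mid V u n. ratio 0 V (set xs) * exp (- t * rate c xs)"
  have qn: "0 \<le> q / n" using q0 by simp
  have S0: "0 \<le> ?S V t" for t using V ratio_nonneg[OF V, of 0] by (intro sum_nonneg) (auto simp: less_imp_le)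
  show ?case
  proof (cases "V = {}")
    case True
    have "PH V u ?m = ex 0 V (\<lambda>_. 0)" unfolding PH_def
    proof (rule ex_cong)
      fix F assume F: "F \<in> forests V"
      have "\<not> hgt F u ?m"
      proof
        assume "hgt F u ?m"
        then obtain xs where "length xs = ?m" "chain F xs u" by (auto simp: hgt_def)
        moreover from this have "xs \<in> paths V u" using F by (intro chain_in_paths) auto
        ultimately show False using True n by (auto simp: paths_def)
      qed
      then show "of_bool (hgt F u ?m) = (0::real)" by simp
    qed
    then have "PH V u ?m = 0" by (simp add: ex_def wsum_def)
    moreover have "0 \<le> dg * t + q / n * ?S V t"
      using t by (intro add_nonneg_nonneg mult_nonneg_nonneg qn S0) auto
    ultimately show ?thesis by simp
  next
    case False
    define D where "D = (\<Sum>v\<in>V. bw V v)"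
    have D: "D > 0" unfolding D_def by (rule sum_bw_pos[OF V False])
    \<comment> \<open>A time step after which either the clock has run out (\<open>t' = 0\<close>)
      or a full branch has been revealed on average (\<open>s * D = 1\<close>).\<close>
    define s where "s = min t (1 / D)"
    define t' where "t' = t - s"
    have s: "0 \<le> s" "s * D \<le> 1" and t': "0 \<le> t'" and tst: "t = s + t'"
      using t D by (auto simp: s_def t'_def min_def field_simps)
    have sc: "s * D = 1 \<or> t' = 0" using D by (auto simp: s_def t'_def min_def)
    define B where "B = (\<Union>x\<in>V. nb x) - V - {u}"
    have B: "finite B" "B \<inter> V = {}" using V by (auto simp: B_def)
    let ?w = "\<lambda>xs. ratio 0 V (set xs) * exp (- t' * rate c xs)"
    have w0: "0 \<le> ?w xs" for xs using ratio_nonneg[OF V, of 0 "set xs"] by simp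
    let ?h = "\<lambda>v xs. ex 0 V (\<lambda>F. of_bool (\<exists>y\<in>set xs. leads F v y))"
    have step: "PH V u ?m \<le> hit 0 V u v + dg * t' + q / n * (\<Sum>xs\<in>mid V u n. ?w xs * (1 - ?h v xs))"
      if v: "v \<in> V" for v
    proof -
      have "PH V u ?m \<le> hit 0 V u v + (\<Sum>b\<in>B. \<Sum>ys\<in>pathsf V v b. ratio 0 V (set ys) * PH (V - set ys) u ?m)"
        unfolding B_def by (rule explore[OF V u v])
      also have "(\<Sum>b\<in>B. \<Sum>ys\<in>pathsf V v b. ratio 0 V (set ys) * PH (V - set ys) u ?m) \<le>
        (\<Sum>b\<in>B. \<Sum>ys\<in>pathsf V v b. ratio 0 V (set ys) * (dg * t') + q / n *
          (\<Sum>xs\<in>mid V u n. ?w xs * (ratio 0 V (set ys) * of_bool (set ys \<inter> set xs = {}))))"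
      proof (intro sum_mono)
        fix b ys assume b: "b \<in> B" and ys: "ys \<in> pathsf V v b"
        have r0: "0 \<le> ratio 0 V (set ys)" using ratio_nonneg[OF V, of 0 "set ys"] by simp
        have "ys \<noteq> []" using ys b v B by (auto simp: pathsf_def)
        moreover have sub: "set ys \<subseteq> V" using ys by (auto simp: pathsf_def paths_def)
        ultimately have "card (V - set ys) < card V"
          using V by (intro psubset_card_mono) (auto simp: neq_Nil_conv)
        then have IH: "PH (V - set ys) u ?m \<le> dg * t' + q / n * ?S (V - set ys) t'"
          using V u t' by (intro less.hyps) auto
        have "?S (V - set ys) t' \<le> (\<Sum>xs\<in>mid V u n. ?w xs * of_bool (set ys \<inter> set xs = {}))"
        proof -
          have "?S (V - set ys) t' \<le> (\<Sum>xs\<in>mid (V - set ys) u n. ?w xs * of_bool (set ys \<inter> set xs = {}))"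
          proof (rule sum_mono)
            fix xs assume "xs \<in> mid (V - set ys) u n"
            then have "set xs \<subseteq> V - set ys" by (auto simp: mid_def paths_def)
            then show "ratio 0 (V - set ys) (set xs) * exp (- t' * rate c xs) \<le> ?w xs * of_bool (set ys \<inter> set xs = {})"
              using V ratio_mono[of V 0 "V - set ys" "set xs"] by (auto intro!: mult_right_mono)
          qed
          also have "\<dots> \<le> (\<Sum>xs\<in>mid V u n. ?w xs * of_bool (set ys \<inter> set xs = {}))"
            using w0 by (intro sum_mono2 finite_mid V) (auto simp: mid_def paths_def)
          finally show ?thesis .
        qed
        then have "PH (V - set ys) u ?m \<le> dg * t' + q / n * (\<Sum>xs\<in>mid V u n. ?w xs * of_bool (set ys \<inter> set xs = {}))"
          by (rule order.trans[OF IH add_left_mono[OF mult_left_mono[OF _ qn]]])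
        then have "ratio 0 V (set ys) * PH (V - set ys) u ?m \<le> ratio 0 V (set ys) *
            (dg * t' + q / n * (\<Sum>xs\<in>mid V u n. ?w xs * of_bool (set ys \<inter> set xs = {})))"
          using r0 by (rule mult_left_mono)
        also have "\<dots> = ratio 0 V (set ys) * (dg * t') + q / n *
          (\<Sum>xs\<in>mid V u n. ?w xs * (ratio 0 V (set ys) * of_bool (set ys \<inter> set xs = {})))"
        proof -
          have "r * (a + k * (\<Sum>xs\<in>M. f xs * e xs)) = r * a + k * (\<Sum>xs\<in>M. f xs * (r * e xs))"
            for r a k :: real and f e :: "'a list \<Rightarrow> real" and M
            by (simp add: distrib_left sum_distrib_left mult_ac)
          then show ?thesis .
        qed
        finally show "ratio 0 V (set ys) * PH (V - set ys) u ?m \<le> ratio 0 V (set ys) * (dg * t') + q / n *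
          (\<Sum>xs\<in>mid V u n. ?w xs * (ratio 0 V (set ys) * of_bool (set ys \<inter> set xs = {})))" .
      qed
      also have "\<dots> = (\<Sum>b\<in>B. hit 0 V b v) * (dg * t') + q / n * (\<Sum>xs\<in>mid V u n. ?w xs *
          (\<Sum>b\<in>B. \<Sum>ys\<in>pathsf V v b. ratio 0 V (set ys) * of_bool (set ys \<inter> set xs = {})))"
      proof -
        have h: "(\<Sum>b\<in>B. hit 0 V b v) = (\<Sum>b\<in>B. \<Sum>ys\<in>pathsf V v b. ratio 0 V (set ys))"
          using B V by (intro sum.cong refl hit_paths) auto
        have id: "(\<Sum>b\<in>B. \<Sum>ys\<in>P b. r ys * a + k * (\<Sum>xs\<in>M. f xs * e ys xs)) =
          (\<Sum>b\<in>B. \<Sum>ys\<in>P b. r ys) * a + k * (\<Sum>xs\<in>M. f xs * (\<Sum>b\<in>B. \<Sum>ys\<in>P b. e ys xs))"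
          for P and r f :: "'a list \<Rightarrow> real" and a k :: real and e and M :: "'a list set"
        proof -
          have "(\<Sum>b\<in>B. \<Sum>ys\<in>P b. \<Sum>xs\<in>M. f xs * e ys xs) = (\<Sum>b\<in>B. \<Sum>xs\<in>M. \<Sum>ys\<in>P b. f xs * e ys xs)"
            by (intro sum.cong refl sum.swap)
          also have "\<dots> = (\<Sum>xs\<in>M. \<Sum>b\<in>B. \<Sum>ys\<in>P b. f xs * e ys xs)" by (rule sum.swap)
          finally have sw: "(\<Sum>b\<in>B. \<Sum>ys\<in>P b. \<Sum>xs\<in>M. f xs * e ys xs) = (\<Sum>xs\<in>M. \<Sum>b\<in>B. \<Sum>ys\<in>P b. f xs * e ys xs)" .
          show ?thesis
            by (simp only: sum.distrib sum_distrib_left[symmetric] sum_distrib_right[symmetric] sw)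
        qed
        show ?thesis unfolding h by (rule id)
      qed
      also have "\<dots> \<le> 1 * (dg * t') + q / n * (\<Sum>xs\<in>mid V u n. ?w xs * (1 - ?h v xs))"
      proof (intro add_mono mult_right_mono mult_left_mono sum_mono)
        show "(\<Sum>b\<in>B. hit 0 V b v) \<le> 1" by (rule sum_hit_le_1[OF V B])
        fix xs assume "xs \<in> mid V u n"
        then show "(\<Sum>b\<in>B. \<Sum>ys\<in>pathsf V v b. ratio 0 V (set ys) * of_bool (set ys \<inter> set xs = {})) \<le> 1 - ?h v xs"
          by (intro sum_avoiding_paths_le[OF V B]) (auto simp: mid_def paths_def)
      qed (use w0 qn t' in auto)
      finally show ?thesis by simp
    qed
    \<comment> \<open>Averaging the start of the branch over the boundary weights turns the hitting
      probabilities of \<open>xs\<close> into \<open>rate c xs\<close>, and the first term into a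
      flux of at most \<open>dg\<close>.\<close>
    have DPH: "D * PH V u ?m \<le> dg + D * (dg * t') + q / n * (\<Sum>xs\<in>mid V u n. ?w xs * (D - rate c xs))"
    proof -
      have "D * PH V u ?m = (\<Sum>v\<in>V. bw V v * PH V u ?m)" by (simp add: D_def sum_distrib_right)
      also have "\<dots> \<le> (\<Sum>v\<in>V. bw V v * (hit 0 V u v + dg * t' + q / n * (\<Sum>xs\<in>mid V u n. ?w xs * (1 - ?h v xs))))"
        using step by (intro sum_mono mult_left_mono bw_nonneg) auto
      also have "\<dots> = (\<Sum>v\<in>V. bw V v * hit 0 V u v) + D * (dg * t') +
          q / n * (\<Sum>xs\<in>mid V u n. ?w xs * (D - (\<Sum>v\<in>V. bw V v * ?h v xs)))"
      proof -
        have "(\<Sum>v\<in>V. b v * (a v + d + k * (\<Sum>xs\<in>M. f xs * (1 - e v xs)))) =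
          (\<Sum>v\<in>V. b v * a v) + (\<Sum>v\<in>V. b v) * d + k * (\<Sum>xs\<in>M. f xs * ((\<Sum>v\<in>V. b v) - (\<Sum>v\<in>V. b v * e v xs)))"
          for b a :: "'a \<Rightarrow> real" and d k :: real and f :: "'a list \<Rightarrow> real" and e M
        proof -
          have "(\<Sum>v\<in>V. b v * (\<Sum>xs\<in>M. f xs * (1 - e v xs))) = (\<Sum>v\<in>V. \<Sum>xs\<in>M. f xs * (b v - b v * e v xs))"
            by (simp add: sum_distrib_left algebra_simps)
          also have "\<dots> = (\<Sum>xs\<in>M. f xs * (\<Sum>v\<in>V. b v - b v * e v xs))"
            by (subst sum.swap) (simp add: sum_distrib_left)
          also have "\<dots> = (\<Sum>xs\<in>M. f xs * ((\<Sum>v\<in>V. b v) - (\<Sum>v\<in>V. b v * e v xs)))"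
            by (simp add: sum_subtractf)
          finally have *: "(\<Sum>v\<in>V. b v * (\<Sum>xs\<in>M. f xs * (1 - e v xs))) =
             (\<Sum>xs\<in>M. f xs * ((\<Sum>v\<in>V. b v) - (\<Sum>v\<in>V. b v * e v xs)))" .
          have "(\<Sum>v\<in>V. b v * (a v + d + k * (\<Sum>xs\<in>M. f xs * (1 - e v xs)))) =
            (\<Sum>v\<in>V. b v * a v) + (\<Sum>v\<in>V. b v * d) + (\<Sum>v\<in>V. k * (b v * (\<Sum>xs\<in>M. f xs * (1 - e v xs))))"
            by (simp only: distrib_left sum.distrib mult.left_commute)
          then show ?thesis by (simp only: sum_distrib_left[symmetric] sum_distrib_right[symmetric] *)
        qed
        then show ?thesis unfolding D_def .
      qed
      also have "\<dots> \<le> dg + D * (dg * t') + q / n * (\<Sum>xs\<in>mid V u n. ?w xs * (D - rate c xs))"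
      proof (intro add_mono mult_left_mono sum_mono order_refl)
        show "(\<Sum>v\<in>V. bw V v * hit 0 V u v) \<le> dg" by (rule flux_le[OF V order_refl u])
        fix xs assume "xs \<in> mid V u n"
        then have "xs \<noteq> []" "set xs \<subseteq> V" using n by (auto simp: mid_def paths_def)
        then show "D - (\<Sum>v\<in>V. bw V v * ?h v xs) \<le> D - rate c xs" using hit[OF V] by simp
      qed (use w0 qn D t' in auto)
      finally show ?thesis .
    qed
    \<comment> \<open>With weight \<open>1 - s * D\<close> no branch is revealed. The weight is
      nonzero only for \<open>t' = 0\<close>, and then the right side is the bound of
      \<open>PH_union_bound\<close>.\<close>
    have rest: "(1 - s * D) * PH V u ?m \<le> (1 - s * D) * (q / n * (\<Sum>xs\<in>mid V u n. ?w xs))"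
    proof (cases "s * D = 1")
      case True
      then show ?thesis by simp
    next
      case False
      then have "t' = 0" using sc by simp
      then show ?thesis using s PH_union_bound[OF V u n q] by (intro mult_left_mono) auto
    qed
    have "PH V u ?m = s * (D * PH V u ?m) + (1 - s * D) * PH V u ?m" by (simp add: algebra_simps)
    also have "\<dots> \<le> s * (dg + D * (dg * t') + q / n * (\<Sum>xs\<in>mid V u n. ?w xs * (D - rate c xs))) +
        (1 - s * D) * (q / n * (\<Sum>xs\<in>mid V u n. ?w xs))"
      by (intro add_mono rest mult_left_mono DPH s)
    also have "\<dots> = dg * s + (s * D) * (dg * t') + q / n * (\<Sum>xs\<in>mid V u n. ?w xs * (1 - s * rate c xs))"
    proof -
      have "s * (a + D * b + k * (\<Sum>xs\<in>M. f xs * (D - e xs))) + (1 - s * D) * (k * (\<Sum>xs\<in>M. f xs)) =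
        a * s + (s * D) * b + k * (\<Sum>xs\<in>M. f xs * (1 - s * e xs))"
        for a b k :: real and f e :: "'a list \<Rightarrow> real" and M
      proof -
        have 1: "(\<Sum>xs\<in>M. f xs * (D - e xs)) = D * (\<Sum>xs\<in>M. f xs) - (\<Sum>xs\<in>M. f xs * e xs)"
          by (simp add: right_diff_distrib sum_subtractf sum_distrib_left mult.commute)
        have 2: "(\<Sum>xs\<in>M. f xs * (1 - s * e xs)) = (\<Sum>xs\<in>M. f xs) - s * (\<Sum>xs\<in>M. f xs * e xs)"
          by (simp add: right_diff_distrib sum_subtractf sum_distrib_left mult.left_commute)
        show ?thesis unfolding 1 2 by (simp add: algebra_simps)
      qed
      then show ?thesis .
    qed
    also have "\<dots> \<le> dg * s + 1 * (dg * t') + q / n * (\<Sum>xs\<in>mid V u n. ?w xs * exp (- s * rate c xs))"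
    proof (intro add_mono mult_left_mono mult_right_mono sum_mono order_refl)
      fix xs show "1 - s * rate c xs \<le> exp (- s * rate c xs)"
        using exp_ge_add_one_self[of "- s * rate c xs"] by simp
    qed (use s t' qn w0 in auto)
    also have "\<dots> = dg * t + q / n * ?S V t"
    proof -
      have "exp (- t' * r) * exp (- s * r) = exp (- t * r)" for r
        unfolding exp_add[symmetric] tst by (simp add: algebra_simps)
      then have w: "?w xs * exp (- s * rate c xs) = ratio 0 V (set xs) * exp (- t * rate c xs)" for xs
        by (simp only: mult.assoc)
      have "dg * s + 1 * (dg * t') = dg * t" by (simp add: tst algebra_simps)
      then show ?thesis by (simp only: w)
    qed
    finally show ?thesis .
  qed
qed

section \<open>Total weight and energy of short paths\<close>

definition shortp :: "'a set \<Rightarrow> 'a \<Rightarrow> nat \<Rightarrow> 'a list set" where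
  "shortp V u m = {xs \<in> paths V u. xs \<noteq> [] \<and> length xs \<le> m}"

lemma finite_shortp: "finite V \<Longrightarrow> finite (shortp V u m)"
  by (simp add: shortp_def)

text \<open>Killing at rate \<open>1 / n\<close> alters the weight of paths of length at most
  \<open>2 * n\<close> by no more than \<open>exp (2 * C1)\<close>; in the killed forest the sums
  over all paths are of order \<open>n\<close> and, with the energy, of order \<open>n\<close>
  squared.\<close>

lemma shortp_bound:
  obtains C :: real where "C > 0"
    "\<And>n V u. n \<ge> 1 \<Longrightarrow> finite V \<Longrightarrow> u \<notin> V \<Longrightarrow> (\<Sum>xs\<in>shortp V u (2 * n). ratio 0 V (set xs)) \<le> C * n"
    "\<And>n V u. n \<ge> 1 \<Longrightarrow> finite V \<Longrightarrow> u \<notin> V \<Longrightarrow>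
      (\<Sum>xs\<in>shortp V u (2 * n). ratio 0 V (set xs) * energy xs) \<le> C * n ^ 2"
proof -
  define K where "K = real dg + 1"
  define E where "E = 2 * (1 / gap * (K * K)) * (1 + 1 / gap * (dg * (K * \<Phi>))) * K"
  define C where "C = exp (2 * C1) * (K + E)"
  have K: "K > 0" by (simp add: K_def)
  have E: "E \<ge> 0" using K gap_pos \<Phi>_nonneg by (simp add: E_def)
  have Cpos: "C > 0" using K E by (simp add: C_def add_pos_nonneg)
  have main: "(\<Sum>xs\<in>shortp V u (2 * n). ratio 0 V (set xs)) \<le> C * n \<and>
      (\<Sum>xs\<in>shortp V u (2 * n). ratio 0 V (set xs) * energy xs) \<le> C * n ^ 2"
    if n: "n \<ge> 1" and V: "finite V" and u: "u \<notin> V" for n V u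
  proof -
    define \<kappa> where "\<kappa> = 1 / real n"
    have \<kappa>: "\<kappa> > 0" "\<kappa> \<le> 1" using n by (auto simp: \<kappa>_def)
    have d1: "dg + \<kappa> \<le> K" "0 \<le> dg + \<kappa>" using \<kappa> by (auto simp: K_def)
    have d2: "(dg + \<kappa>) / \<kappa> \<le> K * n"
    proof -
      have "(dg + \<kappa>) / \<kappa> = (dg + \<kappa>) * n" by (simp add: \<kappa>_def)
      then show ?thesis using d1 by (simp add: mult_right_mono)
    qed
    have ms: "(\<Sum>xs\<in>shortp V u (2 * n). ratio 0 V (set xs) * f xs) \<le>
        exp (2 * C1) * (\<Sum>xs\<in>paths V u - {[]}. ratio \<kappa> V (set xs) * f xs)"
      if f: "\<And>xs. f xs \<ge> 0" for f
    proof -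
      have "(\<Sum>xs\<in>shortp V u (2 * n). ratio 0 V (set xs) * f xs) \<le>
        exp (C1 * \<kappa> * (2 * n)) * (\<Sum>xs\<in>shortp V u (2 * n). ratio \<kappa> V (set xs) * f xs)"
        by (rule massive_sum[OF V, of _ _ u]) (use f \<kappa> in \<open>auto simp: shortp_def\<close>)
      also have "C1 * \<kappa> * (2 * n) = 2 * C1" using n by (simp add: \<kappa>_def)
      also have "exp (2 * C1) * (\<Sum>xs\<in>shortp V u (2 * n). ratio \<kappa> V (set xs) * f xs) \<le>
          exp (2 * C1) * (\<Sum>xs\<in>paths V u - {[]}. ratio \<kappa> V (set xs) * f xs)"
        using V f \<kappa> ratio_nonneg[OF V, of \<kappa>]
        by (intro mult_left_mono sum_mono2) (auto simp: shortp_def less_imp_le)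
      finally show ?thesis .
    qed
    have "(\<Sum>xs\<in>shortp V u (2 * n). ratio 0 V (set xs)) \<le> exp (2 * C1) * (\<Sum>xs\<in>paths V u - {[]}. ratio \<kappa> V (set xs) * 1)"
      using ms[of "\<lambda>_. 1"] by simp
    also have "(\<Sum>xs\<in>paths V u - {[]}. ratio \<kappa> V (set xs) * 1) = (\<Sum>x\<in>V. 1 * hit \<kappa> V u x)"
      using \<kappa> by (intro sum_paths_hd[OF V _ u]) auto
    also have "\<dots> \<le> (dg + \<kappa>) / \<kappa>" using sum_hit_le[OF V \<kappa>(1) u V] by simp
    also have "\<dots> \<le> (K + E) * n" using d2 mult_nonneg_nonneg[OF E of_nat_0_le_iff[of n]] unfolding distrib_right by linarith
    finally have 1: "(\<Sum>xs\<in>shortp V u (2 * n). ratio 0 V (set xs)) \<le> C * n"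
      by (simp add: C_def mult.assoc)
    have "(\<Sum>xs\<in>shortp V u (2 * n). ratio 0 V (set xs) * energy xs) \<le>
        exp (2 * C1) * (\<Sum>xs\<in>paths V u - {[]}. ratio \<kappa> V (set xs) * energy xs)"
      by (rule ms[OF energy_nonneg])
    also have "(\<Sum>xs\<in>paths V u - {[]}. ratio \<kappa> V (set xs) * energy xs) \<le>
      2 * (1 / gap * ((dg + \<kappa>) / \<kappa> * (dg + \<kappa>))) * (1 + 1 / gap * (dg * ((dg + \<kappa>) * \<Phi>))) * ((dg + \<kappa>) / \<kappa>)"
      by (rule sum_paths_energy[OF V \<kappa>(1) u])
    also have "\<dots> \<le> 2 * (1 / gap * ((K * n) * K)) * (1 + 1 / gap * (dg * (K * \<Phi>))) * (K * n)"
    proof -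
      have a0: "0 \<le> (dg + \<kappa>) / \<kappa>" "0 \<le> K * n" using \<kappa> K by auto
      have 1: "(dg + \<kappa>) / \<kappa> * (dg + \<kappa>) \<le> (K * n) * K" using a0 d1 d2 by (intro mult_mono) auto
      then have 2: "2 * (1 / gap * ((dg + \<kappa>) / \<kappa> * (dg + \<kappa>))) \<le> 2 * (1 / gap * ((K * n) * K))"
        using gap_pos by (intro mult_left_mono) auto
      have "(dg + \<kappa>) * \<Phi> \<le> K * \<Phi>" using d1 \<Phi>_nonneg by (intro mult_right_mono) auto
      then have "1 / gap * (dg * ((dg + \<kappa>) * \<Phi>)) \<le> 1 / gap * (dg * (K * \<Phi>))"
        using gap_pos by (intro mult_left_mono) auto
      then have 3: "1 + 1 / gap * (dg * ((dg + \<kappa>) * \<Phi>)) \<le> 1 + 1 / gap * (dg * (K * \<Phi>))" by linarith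
      have n2: "0 \<le> 2 * (1 / gap * ((dg + \<kappa>) / \<kappa> * (dg + \<kappa>)))" "0 \<le> 2 * (1 / gap * ((K * n) * K))"
        using gap_pos \<kappa> K by auto
      have n3: "0 \<le> 1 + 1 / gap * (dg * ((dg + \<kappa>) * \<Phi>))" "0 \<le> 1 + 1 / gap * (dg * (K * \<Phi>))"
        using gap_pos d1 K \<Phi>_nonneg by (auto intro!: add_nonneg_nonneg mult_nonneg_nonneg divide_nonneg_pos)
      show ?thesis
        by (rule mult_mono[OF mult_mono[OF 2 3 n2(2) n3(1)] d2 mult_nonneg_nonneg[OF n2(2) n3(2)] a0(1)])
    qed
    also have "\<dots> = E * n ^ 2" by (simp add: E_def power2_eq_square)
    also have "\<dots> \<le> (K + E) * n ^ 2" using K by (intro mult_right_mono) auto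
    finally have 2: "(\<Sum>xs\<in>shortp V u (2 * n). ratio 0 V (set xs) * energy xs) \<le> C * n ^ 2"
      by (simp add: C_def mult.assoc)
    show ?thesis using 1 2 by (rule conjI)
  qed
  show ?thesis by (rule that[OF Cpos]) (use main in simp_all)
qed

text \<open>A path of energy at most \<open>K * n\<close> is destroyed at rate at least
  \<open>c * n / K\<close>, so running the clock up to \<open>T / n\<close> makes it unlikely to
  survive; paths of larger energy are few by Markov's inequality. The bound at \<open>3 * n\<close>
  becomes \<open>dg * T / n\<close> plus one sixth of the bound at \<open>n\<close>, and a
  contraction stronger than one third per tripling forces the order \<open>1 / n\<close>.\<close>

theorem intrinsic_bound:
  obtains C :: real where "C > 0" "\<And>n V u. n \<ge> 1 \<Longrightarrow> finite V \<Longrightarrow> u \<notin> V \<Longrightarrow> PH V u n \<le> C / n"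
proof -
  obtain c :: real where c: "c > 0" and hit: "\<And>V xs. finite V \<Longrightarrow> xs \<noteq> [] \<Longrightarrow> set xs \<subseteq> V \<Longrightarrow> rate c xs \<le>
      (\<Sum>v\<in>V. bw V v * ex 0 V (\<lambda>F. of_bool (\<exists>y\<in>set xs. leads F v y)))"
    by (rule hitting[folded rate_def]) (rule that)
  obtain A :: real where A: "A > 0"
    "\<And>n V u. n \<ge> 1 \<Longrightarrow> finite V \<Longrightarrow> u \<notin> V \<Longrightarrow> (\<Sum>xs\<in>shortp V u (2 * n). ratio 0 V (set xs)) \<le> A * n"
    "\<And>n V u. n \<ge> 1 \<Longrightarrow> finite V \<Longrightarrow> u \<notin> V \<Longrightarrow>
      (\<Sum>xs\<in>shortp V u (2 * n). ratio 0 V (set xs) * energy xs) \<le> A * n ^ 2"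
    by (rule shortp_bound) (rule that)
  \<comment> \<open>This \<open>K\<close> and the following \<open>T\<close> are chosen so that the
    paths of small and of large energy each contribute at most \<open>n / 12\<close>.\<close>
  define K where "K = 12 * A"
  define T where "T = K / c * \<bar>ln (12 * A)\<bar>"
  have K: "K > 0" using A by (simp add: K_def)
  have T: "T \<ge> 0" using K c by (simp add: T_def)
  have eT: "A * exp (- T * c / K) \<le> 1 / 12"
  proof -
    have "exp (- T * c / K) \<le> exp (- ln (12 * A))" using K c by (simp add: T_def)
    also have "\<dots> = 1 / (12 * A)" using A by (simp add: exp_minus inverse_eq_divide)
    finally show ?thesis using A by (simp add: field_simps)
  qed
  have triple: "PH V u (3 * n) \<le> dg * T / n + q / 6"
    if n: "n \<ge> 1" and q0: "q \<ge> 0" and q: "\<And>V u. finite V \<Longrightarrow> u \<notin> V \<Longrightarrow> PH V u n \<le> q"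
      and V: "finite V" and u: "u \<notin> V" for n q V u
  proof -
    let ?t = "T / n"
    have "?t * (c * n / K) = T * c / K" using n by simp
    then have tck: "exp (- (?t * (c * n / K))) = exp (- T * c / K)" by simp
    have "(\<Sum>xs\<in>mid V u n. ratio 0 V (set xs) * exp (- ?t * rate c xs)) \<le>
      (\<Sum>xs\<in>mid V u n. ratio 0 V (set xs) * exp (- T * c / K) + ratio 0 V (set xs) * energy xs / (K * n))"
    proof (rule sum_mono)
      fix xs assume xs: "xs \<in> mid V u n"
      then have ne: "xs \<noteq> []" using n by (auto simp: mid_def)
      have r: "0 < ratio 0 V (set xs)" using V by (intro ratio_nonneg) auto
      have len: "n \<le> card (set xs)" using xs by (auto simp: mid_def paths_def distinct_card)
      have "exp (- ?t * rate c xs) \<le> exp (- T * c / K) + energy xs / (K * n)"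
      proof (cases "energy xs \<le> K * n")
        case True
        have "c * n / K = c * (n * n) / (K * n)" using n by simp
        also have "\<dots> \<le> c * (card (set xs))\<^sup>2 / energy xs"
          using True energy_pos[OF ne] c K len
          by (intro frac_le mult_left_mono) (auto simp: power2_eq_square intro!: mult_mono)
        finally have "c * n / K \<le> rate c xs" by (simp add: rate_def)
        then have "?t * (c * n / K) \<le> ?t * rate c xs" using T by (intro mult_left_mono) auto
        then have "exp (- ?t * rate c xs) \<le> exp (- T * c / K)" unfolding tck[symmetric] by simp
        then show ?thesis using energy_nonneg[of xs] K by (simp add: add_increasing2)
      next
        case False
        then have "1 \<le> energy xs / (K * n)" using K n by (simp add: field_simps)
        moreover have "0 \<le> rate c xs" using c energy_pos[OF ne] by (simp add: rate_def)
        then have "exp (- ?t * rate c xs) \<le> 1" using T by simp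
        ultimately show ?thesis using exp_gt_zero[of "- T * c / K"] by linarith
      qed
      then have "ratio 0 V (set xs) * exp (- ?t * rate c xs) \<le> ratio 0 V (set xs) * (exp (- T * c / K) + energy xs / (K * n))"
        using r by (intro mult_left_mono) auto
      then show "ratio 0 V (set xs) * exp (- ?t * rate c xs) \<le>
          ratio 0 V (set xs) * exp (- T * c / K) + ratio 0 V (set xs) * energy xs / (K * n)"
        by (simp add: distrib_left)
    qed
    also have "\<dots> \<le> (\<Sum>xs\<in>shortp V u (2 * n). ratio 0 V (set xs) * exp (- T * c / K) + ratio 0 V (set xs) * energy xs / (K * n))"
      using V n K energy_nonneg ratio_nonneg[OF V, of 0]
      by (intro sum_mono2 finite_shortp) (auto simp: mid_def shortp_def less_imp_le)
    also have "\<dots> = (\<Sum>xs\<in>shortp V u (2 * n). ratio 0 V (set xs)) * exp (- T * c / K) +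
        (\<Sum>xs\<in>shortp V u (2 * n). ratio 0 V (set xs) * energy xs) / (K * n)"
      by (simp add: sum.distrib sum_distrib_right sum_divide_distrib)
    also have "\<dots> \<le> A * n * exp (- T * c / K) + A * n ^ 2 / (K * n)"
      using A(2,3)[OF n V u] K by (intro add_mono mult_right_mono divide_right_mono) auto
    also have "\<dots> = n * (A * exp (- T * c / K)) + n / 12"
      using n A(1) by (simp add: K_def power2_eq_square)
    also have "\<dots> \<le> n * (1 / 12) + n / 12" by (intro add_mono mult_left_mono eT) auto
    finally have S: "(\<Sum>xs\<in>mid V u n. ratio 0 V (set xs) * exp (- ?t * rate c xs)) \<le> n / 6" by simp
    have "PH V u (3 * n) \<le> dg * ?t + q / n * (\<Sum>xs\<in>mid V u n. ratio 0 V (set xs) * exp (- ?t * rate c xs))"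
      using T by (intro PH_decay[OF c hit n q0 q V u]) auto
    also have "\<dots> \<le> dg * ?t + q / n * (n / 6)" using q0 S by (intro add_mono mult_left_mono) auto
    finally show ?thesis using n by simp
  qed
  \<comment> \<open>Solves \<open>dg * T + C0 / 6 \<le> C0 / 3\<close>; the summand 1 starts the
    induction.\<close>
  define C0 where "C0 = 6 * dg * T + 1"
  have C0: "C0 > 0" using T by (simp add: C0_def add_nonneg_pos)
  have pow: "PH V u (3 ^ k) \<le> C0 / 3 ^ k" if "finite V" "u \<notin> V" for V u k
    using that
  proof (induction k arbitrary: V u)
    case 0
    have "PH V u 1 \<le> 1" using 0 by (intro PH_le_1)
    also have "1 \<le> C0" using T by (simp add: C0_def)
    finally show ?case by simp
  next
    case (Suc k)
    have "PH V u (3 * 3 ^ k) \<le> dg * T / real (3 ^ k) + (C0 / 3 ^ k) / 6"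
      using C0 by (intro triple Suc) auto
    also have "\<dots> = (dg * T + C0 / 6) / 3 ^ k" by (simp add: add_divide_distrib)
    also have "\<dots> \<le> (C0 / 3) / 3 ^ k" by (intro divide_right_mono) (auto simp: C0_def)
    finally show ?case by (simp add: field_simps)
  qed
  have main: "PH V u n \<le> 3 * C0 / n" if n: "n \<ge> 1" and V: "finite V" "u \<notin> V" for n V u
  proof -
    obtain k where k: "3 ^ k \<le> n" "n < 3 ^ (k + 1)" using ex_power_ivl1[of 3 n] n by auto
    have "PH V u n \<le> PH V u (3 ^ k)" using V k by (intro PH_antimono) auto
    also have "\<dots> \<le> C0 / 3 ^ k" by (rule pow[OF V])
    also have "\<dots> = 3 * C0 / 3 ^ (k + 1)" by simp
    also have "\<dots> \<le> 3 * C0 / n"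
    proof (intro divide_left_mono)
      show "real n \<le> 3 ^ (k + 1)" using k(2) by (metis less_imp_le of_nat_le_iff of_nat_numeral of_nat_power)
    qed (use C0 n in auto)
    finally show ?thesis .
  qed
  show ?thesis by (rule that[OF _ main]) (use C0 in auto)
qed

end

section \<open>Second moments and the extrinsic radius\<close>

lemma sum_of_bool_card:
  assumes "finite S"
  shows "(\<Sum>x\<in>S. of_bool (P x) :: real) = card {x \<in> S. P x}"
proof -
  have "(\<Sum>x\<in>S. of_bool (P x) :: real) = (\<Sum>x\<in>{x \<in> S. P x}. 1)"
    by (rule sum.mono_neutral_cong_right[OF assms]) auto
  then show ?thesis by simp
qed

section \<open>Number of descendants within \<open>n\<close> generations\<close>

context transient_ray
begin

definition cnt :: "'a set \<Rightarrow> 'a \<Rightarrow> nat \<Rightarrow> ('a \<Rightarrow> 'a option) \<Rightarrow> real" where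
  "cnt V u n F = (\<Sum>xs\<in>shortp V u n. of_bool (chain F xs u))"

lemma cnt_nonneg: "0 \<le> cnt V u n F"
  unfolding cnt_def by (intro sum_nonneg) auto

lemma shortp_count:
  obtains A :: real where "A > 0"
    "\<And>n V u. n \<ge> 1 \<Longrightarrow> finite V \<Longrightarrow> u \<notin> V \<Longrightarrow> (\<Sum>xs\<in>shortp V u n. ratio 0 V (set xs)) \<le> A * n"
proof -
  obtain C :: real where C: "C > 0"
    "\<And>n V u. n \<ge> 1 \<Longrightarrow> finite V \<Longrightarrow> u \<notin> V \<Longrightarrow> (\<Sum>xs\<in>shortp V u (2 * n). ratio 0 V (set xs)) \<le> C * n"
    by (rule shortp_bound) (rule that)
  have main: "(\<Sum>xs\<in>shortp V u n. ratio 0 V (set xs)) \<le> C * n" if "n \<ge> 1" "finite V" "u \<notin> V" for n V u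
  proof -
    have "(\<Sum>xs\<in>shortp V u n. ratio 0 V (set xs)) \<le> (\<Sum>xs\<in>shortp V u (2 * n). ratio 0 V (set xs))"
      using that ratio_nonneg[of V 0] by (intro sum_mono2 finite_shortp) (auto simp: shortp_def less_imp_le)
    then show ?thesis using C(2)[OF that] by linarith
  qed
  show ?thesis by (rule that[OF C(1) main])
qed

lemma ex_chain_only:
  assumes "finite V" "xs \<in> paths V u" "u \<notin> V"
  shows "ex 0 V (\<lambda>F. of_bool (chain F xs u)) = ratio 0 V (set xs)"
  using ex_chain[of V 0 xs u "\<lambda>_. 1"] assms by (simp add: ex_const)

lemma ex_cnt:
  assumes "finite V" "u \<notin> V"
  shows "ex 0 V (cnt V u n) = (\<Sum>xs\<in>shortp V u n. ratio 0 V (set xs))"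
  unfolding cnt_def ex_sum using assms by (intro sum.cong refl ex_chain_only) (auto simp: shortp_def)

text \<open>A descendant of \<open>u\<close> off the attached path first joins
  \<open>insert u (set xs)\<close> at some \<open>z\<close>, and up to there its path belongs to the
  old forest. That initial part starts at the descendant and so determines it, which makes the map
  injective.\<close>

lemma cnt_ext_le:
  assumes V: "finite V" and xs: "xs \<in> paths V u" and u: "u \<notin> V" and F: "F \<in> forests (V - set xs)"
  shows "cnt V u n (ext F xs u) \<le> card (set xs) + (\<Sum>z\<in>insert u (set xs). cnt (V - set xs) z n F)"
proof -
  let ?G = "ext F xs u" and ?W = "V - set xs"
  define Y where "Y = {ys \<in> shortp V u n. chain ?G ys u}"
  define Y1 where "Y1 = {ys \<in> Y. hd ys \<in> set xs}"
  define Y2 where "Y2 = {ys \<in> Y. hd ys \<notin> set xs}"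
  have fin: "finite Y" "finite Y1" "finite Y2" using finite_shortp[OF V] by (auto simp: Y_def Y1_def Y2_def)
  have "u \<notin> set xs" using xs u by (auto simp: paths_def)
  then have Gu: "?G u = None" using forestsD(1)[OF F, of u] u by (simp add: ext_notin)
  have inj: "inj_on hd Y"
  proof (rule inj_onI)
    fix ys ys' assume a: "ys \<in> Y" "ys' \<in> Y" "hd ys = hd ys'"
    then have "hd (ys @ [u]) = hd (ys' @ [u])" by (auto simp: Y_def shortp_def)
    then show "ys = ys'" using chain_unique[of ?G u ys ys', OF Gu] a by (auto simp: Y_def)
  qed
  have "cnt V u n ?G = card Y"
    unfolding cnt_def Y_def by (rule sum_of_bool_card[OF finite_shortp[OF V]])
  also have "card Y = card Y1 + card Y2"
    using fin by (subst card_Un_disjoint[symmetric]) (auto simp: Y1_def Y2_def intro: arg_cong[where f = card])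
  finally have split: "cnt V u n ?G = real (card Y1) + real (card Y2)" by simp
  have "card Y1 = card (hd ` Y1)" using inj by (subst card_image) (auto simp: Y1_def inj_on_def)
  also have "\<dots> \<le> card (set xs)" by (intro card_mono) (auto simp: Y1_def)
  finally have c1: "card Y1 \<le> card (set xs)" .
  let ?T = "\<lambda>z. {zs \<in> shortp ?W z n. chain F zs z}"
  let ?P = "\<lambda>v. v \<notin> set xs"
  let ?m = "\<lambda>ys. (hd (dropWhile ?P ys @ [u]), takeWhile ?P ys)"
  have finT: "finite (?T z)" for z using finite_shortp[of ?W z n] V by simp
  have sub: "?m ` Y2 \<subseteq> Sigma (insert u (set xs)) ?T"
  proof (rule image_subsetI)
    fix ys assume ys: "ys \<in> Y2"
    let ?z = "hd (dropWhile ?P ys @ [u])" and ?zs = "takeWhile ?P ys"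
    have z: "?z \<in> insert u (set xs)"
      using hd_dropWhile[of ?P ys] by (cases "dropWhile ?P ys = []") (auto simp: hd_append)
    have "chain ?G (?zs @ dropWhile ?P ys) u" using ys by (simp add: Y2_def Y_def)
    then have "chain ?G ?zs ?z" by (simp only: chain_append)
    then have ch: "chain F ?zs ?z"
      by (rule chain_cong) (auto dest: set_takeWhileD simp: ext_notin)
    have "?zs \<noteq> []" using ys by (cases ys) (auto simp: Y2_def Y_def shortp_def)
    moreover have "length ?zs \<le> n"
      using ys length_takeWhile_le[of ?P ys] by (auto simp: Y2_def Y_def shortp_def)
    ultimately have "?zs \<in> ?T ?z" using chain_in_paths[OF F ch] ch by (simp add: shortp_def)
    then show "?m ys \<in> Sigma (insert u (set xs)) ?T" using z by blast
  qed
  have inj2: "inj_on ?m Y2"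
  proof (rule inj_onI)
    fix ys ys' assume a: "ys \<in> Y2" "ys' \<in> Y2" "?m ys = ?m ys'"
    have hd: "hd (takeWhile ?P ys) = hd ys" if "ys \<in> Y2" for ys
      using that by (cases ys) (auto simp: Y2_def Y_def shortp_def)
    have "hd ys = hd ys'" using hd[OF a(1)] hd[OF a(2)] a(3) by simp
    then show "ys = ys'" using inj a(1,2) by (auto simp: Y2_def inj_on_def)
  qed
  have "card Y2 = card (?m ` Y2)" using inj2 by (simp add: card_image)
  also have "\<dots> \<le> card (Sigma (insert u (set xs)) ?T)" using finT by (intro card_mono sub finite_SigmaI) auto
  also have "\<dots> = (\<Sum>z\<in>insert u (set xs). card (?T z))" using finT by simp
  finally have "real (card Y2) \<le> (\<Sum>z\<in>insert u (set xs). real (card (?T z)))"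
    by (simp flip: of_nat_sum)
  also have "\<dots> = (\<Sum>z\<in>insert u (set xs). cnt ?W z n F)"
    unfolding cnt_def using V by (intro sum.cong refl sum_of_bool_card[symmetric] finite_shortp) auto
  finally show ?thesis using split c1 by simp
qed

text \<open>Reveal the path of one descendant: at most \<open>n + 1\<close> vertices become roots,
  each with order \<open>n\<close> expected descendants. With order \<open>n\<close> for the
  revealed path this makes \<open>n\<close> cubed, as for a critical branching process.\<close>

lemma cnt_second_moment:
  obtains C :: real where "C > 0"
    "\<And>n V u. n \<ge> 1 \<Longrightarrow> finite V \<Longrightarrow> u \<notin> V \<Longrightarrow> ex 0 V (\<lambda>F. cnt V u n F * cnt V u n F) \<le> C * n ^ 3"
proof -
  obtain A :: real where A: "A > 0"
    "\<And>n V u. n \<ge> 1 \<Longrightarrow> finite V \<Longrightarrow> u \<notin> V \<Longrightarrow> (\<Sum>xs\<in>shortp V u n. ratio 0 V (set xs)) \<le> A * n"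
    by (rule shortp_count) (rule that)
  have main: "ex 0 V (\<lambda>F. cnt V u n F * cnt V u n F) \<le> (A * (1 + 2 * A)) * n ^ 3"
    if n: "n \<ge> 1" and V: "finite V" and u: "u \<notin> V" for n V u
  proof -
    have "ex 0 V (\<lambda>F. cnt V u n F * cnt V u n F) =
        (\<Sum>xs\<in>shortp V u n. ex 0 V (\<lambda>F. of_bool (chain F xs u) * cnt V u n F))"
      unfolding ex_sum[symmetric] cnt_def[of V u n] sum_distrib_right ..
    also have "\<dots> \<le> (\<Sum>xs\<in>shortp V u n. ratio 0 V (set xs) * (n + (n + 1) * (A * n)))"
    proof (rule sum_mono)
      fix xs assume "xs \<in> shortp V u n"
      then have xs: "xs \<in> paths V u" "card (set xs) \<le> n" "set xs \<subseteq> V"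
        using order.trans[OF card_length] by (auto simp: shortp_def paths_def)
      have "ex 0 V (\<lambda>F. of_bool (chain F xs u) * cnt V u n F) =
          ratio 0 V (set xs) * ex 0 (V - set xs) (\<lambda>F. cnt V u n (ext F xs u))"
        using V u xs by (intro ex_chain) auto
      also have "\<dots> \<le> ratio 0 V (set xs) * ex 0 (V - set xs)
          (\<lambda>F. card (set xs) + (\<Sum>z\<in>insert u (set xs). cnt (V - set xs) z n F))"
        using V u xs ratio_nonneg[OF V, of 0 "set xs"]
        by (intro mult_left_mono ex_mono cnt_ext_le) auto
      also have "ex 0 (V - set xs) (\<lambda>F. card (set xs) + (\<Sum>z\<in>insert u (set xs). cnt (V - set xs) z n F)) =
          card (set xs) + (\<Sum>z\<in>insert u (set xs). ex 0 (V - set xs) (cnt (V - set xs) z n))"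
        using V ex_const[of "V - set xs" 0 "real (card (set xs))"] by (simp only: ex_add ex_sum) simp
      also have "ratio 0 V (set xs) * \<dots> \<le> ratio 0 V (set xs) * (n + (n + 1) * (A * n))"
      proof (rule mult_left_mono)
        have "(\<Sum>z\<in>insert u (set xs). ex 0 (V - set xs) (cnt (V - set xs) z n)) \<le> (\<Sum>z\<in>insert u (set xs). A * n)"
        proof (rule sum_mono)
          fix z assume "z \<in> insert u (set xs)"
          then have z: "z \<notin> V - set xs" using u by auto
          have "ex 0 (V - set xs) (cnt (V - set xs) z n) = (\<Sum>ys\<in>shortp (V - set xs) z n. ratio 0 (V - set xs) (set ys))"
            using V z by (intro ex_cnt) auto
          also have "\<dots> \<le> A * n" using V z n by (intro A(2)) auto
          finally show "ex 0 (V - set xs) (cnt (V - set xs) z n) \<le> A * n" .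
        qed
        also have "\<dots> = card (insert u (set xs)) * (A * n)" by simp
        also have "\<dots> \<le> (n + 1) * (A * n)"
        proof (rule mult_right_mono)
          have "card (insert u (set xs)) \<le> n + 1" using xs(2) card_insert_le_m1[of "n + 1" "set xs" u] by simp
          then show "real (card (insert u (set xs))) \<le> real (n + 1)" by (simp only: of_nat_le_iff)
        qed (use A in auto)
        finally have 2: "(\<Sum>z\<in>insert u (set xs). ex 0 (V - set xs) (cnt (V - set xs) z n)) \<le> (n + 1) * (A * n)" .
        have "real (card (set xs)) \<le> real n" using xs(2) by simp
        with 2 show "real (card (set xs)) + (\<Sum>z\<in>insert u (set xs). ex 0 (V - set xs) (cnt (V - set xs) z n))
            \<le> n + (n + 1) * (A * n)" by linarith
      qed (use ratio_nonneg[OF V, of 0 "set xs"] in simp)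
      finally show "ex 0 V (\<lambda>F. of_bool (chain F xs u) * cnt V u n F) \<le>
          ratio 0 V (set xs) * (n + (n + 1) * (A * n))" .
    qed
    also have "\<dots> = (\<Sum>xs\<in>shortp V u n. ratio 0 V (set xs)) * (n + (n + 1) * (A * n))"
      by (rule sum_distrib_right[symmetric])
    also have "\<dots> \<le> (A * n) * ((1 + 2 * A) * n ^ 2)"
    proof (rule mult_mono)
      show "(\<Sum>xs\<in>shortp V u n. ratio 0 V (set xs)) \<le> A * n" by (rule A(2)[OF n V u])
      have n1: "1 \<le> real n" using n by simp
      then have nn: "real n \<le> real n ^ 2" by (simp add: power2_eq_square)
      have "A * n \<le> A * n ^ 2" using nn A(1) by (intro mult_left_mono) auto
      then have "real n + (real n * (A * real n) + A * real n) \<le> real n ^ 2 + (A * real n ^ 2 + A * real n ^ 2)"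
        using nn by (simp add: power2_eq_square)
      then show "n + (n + 1) * (A * n) \<le> (1 + 2 * A) * n ^ 2" by (simp add: algebra_simps)
      show "0 \<le> A * real n" "0 \<le> n + (n + 1) * (A * n)" using A by auto
    qed
    also have "\<dots> = (A * (1 + 2 * A)) * n ^ 3" by (simp add: power2_eq_square power3_eq_cube)
    finally show ?thesis .
  qed
  have "A * (1 + 2 * A) > 0" using A(1) by simp
  then show ?thesis by (rule that[OF _ main])
qed

text \<open>Passes from a root outside the volume to a vertex inside it: the edge out of
  \<open>y\<close> has at most \<open>dg\<close> choices, and \<open>ratio\<close> at
  \<open>y\<close> is at most \<open>1 / gap\<close>.\<close>

lemma ex_root_le:
  assumes "finite V" "y \<in> V" "\<And>F. 0 \<le> f F"
    and "\<And>F w. F \<in> forests (V - {y}) \<Longrightarrow> F(y \<mapsto> w) \<in> forests V \<Longrightarrow> f (F(y \<mapsto> w)) \<le> f F"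
  shows "ex 0 V f \<le> dg / gap * ex 0 (V - {y}) f"
proof -
  have "ex 0 V f = ratio 0 V {y} * ex 0 (V - {y})
      (\<lambda>F. 0 * f F + (\<Sum>w\<in>nb y. of_bool (\<not> leads F w y) * f (F(y \<mapsto> w))))"
    using assms by (intro ex_cut) auto
  also have "\<dots> \<le> ratio 0 V {y} * ex 0 (V - {y}) (\<lambda>F. dg * f F)"
  proof (intro mult_left_mono ex_mono)
    fix F assume F: "F \<in> forests (V - {y})"
    have "(\<Sum>w\<in>nb y. of_bool (\<not> leads F w y) * f (F(y \<mapsto> w))) \<le> (\<Sum>w\<in>nb y. f F)"
    proof (rule sum_mono)
      fix w assume w: "w \<in> nb y"
      show "of_bool (\<not> leads F w y) * f (F(y \<mapsto> w)) \<le> f F"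
        using assms(3)[of F] assms(4)[OF F, of w] forests_insert_step[OF F w _ assms(2)]
        by (cases "leads F w y") auto
    qed
    then show "0 * f F + (\<Sum>w\<in>nb y. of_bool (\<not> leads F w y) * f (F(y \<mapsto> w))) \<le> dg * f F"
      by (simp only: mult_zero_left add_0 sum_constant card_nb)
  qed (use assms ratio_nonneg[of V 0 "{y}"] in auto)
  also have "\<dots> = ratio 0 V {y} * (dg * ex 0 (V - {y}) f)" by (simp only: ex_cmult)
  also have "\<dots> \<le> 1 / gap * (dg * ex 0 (V - {y}) f)"
    using assms by (intro mult_right_mono ratio_le mult_nonneg_nonneg ex_nonneg) auto
  finally show ?thesis by simp
qed

end

text \<open>\<open>psi\<close> is a supersolution for the walk killed at rate
  \<open>\<kappa> / 2\<close> and grows exponentially on the diffusive length scale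
  \<open>1 / sqrt \<kappa>\<close>. Half of the killing rate is kept as slack.\<close>

locale transient_metric = transient_ray nb dg g \<phi> gap \<Phi> ray
  for nb :: "'a \<Rightarrow> 'a set" and dg g \<phi> gap \<Phi> ray +
  fixes dst :: "'a \<Rightarrow> 'a \<Rightarrow> real" and psi :: "real \<Rightarrow> 'a \<Rightarrow> 'a \<Rightarrow> real" and c\<psi> C\<psi> :: real
  assumes dst_triangle: "dst x z \<le> dst x y + dst y z"
    and dst_nb: "y \<in> nb x \<Longrightarrow> dst x y \<le> 1"
    and dst_refl: "dst x x = 0"
    and c\<psi>: "c\<psi> > 0" and C\<psi>: "C\<psi> > 0"
    and psi_super: "0 < \<kappa> \<Longrightarrow> \<kappa> \<le> 1 \<Longrightarrow> (\<Sum>w\<in>nb x. psi \<kappa> u w) \<le> (dg + \<kappa> / 2) * psi \<kappa> u x"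
    and psi_root: "0 < \<kappa> \<Longrightarrow> \<kappa> \<le> 1 \<Longrightarrow> psi \<kappa> u u \<le> C\<psi>"
    and psi_ge: "0 < \<kappa> \<Longrightarrow> \<kappa> \<le> 1 \<Longrightarrow> exp (c\<psi> * sqrt \<kappa> * dst x u) \<le> psi \<kappa> u x"
begin

lemma dst_chain: "chain F xs u \<Longrightarrow> F \<in> forests V \<Longrightarrow> dst (hd (xs @ [u])) u \<le> length xs"
proof (induction xs)
  case (Cons x xs)
  have "hd (xs @ [u]) \<in> nb x" using Cons.prems forestsD(2)[OF Cons.prems(2)] by auto
  then have "dst x u \<le> 1 + dst (hd (xs @ [u])) u" using dst_triangle[of x u "hd (xs @ [u])"] dst_nb[of "hd (xs @ [u])" x] by linarith
  then show ?case using Cons by simp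
qed (simp add: dst_refl)

text \<open>With killing at rate \<open>1 / n\<close>, the slack in \<open>psi_super\<close> bounds
  the sum of \<open>hit\<close> times \<open>psi\<close> by order \<open>n\<close>; at distance
  \<open>r\<close> the weight \<open>psi\<close> is at least
  \<open>exp (c\<psi> * r / sqrt n)\<close>, and Markov's inequality gives the tail.\<close>

lemma far_paths_bound:
  obtains C c :: real where "C > 0" "c > 0"
    "\<And>n V u r. n \<ge> 1 \<Longrightarrow> finite V \<Longrightarrow> u \<notin> V \<Longrightarrow>
      (\<Sum>xs\<in>shortp V u n. ratio 0 V (set xs) * of_bool (r \<le> dst (hd xs) u)) \<le> C * n * exp (- c * r / sqrt n)"
proof -
  define C where "C = exp C1 * (2 * (real dg + 1) * C\<psi>)"
  have C: "C > 0" using C\<psi> by (simp add: C_def)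
  have main: "(\<Sum>xs\<in>shortp V u n. ratio 0 V (set xs) * of_bool (r \<le> dst (hd xs) u)) \<le> C * n * exp (- c\<psi> * r / sqrt n)"
    if n: "n \<ge> 1" and V: "finite V" and u: "u \<notin> V" for n V u r
  proof -
    define \<kappa> where "\<kappa> = 1 / real n"
    have \<kappa>: "\<kappa> > 0" "\<kappa> \<le> 1" "\<kappa> \<ge> 0" using n by (auto simp: \<kappa>_def)
    have p0: "0 \<le> psi \<kappa> u x" for x using psi_ge[OF \<kappa>(1,2), of x u] exp_gt_zero less_imp_le order_trans by meson
    let ?e = "exp (- c\<psi> * r / sqrt n)"
    have "C1 * \<kappa> * n = C1" using n by (simp add: \<kappa>_def)
    moreover have "(\<Sum>xs\<in>shortp V u n. ratio 0 V (set xs) * of_bool (r \<le> dst (hd xs) u)) \<le>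
        exp (C1 * \<kappa> * n) * (\<Sum>xs\<in>shortp V u n. ratio \<kappa> V (set xs) * of_bool (r \<le> dst (hd xs) u))"
      by (rule massive_sum[OF V, of _ _ u]) (use \<kappa> in \<open>auto simp: shortp_def\<close>)
    ultimately have a1: "(\<Sum>xs\<in>shortp V u n. ratio 0 V (set xs) * of_bool (r \<le> dst (hd xs) u)) \<le>
        exp C1 * (\<Sum>xs\<in>shortp V u n. ratio \<kappa> V (set xs) * of_bool (r \<le> dst (hd xs) u))"
      by (simp only:)
    have "(\<Sum>xs\<in>shortp V u n. ratio \<kappa> V (set xs) * of_bool (r \<le> dst (hd xs) u)) \<le>
        (\<Sum>xs\<in>paths V u - {[]}. ratio \<kappa> V (set xs) * of_bool (r \<le> dst (hd xs) u))"
      using V \<kappa> ratio_nonneg[OF V, of \<kappa>] by (intro sum_mono2) (auto simp: shortp_def less_imp_le)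
    also have "\<dots> = (\<Sum>x\<in>V. of_bool (r \<le> dst x u) * hit \<kappa> V u x)"
      using \<kappa> by (intro sum_paths_hd[OF V _ u]) auto
    also have "\<dots> \<le> (\<Sum>x\<in>V. ?e * (hit \<kappa> V u x * psi \<kappa> u x))"
    proof (rule sum_mono)
      fix x
      have h0: "0 \<le> hit \<kappa> V u x" using V \<kappa> by (intro hit_nonneg) auto
      show "of_bool (r \<le> dst x u) * hit \<kappa> V u x \<le> ?e * (hit \<kappa> V u x * psi \<kappa> u x)"
      proof (cases "r \<le> dst x u")
        case True
        have "sqrt \<kappa> = 1 / sqrt n" by (simp add: \<kappa>_def real_sqrt_divide)
        then have "c\<psi> * r / sqrt n \<le> c\<psi> * sqrt \<kappa> * dst x u"
          using True c\<psi> by (simp add: divide_right_mono)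
        then have "1 \<le> ?e * exp (c\<psi> * sqrt \<kappa> * dst x u)"
          unfolding exp_add[symmetric] by simp
        also have "\<dots> \<le> ?e * psi \<kappa> u x" using psi_ge[OF \<kappa>(1,2)] by (intro mult_left_mono) auto
        finally have "hit \<kappa> V u x * 1 \<le> hit \<kappa> V u x * (?e * psi \<kappa> u x)" using h0 by (intro mult_left_mono)
        then show ?thesis using True by (simp add: mult.left_commute)
      next
        case False
        then show ?thesis using h0 p0 by simp
      qed
    qed
    also have "\<dots> = ?e * (\<Sum>x\<in>V. hit \<kappa> V u x * psi \<kappa> u x)" by (simp only: sum_distrib_left)
    also have "\<dots> \<le> ?e * (2 * (real dg + 1) * C\<psi> * n)"
    proof (rule mult_left_mono)
      have "\<kappa> / 2 * (\<Sum>x\<in>insert u V. hit \<kappa> V u x * psi \<kappa> u x) \<le>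
          (\<Sum>x\<in>insert u V. hit \<kappa> V u x * ((dg + \<kappa>) * psi \<kappa> u x - (\<Sum>y\<in>nb x. psi \<kappa> u y)))"
        unfolding sum_distrib_left
      proof (rule sum_mono)
        fix x
        have h0: "0 \<le> hit \<kappa> V u x" using V \<kappa> by (intro hit_nonneg) auto
        have "\<kappa> / 2 * psi \<kappa> u x \<le> (dg + \<kappa>) * psi \<kappa> u x - (\<Sum>y\<in>nb x. psi \<kappa> u y)"
          using psi_super[OF \<kappa>(1,2), of u x] by (simp add: algebra_simps)
        then have "hit \<kappa> V u x * (\<kappa> / 2 * psi \<kappa> u x) \<le> hit \<kappa> V u x * ((dg + \<kappa>) * psi \<kappa> u x - (\<Sum>y\<in>nb x. psi \<kappa> u y))"
          using h0 by (rule mult_left_mono)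
        then show "\<kappa> / 2 * (hit \<kappa> V u x * psi \<kappa> u x) \<le> hit \<kappa> V u x * ((dg + \<kappa>) * psi \<kappa> u x - (\<Sum>y\<in>nb x. psi \<kappa> u y))"
          by (simp only: mult.left_commute)
      qed
      also have "\<dots> \<le> (dg + \<kappa>) * psi \<kappa> u u" by (rule green_parts[OF V \<kappa>(3) u p0])
      also have "\<dots> \<le> (real dg + 1) * C\<psi>"
        using \<kappa> psi_root[OF \<kappa>(1,2), of u] p0 by (intro mult_mono) auto
      finally have "\<kappa> / 2 * (\<Sum>x\<in>insert u V. hit \<kappa> V u x * psi \<kappa> u x) \<le> (real dg + 1) * C\<psi>" .
      moreover have "S \<le> 2 * K * n" if "\<kappa> / 2 * S \<le> K" for S K :: real
      proof -
        have "2 * real n * (\<kappa> / 2 * S) \<le> 2 * real n * K" using that by (intro mult_left_mono) auto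
        moreover have "2 * real n * (\<kappa> / 2 * S) = S" using n by (simp add: \<kappa>_def)
        moreover have "2 * real n * K = 2 * K * real n" by simp
        ultimately show ?thesis by linarith
      qed
      ultimately have m1: "(\<Sum>x\<in>insert u V. hit \<kappa> V u x * psi \<kappa> u x) \<le> 2 * ((real dg + 1) * C\<psi>) * n" by blast
      have m2: "(\<Sum>x\<in>V. hit \<kappa> V u x * psi \<kappa> u x) \<le> (\<Sum>x\<in>insert u V. hit \<kappa> V u x * psi \<kappa> u x)"
        using V \<kappa> p0 by (intro sum_mono2) (auto intro!: mult_nonneg_nonneg hit_nonneg)
      show "(\<Sum>x\<in>V. hit \<kappa> V u x * psi \<kappa> u x) \<le> 2 * (real dg + 1) * C\<psi> * n"
        using order.trans[OF m2 m1] by (simp only: mult.assoc)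
    qed simp
    finally have a2: "(\<Sum>xs\<in>shortp V u n. ratio \<kappa> V (set xs) * of_bool (r \<le> dst (hd xs) u)) \<le>
        ?e * (2 * (real dg + 1) * C\<psi> * n)" .
    have "(\<Sum>xs\<in>shortp V u n. ratio 0 V (set xs) * of_bool (r \<le> dst (hd xs) u)) \<le>
        exp C1 * (?e * (2 * (real dg + 1) * C\<psi> * n))"
      by (rule order.trans[OF a1 mult_left_mono[OF a2]]) simp
    also have "\<dots> = C * n * ?e" by (simp add: C_def)
    finally show ?thesis .
  qed
  show ?thesis by (rule that[OF C c\<psi> main])
qed

end

section \<open>Recursion over scales for the extrinsic radius\<close>

definition far :: "('a \<Rightarrow> 'a \<Rightarrow> real) \<Rightarrow> ('a \<Rightarrow> 'a option) \<Rightarrow> 'a \<Rightarrow> nat \<Rightarrow> real \<Rightarrow> bool" where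
  "far d F u n R \<longleftrightarrow> (\<exists>xs. chain F xs u \<and> xs \<noteq> [] \<and> length xs \<le> n \<and> R \<le> d (hd xs) u)"

context transient_metric
begin

definition PF :: "'a set \<Rightarrow> 'a \<Rightarrow> nat \<Rightarrow> real \<Rightarrow> real" where
  "PF V u n R = ex 0 V (\<lambda>F. of_bool (far dst F u n R))"

text \<open>A path to distance \<open>R\<close> either has at most \<open>n - k\<close> steps, or its last \<open>m\<close> vertices
  (\<open>k \<le> m < 2 * k\<close>) already travel \<open>\<eta> * R\<close> and the remaining ones certify a tall past,
  or the remaining ones, of which there are at most \<open>n - k\<close>, travel \<open>(1 - \<eta>) * R\<close>.\<close>

lemma PF_recursion:
  assumes V: "finite V" and u: "u \<notin> V" and k: "k \<ge> 1" and nk: "4 * k \<le> n"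
    and \<eta>: "0 \<le> \<eta>" "\<eta> \<le> 1" and R: "0 \<le> R"
    and q: "\<And>V u. finite V \<Longrightarrow> u \<notin> V \<Longrightarrow> PH V u k \<le> q" and q0: "0 \<le> q"
    and f: "\<And>V u. finite V \<Longrightarrow> u \<notin> V \<Longrightarrow> PF V u (n - k) ((1 - \<eta>) * R) \<le> f" and f0: "0 \<le> f"
  shows "PF V u n R \<le> f + 1 / k * (q * (\<Sum>xs\<in>shortp V u (2 * k). ratio 0 V (set xs) * of_bool (\<eta> * R \<le> dst (hd xs) u))
      + f * (\<Sum>xs\<in>shortp V u (2 * k). ratio 0 V (set xs)))"
proof -
  let ?R = "(1 - \<eta>) * R"
  let ?A = "\<lambda>F xs. of_bool (\<exists>ys. length ys = k \<and> chain F ys (hd xs) \<and> set ys \<inter> set xs = {}) :: real"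
  let ?B = "\<lambda>F xs. of_bool (\<exists>ys. chain F ys (hd xs) \<and> ys \<noteq> [] \<and> length ys \<le> n - k \<and>
      ?R \<le> dst (hd ys) (hd xs) \<and> set ys \<inter> set xs = {}) :: real"
  let ?h = "\<lambda>xs. of_bool (\<eta> * R \<le> dst (hd xs) u) :: real"
  let ?I = "\<lambda>F xs. of_bool (chain F xs u) * (?h xs * ?A F xs + ?B F xs)"
  have RR: "?R \<le> R" using \<eta> R by (simp add: mult_left_le_one_le)
  have "k * PF V u n R = ex 0 V (\<lambda>F. real k * of_bool (far dst F u n R))" by (simp only: PF_def ex_cmult)
  also have "\<dots> \<le> ex 0 V (\<lambda>F. real k * of_bool (far dst F u (n - k) ?R) + (\<Sum>xs\<in>mid V u k. ?I F xs))"
  proof (rule ex_mono[OF V])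
    fix F assume F: "F \<in> forests V"
    have I0: "0 \<le> ?I F xs" for xs by simp
    show "real k * of_bool (far dst F u n R) \<le> real k * of_bool (far dst F u (n - k) ?R) + (\<Sum>xs\<in>mid V u k. ?I F xs)"
    proof (cases "far dst F u n R \<and> \<not> far dst F u (n - k) ?R")
      case False
      then have "real k * of_bool (far dst F u n R) \<le> k * (of_bool (far dst F u (n - k) ?R) :: real)"
        by (intro mult_left_mono) auto
      moreover have "0 \<le> (\<Sum>xs\<in>mid V u k. ?I F xs)" by (intro sum_nonneg I0)
      ultimately show ?thesis by linarith
    next
      case True
      then obtain zs where zs: "chain F zs u" "zs \<noteq> []" "length zs \<le> n" "R \<le> dst (hd zs) u"
        by (auto simp: far_def)
      have "\<not> length zs \<le> n - k"
      proof
        assume "length zs \<le> n - k"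
        then have "far dst F u (n - k) ?R" using zs RR by (auto simp: far_def)
        then show False using True by simp
      qed
      then have lz: "n - k < length zs" by simp
      let ?L = "length zs"
      let ?d = "\<lambda>m. drop (?L - m) zs"
      have dist: "distinct zs" using chain_distinct[OF forestsD(3)[OF F] zs(1)] by simp
      have len: "length (?d m) = m" if "m < 2 * k" for m using lz nk that by simp
      have inj: "inj_on ?d {k..<2 * k}" by (rule inj_onI) (metis atLeastLessThan_iff len)
      have one: "1 \<le> ?I F (?d m)" if m: "m \<in> {k..<2 * k}" for m
      proof -
        let ?ys = "take (?L - m) zs"
        \<comment> \<open>More than \<open>k\<close> vertices remain above every suffix in the
          window, enough to certify a past of height \<open>k\<close>.\<close>
        have "3 * k \<le> n - k" using nk by linarith
        moreover have "m < 2 * k" using m by simp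
        ultimately have mL: "m + k < ?L" using lz by linarith
        have ne: "?d m \<noteq> []" "?ys \<noteq> []" using mL m k zs(2) by auto
        have c1: "chain F (?d m) u" using zs(1) by (rule chain_drop)
        have c2: "chain F ?ys (hd (?d m))"
          using zs(1) chain_append[of F ?ys "?d m" u] ne by (simp add: hd_append)
        have disj: "set ?ys \<inter> set (?d m) = {}" by (rule set_take_disj_set_drop_if_distinct[OF dist order_refl])
        have hdz: "hd ?ys = hd zs" using ne zs(2) by (cases zs; cases "?L - m") auto
        show ?thesis
        proof (cases "\<eta> * R \<le> dst (hd (?d m)) u")
          case True
          have "chain F (drop (?L - m - k) ?ys) (hd (?d m))" using c2 by (rule chain_drop)
          moreover have "length (drop (?L - m - k) ?ys) = k" using mL by simp
          moreover have "set (drop (?L - m - k) ?ys) \<inter> set (?d m) = {}"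
            using disj set_drop_subset[of "?L - m - k" ?ys] by blast
          ultimately have "?A F (?d m) = 1" by (simp only: of_bool_eq_1_iff) blast
          then show ?thesis using True c1 by simp
        next
          case False
          have dR: "?R \<le> dst (hd ?ys) (hd (?d m))"
            using False zs(4) dst_triangle[of "hd zs" u "hd (?d m)"] by (simp add: hdz algebra_simps)
          have "k \<le> m" using m by simp
          then have "?L - m \<le> n - k" using zs(3) by arith
          then have "length ?ys \<le> n - k" by simp
          then have "?B F (?d m) = 1" using dR c2 ne(2) disj by (simp only: of_bool_eq_1_iff) blast
          then show ?thesis using c1 by simp
        qed
      qed
      have "real k = (\<Sum>m\<in>{k..<2 * k}. 1)" by simp
      also have "\<dots> \<le> (\<Sum>m\<in>{k..<2 * k}. ?I F (?d m))" by (intro sum_mono one)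
      also have "\<dots> = (\<Sum>xs\<in>?d ` {k..<2 * k}. ?I F xs)" by (subst sum.reindex[OF inj]) (simp only: comp_def)
      also have "\<dots> \<le> (\<Sum>xs\<in>mid V u k. ?I F xs)"
      proof (rule sum_mono2[OF finite_mid[OF V]])
        show "?d ` {k..<2 * k} \<subseteq> mid V u k"
          using chain_in_paths[OF F chain_drop[OF zs(1)]] len by (auto simp: mid_def)
      qed (rule I0)
      finally show ?thesis using True by simp
    qed
  qed simp
  also have "\<dots> = k * PF V u (n - k) ?R + (\<Sum>xs\<in>mid V u k. ex 0 V (\<lambda>F. ?I F xs))"
    by (simp only: ex_add ex_cmult ex_sum PF_def)
  also have "\<dots> \<le> k * f + (\<Sum>xs\<in>mid V u k. ratio 0 V (set xs) * (?h xs * q + f))"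
  proof (intro add_mono sum_mono mult_left_mono f V u)
    fix xs assume "xs \<in> mid V u k"
    then have xs: "xs \<in> paths V u" "set xs \<subseteq> V" "xs \<noteq> []" using k by (auto simp: mid_def paths_def)
    have hx: "hd xs \<notin> V - set xs" using xs by simp
    have "ex 0 V (\<lambda>F. ?I F xs) = ratio 0 V (set xs) * ex 0 (V - set xs) (\<lambda>F. ?h xs * ?A (ext F xs u) xs + ?B (ext F xs u) xs)"
      using V u xs by (intro ex_chain) auto
    also have "\<dots> \<le> ratio 0 V (set xs) * (?h xs * PH (V - set xs) (hd xs) k + PF (V - set xs) (hd xs) (n - k) ?R)"
      unfolding PH_def PF_def ex_cmult[symmetric] ex_add[symmetric]
    proof (intro mult_left_mono ex_mono add_mono)
      fix F
      have ch: "chain F ys (hd xs)" if "chain (ext F xs u) ys (hd xs)" "set ys \<inter> set xs = {}" for ys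
        by (rule chain_cong[OF that(1)]) (use that(2) in \<open>metis disjoint_iff ext_notin\<close>)
      show "?A (ext F xs u) xs \<le> of_bool (hgt F (hd xs) k)"
        using ch by (auto simp: hgt_def)
      show "?B (ext F xs u) xs \<le> of_bool (far dst F (hd xs) (n - k) ?R)"
        using ch by (auto simp: far_def)
    qed (use V ratio_nonneg[OF V, of 0 "set xs"] in auto)
    also have "\<dots> \<le> ratio 0 V (set xs) * (?h xs * q + f)"
      using V hx ratio_nonneg[OF V, of 0 "set xs"] by (intro mult_left_mono add_mono q f) auto
    finally show "ex 0 V (\<lambda>F. ?I F xs) \<le> ratio 0 V (set xs) * (?h xs * q + f)" .
  qed simp
  also have "(\<Sum>xs\<in>mid V u k. ratio 0 V (set xs) * (?h xs * q + f)) \<le>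
      (\<Sum>xs\<in>shortp V u (2 * k). ratio 0 V (set xs) * (?h xs * q + f))"
    using k q0 f0 ratio_nonneg[OF V, of 0]
    by (intro sum_mono2 finite_shortp V mult_nonneg_nonneg) (auto simp: mid_def shortp_def less_imp_le)
  also have "\<dots> = q * (\<Sum>xs\<in>shortp V u (2 * k). ratio 0 V (set xs) * ?h xs) + f * (\<Sum>xs\<in>shortp V u (2 * k). ratio 0 V (set xs))"
    by (simp add: sum_distrib_left sum.distrib algebra_simps)
  finally have "k * PF V u n R \<le> k * f + (q * (\<Sum>xs\<in>shortp V u (2 * k). ratio 0 V (set xs) * ?h xs) + f * (\<Sum>xs\<in>shortp V u (2 * k). ratio 0 V (set xs)))"
    by simp
  moreover have "a \<le> f + 1 / k * c" if "k * a \<le> k * f + c" for a c :: real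
    using that k by (simp add: field_simps)
  ultimately show ?thesis by blast
qed

text \<open>The induction carries the stronger bound \<open>B / n * exp (- b * R / sqrt n)\<close>.
  Removing \<open>n div 8\<close> generations shrinks \<open>sqrt n\<close> at least by the factor
  \<open>31 / 32\<close>, while the radius shrinks only by \<open>63 / 64\<close>. So
  \<open>R / sqrt n\<close> grows by \<open>63 / 62\<close>, and the gain in the exponential beats
  the factor \<open>2 * K2\<close> of the recursion once \<open>R\<close> is a large multiple of
  \<open>sqrt n\<close>.\<close>

lemma far_bound:
  obtains B lam :: real where "B > 0" "lam > 0"
    "\<And>n V u R. n \<ge> 1 \<Longrightarrow> finite V \<Longrightarrow> u \<notin> V \<Longrightarrow> lam * sqrt n \<le> R \<Longrightarrow> PF V u n R \<le> B / n"
proof -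
  obtain Q :: real where Q: "Q > 0" "\<And>n V u. n \<ge> 1 \<Longrightarrow> finite V \<Longrightarrow> u \<notin> V \<Longrightarrow> PH V u n \<le> Q / n"
    by (rule intrinsic_bound) (rule that)
  obtain A :: real where A: "A > 0"
    "\<And>n V u. n \<ge> 1 \<Longrightarrow> finite V \<Longrightarrow> u \<notin> V \<Longrightarrow> (\<Sum>xs\<in>shortp V u n. ratio 0 V (set xs)) \<le> A * n"
    by (rule shortp_count) (rule that)
  obtain C c :: real where C: "C > 0" "c > 0"
    "\<And>n V u r. n \<ge> 1 \<Longrightarrow> finite V \<Longrightarrow> u \<notin> V \<Longrightarrow>
      (\<Sum>xs\<in>shortp V u n. ratio 0 V (set xs) * of_bool (r \<le> dst (hd xs) u)) \<le> C * n * exp (- c * r / sqrt n)"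
    by (rule far_paths_bound) (rule that)
  \<comment> \<open>The initial share of the radius is \<open>1 / 64\<close>, so this is the rate
    that the displacement bound passes on.\<close>
  define b where "b = c / 64"
  define K1 where "K1 = 32 * Q * C"
  define K2 where "K2 = 1 + 2 * A"
  define B where "B = 2 * K1"
  \<comment> \<open>The logarithm makes the exponential gain at most \<open>1 / (4 * K2)\<close>;
    the 9 puts \<open>R\<close> out of reach of fewer than 8 steps, which starts the
    induction.\<close>
  define lam where "lam = 9 + 62 / b * ln (4 * K2)"
  have b: "b > 0" and K1: "K1 > 0" and K2: "K2 \<ge> 1" and B: "B > 0"
    using Q(1) C(1,2) A(1) by (auto simp: b_def K1_def K2_def B_def)
  have lam: "lam \<ge> 9" using K2 b by (simp add: lam_def)
  have main: "PF V u n R \<le> B / n * exp (- b * R / sqrt n)"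
    if "n \<ge> 1" "finite V" "u \<notin> V" "lam * sqrt n \<le> R" for n V u R
    using that
  proof (induction n arbitrary: V u R rule: less_induct)
    case (less n)
    note n = \<open>n \<ge> 1\<close> and V = \<open>finite V\<close> and u = \<open>u \<notin> V\<close> and R = \<open>lam * sqrt n \<le> R\<close>
    have sn: "sqrt n \<ge> 1" using n by simp
    have R9: "9 * sqrt n \<le> R" using mult_right_mono[OF lam, of "sqrt n"] R by simp
    show ?case
    proof (cases "n < 8")
      case True
      have "PF V u n R = ex 0 V (\<lambda>_. 0)" unfolding PF_def
      proof (rule ex_cong)
        fix F assume F: "F \<in> forests V"
        have "\<not> far dst F u n R"
        proof
          assume "far dst F u n R"
          then obtain xs where xs: "chain F xs u" "xs \<noteq> []" "length xs \<le> n" "R \<le> dst (hd xs) u" by (auto simp: far_def)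
          have "dst (hd xs) u \<le> length xs" using dst_chain[OF xs(1) F] xs(2) by simp
          then have "R \<le> n" using xs by simp
          moreover have "real n < 8" using True by simp
          ultimately show False using R9 sn by linarith
        qed
        then show "of_bool (far dst F u n R) = (0::real)" by simp
      qed
      also have "\<dots> = 0" by (simp add: ex_def wsum_def)
      also have "0 \<le> B / n * exp (- b * R / sqrt n)" using B by simp
      finally show ?thesis .
    next
      case False
      define k where "k = n div 8"
      have "n = 8 * k + n mod 8" "n mod 8 < 8" unfolding k_def by simp_all
      moreover from this have k1: "k \<ge> 1" using False by (cases "k = 0") auto
      ultimately have k: "k \<ge> 1" "4 * k \<le> n" "n < 16 * k" "2 * k \<le> n" by linarith+
      have kr: "real n \<le> 16 * real k" using k(3) by linarith
      define n' where "n' = n - k"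
      have n': "n' < n" "n' \<ge> 1" "n \<le> 2 * n'" using k by (auto simp: n'_def)
      have n'r: "real n' \<le> 15 / 16 * real n" using kr k by (simp add: n'_def of_nat_diff)
      have s': "sqrt n' \<le> 31 / 32 * sqrt n"
      proof -
        have "sqrt n' \<le> sqrt ((31 / 32)\<^sup>2 * real n)" using n'r by (simp add: power2_eq_square)
        then show ?thesis by (simp add: real_sqrt_mult)
      qed
      have sn': "sqrt n' \<ge> 1" using n'(2) by simp
      let ?\<eta> = "1 / 64 :: real"
      let ?R = "(1 - ?\<eta>) * R"
      let ?E = "exp (- b * R / sqrt n)"
      let ?f = "2 * B / n * exp (- b * (63 / 62) * R / sqrt n)"
      have R0: "0 \<le> R" using R9 sn by linarith
      have ratR: "63 / 62 * R / sqrt n \<le> ?R / sqrt n'"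
      proof -
        have "63 / 62 * R / sqrt n = ?R / (31 / 32 * sqrt n)" by simp
        also have "\<dots> \<le> ?R / sqrt n'"
        proof (rule divide_left_mono[OF s'])
          have "0 < sqrt n" "0 < sqrt n'" using sn sn' by linarith+
          then show "0 < 31 / 32 * sqrt n * sqrt n'" by simp
        qed (use R0 in simp)
        finally show ?thesis .
      qed
      have f: "PF V u (n - k) ?R \<le> ?f" if "finite V" "u \<notin> V" for V u
      proof -
        have "lam * sqrt n' \<le> lam * (31 / 32 * sqrt n)" using s' lam by (intro mult_left_mono) auto
        also have "\<dots> \<le> ?R" using R lam R0 by simp
        finally have "PF V u n' ?R \<le> B / n' * exp (- b * ?R / sqrt n')"
          using n' that by (intro less.IH) auto
        also have "\<dots> \<le> (2 * B / n) * exp (- b * (63 / 62) * R / sqrt n)"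
        proof (rule mult_mono)
          have "real n \<le> 2 * real n'" using n'(3) by simp
          then show "B / n' \<le> 2 * B / n" using B n n'(2) by (simp add: field_simps)
          have "b * (63 / 62 * R / sqrt n) \<le> b * (?R / sqrt n')" using ratR b by (intro mult_left_mono) auto
          then show "exp (- b * ?R / sqrt n') \<le> exp (- b * (63 / 62) * R / sqrt n)" by simp
        qed (use B in auto)
        finally show ?thesis by (simp only: n'_def)
      qed
      have f0: "0 \<le> ?f" using B by simp
      have s2k: "sqrt (2 * k) \<le> sqrt n" using k(4) by simp
      have "PF V u n R \<le> ?f + 1 / k * (Q / k * (\<Sum>xs\<in>shortp V u (2 * k). ratio 0 V (set xs) * of_bool (?\<eta> * R \<le> dst (hd xs) u))
          + ?f * (\<Sum>xs\<in>shortp V u (2 * k). ratio 0 V (set xs)))"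
        using Q(1) by (intro PF_recursion[OF V u k(1,2) _ _ R0 Q(2)[OF k(1)] _ f f0]) auto
      also have "\<dots> \<le> ?f + 1 / k * (Q / k * (C * real (2 * k) * ?E) + ?f * (A * real (2 * k)))"
      proof (intro add_mono mult_left_mono order_refl)
        have "(\<Sum>xs\<in>shortp V u (2 * k). ratio 0 V (set xs) * of_bool (?\<eta> * R \<le> dst (hd xs) u)) \<le>
            C * real (2 * k) * exp (- c * (?\<eta> * R) / sqrt (2 * k))"
          using k by (intro C(3) V u) auto
        also have "\<dots> \<le> C * real (2 * k) * ?E"
        proof -
          have "R / sqrt n \<le> R / sqrt (2 * k)" using s2k R0 k(1) by (intro divide_left_mono) auto
          then have "b * (R / sqrt n) \<le> b * (R / sqrt (2 * k))" using b by (intro mult_left_mono) auto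
          then have "exp (- c * (?\<eta> * R) / sqrt (2 * k)) \<le> ?E" by (simp add: b_def)
          then show ?thesis using C(1) by (intro mult_left_mono) auto
        qed
        finally show "(\<Sum>xs\<in>shortp V u (2 * k). ratio 0 V (set xs) * of_bool (?\<eta> * R \<le> dst (hd xs) u)) \<le>
            C * real (2 * k) * ?E" .
        show "(\<Sum>xs\<in>shortp V u (2 * k). ratio 0 V (set xs)) \<le> A * real (2 * k)"
          using k by (intro A(2) V u) auto
      qed (use Q(1) f0 B in auto)
      also have "\<dots> = 2 * Q * C / k * ?E + K2 * ?f"
      proof -
        have id: "f + 1 / m * (q / m * (a * (2 * m) * e) + f * (x * (2 * m))) = 2 * q * a / m * e + (1 + 2 * x) * f"
          if "m \<noteq> 0" for f m q a e x :: real
          using that by (simp add: field_simps)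
        show ?thesis unfolding of_nat_mult of_nat_numeral K2_def by (rule id) (use k(1) in simp)
      qed
      also have "\<dots> \<le> K1 / n * ?E + B / 2 / n * ?E"
      proof (rule add_mono)
        have "2 * Q * C / k \<le> K1 / n" using kr(1) n k(1) Q(1) C(1) by (simp add: K1_def field_simps)
        then show "2 * Q * C / k * ?E \<le> K1 / n * ?E" by (intro mult_right_mono) auto
        have "62 / b * ln (4 * K2) \<le> lam" by (simp add: lam_def)
        also have "lam \<le> R / sqrt n" using R sn by (simp add: field_simps)
        finally have "ln (4 * K2) \<le> b / 62 * (R / sqrt n)" using b by (simp add: field_simps)
        then have "exp (- (b / 62 * (R / sqrt n))) \<le> exp (- ln (4 * K2))" by simp
        also have "\<dots> = 1 / (4 * K2)" using K2 by (simp add: exp_minus inverse_eq_divide)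
        finally have e: "exp (- (b / 62 * (R / sqrt n))) \<le> 1 / (4 * K2)" .
        have "exp (- b * (63 / 62) * R / sqrt n) = exp (- (b / 62 * (R / sqrt n))) * ?E"
          unfolding exp_add[symmetric] by (simp add: field_simps)
        also have "\<dots> \<le> 1 / (4 * K2) * ?E" using e by (intro mult_right_mono) auto
        finally have "K2 * ?f \<le> K2 * (2 * B / n * (1 / (4 * K2) * ?E))"
          using B K2 by (intro mult_left_mono) auto
        also have "\<dots> = B / 2 / n * ?E" using K2 by (simp add: field_simps)
        finally show "K2 * ?f \<le> B / 2 / n * ?E" .
      qed
      also have "\<dots> = B / n * ?E" by (simp add: B_def field_simps)
      finally show ?thesis .
    qed
  qed
  have main': "PF V u n R \<le> B / n" if "n \<ge> 1" "finite V" "u \<notin> V" "lam * sqrt n \<le> R" for n V u R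
  proof -
    have "0 \<le> lam * sqrt n" using lam by simp
    then have "0 \<le> b * R / sqrt n" using that(4) b by simp
    then have "B / n * exp (- b * R / sqrt n) \<le> B / n * 1" using B by (intro mult_left_mono) auto
    then show ?thesis using main[OF that] by simp
  qed
  have "lam > 0" using lam by simp
  then show ?thesis by (rule that[OF B _ main'])
qed

definition reach :: "('a \<Rightarrow> 'a option) \<Rightarrow> 'a \<Rightarrow> real \<Rightarrow> bool" where
  "reach F u R \<longleftrightarrow> (\<exists>xs. chain F xs u \<and> xs \<noteq> [] \<and> R \<le> dst (hd xs) u)"

text \<open>Take \<open>n\<close> of order \<open>R\<close> squared. A past that reaches distance
  \<open>R\<close> has height at least \<open>n\<close> or gets there within \<open>n\<close> steps,
  and both events have probability of order \<open>1 / n\<close>.\<close>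

theorem extrinsic_bound:
  obtains C :: real where "C > 0"
    "\<And>V u R. finite V \<Longrightarrow> u \<notin> V \<Longrightarrow> R > 0 \<Longrightarrow> ex 0 V (\<lambda>F. of_bool (reach F u R)) \<le> C / R\<^sup>2"
proof -
  obtain Q :: real where Q: "Q > 0" "\<And>n V u. n \<ge> 1 \<Longrightarrow> finite V \<Longrightarrow> u \<notin> V \<Longrightarrow> PH V u n \<le> Q / n"
    by (rule intrinsic_bound) (rule that)
  obtain B lam :: real where B: "B > 0" "lam > 0"
    "\<And>n V u R. n \<ge> 1 \<Longrightarrow> finite V \<Longrightarrow> u \<notin> V \<Longrightarrow> lam * sqrt n \<le> R \<Longrightarrow> PF V u n R \<le> B / n"
    by (rule far_bound) (rule that)
  define C where "C = 2 * (Q + B + 1) * lam\<^sup>2"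
  have C: "C > 0" using Q B by (simp add: C_def)
  have main: "ex 0 V (\<lambda>F. of_bool (reach F u R)) \<le> C / R\<^sup>2" if V: "finite V" and u: "u \<notin> V" and R: "R > 0" for V u R
  proof (cases "R < lam")
    case True
    have "ex 0 V (\<lambda>F. of_bool (reach F u R)) \<le> 1" using V by (intro ex_le_1) auto
    also have "1 \<le> lam\<^sup>2 / R\<^sup>2" using True R by (simp add: power_mono)
    also have "\<dots> \<le> C / R\<^sup>2"
    proof (rule divide_right_mono)
      have "1 * lam\<^sup>2 \<le> 2 * (Q + B + 1) * lam\<^sup>2" using Q B by (intro mult_right_mono) auto
      then show "lam\<^sup>2 \<le> C" by (simp add: C_def)
    qed simp
    finally show ?thesis .
  next
    case False
    define n where "n = nat \<lfloor>(R / lam)\<^sup>2\<rfloor>"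
    have "1 \<le> R / lam" using False B by simp
    then have r1: "1 \<le> (R / lam)\<^sup>2" by simp
    then have n1: "n \<ge> 1" by (simp add: n_def le_nat_iff le_floor_iff)
    have n2: "real n \<le> (R / lam)\<^sup>2" unfolding n_def using r1 by simp
    have n3: "(R / lam)\<^sup>2 \<le> 2 * real n"
    proof -
      have "(R / lam)\<^sup>2 < real n + 1" unfolding n_def using r1 by simp
      then show ?thesis using n1 by simp
    qed
    have "sqrt n \<le> R / lam" using n2 R B(2) by (intro real_le_lsqrt) auto
    then have lamR: "lam * sqrt n \<le> R" using B(2) by (simp add: field_simps)
    have "ex 0 V (\<lambda>F. of_bool (reach F u R)) \<le> ex 0 V (\<lambda>F. of_bool (hgt F u n) + of_bool (far dst F u n R))"
    proof (rule ex_mono[OF V])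
      fix F
      have "hgt F u n \<or> far dst F u n R" if "reach F u R"
      proof -
        from that obtain xs where xs: "chain F xs u" "xs \<noteq> []" "R \<le> dst (hd xs) u" by (auto simp: reach_def)
        show ?thesis
        proof (cases "length xs \<le> n")
          case True
          then show ?thesis using xs by (auto simp: far_def)
        next
          case False
          then show ?thesis using xs hgt_mono[of F u "length xs" n] by (auto simp: hgt_def)
        qed
      qed
      then show "of_bool (reach F u R) \<le> (of_bool (hgt F u n) + of_bool (far dst F u n R) :: real)" by auto
    qed simp
    also have "\<dots> = PH V u n + PF V u n R" by (simp only: ex_add PH_def PF_def)
    also have "\<dots> \<le> Q / n + B / n" using Q(2)[OF n1 V u] B(3)[OF n1 V u lamR] by linarith
    also have "\<dots> = (Q + B) / n" by (simp add: add_divide_distrib)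
    also have "\<dots> \<le> 2 * (Q + B) / (R / lam)\<^sup>2"
    proof -
      have le: "(Q + B) * (R / lam)\<^sup>2 \<le> (Q + B) * (2 * real n)" using n3 Q B by (intro mult_left_mono) auto
      have id: "a / m \<le> 2 * a / X" if "a * X \<le> a * (2 * m)" "0 < m" "0 < X" for a m X :: real
        using that by (simp add: field_simps)
      show ?thesis by (rule id[OF le]) (use n1 r1 in \<open>auto simp del: power_divide\<close>)
    qed
    also have "\<dots> = 2 * (Q + B) * lam\<^sup>2 / R\<^sup>2" by (simp add: power_divide)
    also have "\<dots> \<le> C / R\<^sup>2"
    proof (rule divide_right_mono)
      show "2 * (Q + B) * lam\<^sup>2 \<le> C" unfolding C_def by (intro mult_right_mono) auto
    qed simp
    finally show ?thesis .
  qed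
  show ?thesis by (rule that[OF C main])
qed

end

section \<open>The hypercubic lattice\<close>

definition lnb :: "int ^ 'd \<Rightarrow> (int ^ 'd) set" where
  "lnb x = {y. (\<Sum>i\<in>UNIV. \<bar>x $ i - y $ i\<bar>) = 1}"

lemma lnb_eq: "lnb (x :: int ^ 'd) = (\<lambda>(i, s). x + axis i s) ` (UNIV \<times> {1, -1})"
proof (intro equalityI subsetI)
  fix y assume "y \<in> lnb x"
  then have sum1: "(\<Sum>i\<in>UNIV. \<bar>x $ i - y $ i\<bar>) = 1" by (simp add: lnb_def)
  have "\<exists>i. x $ i - y $ i \<noteq> 0"
  proof (rule ccontr)
    assume "\<not> ?thesis"
    then have "(\<Sum>i\<in>UNIV. \<bar>x $ i - y $ i\<bar>) = 0" by simp
    with sum1 show False by simp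
  qed
  then obtain i where i: "x $ i - y $ i \<noteq> 0" by blast
  have split: "\<bar>x $ i - y $ i\<bar> + (\<Sum>j\<in>UNIV - {i}. \<bar>x $ j - y $ j\<bar>) = 1"
    using sum1 by (subst (asm) sum.remove[of UNIV i]) auto
  have nn: "0 \<le> (\<Sum>j\<in>UNIV - {i}. \<bar>x $ j - y $ j\<bar>)" by (intro sum_nonneg) auto
  have a1: "\<bar>x $ i - y $ i\<bar> = 1" and a0: "(\<Sum>j\<in>UNIV - {i}. \<bar>x $ j - y $ j\<bar>) = 0"
    using split nn i by linarith+
  have z: "x $ j = y $ j" if "j \<noteq> i" for j
  proof -
    have "\<forall>j\<in>UNIV - {i}. \<bar>x $ j - y $ j\<bar> = 0"
      using a0 by (subst (asm) sum_nonneg_eq_0_iff) auto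
    then show ?thesis using that by auto
  qed
  have "y = x + axis i (y $ i - x $ i)"
    using z by (auto simp: vec_eq_iff axis_def)
  moreover have "y $ i - x $ i \<in> {1, -1}" using a1 by auto
  ultimately show "y \<in> (\<lambda>(i, s). x + axis i s) ` (UNIV \<times> {1, -1})" by (auto intro!: image_eqI[of _ _ "(i, y $ i - x $ i)"])
next
  fix y assume "y \<in> (\<lambda>(i, s). x + axis i s) ` (UNIV \<times> {1, -1})"
  then obtain i s where y: "y = x + axis i s" and s: "s = 1 \<or> s = -1" by auto
  have "(\<Sum>j\<in>UNIV. \<bar>x $ j - y $ j\<bar>) = (\<Sum>j\<in>UNIV. if j = i then 1 else 0)"
    using s by (intro sum.cong) (auto simp: y axis_def)
  then show "y \<in> lnb x" by (simp add: lnb_def)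
qed

lemma inj_lnb: "inj_on (\<lambda>(i, s). x + axis i s :: int ^ 'd) (UNIV \<times> {1, -1})"
  by (auto simp: inj_on_def axis_eq_axis)

lemma sum_lnb: "(\<Sum>w\<in>lnb x. f w) = (\<Sum>i\<in>UNIV. f (x + axis i 1) + f (x + axis i (-1)) :: real)"
proof -
  have "(\<Sum>w\<in>lnb x. f w) = (\<Sum>(i, s)\<in>UNIV \<times> {1, -1}. f (x + axis i s))"
    unfolding lnb_eq by (subst sum.reindex[OF inj_lnb]) (simp add: case_prod_beta comp_def)
  also have "\<dots> = (\<Sum>i\<in>UNIV. \<Sum>s\<in>{1, -1}. f (x + axis i s))" by (rule sum.cartesian_product[symmetric])
  finally show ?thesis by simp
qed

lemma finite_lnb: "finite (lnb x)"
  unfolding lnb_eq by simp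

lemma card_lnb: "card (lnb (x :: int ^ 'd)) = 2 * CARD('d)"
  unfolding lnb_eq by (subst card_image[OF inj_lnb]) (simp add: card_cartesian_product)

lemma lnb_sym: "y \<in> lnb x \<Longrightarrow> x \<in> lnb y"
  by (simp add: lnb_def abs_minus_commute)

text \<open>A finite set is left by a step upwards from a vertex where one fixed coordinate is
  maximal.\<close>

lemma regular_graph_lnb: "regular_graph (lnb :: int ^ 'd \<Rightarrow> _) (2 * CARD('d))"
proof
  fix S :: "(int ^ 'd) set" assume S: "finite S" "S \<noteq> {}"
  obtain i :: 'd where True by simp
  have "\<exists>y\<in>S. \<forall>z\<in>S. z $ i \<le> y $ i"
  proof -
    have fin: "finite ((\<lambda>z. z $ i) ` S)" "(\<lambda>z. z $ i) ` S \<noteq> {}" using S by auto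
    obtain y where "y \<in> S" "y $ i = Max ((\<lambda>z. z $ i) ` S)" using Max_in[OF fin] by auto
    moreover have "z $ i \<le> Max ((\<lambda>z. z $ i) ` S)" if "z \<in> S" for z
      using that by (intro Max_ge[OF fin(1)]) auto
    ultimately show ?thesis by metis
  qed
  then obtain y where y: "y \<in> S" "\<And>z. z \<in> S \<Longrightarrow> z $ i \<le> y $ i" by blast
  have "y + axis i 1 \<in> lnb y" unfolding lnb_eq by (intro image_eqI[of _ _ "(i, 1)"]) auto
  moreover have "y + axis i 1 \<notin> S" using y(2)[of "y + axis i 1"] by (auto simp: axis_def)
  ultimately show "\<exists>y\<in>S. \<exists>w\<in>lnb y. w \<notin> S" using y(1) by blast
qed (auto simp: finite_lnb card_lnb lnb_sym)

section \<open>Power potentials on the lattice\<close>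

definition nsq :: "int ^ 'd \<Rightarrow> real" where
  "nsq z = (\<Sum>i\<in>UNIV. (real_of_int (z $ i))\<^sup>2)"

definition pot :: "real \<Rightarrow> real \<Rightarrow> int ^ 'd \<Rightarrow> real" where
  "pot b A z = (nsq z + A) powr (- b)"

lemma nsq_nonneg: "0 \<le> nsq z"
  by (simp add: nsq_def sum_nonneg)

lemma nsq_add_axis: "nsq (z + axis i s) = nsq z + 2 * s * z $ i + s\<^sup>2"
proof -
  have "nsq (z + axis i s) = (\<Sum>j\<in>UNIV. (real_of_int (z $ j))\<^sup>2 + (if j = i then 2 * real_of_int s * real_of_int (z $ i) + (real_of_int s)\<^sup>2 else 0))"
    unfolding nsq_def by (intro sum.cong) (auto simp: axis_def power2_eq_square algebra_simps)
  then show ?thesis by (simp add: sum.distrib nsq_def)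
qed

lemma nsq_axis: "nsq (axis i s) = (real_of_int s)\<^sup>2"
  using nsq_add_axis[of 0 i s] by (simp add: nsq_def)

lemma nsq_minus: "nsq (x - y) = nsq (y - x)"
  by (simp add: nsq_def power2_commute)

text \<open>In the symmetric sum the odd terms cancel, so the remainder after the quadratic term is
  of fourth order; the range up to \<open>1 / 2\<close> keeps \<open>1 - u\<close> away from 0 and
  the fourth derivative bounded.\<close>

lemma powr_even_taylor:
  fixes b :: real
  assumes b: "b > 0"
  obtains K where "K > 0"
    "\<And>u. \<bar>u\<bar> \<le> 1 / 2 \<Longrightarrow> (1 + u) powr (- b) + (1 - u) powr (- b) \<le> 2 + b * (b + 1) * u\<^sup>2 + K * u ^ 4"
proof -
  define K where "K = pochhammer b 4 / 12 * (1 / 2) powr (- b - 4)"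
  have p: "pochhammer b m > 0" for m using b by (simp add: pochhammer_pos)
  have K: "K > 0" using p by (simp add: K_def)
  have pos: "(1 + u) powr (- b) + (1 - u) powr (- b) \<le> 2 + b * (b + 1) * u\<^sup>2 + K * u ^ 4"
    if u: "0 < u" "u \<le> 1 / 2" for u
  proof -
    \<comment> \<open>The derivatives of the symmetric sum. The sign alternates only for the summand
      in \<open>1 + t\<close>, since differentiating \<open>1 - t\<close> contributes another
      minus.\<close>
    define D where "D m t = pochhammer b m * ((- 1) ^ m * (1 + t) powr (- b - real m) + (1 - t) powr (- b - real m))"
      for m :: nat and t :: real
    let ?f = "\<lambda>u. (1 + u) powr (- b) + (1 - u) powr (- b)"
    have "\<exists>t>0. t < u \<and> ?f u = (\<Sum>m<4. D m 0 / fact m * u ^ m) + D 4 t / fact 4 * u ^ 4"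
    proof (rule Maclaurin[OF u(1)])
      show "D 0 = ?f" by (simp add: D_def fun_eq_iff)
      show "\<forall>(m::nat) t. m < 4 \<and> 0 \<le> t \<and> t \<le> u \<longrightarrow> DERIV (D m) t :> D (Suc m) t"
      proof (intro allI impI)
        fix m :: nat and t assume t: "m < 4 \<and> 0 \<le> t \<and> t \<le> u"
        then have t1: "1 + t > 0" "1 - t > 0" using u by auto
        have "DERIV (\<lambda>t. 1 + t) t :> 1" "DERIV (\<lambda>t. 1 - t) t :> - 1"
          by (auto intro!: derivative_eq_intros)
        from this[THEN DERIV_fun_powr] t1
        have d: "DERIV (\<lambda>t. (1 + t) powr (- b - real m)) t :> (- b - real m) * (1 + t) powr (- b - real m - 1)"
          "DERIV (\<lambda>t. (1 - t) powr (- b - real m)) t :> - ((- b - real m) * (1 - t) powr (- b - real m - 1))"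
          by fastforce+
        have "DERIV (\<lambda>t. pochhammer b m * ((- 1) ^ m * (1 + t) powr (- b - real m) + (1 - t) powr (- b - real m))) t
          :> pochhammer b m * ((- 1) ^ m * ((- b - real m) * (1 + t) powr (- b - real m - 1)) +
              - ((- b - real m) * (1 - t) powr (- b - real m - 1)))"
          by (intro DERIV_cmult DERIV_add d)
        also have "pochhammer b m * ((- 1) ^ m * ((- b - real m) * (1 + t) powr (- b - real m - 1)) +
              - ((- b - real m) * (1 - t) powr (- b - real m - 1))) = D (Suc m) t"
        proof -
          have "- b - real (Suc m) = - b - real m - 1" by simp
          then show ?thesis unfolding D_def by (simp add: pochhammer_Suc algebra_simps)
        qed
        finally show "DERIV (D m) t :> D (Suc m) t" unfolding D_def[abs_def] .
      qed
    qed simp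
    then obtain t where t: "0 < t" "t < u" "?f u = (\<Sum>m<4. D m 0 / fact m * u ^ m) + D 4 t / fact 4 * u ^ 4" by blast
    have "(\<Sum>m<4. D m 0 / fact m * u ^ m) = 2 + b * (b + 1) * u\<^sup>2"
      by (simp add: D_def eval_nat_numeral pochhammer_Suc algebra_simps)
    moreover have "D 4 t / fact 4 * u ^ 4 \<le> K * u ^ 4"
    proof (rule mult_right_mono)
      have "(1 + t) powr (- b - 4) \<le> (1 / 2) powr (- b - 4)" using t u b by (intro powr_mono2') auto
      moreover have "(1 - t) powr (- b - 4) \<le> (1 / 2) powr (- b - 4)" using t u b by (intro powr_mono2') auto
      ultimately have "pochhammer b 4 * ((1 + t) powr (- b - 4) + (1 - t) powr (- b - 4)) \<le>
          pochhammer b 4 * (2 * (1 / 2) powr (- b - 4))"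
        using p[of 4] by (intro mult_left_mono) auto
      then show "D 4 t / fact 4 \<le> K" by (simp add: D_def K_def fact_numeral)
    qed simp
    ultimately show ?thesis using t(3) by linarith
  qed
  have main: "(1 + u) powr (- b) + (1 - u) powr (- b) \<le> 2 + b * (b + 1) * u\<^sup>2 + K * u ^ 4"
    if "\<bar>u\<bar> \<le> 1 / 2" for u
  proof -
    consider "u = 0" | "u > 0" | "u < 0" by linarith
    then show ?thesis
    proof cases
      case 2
      then show ?thesis using pos[of u] that by simp
    next
      case 3
      then show ?thesis using pos[of "- u"] that by (simp add: add.commute)
    qed simp
  qed
  show ?thesis by (rule that[OF K main])
qed

text \<open>\<open>(\<bar>z\<bar>\<^sup>2 + A) powr (-b)\<close> is strictly superharmonic in the continuum for \<open>2 * (b + 1) < d\<close>;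
  a large \<open>A\<close> absorbs the fourth order discretization error.\<close>

lemma pot_super:
  assumes b: "b > 0" "2 * (b + 1) < real CARD('d)"
  obtains c A0 where "c > 0" "A0 \<ge> 1"
    "\<And>A z. A \<ge> A0 \<Longrightarrow> (\<Sum>w\<in>lnb (z :: int ^ 'd). pot b A w) + c * pot (b + 1) A z \<le> real (2 * CARD('d)) * pot b A z"
proof -
  obtain K where K: "K > 0"
    "\<And>u. \<bar>u\<bar> \<le> 1 / 2 \<Longrightarrow> (1 + u) powr (- b) + (1 - u) powr (- b) \<le> 2 + b * (b + 1) * u\<^sup>2 + K * u ^ 4"
    using powr_even_taylor[OF b(1)] by blast
  let ?d = "real CARD('d)"
  \<comment> \<open>The excess at order \<open>1 / t\<close> is \<open>2 * c0\<close>: one half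
    absorbs the fourth order error, the other survives as the source term.\<close>
  define c0 where "c0 = b * (?d - 2 * (b + 1))"
  have c0: "c0 > 0" using b by (simp add: c0_def)
  define c where "c = c0 * 2 powr (- (b + 1))"
  \<comment> \<open>The 4 keeps the relative increments within \<open>1 / 2\<close>, as the Taylor
    bound requires; the other term makes the fourth order error at most
    \<open>c0 / t\<close>.\<close>
  define A0 where "A0 = max 4 (16 * K / c0)"
  have A0: "A0 \<ge> 4" "16 * K / c0 \<le> A0" by (auto simp: A0_def)
  have main: "(\<Sum>w\<in>lnb z. pot b A w) + c * pot (b + 1) A z \<le> real (2 * CARD('d)) * pot b A z"
    if A: "A \<ge> A0" for A and z :: "int ^ 'd"
  proof -
    define s where "s = nsq z + A"
    \<comment> \<open>The two neighbours in direction \<open>i\<close> change the squared norm by 1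
      plus and 1 minus twice the coordinate. Centring at \<open>s + 1\<close> makes the increments
      opposite.\<close>
    define t where "t = s + 1"
    have s: "s \<ge> 4" using A A0 nsq_nonneg[of z] by (simp add: s_def)
    have t: "t > 0" "t \<ge> A0" "nsq z \<le> t" using s A nsq_nonneg[of z] A0 by (auto simp: t_def s_def)
    let ?z = "\<lambda>i. real_of_int (z $ i)"
    have zi: "(?z i)\<^sup>2 \<le> nsq z" for i unfolding nsq_def by (intro member_le_sum) auto
    have u: "\<bar>2 * ?z i / t\<bar> \<le> 1 / 2" for i
    proof -
      have "0 \<le> (\<bar>?z i\<bar> - 2)\<^sup>2" by simp
      then have "4 * \<bar>?z i\<bar> \<le> (?z i)\<^sup>2 + 4" by (simp add: power2_eq_square algebra_simps)
      also have "\<dots> \<le> t" using zi[of i] A A0 by (simp add: t_def s_def)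
      finally show ?thesis using t by (simp add: abs_mult field_simps)
    qed
    have p: "pot b A (z + axis i 1) + pot b A (z + axis i (-1)) \<le>
        t powr (- b) * (2 + b * (b + 1) * (2 * ?z i / t)\<^sup>2 + K * (2 * ?z i / t) ^ 4)" for i
    proof -
      have "nsq (z + axis i 1) + A = t * (1 + 2 * ?z i / t)" "nsq (z + axis i (-1)) + A = t * (1 - 2 * ?z i / t)"
        using t by (simp_all add: nsq_add_axis t_def s_def field_simps)
      then have "pot b A (z + axis i 1) + pot b A (z + axis i (-1)) =
          (t * (1 + 2 * ?z i / t)) powr (- b) + (t * (1 - 2 * ?z i / t)) powr (- b)"
        by (simp only: pot_def)
      also have "\<dots> = t powr (- b) * ((1 + 2 * ?z i / t) powr (- b) + (1 - 2 * ?z i / t) powr (- b))"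
      proof -
        have "0 \<le> 1 + 2 * ?z i / t" "0 \<le> 1 - 2 * ?z i / t" using u[of i] unfolding abs_le_iff by linarith+
        then have "(t * (1 + 2 * ?z i / t)) powr (- b) = t powr (- b) * (1 + 2 * ?z i / t) powr (- b)"
          "(t * (1 - 2 * ?z i / t)) powr (- b) = t powr (- b) * (1 - 2 * ?z i / t) powr (- b)"
          using t by (auto intro!: powr_mult simp del: right_diff_distrib distrib_left)
        then show ?thesis by (simp only: distrib_left)
      qed
      also have "\<dots> \<le> t powr (- b) * (2 + b * (b + 1) * (2 * ?z i / t)\<^sup>2 + K * (2 * ?z i / t) ^ 4)"
        using K(2)[OF u[of i]] by (intro mult_left_mono) auto
      finally show ?thesis .
    qed
    have "(\<Sum>w\<in>lnb z. pot b A w) \<le> (\<Sum>i\<in>UNIV. t powr (- b) * (2 + b * (b + 1) * (2 * ?z i / t)\<^sup>2 + K * (2 * ?z i / t) ^ 4))"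
      unfolding sum_lnb by (intro sum_mono p)
    also have "\<dots> = t powr (- b) * (2 * ?d + b * (b + 1) * 4 / t\<^sup>2 * nsq z + 16 * K / t ^ 4 * (\<Sum>i\<in>UNIV. (?z i) ^ 4))"
    proof -
      have "(\<Sum>i\<in>UNIV. 2 + b * (b + 1) * (2 * ?z i / t)\<^sup>2 + K * (2 * ?z i / t) ^ 4) =
        2 * ?d + b * (b + 1) * 4 / t\<^sup>2 * nsq z + 16 * K / t ^ 4 * (\<Sum>i\<in>UNIV. (?z i) ^ 4)"
      proof -
        have 1: "(\<Sum>i\<in>UNIV. b * (b + 1) * (2 * ?z i / t)\<^sup>2) = (\<Sum>i\<in>UNIV. b * (b + 1) * 4 / t\<^sup>2 * (?z i)\<^sup>2)"
          by (intro sum.cong refl) (simp add: power_divide power_mult_distrib)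
        have 2: "(\<Sum>i\<in>UNIV. K * (2 * ?z i / t) ^ 4) = (\<Sum>i\<in>UNIV. 16 * K / t ^ 4 * (?z i) ^ 4)"
          by (intro sum.cong refl) (simp add: power_divide power_mult_distrib)
        show ?thesis by (simp only: sum.distrib 1 2) (simp add: nsq_def sum_distrib_left)
      qed
      then show ?thesis by (simp add: sum_distrib_left[symmetric])
    qed
    also have "\<dots> \<le> t powr (- b) * (2 * ?d + 4 * b * (b + 1) / t + 16 * K / t\<^sup>2)"
    proof (intro mult_left_mono add_mono order_refl)
      have "b * (b + 1) * 4 / t\<^sup>2 * nsq z \<le> b * (b + 1) * 4 / t\<^sup>2 * t" using t b by (intro mult_left_mono) auto
      also have "\<dots> = 4 * b * (b + 1) / t" using t by (simp add: power2_eq_square)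
      finally show "b * (b + 1) * 4 / t\<^sup>2 * nsq z \<le> 4 * b * (b + 1) / t" .
      have "(\<Sum>i\<in>UNIV. (?z i) ^ 4) = (\<Sum>i\<in>UNIV. (?z i)\<^sup>2 * (?z i)\<^sup>2)" by (simp add: power4_eq_xxxx power2_eq_square mult.assoc)
      also have "\<dots> \<le> (\<Sum>i\<in>UNIV. (?z i)\<^sup>2 * nsq z)" using zi by (intro sum_mono mult_left_mono) auto
      also have "\<dots> = nsq z * nsq z" by (simp add: nsq_def sum_distrib_right)
      also have "\<dots> \<le> t * t" using t nsq_nonneg[of z] by (intro mult_mono) auto
      finally have "16 * K / t ^ 4 * (\<Sum>i\<in>UNIV. (?z i) ^ 4) \<le> 16 * K / t ^ 4 * (t * t)"
        using K t by (intro mult_left_mono) auto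
      also have "\<dots> = 16 * K / t\<^sup>2" using t by (simp add: power4_eq_xxxx power2_eq_square)
      finally show "16 * K / t ^ 4 * (\<Sum>i\<in>UNIV. (?z i) ^ 4) \<le> 16 * K / t\<^sup>2" .
    qed auto
    also have "\<dots> \<le> t powr (- b) * (2 * ?d * (1 + b / t) - c0 / t)"
    proof (rule mult_left_mono)
      have "16 * K / t \<le> c0"
      proof -
        have "16 * K \<le> A0 * c0" using A0(2) c0 by (simp add: field_simps)
        also have "\<dots> \<le> t * c0" using t c0 by (intro mult_right_mono) auto
        finally show ?thesis using t by (simp add: field_simps)
      qed
      then have "16 * K / t / t \<le> c0 / t" using t by (intro divide_right_mono) auto
      moreover have "2 * ?d * (1 + b / t) - c0 / t - (2 * ?d + 4 * b * (b + 1) / t) = c0 / t"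
        using t by (simp add: c0_def field_simps)
      ultimately show "2 * ?d + 4 * b * (b + 1) / t + 16 * K / t\<^sup>2 \<le> 2 * ?d * (1 + b / t) - c0 / t"
        by (simp add: power2_eq_square)
    qed simp
    also have "\<dots> = 2 * ?d * (t powr (- b) * (1 + b / t)) - c0 * (t powr (- b) / t)"
      by (simp add: algebra_simps)
    also have "\<dots> \<le> 2 * ?d * s powr (- b) - c * s powr (- (b + 1))"
    proof (rule diff_mono)
      \<comment> \<open>Back from \<open>t\<close> to \<open>s\<close>: the factor
        \<open>1 + b / t\<close> is at most \<open>exp (b / t)\<close>, and this is at most a power
        of \<open>1 - 1 / t\<close>, which is the quotient of \<open>s\<close> and
        \<open>t\<close>.\<close>
      have st: "s = t * (1 - 1 / t)" using t by (simp add: t_def field_simps)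
      have "1 / t < 1" using s by (simp add: t_def)
      then have v: "1 - 1 / t > 0" by linarith
      have "1 + b / t \<le> exp (b * (1 / t))" using exp_ge_add_one_self[of "b / t"] by simp
      also have "\<dots> \<le> exp (- b * ln (1 - 1 / t))"
      proof -
        have "ln (1 - 1 / t) \<le> - (1 / t)" using ln_le_minus_one[OF v] by linarith
        then have "b * ln (1 - 1 / t) \<le> b * - (1 / t)" using b by (intro mult_left_mono) auto
        then show ?thesis by simp
      qed
      also have "\<dots> = (1 - 1 / t) powr (- b)"
      proof -
        have "1 - 1 / t \<noteq> 0" using v by linarith
        then show ?thesis unfolding powr_def by (simp only: if_False)
      qed
      finally have "t powr (- b) * (1 + b / t) \<le> t powr (- b) * (1 - 1 / t) powr (- b)"
        by (rule mult_left_mono) simp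
      also have "\<dots> = (t * (1 - 1 / t)) powr (- b)" by (simp add: powr_mult)
      also have "\<dots> = s powr (- b)" by (simp only: st[symmetric])
      finally show "2 * ?d * (t powr (- b) * (1 + b / t)) \<le> 2 * ?d * s powr (- b)" by (intro mult_left_mono) auto
      have "(2 * s) powr (- (b + 1)) \<le> t powr (- (b + 1))" using s b by (intro powr_mono2') (auto simp: t_def)
      moreover have "t powr (- (b + 1)) = t powr (- b) / t" using t by (simp add: powr_diff)
      moreover have "(2 * s) powr (- (b + 1)) = 2 powr (- (b + 1)) * s powr (- (b + 1))" by (simp add: powr_mult)
      ultimately have "c0 * (2 powr (- (b + 1)) * s powr (- (b + 1))) \<le> c0 * (t powr (- b) / t)"
        using c0 by (intro mult_left_mono) auto
      then show "c * s powr (- (b + 1)) \<le> c0 * (t powr (- b) / t)" by (simp add: c_def mult.assoc)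
    qed
    finally show ?thesis by (simp add: pot_def s_def)
  qed
  have "c > 0" "A0 \<ge> 1" using c0 A0 by (auto simp: c_def)
  then show ?thesis by (rule that[OF _ _ main])
qed

lemma sum_lnb_shift: "(\<Sum>w\<in>lnb x. f (w - y)) = (\<Sum>w\<in>lnb (x - y). f w :: real)"
  unfolding sum_lnb by (simp add: algebra_simps)

lemma pot_pos: "A > 0 \<Longrightarrow> 0 < pot b A z"
  using nsq_nonneg[of z] by (simp add: pot_def)

lemma pot_le_0: "A > 0 \<Longrightarrow> b \<ge> 0 \<Longrightarrow> pot b A z \<le> pot b A 0"
  using nsq_nonneg[of z] by (auto simp: pot_def nsq_def intro!: powr_mono2')

lemma pot_minus: "pot b A (x - y) = pot b A (y - x)"
  by (simp add: pot_def nsq_minus)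

section \<open>Distance, axis rays and exponential supersolutions\<close>

definition ldist :: "int ^ 'd \<Rightarrow> int ^ 'd \<Rightarrow> real" where
  "ldist x y = (\<Sum>i\<in>UNIV. \<bar>real_of_int (x $ i - y $ i)\<bar>)"

definition lray :: "int ^ 'd \<Rightarrow> int \<Rightarrow> int ^ 'd" where
  "lray y k = y + axis (SOME i. True) k"

text \<open>A sum over the coordinates of twice a hyperbolic cosine. The neighbour sum multiplies
  each summand by an exact constant, so there is no discretization error to absorb.\<close>

definition lpsi :: "real \<Rightarrow> int ^ 'd \<Rightarrow> int ^ 'd \<Rightarrow> real" where
  "lpsi \<kappa> u x = (\<Sum>i\<in>UNIV. exp (sqrt \<kappa> / 2 * real_of_int (x $ i - u $ i)) + exp (- (sqrt \<kappa> / 2 * real_of_int (x $ i - u $ i))))"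

lemma ldist_nonneg: "0 \<le> ldist x y"
  unfolding ldist_def by (intro sum_nonneg) auto

lemma ldist_triangle: "ldist x z \<le> ldist x y + ldist y z"
  unfolding ldist_def sum.distrib[symmetric] by (intro sum_mono) linarith

lemma ldist_lnb: "y \<in> lnb x \<Longrightarrow> ldist x y = 1"
proof -
  assume "y \<in> lnb x"
  then have "real_of_int (\<Sum>i\<in>UNIV. \<bar>x $ i - y $ i\<bar>) = 1" by (simp add: lnb_def)
  then show ?thesis unfolding ldist_def by simp
qed

lemma nsq_le_ldist: "nsq x \<le> (ldist x 0)\<^sup>2"
proof -
  let ?S = "ldist x 0"
  have "\<bar>real_of_int (x $ i)\<bar> \<le> ?S" for i
    unfolding ldist_def by (rule order.trans[OF _ member_le_sum[of i]]) auto
  then have "(real_of_int (x $ i))\<^sup>2 \<le> \<bar>real_of_int (x $ i)\<bar> * ?S" for i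
    using mult_left_mono[of "\<bar>real_of_int (x $ i)\<bar>" ?S "\<bar>real_of_int (x $ i)\<bar>"]
    by (simp add: power2_eq_square abs_mult_self_eq)
  then have "nsq x \<le> (\<Sum>i\<in>UNIV. \<bar>real_of_int (x $ i)\<bar> * ?S)" unfolding nsq_def by (intro sum_mono)
  also have "\<dots> = ?S\<^sup>2" by (simp add: ldist_def power2_eq_square sum_distrib_right)
  finally show ?thesis .
qed

text \<open>The two neighbours in direction \<open>i\<close> multiply the summand of that coordinate
  by \<open>exp \<theta> + exp (- \<theta>)\<close> in total and the other summands by 2. With
  \<open>\<theta> = sqrt \<kappa> / 2\<close> the excess over 2 is at most
  \<open>\<kappa> / 2\<close>.\<close>

lemma lpsi_super:
  assumes "0 < \<kappa>" "\<kappa> \<le> 1"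
  shows "(\<Sum>w\<in>lnb x. lpsi \<kappa> u w) \<le> (real (2 * CARD('d)) + \<kappa> / 2) * lpsi \<kappa> u (x :: int ^ 'd)"
proof -
  define \<theta> where "\<theta> = sqrt \<kappa> / 2"
  have "sqrt \<kappa> \<le> 1" using assms by simp
  then have "\<theta> \<le> 1" unfolding \<theta>_def by linarith
  then have \<theta>: "0 \<le> \<theta>" "\<theta> \<le> 1" "2 * \<theta>\<^sup>2 = \<kappa> / 2" using assms(1) by (auto simp: \<theta>_def power_divide)
  let ?E = "exp \<theta> + exp (- \<theta>)"
  have E: "?E \<le> 2 + \<kappa> / 2"
  proof -
    have 1: "exp \<theta> \<le> 1 + \<theta> + \<theta>\<^sup>2" using \<theta> by (intro exp_bound)
    \<comment> \<open>The product equals 1 plus the cube of \<theta>. It bounds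
      \<open>exp (- \<theta>)\<close> from above by way of the lower bound for
      \<open>exp \<theta>\<close>.\<close>
    have "1 \<le> (1 - \<theta> + \<theta>\<^sup>2) * (1 + \<theta>)" using \<theta> by (simp add: algebra_simps power2_eq_square)
    also have "\<dots> \<le> (1 - \<theta> + \<theta>\<^sup>2) * exp \<theta>" using \<theta> by (intro mult_left_mono exp_ge_add_one_self) auto
    finally have "exp (- \<theta>) * 1 \<le> exp (- \<theta>) * ((1 - \<theta> + \<theta>\<^sup>2) * exp \<theta>)" by (intro mult_left_mono) auto
    also have "\<dots> = 1 - \<theta> + \<theta>\<^sup>2" by (simp add: exp_minus)
    finally show ?thesis using 1 \<theta>(3) by simp
  qed
  let ?t = "\<lambda>x i. exp (\<theta> * real_of_int (x $ i - u $ i)) + exp (- (\<theta> * real_of_int (x $ i - u $ i)))"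
  have t0: "0 \<le> ?t x i" for x i by (simp add: add_nonneg_nonneg)
  have step: "?t (x + axis j 1) i + ?t (x + axis j (-1)) i = ?t x i * (if j = i then ?E else 2)" for i j
  proof (cases "j = i")
    case True
    have "exp (\<theta> * (real_of_int (x $ i - u $ i) + 1)) = exp (\<theta> * real_of_int (x $ i - u $ i)) * exp \<theta>"
      "exp (\<theta> * (real_of_int (x $ i - u $ i) - 1)) = exp (\<theta> * real_of_int (x $ i - u $ i)) * exp (- \<theta>)"
      "exp (- (\<theta> * (real_of_int (x $ i - u $ i) + 1))) = exp (- (\<theta> * real_of_int (x $ i - u $ i))) * exp (- \<theta>)"
      "exp (- (\<theta> * (real_of_int (x $ i - u $ i) - 1))) = exp (- (\<theta> * real_of_int (x $ i - u $ i))) * exp \<theta>"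
      unfolding exp_add[symmetric] by (simp_all add: algebra_simps)
    moreover have "real_of_int ((x + axis j 1) $ i - u $ i) = real_of_int (x $ i - u $ i) + 1"
      "real_of_int ((x + axis j (-1)) $ i - u $ i) = real_of_int (x $ i - u $ i) - 1"
      using True by (simp_all add: axis_def)
    ultimately have "?t (x + axis j 1) i + ?t (x + axis j (-1)) i = ?t x i * ?E"
      by (simp only: distrib_left distrib_right)
    then show ?thesis using True by simp
  qed (simp add: axis_def)
  have "(\<Sum>w\<in>lnb x. lpsi \<kappa> u w) = (\<Sum>j\<in>UNIV. \<Sum>i\<in>UNIV. ?t x i * (if j = i then ?E else 2))"
    unfolding sum_lnb lpsi_def \<theta>_def[symmetric] sum.distrib[symmetric]
    by (intro sum.cong refl) (use step in \<open>simp only: add.assoc\<close>)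
  also have "\<dots> = (\<Sum>i\<in>UNIV. ?t x i * (\<Sum>j\<in>UNIV. if j = i then ?E else 2))"
    by (subst sum.swap) (simp only: sum_distrib_left)
  also have "\<dots> \<le> (\<Sum>i\<in>UNIV. ?t x i * (real (2 * CARD('d)) + \<kappa> / 2))"
  proof (intro sum_mono mult_left_mono t0)
    fix i :: 'd
    have "(\<Sum>j\<in>(UNIV :: 'd set). if j = i then ?E else 2) = (\<Sum>j\<in>(UNIV :: 'd set). 2 + (if j = i then ?E - 2 else 0))"
      by (intro sum.cong) auto
    also have "\<dots> = real (2 * CARD('d)) + (?E - 2)" by (simp add: sum.distrib)
    finally show "(\<Sum>j\<in>(UNIV :: 'd set). if j = i then ?E else 2) \<le> real (2 * CARD('d)) + \<kappa> / 2" using E by simp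
  qed
  also have "\<dots> = (real (2 * CARD('d)) + \<kappa> / 2) * lpsi \<kappa> u x"
    by (simp only: lpsi_def \<theta>_def sum_distrib_left mult.commute)
  finally show ?thesis .
qed

text \<open>Some coordinate carries at least the d-th part of the distance; with the 2 in the
  exponent of \<open>lpsi\<close> this is the origin of the rate \<open>1 / (2 * d)\<close>.\<close>

lemma lpsi_ge:
  assumes "0 < \<kappa>"
  shows "exp (1 / real (2 * CARD('d)) * sqrt \<kappa> * ldist x u) \<le> lpsi \<kappa> u (x :: int ^ 'd)"
proof -
  let ?a = "\<lambda>i. \<bar>real_of_int (x $ i - u $ i)\<bar>"
  have "\<exists>i. ldist x u \<le> real CARD('d) * ?a i"
  proof (rule ccontr)
    assume "\<not> ?thesis"
    then have "?a i < ldist x u / real CARD('d)" for i by (simp add: not_le field_simps)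
    then have "(\<Sum>i\<in>UNIV. ?a i) < (\<Sum>i\<in>(UNIV :: 'd set). ldist x u / real CARD('d))"
      by (intro sum_strict_mono) auto
    then show False by (simp add: ldist_def)
  qed
  then obtain i where i: "ldist x u \<le> real CARD('d) * ?a i" by blast
  have "1 / real (2 * CARD('d)) * sqrt \<kappa> * ldist x u = sqrt \<kappa> / 2 * (ldist x u / real CARD('d))" by simp
  also have "\<dots> \<le> sqrt \<kappa> / 2 * ?a i" using i assms by (intro mult_left_mono) (auto simp: divide_le_eq mult.commute)
  finally have "exp (1 / real (2 * CARD('d)) * sqrt \<kappa> * ldist x u) \<le> exp (sqrt \<kappa> / 2 * ?a i)" by simp
  also have "\<dots> \<le> exp (sqrt \<kappa> / 2 * real_of_int (x $ i - u $ i)) + exp (- (sqrt \<kappa> / 2 * real_of_int (x $ i - u $ i)))"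
  proof -
    have "exp (s * \<bar>t\<bar>) \<le> exp (s * t) + exp (- (s * t))" for s t :: real
    proof (cases "t \<ge> 0")
      case False
      then have "s * \<bar>t\<bar> = - (s * t)" by simp
      then show ?thesis by (metis add_increasing exp_ge_zero order_refl)
    qed simp
    then show ?thesis by (simp only: of_int_abs)
  qed
  also have "\<dots> \<le> lpsi \<kappa> u x" unfolding lpsi_def
    by (rule member_le_sum[of i UNIV "\<lambda>i. exp (sqrt \<kappa> / 2 * real_of_int (x $ i - u $ i)) + exp (- (sqrt \<kappa> / 2 * real_of_int (x $ i - u $ i)))"])
      (auto intro: add_nonneg_nonneg)
  finally show ?thesis .
qed

lemma lray_diff: "lray y j - lray y k = axis (SOME i. True) (j - k)"
  by (simp add: lray_def vec_eq_iff axis_def)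

section \<open>The lattice in dimension at least five as an instance\<close>

lemma sum_inverse_squares_le:
  fixes m :: real
  assumes "m > 0"
  shows "(\<Sum>k\<le>N. 1 / (m + 1 + real k)\<^sup>2) \<le> 1 / m - 1 / (m + 1 + real N)"
proof (induction N)
  case 0
  have "1 / (m + 1)\<^sup>2 \<le> 1 / (m * (m + 1))" using assms by (intro divide_left_mono) (auto simp: power2_eq_square)
  also have "\<dots> = 1 / m - 1 / (m + 1)" using assms by (simp add: field_simps)
  finally show ?case by simp
next
  case (Suc N)
  let ?a = "m + 1 + real N"
  have a: "?a > 0" using assms by simp
  have "1 / (?a + 1)\<^sup>2 \<le> 1 / (?a * (?a + 1))" using a by (intro divide_left_mono) (auto simp: power2_eq_square)
  also have "\<dots> = 1 / ?a - 1 / (?a + 1)" using a by (simp add: field_simps)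
  finally have "1 / (m + 1 + real (Suc N))\<^sup>2 \<le> 1 / ?a - 1 / (m + 1 + real (Suc N))" by (simp add: add_ac)
  then show ?case using Suc by simp
qed

text \<open>\<open>g\<close> and \<open>\<phi>\<close> decay like the distance to the powers -5/2
  and -1/2. The exponent \<open>5 / 4\<close> is admissible because
  \<open>2 * (5 / 4 + 1) < 5\<close>, is summable along a line, and exceeds \<open>1 / 4\<close> by
  one, so that the source of the second potential is a multiple of the first. The source of the
  first potential at the pole supplies \<open>gap\<close>.\<close>

theorem lattice_transient:
  assumes d: "5 \<le> CARD('d)"
  shows "\<exists>g \<phi> gap \<Phi>. transient_metric (lnb :: int ^ 'd \<Rightarrow> _) (2 * CARD('d)) g \<phi> gap \<Phi> lray ldist lpsi
    (1 / real (2 * CARD('d))) (real (2 * CARD('d)))"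
proof -
  let ?d = "real CARD('d)" and ?D = "real (2 * CARD('d))"
  have "2 * (5 / 4 + 1) < ?d" "2 * (1 / 4 + 1) < ?d" using d by simp_all
  then obtain c A1 c' A2 where c: "c > 0" "A1 \<ge> 1"
      "\<And>A z. A \<ge> A1 \<Longrightarrow> (\<Sum>w\<in>lnb (z :: int ^ 'd). pot (5 / 4) A w) + c * pot (5 / 4 + 1) A z \<le> ?D * pot (5 / 4) A z"
    and c': "c' > 0" "A2 \<ge> 1"
      "\<And>A z. A \<ge> A2 \<Longrightarrow> (\<Sum>w\<in>lnb (z :: int ^ 'd). pot (1 / 4) A w) + c' * pot (1 / 4 + 1) A z \<le> ?D * pot (1 / 4) A z"
    using pot_super[where 'd = 'd, of "5 / 4"] pot_super[where 'd = 'd, of "1 / 4"] by (metis zero_less_divide_iff zero_less_numeral zero_less_one)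
  define A where "A = max A1 A2"
  have A: "A \<ge> 1" "A > 0" "A \<ge> A1" "A \<ge> A2" using c(2) by (auto simp: A_def)
  define p where "p = pot (5 / 4) A (0 :: int ^ 'd)"
  have p: "p > 0" using A by (simp add: p_def pot_pos)
  define g where "g x y = pot (5 / 4) A (x - y :: int ^ 'd) / p" for x y
  \<comment> \<open>Scales the source \<open>c' * pot (1 / 4 + 1)\<close> of the second potential to
    exactly \<open>g\<close>.\<close>
  define L where "L = 1 / (c' * p)"
  have L: "L > 0" using c'(1) p by (simp add: L_def)
  define \<phi> where "\<phi> x y = L * pot (1 / 4) A (x - y :: int ^ 'd)" for x y
  define gap where "gap = c * pot (5 / 4 + 1) A (0 :: int ^ 'd) / p"
  define \<Phi> where "\<Phi> = L * pot (1 / 4) A (0 :: int ^ 'd)"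
  have shift: "(\<Sum>w\<in>lnb x. pot b A (w - y)) = (\<Sum>w\<in>lnb (x - y). pot b A w)" for b and x y :: "int ^ 'd"
    by (rule sum_lnb_shift)
  have gs: "(\<Sum>w\<in>lnb x. g w y) + c * pot (5 / 4 + 1) A (x - y) / p \<le> ?D * g x y" for x y
  proof -
    have "((\<Sum>w\<in>lnb x. pot (5 / 4) A (w - y)) + c * pot (5 / 4 + 1) A (x - y)) / p \<le> ?D * pot (5 / 4) A (x - y) / p"
      unfolding shift using c(3)[OF A(3), of "x - y"] p by (intro divide_right_mono) auto
    then show ?thesis by (simp add: g_def sum_divide_distrib add_divide_distrib)
  qed
  have fs: "(\<Sum>w\<in>lnb x. \<phi> w y) + g x y \<le> ?D * \<phi> x y" for x y
  proof -
    have "L * ((\<Sum>w\<in>lnb x. pot (1 / 4) A (w - y)) + c' * pot (1 / 4 + 1) A (x - y)) \<le> L * (?D * pot (1 / 4) A (x - y))"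
      unfolding shift using c'(3)[OF A(4), of "x - y"] L by (intro mult_left_mono) auto
    moreover have "L * (c' * pot (1 / 4 + 1) A (x - y)) = g x y"
      using c'(1) by (simp add: L_def g_def)
    ultimately show ?thesis by (simp add: \<phi>_def distrib_left sum_distrib_left mult.left_commute)
  qed
  have axisg: "pot (5 / 4) A (axis i k :: int ^ 'd) \<le> 1 / (real_of_int k)\<^sup>2" if "k \<noteq> 0" for i k
  proof -
    have k: "1 \<le> (real_of_int k)\<^sup>2"
    proof -
      have "1 \<le> \<bar>k\<bar>" using that by linarith
      then have "1 \<le> \<bar>real_of_int k\<bar>" by linarith
      then show ?thesis by (metis abs_ge_zero one_le_power power2_abs)
    qed
    have "pot (5 / 4) A (axis i k :: int ^ 'd) = ((real_of_int k)\<^sup>2 + A) powr (- (5 / 4))" by (simp add: pot_def nsq_axis)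
    also have "\<dots> \<le> ((real_of_int k)\<^sup>2 + A) powr (- 1)" using k A by (intro powr_mono) auto
    also have "\<dots> = 1 / ((real_of_int k)\<^sup>2 + A)" using k A by (simp add: powr_minus inverse_eq_divide)
    also have "\<dots> \<le> 1 / (real_of_int k)\<^sup>2" 
    proof (rule divide_left_mono)
      have "0 < (real_of_int k)\<^sup>2" "0 < (real_of_int k)\<^sup>2 + A" using k A by linarith+
      then show "0 < ((real_of_int k)\<^sup>2 + A) * (real_of_int k)\<^sup>2" by (intro mult_pos_pos)
    qed (use A in auto)
    finally show ?thesis .
  qed
  interpret regular_graph "lnb :: int ^ 'd \<Rightarrow> _" "2 * CARD('d)" by (rule regular_graph_lnb)
  have "transient_metric (lnb :: int ^ 'd \<Rightarrow> _) (2 * CARD('d)) g \<phi> gap \<Phi> lray ldist lpsi (1 / ?D) ?D"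
  proof
    fix x y z :: "int ^ 'd"
    show "0 \<le> g x y" using p A by (simp add: g_def pot_pos less_imp_le)
    show "g x x = 1" using p by (simp add: g_def p_def)
    show "g x y = g y x" by (simp add: g_def pot_minus)
    have "0 \<le> c * pot (5 / 4 + 1) A (x - y) / p" using c(1) p A by (simp add: pot_pos less_imp_le)
    then show "(\<Sum>w\<in>lnb x. g w y) \<le> real (2 * CARD('d)) * g x y" using gs[of y x] by linarith
    show "gap > 0" using c(1) p A by (simp add: gap_def pot_pos)
    show "(\<Sum>w\<in>lnb y. g w y) \<le> real (2 * CARD('d)) - gap"
      using gs[of y y] p by (simp add: gap_def) (simp add: g_def p_def)
    show "0 \<le> \<phi> x y" using L A by (simp add: \<phi>_def pot_pos less_imp_le)
    show "\<phi> x y \<le> \<Phi>" using L A by (simp add: \<phi>_def \<Phi>_def pot_le_0)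
    show "(\<Sum>w\<in>lnb x. \<phi> w y) + g x y \<le> real (2 * CARD('d)) * \<phi> x y" by (rule fs)
    show "lray y 0 = y" by (simp add: lray_def vec_eq_iff axis_def)
    show "lray y (k + 1) \<in> lnb (lray y k)" for k
      unfolding lnb_eq by (intro image_eqI[of _ _ "(SOME i. True, 1)"]) (auto simp: lray_def vec_eq_iff axis_def)
    show "j = k" if "lray y j = lray y k" for j k
    proof -
      have "lray y j $ (SOME i. True) = lray y k $ (SOME i. True)" using that by simp
      then show ?thesis by (simp add: lray_def axis_def)
    qed
    show "\<exists>M. \<forall>y N. (\<Sum>k\<le>N. g (lray y (1 + int M)) (lray y (- int k))) \<le> 1 / 2"
    proof -
      obtain M :: nat where M: "2 / p < real M" using reals_Archimedean2 by blast
      have M0: "real M > 0" using M p by (meson divide_pos_pos less_trans zero_less_numeral)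
      have "(\<Sum>k\<le>N. g (lray y (1 + int M)) (lray y (- int k))) \<le> 1 / 2" for y N
      proof -
        have "g (lray y (1 + int M)) (lray y (- int k)) \<le> 1 / p * (1 / (real M + 1 + real k)\<^sup>2)" for k
        proof -
          have "g (lray y (1 + int M)) (lray y (- int k)) = pot (5 / 4) A (axis (SOME i. True) (1 + int M + int k) :: int ^ 'd) / p"
            by (simp add: g_def lray_diff)
          also have "\<dots> \<le> 1 / (real_of_int (1 + int M + int k))\<^sup>2 / p"
            using p by (intro divide_right_mono axisg) auto
          finally show ?thesis by (simp add: ac_simps)
        qed
        then have "(\<Sum>k\<le>N. g (lray y (1 + int M)) (lray y (- int k))) \<le> (\<Sum>k\<le>N. 1 / p * (1 / (real M + 1 + real k)\<^sup>2))"
          by (intro sum_mono)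
        also have "\<dots> = 1 / p * (\<Sum>k\<le>N. 1 / (real M + 1 + real k)\<^sup>2)" by (rule sum_distrib_left[symmetric])
        also have "\<dots> \<le> 1 / p * (1 / real M)"
        proof (rule mult_left_mono)
          have "0 \<le> 1 / (real M + 1 + real N)" by simp
          then show "(\<Sum>k\<le>N. 1 / (real M + 1 + real k)\<^sup>2) \<le> 1 / real M"
            using sum_inverse_squares_le[OF M0, of N] by linarith
        qed (use p in auto)
        also have "\<dots> \<le> 1 / 2" using M M0 p by (simp add: field_simps)
        finally show ?thesis .
      qed
      then show ?thesis by blast
    qed
    show "\<exists>M\<ge>1. \<forall>y. \<phi> (lray y 1) (lray y (- int M)) \<le> \<epsilon> \<and> g (lray y (- int M)) y \<le> 1 / 4" if \<epsilon>: "\<epsilon> > 0" for \<epsilon> :: real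
    proof -
      \<comment> \<open>Along the ray \<open>\<phi>\<close> is at most
        \<open>L * M powr (- (1 / 2))\<close>, hence the exponent -2; the other term serves the
        bound on \<open>g\<close>.\<close>
      obtain M :: nat where M: "max (4 / p) ((\<epsilon> / L) powr (- 2)) < real M" using reals_Archimedean2 by blast
      have "4 / p < real M" using M by (rule le_less_trans[OF max.cobounded1])
      moreover have "4 / p > 0" using p by simp
      ultimately have M0: "real M > 0" by linarith
      then have M1: "M \<ge> 1" by simp
      have "\<phi> (lray y 1) (lray y (- int M)) \<le> \<epsilon>" for y
      proof -
        have "\<phi> (lray y 1) (lray y (- int M)) = L * ((real_of_int (1 + int M))\<^sup>2 + A) powr (- (1 / 4))"
          by (simp add: \<phi>_def lray_diff pot_def nsq_axis)
        also have "\<dots> \<le> L * ((real M)\<^sup>2) powr (- (1 / 4))"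
        proof -
          have "(real M)\<^sup>2 \<le> (real_of_int (1 + int M))\<^sup>2 + A" 
          proof -
            have e: "real_of_int (1 + int M) = 1 + real M" by simp
            have "(real M)\<^sup>2 \<le> (1 + real M)\<^sup>2" by (intro power_mono) auto
            then show ?thesis unfolding e using A(2) by linarith
          qed
          then show ?thesis using L M0 by (intro mult_left_mono powr_mono2') auto
        qed
        also have "((real M)\<^sup>2) powr (- (1 / 4)) = (real M) powr (- (1 / 2))"
        proof -
          have "(real M)\<^sup>2 = (real M) powr 2" using M0 by simp
          then show ?thesis by (simp only: powr_powr) simp
        qed
        also have "L * (real M) powr (- (1 / 2)) \<le> L * (\<epsilon> / L)"
        proof (rule mult_left_mono)
          have e: "(\<epsilon> / L) powr (- 2) > 0" using \<epsilon> L by simp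
          have "(real M) powr (- (1 / 2)) \<le> ((\<epsilon> / L) powr (- 2)) powr (- (1 / 2))"
            using M e by (intro powr_mono2') auto
          also have "\<dots> = \<epsilon> / L" using \<epsilon> L by (simp add: powr_powr)
          finally show "(real M) powr (- (1 / 2)) \<le> \<epsilon> / L" .
        qed (use L in auto)
        also have "\<dots> = \<epsilon>" using L by simp
        finally show ?thesis by simp
      qed
      moreover have "g (lray y (- int M)) y \<le> 1 / 4" for y
      proof -
        have "g (lray y (- int M)) y = pot (5 / 4) A (axis (SOME i. True) (- int M) :: int ^ 'd) / p"
          by (simp add: g_def lray_def)
        also have "\<dots> \<le> 1 / (real_of_int (- int M))\<^sup>2 / p" using M1 p by (intro divide_right_mono axisg) auto
        also have "\<dots> = 1 / ((real M)\<^sup>2 * p)" by simp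
        also have "\<dots> \<le> 1 / (real M * p)"
          using M1 p by (intro divide_left_mono mult_right_mono) (auto simp: power2_eq_square)
        also have "\<dots> \<le> 1 / 4" using M M0 p by (simp add: field_simps)
        finally show ?thesis .
      qed
      ultimately show ?thesis using M1 by blast
    qed
    show "ldist x z \<le> ldist x y + ldist y z" by (rule ldist_triangle)
    show "ldist x y \<le> 1" if "y \<in> lnb x" using ldist_lnb[OF that] by simp
    show "ldist x x = 0" by (simp add: ldist_def)
    show "1 / real (2 * CARD('d)) > 0" "real (2 * CARD('d)) > 0" by simp_all
    show "(\<Sum>w\<in>lnb x. lpsi \<kappa> u w) \<le> (real (2 * CARD('d)) + \<kappa> / 2) * lpsi \<kappa> u x" if "0 < \<kappa>" "\<kappa> \<le> 1" for \<kappa> and u :: "int ^ 'd"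
      by (rule lpsi_super[OF that])
    show "lpsi \<kappa> u u \<le> real (2 * CARD('d))" for \<kappa> and u :: "int ^ 'd" by (simp add: lpsi_def)
    show "exp (1 / real (2 * CARD('d)) * sqrt \<kappa> * ldist x u) \<le> lpsi \<kappa> u x" if "0 < \<kappa>" for \<kappa> and u :: "int ^ 'd"
      by (rule lpsi_ge[OF that])
  qed
  then show ?thesis by blast
qed

text \<open>A ball of radius \<open>R\<close> is occupied for a time of order \<open>R\<close>
  squared. With exponent 1 and offset \<open>A0 * R\<^sup>2\<close> the source is at least of order
  \<open>R\<close> to the power -4 on the ball, while the potential is at most of order
  \<open>R\<close> to the power -2; the factor \<open>K\<close> normalizes the source to 1.\<close>

lemma ball_potential:
  assumes d: "5 \<le> CARD('d)"
  obtains C :: real where "C > 0"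
    "\<And>R. R \<ge> 1 \<Longrightarrow> \<exists>\<psi> :: int ^ 'd \<Rightarrow> real. (\<forall>x. 0 \<le> \<psi> x \<and> \<psi> x \<le> C * R\<^sup>2 \<and>
      (\<Sum>w\<in>lnb x. \<psi> w) + of_bool (ldist x 0 < R) \<le> real (2 * CARD('d)) * \<psi> x)"
proof -
  have "2 * (1 + 1) < real CARD('d)" using d by simp
  then obtain c A0 where c: "c > 0" "A0 \<ge> 1"
      "\<And>A z. A \<ge> A0 \<Longrightarrow> (\<Sum>w\<in>lnb (z :: int ^ 'd). pot 1 A w) + c * pot (1 + 1) A z \<le> real (2 * CARD('d)) * pot 1 A z"
    using pot_super[where 'd = 'd, of 1] by (metis zero_less_one)
  define C where "C = (1 + A0)\<^sup>2 / (c * A0)"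
  have C: "C > 0" using c(1,2) by (simp add: C_def)
  have main: "\<exists>\<psi> :: int ^ 'd \<Rightarrow> real. (\<forall>x. 0 \<le> \<psi> x \<and> \<psi> x \<le> C * R\<^sup>2 \<and>
      (\<Sum>w\<in>lnb x. \<psi> w) + of_bool (ldist x 0 < R) \<le> real (2 * CARD('d)) * \<psi> x)" if R: "R \<ge> 1" for R
  proof -
    define A where "A = A0 * R\<^sup>2"
    have R2: "R\<^sup>2 \<ge> 1" using R by simp
    have A: "A \<ge> A0" using mult_left_mono[OF R2, of A0] c(2) by (simp add: A_def)
    then have A: "A \<ge> A0" "A > 0" using c(2) by linarith+
    define K where "K = ((1 + A0) * R\<^sup>2)\<^sup>2 / c"
    have K: "K > 0" using c(1,2) R by (simp add: K_def)
    define \<psi> where "\<psi> x = K * pot 1 A (x :: int ^ 'd)" for x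
    have "0 \<le> \<psi> x" for x using K A by (simp add: \<psi>_def pot_pos less_imp_le)
    moreover have "\<psi> x \<le> C * R\<^sup>2" for x
    proof -
      have "\<psi> x \<le> K * pot 1 A (0 :: int ^ 'd)" using K A by (auto simp: \<psi>_def intro!: mult_left_mono pot_le_0)
      also have "pot 1 A (0 :: int ^ 'd) = 1 / A" using A by (simp add: pot_def nsq_def powr_minus inverse_eq_divide)
      also have "K * (1 / A) = C * R\<^sup>2"
        using c(1,2) R by (simp add: K_def C_def A_def power2_eq_square)
      finally show ?thesis .
    qed
    moreover have "(\<Sum>w\<in>lnb x. \<psi> w) + of_bool (ldist x 0 < R) \<le> real (2 * CARD('d)) * \<psi> x" for x
    proof -
      have "of_bool (ldist x 0 < R) \<le> K * (c * pot (1 + 1) A x)"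
      proof (cases "ldist x 0 < R")
        case True
        have "nsq x \<le> R\<^sup>2" using nsq_le_ldist[of x] power_mono[of "ldist x 0" R 2] True ldist_nonneg[of x 0] by (meson less_imp_le order_trans)
        then have le: "nsq x + A \<le> (1 + A0) * R\<^sup>2" by (simp add: A_def algebra_simps)
        have pos: "0 < nsq x + A" using nsq_nonneg[of x] A by simp
        have "pot (1 + 1) A x = 1 / (nsq x + A)\<^sup>2"
          using pos by (simp add: pot_def powr_minus inverse_eq_divide powr_numeral)
        then have "K * (c * pot (1 + 1) A x) = ((1 + A0) * R\<^sup>2)\<^sup>2 / (nsq x + A)\<^sup>2" using c(1) by (simp add: K_def)
        also have "\<dots> \<ge> 1" using le pos by (simp add: power_mono)
        finally show ?thesis using True by simp
      next
        case False
        then show ?thesis using K c(1) A by (simp add: pot_pos less_imp_le)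
      qed
      moreover have "K * ((\<Sum>w\<in>lnb x. pot 1 A w) + c * pot (1 + 1) A x) \<le> K * (real (2 * CARD('d)) * pot 1 A x)"
        using c(3)[OF A(1), of x] K by (intro mult_left_mono) auto
      ultimately show ?thesis by (simp add: \<psi>_def distrib_left sum_distrib_left mult.left_commute)
    qed
    ultimately show ?thesis by blast
  qed
  show ?thesis by (rule that[OF C main])
qed

section \<open>Spanning trees of the wired graph\<close>

text \<open>\<open>wired\<close> with a free choice of arcs, so that a tree, the whole graph and a
  tree with one more edge share their end point maps and their walks.\<close>

definition tgraph :: "'a set \<Rightarrow> ('a \<times> 'a) set \<Rightarrow> ('a option, 'a \<times> 'a) pre_digraph" where
  "tgraph W A = \<lparr>verts = insert None (Some ` W), arcs = A, tail = contract W \<circ> fst, head = contract W \<circ> snd\<rparr>"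

lemma tgraph_simps [simp]:
  "verts (tgraph W A) = insert None (Some ` W)" "arcs (tgraph W A) = A"
  "tail (tgraph W A) a = contract W (fst a)" "head (tgraph W A) a = contract W (snd a)"
  by (auto simp: tgraph_def)

lemma tail_tgraph: "tail (tgraph W A) = contract W \<circ> fst" and head_tgraph: "head (tgraph W A) = contract W \<circ> snd"
  by (auto simp: tgraph_def)

lemma contract_eq_Some [simp]: "contract W x = Some v \<longleftrightarrow> x = v \<and> v \<in> W"
  and contract_eq_None [simp]: "contract W x = None \<longleftrightarrow> x \<notin> W"
  and contract_mem [simp]: "x \<in> W \<Longrightarrow> contract W x = Some x"
  and contract_in [simp]: "contract W x \<in> insert None (Some ` W)"
  by (auto simp: contract_def)

lemma wf_tgraph: "wf_digraph (tgraph W A)"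
  by unfold_locales (simp_all only: tgraph_simps contract_in)

lemma walk_simps:
  "pre_digraph.cas G u [] v \<longleftrightarrow> u = v"
  "pre_digraph.cas G u (a # p) v \<longleftrightarrow> tail G a = u \<and> pre_digraph.cas G (head G a) p v"
  "pre_digraph.awalk_verts G u [] = [u]"
  "pre_digraph.awalk_verts G u (a # p) = tail G a # pre_digraph.awalk_verts G (head G a) p"
  by (simp_all add: pre_digraph.cas.simps pre_digraph.awalk_verts.simps)

lemma awalk_verts_eq_Cons: "pre_digraph.cas G u p v \<Longrightarrow> pre_digraph.awalk_verts G u p = u # tl (pre_digraph.awalk_verts G u p)"
  by (cases p) (auto simp: walk_simps)

lemma cas_append_iff: "pre_digraph.cas G u p m \<Longrightarrow> pre_digraph.cas G u (p @ q) v \<longleftrightarrow> pre_digraph.cas G m q v"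
  by (induction p arbitrary: u) (auto simp: walk_simps)

lemma awalk_verts_append_tl:
  "pre_digraph.cas G u p m \<Longrightarrow> pre_digraph.cas G m q v \<Longrightarrow>
    pre_digraph.awalk_verts G u (p @ q) = pre_digraph.awalk_verts G u p @ tl (pre_digraph.awalk_verts G m q)"
  by (induction p arbitrary: u) (auto simp: walk_simps intro: awalk_verts_eq_Cons)

lemma closed_walk_tails_heads:
  assumes "pre_digraph.cas G u p u" "p \<noteq> []"
  shows "tail G ` set p = head G ` set p"
proof -
  have "insert v (tail G ` set p) = insert u (head G ` set p) \<and> u \<in> tail G ` set p \<and> v \<in> head G ` set p"
    if "pre_digraph.cas G u p v" "p \<noteq> []" for u v p
    using that
  proof (induction p arbitrary: u)
    case (Cons a p)
    show ?case
    proof (cases "p = []")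
      case False
      with Cons show ?thesis by (simp add: walk_simps) blast
    qed (use Cons in \<open>auto simp: walk_simps\<close>)
  qed simp
  from this[OF assms] show ?thesis by (metis insert_absorb)
qed

section \<open>The tree of an acyclic successor function\<close>

locale rooted_forest =
  fixes W :: "'a set" and F :: "'a \<Rightarrow> 'a option"
  assumes finite_W: "finite W"
    and dom_F: "v \<in> W \<longleftrightarrow> F v \<noteq> None"
    and acyclic_F: "acyclic (steps F)"
begin

definition A :: "('a \<times> 'a) set" where "A = {(v, w). F v = Some w \<or> F w = Some v}"

definition height :: "'a option \<Rightarrow> nat" where
  "height s = (case s of None \<Rightarrow> 0 | Some v \<Rightarrow> card {y \<in> W. leads F v y})"

definition par :: "'a option rel" where "par = {(Some v, contract W w) | v w. F v = Some w}"

abbreviation "T \<equiv> tgraph W A"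

lemma step_W: "F v = Some w \<Longrightarrow> v \<in> W"
  using dom_F by auto

lemma height_step:
  assumes "F v = Some w"
  shows "height (Some v) = Suc (height (contract W w))"
proof -
  have "\<not> leads F w v"
  proof
    assume "leads F w v"
    then have "(v, v) \<in> (steps F)\<^sup>+" using assms unfolding leads_def steps_def by (meson CollectI case_prodI rtrancl_into_trancl2)
    then show False using acyclic_F by (simp add: acyclic_def)
  qed
  moreover have "{y \<in> W. leads F v y} = insert v {y \<in> W. leads F w y}"
    using assms step_W[OF assms] by (subst leads_unfold) auto
  ultimately have "card {y \<in> W. leads F v y} = Suc (card {y \<in> W. leads F w y})"
    using finite_W by simp
  moreover have "card {y \<in> W. leads F w y} = 0" if "w \<notin> W"
  proof -
    have "{y \<in> W. leads F w y} = {}" using that dom_F by (subst leads_unfold) auto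
    then show ?thesis by (simp only: card.empty)
  qed
  ultimately show ?thesis by (auto simp: height_def contract_def)
qed

lemma height_par: "(s, t) \<in> par \<Longrightarrow> height s = Suc (height t)"
  using height_step by (auto simp: par_def)

lemma height_par_rtrancl: "(s, t) \<in> par\<^sup>* \<Longrightarrow> height t \<le> height s"
  by (induction rule: rtrancl_induct) (auto dest: height_par)

lemma par_None: "s \<in> verts T \<Longrightarrow> (s, None) \<in> par\<^sup>*"
proof (induction "height s" arbitrary: s rule: less_induct)
  case less
  show ?case
  proof (cases s)
    case (Some v)
    then obtain w where w: "F v = Some w" using less.prems dom_F by auto
    then have "(s, contract W w) \<in> par" using Some by (auto simp: par_def)
    moreover have "(contract W w, None) \<in> par\<^sup>*"
      using height_step[OF w] Some by (intro less.hyps) (auto simp: contract_def)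
    ultimately show ?thesis by (rule converse_rtrancl_into_rtrancl)
  qed simp
qed

text \<open>The clauses on heights and on the naming of arcs are what is needed to glue an ascending
  and a descending walk into a simple cycle.\<close>

lemma upward_path:
  assumes "(s, m) \<in> par\<^sup>*"
  shows "\<exists>p. pre_digraph.cas T s p m \<and> distinct (pre_digraph.awalk_verts T s p) \<and>
    (\<forall>z\<in>set (pre_digraph.awalk_verts T s p). (s, z) \<in> par\<^sup>* \<and> (z = m \<or> height m < height z)) \<and>
    (\<forall>b\<in>set p. F (fst b) = Some (snd b) \<and> Some (fst b) \<in> set (pre_digraph.awalk_verts T s p) - {m})"
  using assms
proof (induction rule: converse_rtrancl_induct)
  case base
  show ?case by (intro exI[of _ "[]"]) (simp add: walk_simps)
next
  case (step s s')
  then obtain p where p: "pre_digraph.cas T s' p m" "distinct (pre_digraph.awalk_verts T s' p)"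
    "\<And>z. z \<in> set (pre_digraph.awalk_verts T s' p) \<Longrightarrow> (s', z) \<in> par\<^sup>* \<and> (z = m \<or> height m < height z)"
    "\<And>b. b \<in> set p \<Longrightarrow> F (fst b) = Some (snd b) \<and> Some (fst b) \<in> set (pre_digraph.awalk_verts T s' p) - {m}"
    by blast
  obtain v w where vw: "s = Some v" "s' = contract W w" "F v = Some w" using step.hyps(1) by (auto simp: par_def)
  have h: "height z < height s" if "(s', z) \<in> par\<^sup>*" for z
    using height_par_rtrancl[OF that] height_par[OF step.hyps(1)] by simp
  have hm: "height m < height s" by (rule h[OF step.hyps(2)])
  have v: "contract W v = s" using vw step_W by simp
  have V: "pre_digraph.awalk_verts T s ((v, w) # p) = s # pre_digraph.awalk_verts T s' p"
    using vw v by (simp add: walk_simps)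
  have "s \<notin> set (pre_digraph.awalk_verts T s' p)" using p(3) h by blast
  moreover have "(s, z) \<in> par\<^sup>*" if "(s', z) \<in> par\<^sup>*" for z using that step.hyps(1) by (rule converse_rtrancl_into_rtrancl[rotated])
  ultimately show ?case
    using p hm vw v by (intro exI[of _ "(v, w) # p"]) (auto simp: V walk_simps)
qed

lemma downward_path:
  assumes "(s, m) \<in> par\<^sup>*"
  shows "\<exists>p. pre_digraph.cas T m p s \<and> distinct (pre_digraph.awalk_verts T m p) \<and>
    (\<forall>z\<in>set (pre_digraph.awalk_verts T m p). (s, z) \<in> par\<^sup>* \<and> (z = m \<or> height m < height z)) \<and>
    (\<forall>b\<in>set p. F (snd b) = Some (fst b) \<and> Some (snd b) \<in> set (pre_digraph.awalk_verts T m p) - {m})"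
  using assms
proof (induction rule: converse_rtrancl_induct)
  case base
  show ?case by (intro exI[of _ "[]"]) (simp add: walk_simps)
next
  case (step s s')
  then obtain p where p: "pre_digraph.cas T m p s'" "distinct (pre_digraph.awalk_verts T m p)"
    "\<And>z. z \<in> set (pre_digraph.awalk_verts T m p) \<Longrightarrow> (s', z) \<in> par\<^sup>* \<and> (z = m \<or> height m < height z)"
    "\<And>b. b \<in> set p \<Longrightarrow> F (snd b) = Some (fst b) \<and> Some (snd b) \<in> set (pre_digraph.awalk_verts T m p) - {m}"
    by blast
  obtain v w where vw: "s = Some v" "s' = contract W w" "F v = Some w" using step.hyps(1) by (auto simp: par_def)
  have h: "height z < height s" if "(s', z) \<in> par\<^sup>*" for z
    using height_par_rtrancl[OF that] height_par[OF step.hyps(1)] by simp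
  have hm: "height m < height s" by (rule h[OF step.hyps(2)])
  have v: "contract W v = s" using vw step_W by simp
  have c: "pre_digraph.cas T s' [(w, v)] s" using vw v by (simp add: walk_simps)
  have V: "pre_digraph.awalk_verts T m (p @ [(w, v)]) = pre_digraph.awalk_verts T m p @ [s]"
    using awalk_verts_append_tl[OF p(1) c] vw v by (simp add: walk_simps)
  have C: "pre_digraph.cas T m (p @ [(w, v)]) s" using cas_append_iff[OF p(1)] c by simp
  have "s \<notin> set (pre_digraph.awalk_verts T m p)" using p(3) h by blast
  moreover have "(s, z) \<in> par\<^sup>*" if "(s', z) \<in> par\<^sup>*" for z using that step.hyps(1) by (rule converse_rtrancl_into_rtrancl[rotated])
  ultimately show ?case
    using p hm vw C by (intro exI[of _ "p @ [(w, v)]"]) (auto simp: V)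
qed

text \<open>At a vertex of maximal height on a closed walk, the arc that enters and the arc that
  leaves both join it to its parent. There is only one such edge, so one arc is the reverse of the
  other.\<close>

lemma no_cycle: "\<not> (\<exists>p. pre_digraph.cycle T p \<and> (\<forall>a\<in>set p. prod.swap a \<notin> set p))"
proof
  assume "\<exists>p. pre_digraph.cycle T p \<and> (\<forall>a\<in>set p. prod.swap a \<notin> set p)"
  then obtain p u where p: "pre_digraph.cas T u p u" "p \<noteq> []" "set p \<subseteq> A" "\<And>a. a \<in> set p \<Longrightarrow> prod.swap a \<notin> set p"
    by (auto simp: pre_digraph.cycle_def pre_digraph.awalk_def)
  let ?H = "head T ` set p"
  have TH: "tail T ` set p = ?H" by (rule closed_walk_tails_heads[OF p(1,2)])
  have "finite (height ` ?H)" "height ` ?H \<noteq> {}" using p(2) by auto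
  then have "Max (height ` ?H) \<in> height ` ?H" by (rule Max_in)
  then obtain x where "x \<in> ?H" "Max (height ` ?H) = height x" by blast
  then have x: "x \<in> ?H" "\<And>y. y \<in> ?H \<Longrightarrow> height y \<le> height x"
    using Max_ge[OF \<open>finite (height ` ?H)\<close>] by (metis, metis imageI)
  obtain a where a: "a \<in> set p" "x = head T a" using x(1) by blast
  obtain b where b: "b \<in> set p" "x = tail T b" using x(1) TH by blast
  have up: False if "F (fst a) = Some (snd a)"
  proof -
    have "height (tail T a) = Suc (height x)" using height_step[OF that] step_W[OF that] a(2) by simp
    moreover have "tail T a \<in> ?H" using a(1) TH by blast
    ultimately show False using x(2)[of "tail T a"] by simp
  qed
  have down: False if "F (snd b) = Some (fst b)"
  proof -
    have "height (head T b) = Suc (height x)" using height_step[OF that] step_W[OF that] b(2) by simp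
    then show False using x(2)[of "head T b"] b(1) by simp
  qed
  have "F (snd a) = Some (fst a)" "F (fst b) = Some (snd b)"
    using a(1) b(1) p(3) up down by (auto simp: A_def)
  moreover have "fst b = snd a"
    using a(2) b(2) step_W[OF \<open>F (snd a) = _\<close>] step_W[OF \<open>F (fst b) = _\<close>] by simp
  ultimately have "b = prod.swap a" by (simp add: prod_eq_iff)
  then show False using p(4)[OF a(1)] b(1) by simp
qed

lemma up_in_A: "F (fst b) = Some (snd b) \<Longrightarrow> b \<in> A" and down_in_A: "F (snd b) = Some (fst b) \<Longrightarrow> b \<in> A"
  by (auto simp: A_def case_prod_unfold)

lemma connected_T: "Digraph_Component.connected T"
proof -
  let ?R = "arcs_ends (with_proj (mk_symmetric T))"
  have par_R: "(s, t) \<in> ?R \<and> (t, s) \<in> ?R" if st: "(s, t) \<in> par" for s t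
  proof -
    obtain v w where vw: "s = Some v" "t = contract W w" "F v = Some w" using st by (auto simp: par_def)
    have "(s, t) = (tail T (v, w), head T (v, w))" "(v, w) \<in> arcs T" using vw step_W by (auto simp: A_def)
    then show ?thesis unfolding arcs_ends_conv by (force simp: parcs_mk_symmetric)
  qed
  have V: "(s, t) \<in> par \<Longrightarrow> s \<in> verts T \<and> t \<in> verts T" for s t
    unfolding par_def using step_W by (auto simp del: contract_eq_Some simp: contract_def)
  have "(s, None) \<in> rtrancl_on (verts T) ?R \<and> (None, s) \<in> rtrancl_on (verts T) ?R" if "s \<in> verts T" for s
  proof -
    have "(s, None) \<in> par\<^sup>*" using that by (rule par_None)
    then show ?thesis
    proof (induction rule: converse_rtrancl_induct)
      case (step y z)
      then show ?case using par_R[OF step.hyps(1)] V[OF step.hyps(1)]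
        by (meson converse_rtrancl_on_into_rtrancl_on rtrancl_on_into_rtrancl_on)
    qed (auto intro: rtrancl_on_refl)
  qed
  then show ?thesis unfolding connected_def strongly_connected_def reachable_def
    by (auto intro: rtrancl_on_trans)
qed

text \<open>Parent arcs give a simple walk to the boundary. Conversely, a simple walk that starts
  with a descent cannot turn: the only arc up from a vertex returns to the one just left. Such a
  walk never arrives at the boundary.\<close>

lemma orient_T: "orient_towards None T = {(v, w). F v = Some w}"
proof (intro set_eqI iffI)
  fix a assume "a \<in> {(v, w). F v = Some w}"
  then have a: "F (fst a) = Some (snd a)" by auto
  then have "fst a \<in> W" by (rule step_W)
  then have "(Some (fst a), None) \<in> par\<^sup>*" by (intro par_None) auto
  from upward_path[OF this] obtain p where p: "pre_digraph.cas T (Some (fst a)) p None"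
    "distinct (pre_digraph.awalk_verts T (Some (fst a)) p)" "\<forall>b\<in>set p. F (fst b) = Some (snd b)" by blast
  then obtain b q where q: "p = b # q" by (cases p) (auto simp: walk_simps)
  then have "fst b = fst a" "F (fst b) = Some (snd b)" using p by (auto simp: walk_simps)
  then have "b = a" using a by (simp add: prod_eq_iff)
  moreover have "set p \<subseteq> A" using p(3) up_in_A by blast
  ultimately have "pre_digraph.apath T (tail T a) (a # q) None"
    using p q \<open>fst a \<in> W\<close> by (simp add: pre_digraph.apath_def pre_digraph.awalk_def)
  then show "a \<in> orient_towards None T"
    unfolding orient_towards_def using up_in_A[OF a] by auto
next
  fix a assume "a \<in> orient_towards None T"
  then obtain p where a: "a \<in> A" "pre_digraph.apath T (tail T a) (a # p) None" unfolding orient_towards_def by auto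
  show "a \<in> {(v, w). F v = Some w}"
  proof (rule ccontr)
    assume "a \<notin> {(v, w). F v = Some w}"
    then have d: "F (snd a) = Some (fst a)" using a(1) by (auto simp: A_def)
    have no: False if "F v = Some w" "pre_digraph.cas T (Some v) p None" "set p \<subseteq> A"
        "distinct (contract W w # pre_digraph.awalk_verts T (Some v) p)" for v w p
      using that
    proof (induction p arbitrary: v w)
      case (Cons b p)
      have b: "fst b = v" "v \<in> W" using Cons.prems(2) by (auto simp: walk_simps)
      have V: "pre_digraph.awalk_verts T (head T b) p = head T b # tl (pre_digraph.awalk_verts T (head T b) p)"
        using Cons.prems(2) by (intro awalk_verts_eq_Cons[where v = None]) (auto simp: walk_simps)
      show ?case
      proof (cases "F v = Some (snd b)")
        case True
        then have "contract W w = head T b" using Cons.prems(1) by simp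
        then have "contract W w \<in> set (pre_digraph.awalk_verts T (head T b) p)" by (subst V) simp
        then show False using Cons.prems(4) by (simp add: walk_simps)
      next
        case False
        then have F: "F (snd b) = Some v" using Cons.prems(3) b by (auto simp: A_def)
        then have h: "head T b = Some (snd b)" using step_W by simp
        show False
          using Cons.prems(2-4) b h by (intro Cons.IH[OF F]) (auto simp: walk_simps)
      qed
    qed (simp add: walk_simps)
    have "snd a \<in> W" using d by (rule step_W)
    with a(2) d show False
      by (intro no[of "snd a" "fst a" p]) (auto simp: pre_digraph.apath_def pre_digraph.awalk_def walk_simps)
  qed
qed

text \<open>From the ends of \<open>a\<close> the parent arcs ascend to a common ancestor of maximal
  height, below which the two branches are disjoint; with \<open>a\<close> they form a cycle. Arcs
  are compared by name and not by end points, so this also covers an \<open>a\<close> that is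
  parallel to an edge of the tree.\<close>

lemma cycle_through:
  assumes "a \<notin> A" "fst a \<noteq> snd a" "fst a \<in> W \<or> snd a \<in> W"
  shows "\<exists>p. set p \<subseteq> insert a A \<and> pre_digraph.cycle (tgraph W (insert a (insert (prod.swap a) A))) p \<and>
    (\<forall>b\<in>set p. prod.swap b \<notin> set p)"
proof -
  define sx sy where "sx = contract W (fst a)" "sy = contract W (snd a)"
  let ?C = "{m. (sx, m) \<in> par\<^sup>* \<and> (sy, m) \<in> par\<^sup>*}"
  have "None \<in> ?C" by (simp add: sx_sy_def par_None contract_in del: contract_eq_Some)
  moreover have "height m \<le> height sx" if "m \<in> ?C" for m using that height_par_rtrancl by blast
  ultimately obtain m where m: "m \<in> ?C" "\<And>z. z \<in> ?C \<Longrightarrow> height z \<le> height m"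
    using ex_has_greatest_nat[of "\<lambda>m. m \<in> ?C" None height "Suc (height sx)"] by (metis (no_types, lifting) less_Suc_eq_le)
  let ?T = "tgraph W (insert a (insert (prod.swap a) A))"
  have cas: "pre_digraph.cas ?T = pre_digraph.cas T" and vs: "pre_digraph.awalk_verts ?T = pre_digraph.awalk_verts T"
  proof -
    have "pre_digraph.cas ?T u p v = pre_digraph.cas T u p v" "pre_digraph.awalk_verts ?T u p = pre_digraph.awalk_verts T u p" for u p v
      by (induction p arbitrary: u) (simp_all add: walk_simps)
    then show "pre_digraph.cas ?T = pre_digraph.cas T" "pre_digraph.awalk_verts ?T = pre_digraph.awalk_verts T" by blast+
  qed
  obtain p where p: "pre_digraph.cas T sy p m" "distinct (pre_digraph.awalk_verts T sy p)"
    "\<And>z. z \<in> set (pre_digraph.awalk_verts T sy p) \<Longrightarrow> (sy, z) \<in> par\<^sup>* \<and> (z = m \<or> height m < height z)"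
    "\<And>b. b \<in> set p \<Longrightarrow> F (fst b) = Some (snd b) \<and> Some (fst b) \<in> set (pre_digraph.awalk_verts T sy p) - {m}"
    using upward_path[of sy m] m(1) by blast
  obtain q where q: "pre_digraph.cas T m q sx" "distinct (pre_digraph.awalk_verts T m q)"
    "\<And>z. z \<in> set (pre_digraph.awalk_verts T m q) \<Longrightarrow> (sx, z) \<in> par\<^sup>* \<and> (z = m \<or> height m < height z)"
    "\<And>b. b \<in> set q \<Longrightarrow> F (snd b) = Some (fst b) \<and> Some (snd b) \<in> set (pre_digraph.awalk_verts T m q) - {m}"
    using downward_path[of sx m] m(1) by blast
  have common: "z = m" if "z \<in> set (pre_digraph.awalk_verts T sy p)" "z \<in> set (pre_digraph.awalk_verts T m q)" for z
    using m(2)[of z] p(3)[OF that(1)] q(3)[OF that(2)] by auto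
  define c where "c = a # p @ q"
  have "pre_digraph.cas T sx c sx"
    using cas_append_iff[OF p(1), of q sx] q(1) by (simp add: c_def walk_simps sx_sy_def)
  moreover have "tl (pre_digraph.awalk_verts T sx c) = pre_digraph.awalk_verts T sy p @ tl (pre_digraph.awalk_verts T m q)"
    using awalk_verts_append_tl[OF p(1) q(1)] by (simp add: c_def walk_simps sx_sy_def)
  moreover have "distinct (pre_digraph.awalk_verts T sy p @ tl (pre_digraph.awalk_verts T m q))"
  proof -
    have V: "pre_digraph.awalk_verts T m q = m # tl (pre_digraph.awalk_verts T m q)" by (rule awalk_verts_eq_Cons[OF q(1)])
    have "m \<notin> set (tl (pre_digraph.awalk_verts T m q))" "distinct (tl (pre_digraph.awalk_verts T m q))"
      using q(2) by (subst (asm) V, simp)+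
    moreover have "set (tl (pre_digraph.awalk_verts T m q)) \<subseteq> set (pre_digraph.awalk_verts T m q)"
      by (subst (2) V) auto
    ultimately show ?thesis using p(2) common by auto
  qed
  moreover have A: "set p \<subseteq> A" "set q \<subseteq> A" using p(4) q(4) up_in_A down_in_A by blast+
  moreover have sw_c: "prod.swap b \<notin> set c" if "b \<in> set c" for b
  proof -
    have sw: "prod.swap b \<in> A \<longleftrightarrow> b \<in> A" for b by (auto simp: A_def case_prod_unfold)
    have asym: False if "F v = Some w" "F w = Some v" for v w
    proof -
      have "contract W w = Some w" "contract W v = Some v" using that step_W by auto
      then show False using height_step[OF that(1)] height_step[OF that(2)] by simp
    qed
    have a: "prod.swap a \<notin> set c"
      using assms(1,2) A sw[of a] by (auto simp: c_def prod_eq_iff)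
    have pp: "prod.swap b \<notin> set p" if "b \<in> set p" for b
      using p(4)[OF that] p(4)[of "prod.swap b"] asym by auto
    have qq: "prod.swap b \<notin> set q" if "b \<in> set q" for b
      using q(4)[OF that] q(4)[of "prod.swap b"] asym by auto
    have pq: "prod.swap b \<notin> set q" if "b \<in> set p" for b
      using p(4)[OF that] q(4)[of "prod.swap b"] common[of "Some (fst b)"] by auto
    have qp: "prod.swap b \<notin> set p" if "b \<in> set q" for b
      using pq[of "prod.swap b"] that by auto
    have ne: "prod.swap b \<noteq> a" if "b \<in> set p \<union> set q" for b
    proof
      assume "prod.swap b = a"
      then have "prod.swap a = b" by (metis swap_swap)
      then have "prod.swap a \<in> set c" using that by (simp add: c_def)
      with a show False by contradiction
    qed
    from that consider "b = a" | "b \<in> set p" | "b \<in> set q" unfolding c_def by (metis UnE set_ConsD set_append)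
    then show ?thesis
    proof cases
      case 1
      then show ?thesis using a by simp
    next
      case 2
      then show ?thesis unfolding c_def using pp pq ne by (metis UnE UnI1 set_ConsD set_append)
    next
      case 3
      then show ?thesis unfolding c_def using qq qp ne by (metis UnE UnI2 set_ConsD set_append)
    qed
  qed
  moreover have "sx \<in> verts ?T" by (simp add: sx_sy_def contract_in del: contract_eq_Some)
  moreover have "set c \<subseteq> insert a A" "c \<noteq> []" using A by (auto simp: c_def)
  moreover have "insert a A \<subseteq> arcs ?T" by auto
  ultimately have "pre_digraph.awalk ?T sx c sx \<and> distinct (tl (pre_digraph.awalk_verts ?T sx c)) \<and> c \<noteq> []"
    unfolding pre_digraph.awalk_def cas vs by (metis subset_trans)
  then have "pre_digraph.cycle ?T c" unfolding pre_digraph.cycle_def by blast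
  then show ?thesis using \<open>set c \<subseteq> insert a A\<close> sw_c by blast
qed

end

section \<open>Spanning trees of the wired graph as successor functions\<close>

context regular_graph
begin

definition full_forests :: "'a set \<Rightarrow> ('a \<Rightarrow> 'a option) set" where
  "full_forests W = {F \<in> forests W. \<forall>v\<in>W. F v \<noteq> None}"

abbreviation "nbgraph \<equiv> \<lparr>verts = UNIV, arcs = {(x, y). y \<in> nb x}, tail = fst, head = snd\<rparr>"

lemma full_forest: "finite W \<Longrightarrow> F \<in> full_forests W \<Longrightarrow> rooted_forest W F"
  by unfold_locales (auto simp: full_forests_def forests_def)

lemma wired_nbgraph: "wired nbgraph W = tgraph W {(x, y). y \<in> nb x \<and> (x \<in> W \<or> y \<in> W)}"
  by (auto simp: wired_def tgraph_def)

lemma ust_iff: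
  "undirected_spanning_tree T (wired nbgraph W) \<longleftrightarrow> T = tgraph W (arcs T) \<and>
    arcs T \<subseteq> {(x, y). y \<in> nb x \<and> (x \<in> W \<or> y \<in> W)} \<and> prod.swap ` arcs T = arcs T \<and> Digraph_Component.connected T \<and>
     \<not> (\<exists>p. pre_digraph.cycle T p \<and> (\<forall>a \<in> set p. prod.swap a \<notin> set p))"
proof -
  have "spanning T (wired nbgraph W) \<longleftrightarrow> T = tgraph W (arcs T) \<and> arcs T \<subseteq> {(x, y). y \<in> nb x \<and> (x \<in> W \<or> y \<in> W)}"
    (is "?l \<longleftrightarrow> ?r")
  proof
    assume ?l
    then show ?r unfolding wired_nbgraph spanning_def subgraph_def compatible_def
      by (cases T) (auto simp: tgraph_def)
  next
    assume ?r
    then obtain B where "T = tgraph W B" "B \<subseteq> {(x, y). y \<in> nb x \<and> (x \<in> W \<or> y \<in> W)}" by blast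
    then show ?l unfolding wired_nbgraph spanning_def subgraph_def compatible_def
      using wf_tgraph by (auto simp: tail_tgraph head_tgraph)
  qed
  then show ?thesis unfolding undirected_spanning_tree_def by blast
qed

lemma ust_of_forest:
  assumes "finite W" "F \<in> full_forests W"
  shows "undirected_spanning_tree (tgraph W (rooted_forest.A F)) (wired nbgraph W)"
proof -
  interpret rf: rooted_forest W F by (rule full_forest[OF assms])
  have "rf.A \<subseteq> {(x, y). y \<in> nb x \<and> (x \<in> W \<or> y \<in> W)}"
    using assms(2) rf.step_W nb_sym by (auto simp: rf.A_def full_forests_def forests_def)
  moreover have "prod.swap ` rf.A = rf.A" by (force simp: rf.A_def image_iff)
  ultimately show ?thesis unfolding ust_iff using rf.connected_T rf.no_cycle by simp
qed

text \<open>Each vertex is sent along an arc of the tree that decreases the distance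
  \<open>rk\<close> to the boundary vertex. The resulting tree lies in the given one, and any
  further arc would close a cycle by \<open>cycle_through\<close>.\<close>

lemma forest_of_ust:
  assumes irr: "\<And>x. x \<notin> nb x" and W: "finite W" and T: "undirected_spanning_tree T (wired nbgraph W)"
  shows "\<exists>F\<in>full_forests W. T = tgraph W (rooted_forest.A F)"
proof -
  define B where "B = arcs T"
  note T = T[unfolded ust_iff, folded B_def]
  have TB: "T = tgraph W B" using T by simp
  define E where "E = (\<lambda>a. (contract W (fst a), contract W (snd a))) ` B"
  have sym: "(y, x) \<in> B" if "(x, y) \<in> B" for x y using T that by (metis (no_types, lifting) image_eqI swap_simp)
  have "arcs_ends (with_proj (mk_symmetric T)) = E"
    unfolding TB arcs_ends_conv E_def using sym by (force simp: parcs_mk_symmetric)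
  then have conn: "(s, None) \<in> E\<^sup>*" if "s \<in> verts T" for s
    using T that unfolding connected_def strongly_connected_def reachable_def
    by (metis TB insertI1 pverts_mk_symmetric rtrancl_on_rtranclI tgraph_simps(1) with_proj_simps(1))
  define rk where "rk s = (LEAST n. (s, None) \<in> E ^^ n)" for s
  have rk: "(s, None) \<in> E ^^ rk s" if "s \<in> verts T" for s
    unfolding rk_def using conn[OF that] by (metis LeastI rtrancl_imp_relpow)
  have "\<exists>w. (v, w) \<in> B \<and> rk (contract W w) < rk (Some v)" if v: "v \<in> W" for v
  proof -
    have R: "(Some v, None) \<in> E ^^ rk (Some v)" using v by (intro rk) (simp add: TB)
    then obtain n where n: "rk (Some v) = Suc n" by (cases "rk (Some v)") auto
    then obtain s where s: "(Some v, s) \<in> E" "(s, None) \<in> E ^^ n" using R relpow_Suc_D2 by metis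
    from s(1) obtain a where "a \<in> B" "(Some v, s) = (contract W (fst a), contract W (snd a))" unfolding E_def by blast
    then have a: "a \<in> B" "contract W (fst a) = Some v" "s = contract W (snd a)" by (metis prod.inject)+
    have "rk s \<le> n" unfolding rk_def using s(2) by (rule Least_le)
    then show ?thesis using a n by (intro exI[of _ "snd a"]) (auto simp: less_Suc_eq_le)
  qed
  then obtain nx where nx: "\<And>v. v \<in> W \<Longrightarrow> (v, nx v) \<in> B \<and> rk (contract W (nx v)) < rk (Some v)" by metis
  define F where "F v = (if v \<in> W then Some (nx v) else None)" for v
  have FS: "F v = Some w \<Longrightarrow> v \<in> W \<and> w = nx v" for v w by (auto simp: F_def split: if_splits)
  \<comment> \<open>Ranks in \<open>W\<close> are raised by one and those outside set to 0, so a
    step out of \<open>W\<close> decreases them too.\<close>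
  have "steps F \<subseteq> (inv_image less_than (\<lambda>v. if v \<in> W then Suc (rk (Some v)) else 0))\<inverse>"
  proof (rule subrelI)
    fix v w assume "(v, w) \<in> steps F"
    then have "v \<in> W" "w = nx v" using FS by (auto simp: steps_def)
    with nx[of v] show "(v, w) \<in> (inv_image less_than (\<lambda>v. if v \<in> W then Suc (rk (Some v)) else 0))\<inverse>"
      by (cases "w \<in> W") auto
  qed
  moreover have "acyclic ((inv_image less_than (\<lambda>v. if v \<in> W then Suc (rk (Some v)) else 0))\<inverse>)"
    unfolding acyclic_converse by (intro wf_acyclic wf_inv_image wf_less_than)
  ultimately have "acyclic (steps F)" by (rule acyclic_subset[rotated])
  then have full: "F \<in> full_forests W"
  proof -
    have "w \<in> nb v" if "F v = Some w" for v w using FS[OF that] nx[of v] T by auto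
    moreover have "F v = None \<longleftrightarrow> v \<notin> W" for v by (simp add: F_def)
    ultimately show ?thesis using \<open>acyclic (steps F)\<close> by (auto simp: full_forests_def forests_def)
  qed
  interpret rf: rooted_forest W F by (rule full_forest[OF W full])
  have AB: "rf.A \<subseteq> B"
  proof (rule subrelI)
    fix v w assume "(v, w) \<in> rf.A"
    then show "(v, w) \<in> B" using FS[of v w] FS[of w v] nx[of v] nx[of w] sym by (auto simp: rf.A_def)
  qed
  have "a \<in> rf.A" if a: "a \<in> B" for a
  proof (rule ccontr)
    assume no: "a \<notin> rf.A"
    have "fst a \<noteq> snd a" "fst a \<in> W \<or> snd a \<in> W" using T a irr by auto
    from rf.cycle_through[OF no this] obtain p where p: "set p \<subseteq> insert a rf.A"
      "pre_digraph.cycle (tgraph W (insert a (insert (prod.swap a) rf.A))) p" "\<forall>b\<in>set p. prod.swap b \<notin> set p" by blast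
    have eq: "pre_digraph.cas (tgraph W C) u q v = pre_digraph.cas T u q v"
      "pre_digraph.awalk_verts (tgraph W C) u q = pre_digraph.awalk_verts T u q" for C u q v
      unfolding TB by (induction q arbitrary: u) (simp_all add: walk_simps)
    have "set p \<subseteq> B" using p(1) AB a by auto
    then have "pre_digraph.cycle T p"
      using p(2) unfolding pre_digraph.cycle_def pre_digraph.awalk_def eq by (auto simp: TB)
    then show False using T p(3) by blast
  qed
  then have "rf.A = B" using AB by blast
  then show ?thesis using TB full by blast
qed

lemma sum_full_forests: "finite W \<Longrightarrow> wsum 0 W f = sum f (full_forests W)"
proof -
  assume W: "finite W"
  have "wt 0 W F * f F = (if \<forall>v\<in>W. F v \<noteq> None then f F else 0)" for F
  proof (cases "\<forall>v\<in>W. F v \<noteq> None")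
    case True
    then have "wt 0 W F = 1" unfolding wt_def by (intro prod.neutral) auto
    then show ?thesis using True by simp
  next
    case False
    then have "wt 0 W F = 0" unfolding wt_def using W by (intro prod_zero) auto
    then show ?thesis unfolding if_not_P[OF False] by simp
  qed
  then show ?thesis
    using W unfolding wsum_def full_forests_def by (simp only: sum.inter_filter finite_forests)
qed

text \<open>Orienting the tree recovers the successor function, so the map to trees is injective;
  the uniform tree corresponds to the uniform full successor function, and at \<kappa> = 0 the
  weight counts these.\<close>

theorem expectation_oriented_UST:
  assumes irr: "\<And>x. x \<notin> nb x" and W: "finite W"
  shows "measure_pmf.expectation (oriented_UST_wired nbgraph W) f = ex 0 W (\<lambda>F. f (\<lambda>a. F (fst a) = Some (snd a)))"
proof -
  let ?T = "\<lambda>F. tgraph W (rooted_forest.A F)" and ?R = "full_forests W"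
  let ?g = "\<lambda>F a. F (fst a) = Some (snd a)"
  have fin: "finite ?R" using W by (auto simp: full_forests_def)
  have card: "Z 0 W = real (card ?R)" by (simp add: sum_full_forests[OF W])
  then have ne: "?R \<noteq> {}" using Z_pos[OF W, of 0] by auto
  have ori: "(\<lambda>a. a \<in> orient_towards None (?T F)) = ?g F" if "F \<in> ?R" for F
    using rooted_forest.orient_T[OF full_forest[OF W that]] by auto
  have inj: "inj_on ?T ?R"
  proof (rule inj_onI)
    fix F F' assume F: "F \<in> ?R" "F' \<in> ?R" "?T F = ?T F'"
    then have "?g F = ?g F'" using ori by metis
    then have "F v = Some w \<longleftrightarrow> F' v = Some w" for v w by (metis fst_conv snd_conv)
    then show "F = F'" by (metis not_Some_eq option.exhaust ext)
  qed
  have set: "{T. undirected_spanning_tree T (wired nbgraph W)} = ?T ` ?R"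
    using ust_of_forest[OF W] forest_of_ust[OF irr W] by blast
  have "oriented_UST_wired nbgraph W = map_pmf (\<lambda>T a. a \<in> orient_towards None T) (map_pmf ?T (pmf_of_set ?R))"
    unfolding oriented_UST_wired_def set using map_pmf_of_set_inj[OF inj ne fin] by simp
  also have "\<dots> = map_pmf ?g (pmf_of_set ?R)"
    unfolding map_pmf_comp by (intro map_pmf_cong refl) (use ori fin ne in auto)
  finally show ?thesis
    using fin ne by (simp add: integral_pmf_of_set ex_def card sum_full_forests[OF W])
qed

end

section \<open>Path probabilities in infinite volume\<close>

text \<open>Convergence along all finite sets, not only along one sequence, makes the limits
  independent of the exhaustion and thereby translation invariant.\<close>

lemma filterlim_monotone_sup:
  fixes h :: "'a set \<Rightarrow> real"
  assumes X: "finite X" and mono: "\<And>V V'. finite V' \<Longrightarrow> X \<subseteq> V \<Longrightarrow> V \<subseteq> V' \<Longrightarrow> h V \<le> h V'"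
    and B: "\<And>V. finite V \<Longrightarrow> X \<subseteq> V \<Longrightarrow> h V \<le> B"
  shows "\<exists>l. (h \<longlongrightarrow> l) (finite_subsets_at_top UNIV)"
proof
  let ?S = "h ` {V. finite V \<and> X \<subseteq> V}"
  have bdd: "bdd_above ?S" using B by (intro bdd_aboveI2[of _ _ B]) auto
  have ne: "?S \<noteq> {}" using X by auto
  show "(h \<longlongrightarrow> Sup ?S) (finite_subsets_at_top UNIV)"
  proof (rule increasing_tendsto)
    show "eventually (\<lambda>V. h V \<le> Sup ?S) (finite_subsets_at_top UNIV)"
      unfolding eventually_finite_subsets_at_top
      by (intro exI[of _ X]) (auto intro!: X cSup_upper[OF _ bdd])
    fix x assume "x < Sup ?S"
    then obtain V where V: "finite V" "X \<subseteq> V" "x < h V" using less_cSup_iff[OF ne bdd] by auto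
    have "x < h V'" if "finite V'" "V \<subseteq> V'" for V' using mono[OF that(1) V(2) that(2)] V(3) by linarith
    then show "eventually (\<lambda>V. x < h V) (finite_subsets_at_top UNIV)"
      unfolding eventually_finite_subsets_at_top using V(1) by (intro exI[of _ V]) auto
  qed
qed

lemma chain_upd_iff: "y \<notin> set xs \<Longrightarrow> chain (F(y := v)) xs u \<longleftrightarrow> chain F xs u"
  by (induction xs) auto

lemma leads_ext_root:
  assumes "distinct xs" "\<And>x. x \<in> set xs \<Longrightarrow> F x = None"
  shows "leads (ext F xs u) v u \<longleftrightarrow> (\<exists>z\<in>insert u (set xs). leads F v z)"
proof
  assume "leads (ext F xs u) v u"
  then show "\<exists>z\<in>insert u (set xs). leads F v z"
    unfolding leads_def[of "ext F xs u"]
  proof (induction rule: converse_rtrancl_induct)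
    case (step y z)
    show ?case
    proof (cases "y \<in> set xs")
      case False
      then have "F y = Some z" using step.hyps(1) by (simp add: steps_def ext_notin)
      then show ?thesis using step.IH leads_step by metis
    qed auto
  qed auto
next
  have "steps F \<subseteq> steps (ext F xs u)"
    using assms(2) by (auto simp: steps_def) (metis ext_notin option.distinct(1))
  then have le: "leads (ext F xs u) v z" if "leads F v z" for v z using that rtrancl_mono unfolding leads_def by blast
  assume "\<exists>z\<in>insert u (set xs). leads F v z"
  then obtain z where z: "z \<in> insert u (set xs)" "leads F v z" by blast
  then have "leads (ext F xs u) z u" using chain_leads[OF chain_ext[OF assms(1)]] by auto
  with le[OF z(2)] show "leads (ext F xs u) v u" by (rule leads_trans)
qed

context regular_graph
begin

text \<open>When \<open>u\<close> belongs to the volume, its own edge is cut as well and must not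
  lead back to the path. The point is that \<open>ratio\<close> and every \<open>hit\<close> on the
  right are monotone in the volume, which gives convergence of a quantity whose own monotonicity is
  not apparent.\<close>

lemma ex_chain_inside:
  assumes V: "finite V" and u: "u \<in> V" and xs: "distinct xs" "set xs \<subseteq> V - {u}" "link nb xs u"
  shows "ex 0 V (\<lambda>F. of_bool (chain F xs u)) = ratio 0 V (insert u (set xs)) *
    (\<Sum>w\<in>nb u. 1 - (\<Sum>z\<in>insert u (set xs). hit 0 (V - insert u (set xs)) z w))"
proof -
  let ?U = "V - {u}" and ?W = "V - insert u (set xs)"
  have W: "?U - set xs = ?W" by auto
  have xsp: "xs \<in> paths ?U u" using xs by (auto simp: paths_def)
  have "ex 0 V (\<lambda>F. of_bool (chain F xs u)) = ratio 0 V {u} * ex 0 ?U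
    (\<lambda>F. 0 * of_bool (chain F xs u) + (\<Sum>w\<in>nb u. of_bool (\<not> leads F w u) * of_bool (chain (F(u \<mapsto> w)) xs u)))"
    using V u by (intro ex_cut) auto
  also have "ex 0 ?U (\<lambda>F. 0 * of_bool (chain F xs u) + (\<Sum>w\<in>nb u. of_bool (\<not> leads F w u) * of_bool (chain (F(u \<mapsto> w)) xs u)))
    = ex 0 ?U (\<lambda>F. \<Sum>w\<in>nb u. of_bool (chain F xs u) * of_bool (\<not> leads F w u))"
  proof (rule ex_cong)
    fix F
    have "chain (F(u \<mapsto> w)) xs u \<longleftrightarrow> chain F xs u" for w
      using xs(2) by (intro chain_upd_iff) auto
    then show "0 * of_bool (chain F xs u) + (\<Sum>w\<in>nb u. of_bool (\<not> leads F w u) * of_bool (chain (F(u \<mapsto> w)) xs u))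
      = (\<Sum>w\<in>nb u. of_bool (chain F xs u) * of_bool (\<not> leads F w u) :: real)"
      by (simp add: mult.commute)
  qed
  also have "\<dots> = (\<Sum>w\<in>nb u. ratio 0 ?U (set xs) * ex 0 ?W (\<lambda>F. of_bool (\<not> leads (ext F xs u) w u)))"
    unfolding ex_sum W[symmetric] using V xsp by (intro sum.cong refl ex_chain) auto
  also have "\<dots> = ratio 0 ?U (set xs) * (\<Sum>w\<in>nb u. ex 0 ?W (\<lambda>F. of_bool (\<not> leads (ext F xs u) w u)))"
    by (rule sum_distrib_left[symmetric])
  also have "(\<Sum>w\<in>nb u. ex 0 ?W (\<lambda>F. of_bool (\<not> leads (ext F xs u) w u))) =
      (\<Sum>w\<in>nb u. 1 - (\<Sum>z\<in>insert u (set xs). hit 0 ?W z w))"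
  proof (rule sum.cong[OF refl])
    fix w
    have "ex 0 ?W (\<lambda>F. of_bool (\<not> leads (ext F xs u) w u)) = ex 0 ?W (\<lambda>F. 1 - (\<Sum>z\<in>insert u (set xs). of_bool (leads F w z)))"
    proof (rule ex_cong)
      fix F assume F: "F \<in> forests ?W"
      have none: "F z = None" if "z \<in> insert u (set xs)" for z by (rule forestsD(1)[OF F]) (use that in simp)
      have eq: "leads (ext F xs u) w u \<longleftrightarrow> (\<exists>z\<in>insert u (set xs). leads F w z)"
        by (rule leads_ext_root[OF xs(1) none]) simp
      have "(\<Sum>z\<in>insert u (set xs). of_bool (leads F w z)) = (of_bool (\<exists>z\<in>insert u (set xs). leads F w z) :: real)"
      proof (cases "\<exists>z\<in>insert u (set xs). leads F w z")
        case True
        then obtain z where z: "z \<in> insert u (set xs)" "leads F w z" by blast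
        have "(\<Sum>z'\<in>insert u (set xs). of_bool (leads F w z')) = (\<Sum>z'\<in>insert u (set xs). if z' = z then 1 else 0 :: real)"
        proof (rule sum.cong[OF refl])
          fix z' assume z': "z' \<in> insert u (set xs)"
          have "z' = z" if "leads F w z'" by (rule leads_terminal_unique[OF that z(2) none[OF z'] none[OF z(1)]])
          then show "of_bool (leads F w z') = (if z' = z then 1 else 0 :: real)" using z(2) by (cases "z' = z") auto
        qed
        also have "\<dots> = 1" using z(1) by (simp add: sum.delta)
        finally show ?thesis using True by (simp only: of_bool_eq)
      next
        case False
        then have "(\<Sum>z\<in>insert u (set xs). of_bool (leads F w z)) = (0 :: real)" by (intro sum.neutral) auto
        then show ?thesis using False by (simp only: of_bool_eq)
      qed
      then show "of_bool (\<not> leads (ext F xs u) w u) = 1 - (\<Sum>z\<in>insert u (set xs). of_bool (leads F w z) :: real)"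
        by (simp only: eq of_bool_not_iff)
    qed
    also have "\<dots> = 1 - (\<Sum>z\<in>insert u (set xs). hit 0 ?W z w)"
      unfolding ex_diff ex_sum hit_def using V by (simp add: ex_const)
    finally show "ex 0 ?W (\<lambda>F. of_bool (\<not> leads (ext F xs u) w u)) = 1 - (\<Sum>z\<in>insert u (set xs). hit 0 ?W z w)" .
  qed
  also have "ratio 0 V {u} * (ratio 0 ?U (set xs) * (\<Sum>w\<in>nb u. 1 - (\<Sum>z\<in>insert u (set xs). hit 0 ?W z w))) =
    ratio 0 V (insert u (set xs)) * (\<Sum>w\<in>nb u. 1 - (\<Sum>z\<in>insert u (set xs). hit 0 ?W z w))"
  proof -
    have "ratio 0 V {u} * ratio 0 ?U (set xs) = ratio 0 V (insert u (set xs))"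
      using Z_pos[of ?U 0] V by (simp add: ratio_def W)
    then show ?thesis by simp
  qed
  finally show ?thesis .
qed

lemma wsum_automorphism:
  assumes bij: "bij \<tau>" and aut: "\<And>x y. \<tau> y \<in> nb (\<tau> x) \<longleftrightarrow> y \<in> nb x"
  shows "wsum \<kappa> (\<tau> ` V) f = wsum \<kappa> V (\<lambda>F. f (\<lambda>v. map_option \<tau> (F (inv \<tau> v))))"
proof -
  let ?h = "\<lambda>\<tau> F v. map_option \<tau> (F (inv \<tau> v))"
  have map: "?h \<sigma> F \<in> forests (\<sigma> ` U)" if F: "F \<in> forests U" and s: "bij \<sigma>" "\<And>x y. \<sigma> y \<in> nb (\<sigma> x) \<longleftrightarrow> y \<in> nb x" for \<sigma> F U
  proof -
    have inv: "inv \<sigma> (\<sigma> x) = x" "\<sigma> (inv \<sigma> x) = x" for x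
      using s(1) by (simp_all add: bij_is_inj bij_is_surj surj_f_inv_f)
    have "steps (?h \<sigma> F) \<subseteq> inv_image (steps F) (inv \<sigma>)"
      by (auto simp: steps_def inv)
    moreover have "acyclic (inv_image (steps F) (inv \<sigma>))"
    proof (rule acyclicI, rule allI, rule notI)
      fix x assume "(x, x) \<in> (inv_image (steps F) (inv \<sigma>))\<^sup>+"
      moreover have "(inv \<sigma> x, inv \<sigma> y) \<in> (steps F)\<^sup>+" if "(x, y) \<in> (inv_image (steps F) (inv \<sigma>))\<^sup>+" for x y
        using that
      proof (induction rule: trancl_induct)
        case (step y z)
        then show ?case by (auto intro: trancl_into_trancl)
      qed auto
      ultimately have "(inv \<sigma> x, inv \<sigma> x) \<in> (steps F)\<^sup>+" by blast
      then show False using forestsD(3)[OF F] by (auto simp: acyclic_def)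
    qed
    ultimately have "acyclic (steps (?h \<sigma> F))" by (rule acyclic_subset[rotated])
    moreover have "?h \<sigma> F v = None" if "v \<notin> \<sigma> ` U" for v
      using forestsD(1)[OF F, of "inv \<sigma> v"] that inv by (metis image_eqI option.simps(8))
    moreover have "w \<in> nb v" if hw: "?h \<sigma> F v = Some w" for v w
    proof -
      obtain w' where "F (inv \<sigma> v) = Some w'" "w = \<sigma> w'" using hw by auto
      then show ?thesis using forestsD(2)[OF F] s(2)[of w' "inv \<sigma> v"] inv by simp
    qed
    ultimately show ?thesis by (auto simp: forests_def)
  qed
  have inv: "inv \<tau> (\<tau> x) = x" "\<tau> (inv \<tau> x) = x" for x
    using bij by (simp_all add: bij_is_inj bij_is_surj surj_f_inv_f)
  have bi: "bij (inv \<tau>)" "inv (inv \<tau>) = \<tau>" using bij by (simp_all add: bij_imp_bij_inv inv_inv_eq)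
  have aut': "inv \<tau> y \<in> nb (inv \<tau> x) \<longleftrightarrow> y \<in> nb x" for x y using aut[of "inv \<tau> y" "inv \<tau> x"] inv by simp
  have im: "inv \<tau> ` \<tau> ` V = V" by (auto simp: image_image inv)
  have "bij_betw (?h \<tau>) (forests V) (forests (\<tau> ` V))"
  proof (rule bij_betwI[where g = "?h (inv \<tau>)"])
    show "?h \<tau> \<in> forests V \<rightarrow> forests (\<tau> ` V)" using map[OF _ bij aut] by blast
    show "?h (inv \<tau>) \<in> forests (\<tau> ` V) \<rightarrow> forests V" using map[OF _ bi(1) aut', of _ "\<tau> ` V"] im by auto
    show "?h (inv \<tau>) (?h \<tau> F) = F" for F by (simp add: bi inv option.map_comp comp_def option.map_ident)
    show "?h \<tau> (?h (inv \<tau>) F) = F" for F by (simp add: bi inv option.map_comp comp_def option.map_ident)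
  qed
  then have "wsum \<kappa> (\<tau> ` V) f = (\<Sum>F\<in>forests V. wt \<kappa> (\<tau> ` V) (?h \<tau> F) * f (?h \<tau> F))"
    unfolding wsum_def by (rule sum.reindex_bij_betw[symmetric])
  moreover have "wt \<kappa> (\<tau> ` V) (?h \<tau> F) = wt \<kappa> V F" for F
    unfolding wt_def using inj_on_subset[OF bij_is_inj[OF bij], of V] by (subst prod.reindex) (auto simp: inv intro!: prod.cong)
  ultimately show ?thesis by (simp only: wsum_def)
qed

lemma ex_automorphism:
  assumes "bij \<tau>" "\<And>x y. \<tau> y \<in> nb (\<tau> x) \<longleftrightarrow> y \<in> nb x"
  shows "ex \<kappa> (\<tau> ` V) f = ex \<kappa> V (\<lambda>F. f (\<lambda>v. map_option \<tau> (F (inv \<tau> v))))"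
  unfolding ex_def wsum_automorphism[OF assms] ..

lemma chain_automorphism:
  assumes "bij \<tau>"
  shows "chain (\<lambda>v. map_option \<tau> (F (inv \<tau> v))) (map \<tau> xs) (\<tau> u) \<longleftrightarrow> chain F xs u"
proof -
  have "inv \<tau> (\<tau> x) = x" "\<tau> x = \<tau> y \<longleftrightarrow> x = y" for x y
    using assms by (simp_all add: bij_is_inj inj_eq)
  moreover have "hd (map \<tau> xs @ [\<tau> u]) = \<tau> (hd (xs @ [u]))" for xs by (cases xs) auto
  ultimately show ?thesis by (induction xs) auto
qed

definition orbit :: "('a \<Rightarrow> 'a option) \<Rightarrow> nat \<Rightarrow> 'a \<Rightarrow> 'a" where
  "orbit F m x = ((\<lambda>v. the (F v)) ^^ m) x"

lemma orbit_Suc: "orbit F (Suc m) x = the (F (orbit F m x))"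
  by (simp add: orbit_def)

lemma chain_orbit:
  assumes "\<And>k. k < m \<Longrightarrow> F (orbit F k x) \<noteq> None"
  shows "chain F (map (\<lambda>k. orbit F k x) [0..<m]) (orbit F m x)"
  using assms
proof (induction m)
  case (Suc m)
  have "F (orbit F m x) = Some (orbit F (Suc m) x)" using Suc.prems[of m] by (auto simp: orbit_Suc)
  then show ?case using Suc by (simp add: chain_snoc)
qed simp

lemma ex_mono_full:
  assumes "finite V" "\<And>F. F \<in> full_forests V \<Longrightarrow> f F \<le> f' F"
  shows "ex 0 V f \<le> ex 0 V f'"
  unfolding ex_def sum_full_forests[OF assms(1), of f] sum_full_forests[OF assms(1), of f']
  using assms Z_pos[of V 0] by (intro divide_right_mono sum_mono) auto

fun nball :: "'a \<Rightarrow> nat \<Rightarrow> 'a set" where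
  "nball x 0 = {x}"
| "nball x (Suc n) = nball x n \<union> (\<Union>y\<in>nball x n. nb y)"

lemma finite_nball: "finite (nball x n)"
  by (induction n) auto

lemma nball_mono: "m \<le> n \<Longrightarrow> nball x m \<subseteq> nball x n"
  by (induction n) (auto simp: le_Suc_eq)

lemma link_nball: "link nb xs u \<Longrightarrow> set (xs @ [u]) \<subseteq> nball (hd (xs @ [u])) (length xs)"
proof (induction xs arbitrary: u rule: rev_induct)
  case (snoc z xs)
  have "link nb xs z" "u \<in> nb z" using snoc.prems by (auto simp: link_append)
  with snoc.IH[of z] show ?case by (auto simp: hd_append)
qed simp

lemma chain_link: "chain F xs u \<Longrightarrow> F \<in> forests V \<Longrightarrow> link nb xs u"
  by (induction xs) (auto dest: forestsD(2))

end

context transient_graph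
begin

lemma ratio_bound:
  assumes "finite V" "X \<subseteq> V"
  shows "ratio 0 V X \<le> (1 / gap) ^ card X"
proof -
  have "finite X" using assms finite_subset by blast
  then show ?thesis using assms(2)
  proof (induction X)
    case empty
    show ?case using Z_pos[OF assms(1), of 0] by (simp add: ratio_def)
  next
    case (insert y X)
    have "ratio 0 V (insert y X) = ratio 0 V X * ratio 0 (V - X) {y}" using assms by (intro ratio_insert) auto
    also have "\<dots> \<le> (1 / gap) ^ card X * (1 / gap)"
    proof (rule mult_mono)
      show "ratio 0 (V - X) {y} \<le> 1 / gap" using insert assms by (intro ratio_le) auto
      show "0 \<le> (1 / gap) ^ card X" using gap_pos by simp
      show "0 \<le> ratio 0 (V - X) {y}" using ratio_nonneg[of "V - X" 0 "{y}"] assms by simp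
    qed (use insert in auto)
    finally show ?case using insert by simp
  qed
qed

lemma chain_prob_converges:
  assumes xs: "distinct xs" "u \<notin> set xs" "link nb xs u"
  shows "\<exists>l. ((\<lambda>V. ex 0 V (\<lambda>F. of_bool (chain F xs u))) \<longlongrightarrow> l) (finite_subsets_at_top UNIV)"
proof -
  let ?X = "insert u (set xs)"
  have "\<exists>r. ((\<lambda>V. ratio 0 V ?X) \<longlongrightarrow> r) (finite_subsets_at_top UNIV)"
  proof (rule filterlim_monotone_sup)
    show "finite ?X" by simp
    show "ratio 0 V ?X \<le> ratio 0 V' ?X" if "finite V'" "?X \<subseteq> V" "V \<subseteq> V'" for V V'
      using that by (intro ratio_mono) auto
    show "ratio 0 V ?X \<le> (1 / gap) ^ card ?X" if "finite V" "?X \<subseteq> V" for V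
      using that by (rule ratio_bound)
  qed
  then obtain r where r: "((\<lambda>V. ratio 0 V ?X) \<longlongrightarrow> r) (finite_subsets_at_top UNIV)" by blast
  have "\<exists>l. ((\<lambda>V. hit 0 (V - ?X) z w) \<longlongrightarrow> l) (finite_subsets_at_top UNIV)" if z: "z \<in> ?X" for z w
  proof (rule filterlim_monotone_sup)
    show "finite ?X" by simp
    show "hit 0 (V - ?X) z w \<le> hit 0 (V' - ?X) z w" if "finite V'" "?X \<subseteq> V" "V \<subseteq> V'" for V V'
      using that z by (intro hit_mono) auto
    show "hit 0 (V - ?X) z w \<le> 1" if "finite V" "?X \<subseteq> V" for V
      using that unfolding hit_def by (intro ex_le_1) auto
  qed
  then obtain h where h: "\<And>z w. z \<in> ?X \<Longrightarrow> ((\<lambda>V. hit 0 (V - ?X) z w) \<longlongrightarrow> h z w) (finite_subsets_at_top UNIV)" by metis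
  have "((\<lambda>V. ratio 0 V ?X * (\<Sum>w\<in>nb u. 1 - (\<Sum>z\<in>?X. hit 0 (V - ?X) z w))) \<longlongrightarrow>
      r * (\<Sum>w\<in>nb u. 1 - (\<Sum>z\<in>?X. h z w))) (finite_subsets_at_top UNIV)"
    by (intro tendsto_intros r h)
  moreover have "eventually (\<lambda>V. ratio 0 V ?X * (\<Sum>w\<in>nb u. 1 - (\<Sum>z\<in>?X. hit 0 (V - ?X) z w)) =
      ex 0 V (\<lambda>F. of_bool (chain F xs u))) (finite_subsets_at_top UNIV)"
    unfolding eventually_finite_subsets_at_top
  proof (intro exI[of _ ?X] conjI allI impI)
    fix V assume V: "finite V \<and> ?X \<subseteq> V \<and> V \<subseteq> UNIV"
    show "ratio 0 V ?X * (\<Sum>w\<in>nb u. 1 - (\<Sum>z\<in>?X. hit 0 (V - ?X) z w)) = ex 0 V (\<lambda>F. of_bool (chain F xs u))"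
      by (rule ex_chain_inside[symmetric]) (use V xs in auto)
  qed auto
  ultimately show ?thesis by (blast intro: Lim_transform_eventually)
qed

definition chain_prob :: "'a list \<Rightarrow> 'a \<Rightarrow> real" where
  "chain_prob xs u = Lim (finite_subsets_at_top UNIV) (\<lambda>V. ex 0 V (\<lambda>F. of_bool (chain F xs u)))"

lemma chain_prob_lim:
  assumes "distinct xs" "u \<notin> set xs" "link nb xs u"
  shows "((\<lambda>V. ex 0 V (\<lambda>F. of_bool (chain F xs u))) \<longlongrightarrow> chain_prob xs u) (finite_subsets_at_top UNIV)"
proof -
  obtain l where l: "((\<lambda>V. ex 0 V (\<lambda>F. of_bool (chain F xs u))) \<longlongrightarrow> l) (finite_subsets_at_top UNIV)"
    using chain_prob_converges[OF assms] by blast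
  have "chain_prob xs u = l" unfolding chain_prob_def by (rule tendsto_Lim[OF finite_subsets_at_top_neq_bot l])
  with l show ?thesis by simp
qed

lemma link_automorphism:
  assumes "\<And>x y. \<tau> y \<in> nb (\<tau> x) \<longleftrightarrow> y \<in> nb x"
  shows "link nb (map \<tau> xs) (\<tau> u) \<longleftrightarrow> link nb xs u"
proof -
  have "hd (map \<tau> xs @ [\<tau> u]) = \<tau> (hd (xs @ [u]))" for xs by (cases xs) auto
  then show ?thesis by (induction xs) (auto simp: assms)
qed

text \<open>The map \<open>image \<tau>\<close> respects the filter of finite sets, so equivariance
  in finite volume becomes invariance of the limit.\<close>

lemma chain_prob_automorphism:
  assumes bij: "bij \<tau>" and aut: "\<And>x y. \<tau> y \<in> nb (\<tau> x) \<longleftrightarrow> y \<in> nb x"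
    and xs: "distinct xs" "u \<notin> set xs" "link nb xs u"
  shows "chain_prob (map \<tau> xs) (\<tau> u) = chain_prob xs u"
proof -
  let ?A = "finite_subsets_at_top (UNIV :: 'a set)"
  have inj: "inj \<tau>" and sur: "\<tau> (inv \<tau> x) = x" for x using bij by (simp_all add: bij_is_inj bij_is_surj surj_f_inv_f)
  have "filterlim (image \<tau>) ?A ?A"
    unfolding filterlim_finite_subsets_at_top eventually_finite_subsets_at_top
  proof (intro allI impI)
    fix X :: "'a set" assume X: "finite X \<and> X \<subseteq> UNIV"
    have "X \<subseteq> \<tau> ` Y" if "inv \<tau> ` X \<subseteq> Y" for Y
      using that sur by (metis image_subset_iff imageI subsetI)
    then show "\<exists>Z. finite Z \<and> Z \<subseteq> UNIV \<and> (\<forall>Y. finite Y \<and> Z \<subseteq> Y \<and> Y \<subseteq> UNIV \<longrightarrow> finite (\<tau> ` Y) \<and> X \<subseteq> \<tau> ` Y \<and> \<tau> ` Y \<subseteq> UNIV)"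
      using X by (intro exI[of _ "inv \<tau> ` X"]) auto
  qed
  moreover have "((\<lambda>V. ex 0 V (\<lambda>F. of_bool (chain F (map \<tau> xs) (\<tau> u)))) \<longlongrightarrow> chain_prob (map \<tau> xs) (\<tau> u)) ?A"
  proof (rule chain_prob_lim)
    show "distinct (map \<tau> xs)" using xs(1) inj_on_subset[OF inj, of "set xs"] by (simp add: distinct_map)
    show "\<tau> u \<notin> set (map \<tau> xs)" using xs(2) inj by (auto dest: injD)
    show "link nb (map \<tau> xs) (\<tau> u)" using xs(3) link_automorphism[of \<tau>, OF aut] by simp
  qed
  ultimately have "((\<lambda>V. ex 0 (\<tau> ` V) (\<lambda>F. of_bool (chain F (map \<tau> xs) (\<tau> u)))) \<longlongrightarrow> chain_prob (map \<tau> xs) (\<tau> u)) ?A"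
    by (rule filterlim_compose[rotated])
  then have "((\<lambda>V. ex 0 V (\<lambda>F. of_bool (chain F xs u))) \<longlongrightarrow> chain_prob (map \<tau> xs) (\<tau> u)) ?A"
    unfolding ex_automorphism[of \<tau>, OF bij aut] chain_automorphism[OF bij] .
  then show ?thesis by (rule tendsto_unique[OF finite_subsets_at_top_neq_bot _ chain_prob_lim[OF xs]])
qed

end

section \<open>Translations, mass transport and the lower bound\<close>

locale transient_cayley = transient_metric nb dg g \<phi> gap \<Phi> ray dst psi c\<psi> C\<psi>
  for nb :: "'a :: ab_group_add \<Rightarrow> 'a set" and dg g \<phi> gap \<Phi> ray dst psi c\<psi> C\<psi> +
  fixes Cb :: real
  assumes nb_shift: "y + z \<in> nb (x + z) \<longleftrightarrow> y \<in> nb x"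
    and dst_shift: "dst (x + z) (y + z) = dst x y"
    and Cb: "Cb > 0"
    and ball_potential: "R \<ge> 1 \<Longrightarrow> \<exists>\<psi> :: 'a \<Rightarrow> real. \<forall>x. 0 \<le> \<psi> x \<and> \<psi> x \<le> Cb * R\<^sup>2 \<and>
      (\<Sum>w\<in>nb x. \<psi> w) + of_bool (dst x 0 < R) \<le> dg * \<psi> x"
begin

text \<open>A finite set of candidate paths rather than an event. Summing path probabilities over it
  gives the expected number of far ancestors of \<open>0\<close> within \<open>n\<close>
  generations; \<open>inward\<close> does the same for descendants.\<close>

definition outward :: "nat \<Rightarrow> real \<Rightarrow> ('a list \<times> 'a) set" where
  "outward n R = {(xs, u). distinct xs \<and> u \<notin> set xs \<and> link nb xs u \<and> xs \<noteq> [] \<and> length xs \<le> n \<and> hd xs = 0 \<and> R \<le> dst u 0}"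

definition inward :: "nat \<Rightarrow> real \<Rightarrow> 'a list set" where
  "inward n R = {xs. distinct xs \<and> 0 \<notin> set xs \<and> link nb xs 0 \<and> xs \<noteq> [] \<and> length xs \<le> n \<and> R \<le> dst 0 (hd xs)}"

lemma finite_outward: "finite (outward n R)"
proof (rule finite_subset)
  let ?B = "nball 0 n"
  show "outward n R \<subseteq> {xs. set xs \<subseteq> ?B \<and> length xs \<le> n} \<times> ?B"
  proof
    fix p assume p: "p \<in> outward n R"
    obtain xs u where xu: "p = (xs, u)" by (cases p)
    with p have "link nb xs u" "length xs \<le> n" "hd (xs @ [u]) = 0" by (auto simp: outward_def)
    with link_nball[of xs u] nball_mono[of "length xs" n 0] show "p \<in> {xs. set xs \<subseteq> ?B \<and> length xs \<le> n} \<times> ?B"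
      by (auto simp: xu)
  qed
  show "finite ({xs. set xs \<subseteq> ?B \<and> length xs \<le> n} \<times> ?B)"
    by (intro finite_cartesian_product finite_lists_length_le finite_nball)
qed

lemma shift_aut: "bij (\<lambda>x. x - z :: 'a)" "(\<lambda>x. x - z) y \<in> nb ((\<lambda>x. x - z) x) \<longleftrightarrow> y \<in> nb x"
proof -
  show "bij (\<lambda>x. x - z)" by (rule bij_betw_byWitness[where f' = "\<lambda>x. x + z"]) auto
  show "(\<lambda>x. x - z) y \<in> nb ((\<lambda>x. x - z) x) \<longleftrightarrow> y \<in> nb x" using nb_shift[of y "- z" x] by simp
qed

lemma shift_outward:
  "(xs, u) \<in> outward n R \<Longrightarrow> map (\<lambda>x. x - u) xs \<in> inward n R"
proof -
  assume a: "(xs, u) \<in> outward n R"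
  have "link nb (map (\<lambda>x. x - u) xs) (u - u)"
    using a link_automorphism[of "\<lambda>x. x - u" xs u, OF shift_aut(2)] by (simp add: outward_def)
  moreover have "dst u 0 = dst 0 (- u)" using dst_shift[of u "- u" 0] by simp
  ultimately show ?thesis using a by (auto simp: outward_def inward_def distinct_map inj_on_def hd_map)
qed

lemma shift_inward:
  "xs \<in> inward n R \<Longrightarrow> (map (\<lambda>x. x - hd xs) xs, - hd xs) \<in> outward n R"
proof -
  assume a: "xs \<in> inward n R"
  have "link nb (map (\<lambda>x. x - hd xs) xs) (0 - hd xs)"
    using a link_automorphism[of "\<lambda>x. x - hd xs" xs 0, OF shift_aut(2)] by (simp add: inward_def)
  moreover have "dst 0 (hd xs) = dst (- hd xs) 0" using dst_shift[of 0 "- hd xs" "hd xs"] by simp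
  ultimately show ?thesis using a by (auto simp: outward_def inward_def distinct_map inj_on_def hd_map)
qed

text \<open>A path from \<open>0\<close> to \<open>u\<close> is translated to the path from \<open>- u\<close> to \<open>0\<close>.\<close>

lemma mass_transport: "(\<Sum>(xs, u)\<in>outward n R. chain_prob xs u) = (\<Sum>xs\<in>inward n R. chain_prob xs 0)"
proof (rule sum.reindex_bij_witness[where j = "\<lambda>(xs, u). map (\<lambda>x. x - u) xs" and i = "\<lambda>xs. (map (\<lambda>x. x - hd xs) xs, - hd xs)"])
  show "(\<lambda>(xs, u). map (\<lambda>x. x - u) xs) p \<in> inward n R" if "p \<in> outward n R" for p
    using that by (cases p) (simp add: shift_outward)
  show "(map (\<lambda>x. x - hd xs) xs, - hd xs) \<in> outward n R" if "xs \<in> inward n R" for xs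
    using that by (rule shift_inward)
  show "(map (\<lambda>x. x - hd ((\<lambda>(xs, u). map (\<lambda>x. x - u) xs) p)) ((\<lambda>(xs, u). map (\<lambda>x. x - u) xs) p), - hd ((\<lambda>(xs, u). map (\<lambda>x. x - u) xs) p)) = p"
    if "p \<in> outward n R" for p
    using that by (auto simp: outward_def hd_map comp_def)
  show "(\<lambda>(xs, u). map (\<lambda>x. x - u) xs) (map (\<lambda>x. x - hd xs) xs, - hd xs) = xs" if "xs \<in> inward n R" for xs
    by (simp add: comp_def)
  show "chain_prob ((\<lambda>(xs, u). map (\<lambda>x. x - u) xs) p) 0 = (case p of (xs, u) \<Rightarrow> chain_prob xs u)" if "p \<in> outward n R" for p
  proof -
    obtain xs u where p: "p = (xs, u)" by (cases p)
    have "chain_prob (map (\<lambda>x. x - u) xs) (u - u) = chain_prob xs u"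
      using that p by (intro chain_prob_automorphism shift_aut) (auto simp: outward_def)
    then show ?thesis using p by simp
  qed
qed

lemma finite_inward: "finite (inward n R)"
proof (rule finite_subset)
  show "inward n R \<subseteq> (\<lambda>(xs, u). map (\<lambda>x. x - u) xs) ` outward n R"
    using shift_inward by (force simp: image_iff comp_def)
qed (simp add: finite_outward)

text \<open>A volume that contains the ball of radius \<open>n\<close> holds the first
  \<open>n\<close> ancestors of \<open>0\<close>, which are distinct by acyclicity. The near ones
  are among the vertices of the ball of radius \<open>R\<close> visited by the branch of
  \<open>0\<close>; the far ones are counted on the right.\<close>

lemma outward_count:
  assumes V: "finite V" "nball 0 n \<subseteq> V" and F: "F \<in> full_forests V"
  shows "real n - (\<Sum>x\<in>V. of_bool (leads F 0 x) * of_bool (dst x 0 < R)) \<le> (\<Sum>(xs, u)\<in>outward n R. of_bool (chain F xs u) :: real)"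
proof -
  let ?o = "\<lambda>k. orbit F k 0"
  have Ff: "F \<in> forests V" "\<And>v. v \<in> V \<Longrightarrow> F v \<noteq> None" using F by (auto simp: full_forests_def)
  have ball: "?o k \<in> nball 0 k" if "k \<le> n" for k
    using that
  proof (induction k)
    case (Suc k)
    then have k: "?o k \<in> nball 0 k" by simp
    then have "?o k \<in> V" using V(2) nball_mono[of k n 0] Suc.prems by auto
    then obtain w where w: "F (?o k) = Some w" using Ff(2) by blast
    then show ?case using k forestsD(2)[OF Ff(1) w] by (auto simp: orbit_Suc)
  qed (simp add: orbit_def)
  have oV: "?o k \<in> V" if "k \<le> n" for k using ball[OF that] nball_mono[OF that] V(2) by blast
  have ch: "chain F (map ?o [0..<k]) (?o k)" if "k \<le> n" for k
    by (rule chain_orbit) (use that oV Ff(2) in simp)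
  have di: "distinct (map ?o [0..<k] @ [?o k])" if "k \<le> n" for k
    by (rule chain_distinct[OF forestsD(3)[OF Ff(1)] ch[OF that]])
  have oinj: "inj_on ?o {..n}"
    using di[of n] by (simp add: distinct_map atLeast0LessThan lessThan_Suc_atMost[symmetric] lessThan_Suc)
  have ld: "leads F 0 (?o k)" if "k \<le> n" for k
  proof (cases k)
    case (Suc j)
    have "0 \<in> {0..<k}" unfolding atLeastLessThan_iff using Suc by linarith
    then have "?o 0 \<in> set (map ?o [0..<k])" unfolding set_map set_upt by (rule imageI)
    from chain_leads[OF ch[OF that] this] show ?thesis by (simp add: orbit_def)
  qed (simp add: orbit_def)
  define K1 where "K1 = {k \<in> {1..n}. R \<le> dst (?o k) 0}"
  define K2 where "K2 = {k \<in> {1..n}. dst (?o k) 0 < R}"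
  have "card K1 + card K2 = card (K1 \<union> K2)" by (rule card_Un_disjoint[symmetric]) (auto simp: K1_def K2_def)
  also have "K1 \<union> K2 = {1..n}" by (auto simp: K1_def K2_def)
  finally have n: "real n = real (card K1) + real (card K2)" by simp
  have "card K2 = card (?o ` K2)" by (rule card_image[symmetric], rule inj_on_subset[OF oinj]) (auto simp: K2_def)
  also have "\<dots> \<le> card {x \<in> V. leads F 0 x \<and> dst x 0 < R}"
    using V(1) oV ld by (intro card_mono) (auto simp: K2_def)
  finally have 2: "real (card K2) \<le> (\<Sum>x\<in>V. of_bool (leads F 0 x) * of_bool (dst x 0 < R))"
    using sum_of_bool_card[OF V(1), of "\<lambda>x. leads F 0 x \<and> dst x 0 < R"] by (simp add: of_bool_conj)
  let ?p = "\<lambda>k. (map ?o [0..<k], ?o k)"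
  have "card K1 = card (?p ` K1)"
  proof (rule card_image[symmetric], rule inj_onI)
    fix j k assume "?p j = ?p k"
    then have "length (map ?o [0..<j]) = length (map ?o [0..<k])" by (metis prod.inject)
    then show "j = k" by simp
  qed
  also have "\<dots> \<le> card {p \<in> outward n R. chain F (fst p) (snd p)}"
  proof (rule card_mono)
    show "finite {p \<in> outward n R. chain F (fst p) (snd p)}" using finite_outward by simp
    have "?p k \<in> outward n R" if "k \<in> K1" for k
    proof -
      have k: "1 \<le> k" "k \<le> n" "R \<le> dst (?o k) 0" using that by (auto simp: K1_def)
      have "hd (map ?o [0..<k]) = 0" using k(1) by (simp add: hd_map orbit_def)
      moreover have "map ?o [0..<k] \<noteq> []" using k(1) by simp
      moreover have "link nb (map ?o [0..<k]) (?o k)" by (rule chain_link[OF ch[OF k(2)] Ff(1)])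
      moreover have "distinct (map ?o [0..<k])" "?o k \<notin> set (map ?o [0..<k])" using di[OF k(2)] by (simp_all only: distinct_append) auto
      ultimately show ?thesis unfolding outward_def using k by (simp only: mem_Collect_eq case_prod_conv) simp
    qed
    then show "?p ` K1 \<subseteq> {p \<in> outward n R. chain F (fst p) (snd p)}"
      using ch by (auto simp: K1_def)
  qed
  finally have 1: "real (card K1) \<le> (\<Sum>(xs, u)\<in>outward n R. of_bool (chain F xs u))"
    using sum_of_bool_card[OF finite_outward, of "\<lambda>p. chain F (fst p) (snd p)" n R] by (simp add: case_prod_unfold)
  show ?thesis using n 1 2 by linarith
qed

text \<open>By the ball potential the branch of \<open>0\<close> visits at most order
  \<open>R\<close> squared vertices at distance less than \<open>R\<close>, so the other ones among
  the first \<open>n\<close> ancestors are far. The bound passes to the limit for ancestors and is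
  then moved to descendants by \<open>mass_transport\<close>.\<close>

lemma inward_first_moment:
  assumes R: "R \<ge> 1"
  shows "real n - dg / gap * (dg * (Cb * R\<^sup>2)) \<le> (\<Sum>xs\<in>inward n R. chain_prob xs 0)"
proof -
  let ?A = "finite_subsets_at_top (UNIV :: 'a set)"
  let ?E = "\<lambda>V. \<Sum>(xs, u)\<in>outward n R. ex 0 V (\<lambda>F. of_bool (chain F xs u))"
  obtain \<psi> :: "'a \<Rightarrow> real" where "\<forall>x. 0 \<le> \<psi> x \<and> \<psi> x \<le> Cb * R\<^sup>2 \<and>
      (\<Sum>w\<in>nb x. \<psi> w) + of_bool (dst x 0 < R) \<le> dg * \<psi> x"
    using ball_potential[OF R] by (rule exE)
  then have \<psi>: "0 \<le> \<psi> x" "\<psi> x \<le> Cb * R\<^sup>2" "(\<Sum>w\<in>nb x. \<psi> w) + of_bool (dst x 0 < R) \<le> dg * \<psi> x" for x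
    by simp_all
  have "(?E \<longlongrightarrow> (\<Sum>(xs, u)\<in>outward n R. chain_prob xs u)) ?A"
    unfolding case_prod_unfold by (intro tendsto_sum chain_prob_lim) (auto simp: outward_def)
  moreover have "eventually (\<lambda>V. real n - dg / gap * (dg * (Cb * R\<^sup>2)) \<le> ?E V) ?A"
    unfolding eventually_finite_subsets_at_top
  proof (intro exI[of _ "nball 0 n"] conjI allI impI)
    fix V :: "'a set" assume "finite V \<and> nball 0 n \<subseteq> V \<and> V \<subseteq> UNIV"
    then have V: "finite V" "nball 0 n \<subseteq> V" by auto
    have "(\<Sum>x\<in>V. ex 0 V (\<lambda>F. of_bool (leads F 0 x)) * of_bool (dst x 0 < R))
      \<le> (\<Sum>x\<in>V. dg / gap * (hit 0 (V - {x}) x 0 * of_bool (dst x 0 < R)))"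
      using visit_le[OF V(1), of 0] by (intro sum_mono) (auto simp: mult.assoc[symmetric] intro!: mult_right_mono)
    also have "\<dots> = dg / gap * (\<Sum>x\<in>V. hit 0 (V - {x}) x 0 * of_bool (dst x 0 < R))"
      by (rule sum_distrib_left[symmetric])
    also have "\<dots> \<le> dg / gap * (dg * (Cb * R\<^sup>2))"
    proof (rule mult_left_mono)
      have "(\<Sum>x\<in>V. hit 0 (V - {x}) x 0 * of_bool (dst x 0 < R)) \<le> dg * \<psi> 0"
        using V(1) \<psi> by (intro sum_visit) auto
      also have "\<dots> \<le> dg * (Cb * R\<^sup>2)" using \<psi>(2) by (intro mult_left_mono) auto
      finally show "(\<Sum>x\<in>V. hit 0 (V - {x}) x 0 * of_bool (dst x 0 < R)) \<le> dg * (Cb * R\<^sup>2)" .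
    qed (use gap_pos in auto)
    finally have "real n - dg / gap * (dg * (Cb * R\<^sup>2)) \<le> real n - (\<Sum>x\<in>V. ex 0 V (\<lambda>F. of_bool (leads F 0 x)) * of_bool (dst x 0 < R))"
      by simp
    also have "\<dots> = real n - (\<Sum>x\<in>V. ex 0 V (\<lambda>F. of_bool (leads F 0 x) * of_bool (dst x 0 < R)))"
    proof -
      have "ex 0 V f * r = ex 0 V (\<lambda>F. f F * r)" for f r using ex_cmult[of 0 V r f] by (simp only: mult.commute)
      then show ?thesis by (simp only:)
    qed
    also have "\<dots> = ex 0 V (\<lambda>F. real n - (\<Sum>x\<in>V. of_bool (leads F 0 x) * of_bool (dst x 0 < R)))"
      unfolding ex_diff ex_sum by (simp add: ex_const V(1))
    also have "\<dots> \<le> ex 0 V (\<lambda>F. \<Sum>(xs, u)\<in>outward n R. of_bool (chain F xs u))"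
      using V outward_count by (intro ex_mono_full) auto
    also have "\<dots> = ?E V" unfolding case_prod_unfold ex_sum ..
    finally show "real n - dg / gap * (dg * (Cb * R\<^sup>2)) \<le> ?E V" .
  qed (simp_all add: finite_nball)
  ultimately have "real n - dg / gap * (dg * (Cb * R\<^sup>2)) \<le> (\<Sum>(xs, u)\<in>outward n R. chain_prob xs u)"
    by (rule tendsto_lowerbound) simp
  then show ?thesis unfolding mass_transport .
qed

text \<open>With a first moment of order \<open>R\<close> squared and a second moment of order
  \<open>R\<close> to the sixth, the probability is at least of order \<open>R\<close> to the power
  4 - 6. The event involves finitely many paths, so that it survives weak convergence.\<close>

theorem reach_lower_bound:
  obtains c :: real where "c > 0"
    "\<And>R. R \<ge> 1 \<Longrightarrow> \<exists>n. eventually (\<lambda>V. c / R\<^sup>2 \<le> ex 0 V (\<lambda>F. of_bool (\<exists>xs\<in>inward n R. chain F xs 0))) (finite_subsets_at_top UNIV)"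
proof -
  obtain C :: real where C: "C > 0"
    "\<And>n V u. n \<ge> 1 \<Longrightarrow> finite V \<Longrightarrow> u \<notin> V \<Longrightarrow> ex 0 V (\<lambda>F. cnt V u n F * cnt V u n F) \<le> C * n ^ 3"
    by (rule cnt_second_moment) (rule that)
  define C1 where "C1 = dg / gap * (dg * Cb)"
  have C1: "C1 > 0" using dg_pos gap_pos Cb by (simp add: C1_def)
  define D where "D = dg / gap * (C * (C1 + 3) ^ 3)"
  have D: "D > 0" using dg_pos gap_pos C C1 by (simp add: D_def)
  have main: "\<exists>n. eventually (\<lambda>V. 1 / D / R\<^sup>2 \<le> ex 0 V (\<lambda>F. of_bool (\<exists>xs\<in>inward n R. chain F xs 0))) (finite_subsets_at_top UNIV)"
    if R: "R \<ge> 1" for R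
  proof -
    have R2: "R\<^sup>2 \<ge> 1" using R by simp
    \<comment> \<open>At most \<open>C1 * R\<^sup>2\<close> ancestors are near on average; the extra
      \<open>2 * R\<^sup>2\<close> makes the limiting first moment exceed \<open>R\<^sup>2\<close>
      strictly, hence also the first moment in all large volumes.\<close>
    define n where "n = nat \<lceil>(C1 + 2) * R\<^sup>2\<rceil>"
    have CR: "(C1 + 2) * R\<^sup>2 \<ge> 0" using C1 R2 by simp
    have n: "(C1 + 2) * R\<^sup>2 \<le> n" "n \<le> (C1 + 3) * R\<^sup>2"
    proof -
      show "(C1 + 2) * R\<^sup>2 \<le> n" unfolding n_def by (rule real_nat_ceiling_ge)
      have "real n < (C1 + 2) * R\<^sup>2 + 1" unfolding n_def using CR by linarith
      also have "\<dots> \<le> (C1 + 3) * R\<^sup>2" using R2 by (simp add: algebra_simps)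
      finally show "n \<le> (C1 + 3) * R\<^sup>2" by simp
    qed
    have "n \<ge> 1"
    proof -
      have "(C1 + 2) * 1 \<le> (C1 + 2) * R\<^sup>2" using C1 R2 by (intro mult_left_mono) auto
      then have "1 \<le> real n" using n(1) C1 unfolding mult_1_right by linarith
      then show ?thesis by simp
    qed
    let ?I = "inward n R"
    let ?X = "\<lambda>F. \<Sum>xs\<in>?I. of_bool (chain F xs 0) :: real"
    let ?P = "\<lambda>V. ex 0 V (\<lambda>F. of_bool (\<exists>xs\<in>?I. chain F xs 0))"
    have "real n - C1 * R\<^sup>2 \<le> (\<Sum>xs\<in>?I. chain_prob xs 0)"
      using inward_first_moment[OF R, of n] by (simp add: C1_def mult.assoc)
    moreover have "real n - C1 * R\<^sup>2 \<ge> 2 * R\<^sup>2" using n(1) by (simp add: algebra_simps)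
    ultimately have "R\<^sup>2 < (\<Sum>xs\<in>?I. chain_prob xs 0)" using R2 by linarith
    moreover have "((\<lambda>V. \<Sum>xs\<in>?I. ex 0 V (\<lambda>F. of_bool (chain F xs 0))) \<longlongrightarrow> (\<Sum>xs\<in>?I. chain_prob xs 0)) (finite_subsets_at_top UNIV)"
      by (intro tendsto_sum chain_prob_lim) (auto simp: inward_def)
    ultimately have ev1: "eventually (\<lambda>V. R\<^sup>2 < (\<Sum>xs\<in>?I. ex 0 V (\<lambda>F. of_bool (chain F xs 0)))) (finite_subsets_at_top UNIV)"
      by (rule order_tendstoD(1)[rotated])
    have ev2: "eventually (\<lambda>V. finite V \<and> insert 0 (\<Union>xs\<in>?I. set xs) \<subseteq> V) (finite_subsets_at_top UNIV)"
      unfolding eventually_finite_subsets_at_top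
      by (intro exI[of _ "insert 0 (\<Union>xs\<in>?I. set xs)"]) (auto simp: finite_inward)
    have "eventually (\<lambda>V. 1 / D / R\<^sup>2 \<le> ?P V) (finite_subsets_at_top UNIV)"
      using ev1 ev2
    proof eventually_elim
      case (elim V)
      then have V: "finite V" "0 \<in> V" "\<And>xs. xs \<in> ?I \<Longrightarrow> set xs \<subseteq> V" by auto
      let ?U = "V - {0}"
      \<comment> \<open>With the second moment at most \<open>D * R ^ 6\<close>, this turns the
        quadratic term into \<open>R\<^sup>2 / 2\<close>, half of the lower bound for the first
        moment.\<close>
      define t where "t = D * R ^ 4"
      have t: "t > 0" using D R by (simp add: t_def)
      have X: "0 \<le> ?X F" "?X F \<le> cnt ?U 0 n F" for F
      proof -
        show "0 \<le> ?X F" by (intro sum_nonneg) auto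
        have "?I \<subseteq> shortp ?U 0 n" using V(3) by (auto simp: inward_def shortp_def paths_def)
        then show "?X F \<le> cnt ?U 0 n F" unfolding cnt_def
          using V(1) by (intro sum_mono2) (auto simp: finite_shortp)
      qed
      have amgm: "?X F \<le> 1 / (2 * t) * (cnt ?U 0 n F * cnt ?U 0 n F) + t / 2 * of_bool (\<exists>xs\<in>?I. chain F xs 0)" for F
      proof (cases "\<exists>xs\<in>?I. chain F xs 0")
        case True
        have "a \<le> 1 / (2 * t) * (b * b) + t / 2" if "0 \<le> a" "a \<le> b" for a b :: real
        proof -
          have "0 \<le> (b - t)\<^sup>2" by simp
          then have "2 * t * b \<le> b * b + t * t" by (simp add: power2_eq_square algebra_simps)
          then have "b \<le> 1 / (2 * t) * (b * b) + t / 2" using t by (simp add: field_simps)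
          with that show ?thesis by linarith
        qed
        from this[OF X] show ?thesis using True by (simp only: of_bool_eq mult_1_right)
      next
        case False
        then have "?X F = 0" by (intro sum.neutral) auto
        then show ?thesis using t by (simp add: cnt_nonneg)
      qed
      have "ex 0 V (\<lambda>F. cnt ?U 0 n F * cnt ?U 0 n F) \<le> dg / gap * ex 0 ?U (\<lambda>F. cnt ?U 0 n F * cnt ?U 0 n F)"
      proof (rule ex_root_le[OF V(1,2)])
        show "0 \<le> cnt ?U 0 n F * cnt ?U 0 n F" for F by (simp add: cnt_nonneg)
        fix F w
        have "chain (F(0 \<mapsto> w)) xs 0 \<longleftrightarrow> chain F xs 0" if "xs \<in> shortp ?U 0 n" for xs
        proof -
          have "0 \<notin> set xs" using that by (auto simp: shortp_def paths_def)
          then show ?thesis by (rule chain_upd_iff)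
        qed
        then have "cnt ?U 0 n (F(0 \<mapsto> w)) = cnt ?U 0 n F" unfolding cnt_def by (intro sum.cong) auto
        then show "cnt ?U 0 n (F(0 \<mapsto> w)) * cnt ?U 0 n (F(0 \<mapsto> w)) \<le> cnt ?U 0 n F * cnt ?U 0 n F" by simp
      qed
      also have "\<dots> \<le> dg / gap * (C * n ^ 3)"
        using C(2)[OF \<open>n \<ge> 1\<close>, of ?U 0] V(1) gap_pos by (intro mult_left_mono) auto
      also have "\<dots> \<le> dg / gap * (C * ((C1 + 3) * R\<^sup>2) ^ 3)"
        using n(2) C(1) gap_pos by (intro mult_left_mono power_mono) auto
      also have "\<dots> = D * R ^ 6" by (simp add: D_def power_mult_distrib power_mult[symmetric])
      finally have m2: "ex 0 V (\<lambda>F. cnt ?U 0 n F * cnt ?U 0 n F) \<le> D * R ^ 6" .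
      have "R\<^sup>2 < ex 0 V ?X" using elim(1) by (simp only: ex_sum)
      also have "\<dots> \<le> ex 0 V (\<lambda>F. 1 / (2 * t) * (cnt ?U 0 n F * cnt ?U 0 n F) + t / 2 * of_bool (\<exists>xs\<in>?I. chain F xs 0))"
        using V(1) amgm by (intro ex_mono) auto
      also have "\<dots> = 1 / (2 * t) * ex 0 V (\<lambda>F. cnt ?U 0 n F * cnt ?U 0 n F) + t / 2 * ?P V"
        unfolding ex_add ex_cmult ..
      also have "\<dots> \<le> 1 / (2 * t) * (D * R ^ 6) + t / 2 * ?P V"
        using m2 t by (intro add_right_mono mult_left_mono) auto
      also have "1 / (2 * t) * (D * R ^ 6) = R\<^sup>2 / 2"
      proof -
        have "D * R ^ 6 = R\<^sup>2 * t" by (simp add: t_def eval_nat_numeral)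
        then show ?thesis using t by simp
      qed
      finally have "R\<^sup>2 \<le> t * ?P V" by simp
      then have "R\<^sup>2 / t \<le> ?P V" using t by (simp add: divide_le_eq mult.commute)
      moreover have "R\<^sup>2 / t = 1 / D / R\<^sup>2" using R by (simp add: t_def eval_nat_numeral)
      ultimately show ?case by simp
    qed
    then show ?thesis by blast
  qed
  show thesis by (rule that[OF _ main]) (use D in simp)
qed

theorem reach_upper_bound:
  obtains C :: real where "C > 0"
    "\<And>V R. finite V \<Longrightarrow> 0 \<in> V \<Longrightarrow> R > 0 \<Longrightarrow> ex 0 V (\<lambda>F. of_bool (reach F 0 R)) \<le> C / R\<^sup>2"
proof -
  obtain C :: real where C: "C > 0"
    "\<And>V u R. finite V \<Longrightarrow> u \<notin> V \<Longrightarrow> R > 0 \<Longrightarrow> ex 0 V (\<lambda>F. of_bool (reach F u R)) \<le> C / R\<^sup>2"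
    by (rule extrinsic_bound) (rule that)
  have main: "ex 0 V (\<lambda>F. of_bool (reach F 0 R)) \<le> (dg / gap * C) / R\<^sup>2" if V: "finite V" "0 \<in> V" and R: "R > 0" for V R
  proof -
    have "ex 0 V (\<lambda>F. of_bool (reach F 0 R)) \<le> dg / gap * ex 0 (V - {0}) (\<lambda>F. of_bool (reach F 0 R))"
    proof (rule ex_root_le[OF V])
      fix F w assume F: "F(0 \<mapsto> w) \<in> forests V"
      have "reach F 0 R" if r: "reach (F(0 \<mapsto> w)) 0 R"
      proof -
        obtain xs where xs: "chain (F(0 \<mapsto> w)) xs 0" "xs \<noteq> []" "R \<le> dst (hd xs) 0" using r unfolding reach_def by blast
        have "0 \<notin> set xs" using chain_distinct[OF forestsD(3)[OF F] xs(1)] by simp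
        then have "chain F xs 0" by (intro chain_cong[OF xs(1)]) auto
        with xs show ?thesis unfolding reach_def by blast
      qed
      then show "of_bool (reach (F(0 \<mapsto> w)) 0 R) \<le> (of_bool (reach F 0 R) :: real)" by auto
    qed auto
    also have "\<dots> \<le> dg / gap * (C / R\<^sup>2)"
      using V R gap_pos by (intro mult_left_mono C(2)) auto
    finally show ?thesis by simp
  qed
  show thesis by (rule that[OF _ main]) (use C dg_pos gap_pos in auto)
qed

end

section \<open>The wired uniform spanning forest\<close>

lemma lattice_eq: "lattice = \<lparr>verts = UNIV, arcs = {(x, y). y \<in> lnb x}, tail = fst, head = snd\<rparr>"
  by (simp add: lattice_def lnb_def)

lemma lattice_simps [simp]:
  "verts lattice = UNIV" "tail lattice = fst" "head lattice = snd" "a \<in> arcs lattice \<longleftrightarrow> snd a \<in> lnb (fst a)"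
  by (auto simp: lattice_eq case_prod_unfold)

lemma wf_lattice: "wf_digraph lattice"
  by unfold_locales auto

lemma ldist_sym: "ldist x y = ldist y x"
  by (simp add: ldist_def abs_minus_commute)

lemma ldist_int: "ldist x y = real_of_int (\<Sum>i\<in>UNIV. \<bar>x $ i - y $ i\<bar>)"
  by (simp add: ldist_def)

lemma lattice_walk_exists:
  "ldist x (y :: int ^ 'd) = real n \<Longrightarrow> \<exists>p. length p = n \<and> set p \<subseteq> arcs lattice \<and> pre_digraph.cas lattice x p y"
proof (induction n arbitrary: x)
  case 0
  have "\<bar>real_of_int (x $ i - y $ i)\<bar> \<le> ldist x y" for i
    unfolding ldist_def by (rule member_le_sum) auto
  then have "x = y" using 0 by (simp add: vec_eq_iff)
  then show ?case by (intro exI[of _ "[]"]) (simp add: walk_simps)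
next
  case (Suc n)
  have "x \<noteq> y" using Suc.prems by (auto simp: ldist_def)
  then obtain i where i: "x $ i \<noteq> y $ i" by (auto simp: vec_eq_iff)
  define s :: int where "s = sgn (y $ i - x $ i)"
  have s: "s \<in> {1, -1}" "\<bar>x $ i + s - y $ i\<bar> = \<bar>x $ i - y $ i\<bar> - 1" using i by (auto simp: s_def sgn_if)
  define x' where "x' = x + axis i s"
  have x': "x' \<in> lnb x" unfolding lnb_eq x'_def using s(1) by (intro image_eqI[of _ _ "(i, s)"]) auto
  have "ldist x' y = (\<Sum>j\<in>UNIV. \<bar>real_of_int (x $ j - y $ j)\<bar> - (if j = i then 1 else 0))"
    unfolding ldist_def
  proof (rule sum.cong[OF refl])
    fix j
    show "\<bar>real_of_int (x' $ j - y $ j)\<bar> = \<bar>real_of_int (x $ j - y $ j)\<bar> - (if j = i then 1 else 0)"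
    proof (cases "j = i")
      case True
      have "real_of_int \<bar>x $ i + s - y $ i\<bar> = real_of_int (\<bar>x $ i - y $ i\<bar> - 1)" using s(2) by (rule arg_cong)
      then show ?thesis using True by (simp add: x'_def axis_def)
    qed (simp add: x'_def axis_def)
  qed
  also have "\<dots> = ldist x y - 1" by (simp add: ldist_def sum_subtractf)
  finally have "ldist x' y = real n" using Suc.prems by simp
  then obtain p where p: "length p = n" "set p \<subseteq> arcs lattice" "pre_digraph.cas lattice x' p y"
    using Suc.IH by blast
  then show ?case using x' by (intro exI[of _ "(x, x') # p"]) (auto simp: walk_simps)
qed

lemma graph_dist_lattice: "graph_dist lattice x (y :: int ^ 'd) = ereal (ldist x y)"
proof -
  have low: "ldist x y \<le> length p" if "set p \<subseteq> arcs lattice" "pre_digraph.cas lattice x p y" for p :: "((int ^ 'd) \<times> (int ^ 'd)) list" and x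
    using that
  proof (induction p arbitrary: x)
    case Nil
    then show ?case by (simp add: walk_simps ldist_def)
  next
    case (Cons a p)
    then have "ldist (snd a) y \<le> length p" "fst a = x" "snd a \<in> lnb x" by (auto simp: walk_simps)
    then show ?case using ldist_triangle[of x y "snd a"] ldist_lnb[of "snd a" x] by simp
  qed
  have "graph_dist lattice x y = (INF p\<in>{p. pre_digraph.awalk lattice x p y}. ereal (length p))"
    unfolding graph_dist_def wf_digraph.\<mu>_def[OF wf_lattice] wf_digraph.awalk_cost_def[OF wf_lattice]
    by (simp add: sum_list_triv)
  also have "\<dots> = ereal (ldist x y)"
  proof (rule antisym)
    have "real (nat (\<Sum>i\<in>UNIV. \<bar>x $ i - y $ i\<bar>)) = ldist x y" unfolding ldist_int by (simp add: sum_nonneg)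
    then obtain p where p: "real (length p) = ldist x y" "set p \<subseteq> arcs lattice" "pre_digraph.cas lattice x p y"
      using lattice_walk_exists[of x y "nat (\<Sum>i\<in>UNIV. \<bar>x $ i - y $ i\<bar>)"] by metis
    show "(INF p\<in>{p. pre_digraph.awalk lattice x p y}. ereal (length p)) \<le> ereal (ldist x y)"
      by (rule INF_lower2[of p]) (use p in \<open>auto simp: pre_digraph.awalk_def\<close>)
    show "ereal (ldist x y) \<le> (INF p\<in>{p. pre_digraph.awalk lattice x p y}. ereal (length p))"
      using low by (intro INF_greatest) (auto simp: pre_digraph.awalk_def)
  qed
  finally show ?thesis .
qed

text \<open>Distances are integers: if all of them are less than \<open>R\<close>, they are at most
  \<open>\<lceil>R\<rceil> - 1\<close>, and so is the supremum, which then stays below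
  \<open>R\<close>.\<close>

lemma diam_ge_iff:
  "ereal R \<le> diam_ext lattice K \<longleftrightarrow> (\<exists>u\<in>verts K. \<exists>v\<in>verts K. R \<le> ldist u (v :: int ^ 'd))"
proof
  assume "\<exists>u\<in>verts K. \<exists>v\<in>verts K. R \<le> ldist u v"
  then obtain u v where uv: "u \<in> verts K" "v \<in> verts K" "R \<le> ldist u v" by blast
  have "ereal R \<le> graph_dist lattice u v" using uv(3) by (simp add: graph_dist_lattice)
  also have "\<dots> \<le> diam_ext lattice K" unfolding diam_ext_def
    by (rule SUP_upper2[OF uv(1)], rule SUP_upper[OF uv(2)])
  finally show "ereal R \<le> diam_ext lattice K" .
next
  assume le: "ereal R \<le> diam_ext lattice K"
  show "\<exists>u\<in>verts K. \<exists>v\<in>verts K. R \<le> ldist u v"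
  proof (rule ccontr)
    assume no: "\<not> ?thesis"
    have "graph_dist lattice u v \<le> ereal (real_of_int (\<lceil>R\<rceil> - 1))" if "u \<in> verts K" "v \<in> verts K" for u v
    proof -
      have "ldist u v < R" using no that by (meson not_le)
      then have "(\<Sum>i\<in>UNIV. \<bar>u $ i - v $ i\<bar>) < \<lceil>R\<rceil>" unfolding ldist_int by (simp only: less_ceiling_iff)
      then have "(\<Sum>i\<in>UNIV. \<bar>u $ i - v $ i\<bar>) \<le> \<lceil>R\<rceil> - 1" by simp
      then show ?thesis unfolding graph_dist_lattice ldist_int ereal_less_eq by (simp only: of_int_le_iff)
    qed
    then have "diam_ext lattice K \<le> ereal (real_of_int (\<lceil>R\<rceil> - 1))" unfolding diam_ext_def by (intro SUP_least) auto
    with le have "ereal R \<le> ereal (real_of_int (\<lceil>R\<rceil> - 1))" by (rule order_trans)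
    then have "R \<le> real_of_int (\<lceil>R\<rceil> - 1)" by (simp only: ereal_less_eq)
    then show False by linarith
  qed
qed

section \<open>The past as a union of open paths\<close>

fun edges :: "'a list \<Rightarrow> 'a \<Rightarrow> ('a \<times> 'a) list" where
  "edges [] v = []"
| "edges (x # xs) v = (x, hd (xs @ [v])) # edges xs v"

lemma chain_edges: "chain F xs v \<longleftrightarrow> (\<forall>a\<in>set (edges xs v). F (fst a) = Some (snd a))"
  by (induction xs) auto

lemma walk_edges:
  assumes "tail G = fst" "head G = snd"
  shows "pre_digraph.cas G (hd (xs @ [v])) (edges xs v) v"
    and "pre_digraph.awalk_verts G (hd (xs @ [v])) (edges xs v) = xs @ [v]"
  using assms by (induction xs) (auto simp: walk_simps)

lemma edges_walk:
  assumes "tail G = fst" "head G = snd" "pre_digraph.cas G u p v"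
  shows "edges (map fst p) v = p \<and> hd (map fst p @ [v]) = u"
  using assms(3)
proof (induction p arbitrary: u)
  case (Cons a p)
  then show ?case using assms(1,2) by (auto simp: walk_simps prod_eq_iff)
qed (simp add: walk_simps)

definition open_chain :: "('a \<times> 'a \<Rightarrow> bool) \<Rightarrow> 'a list \<Rightarrow> 'a \<Rightarrow> bool" where
  "open_chain \<omega> xs v \<longleftrightarrow> (\<forall>a\<in>set (edges xs v). \<omega> a)"

lemma open_chain_forest: "open_chain (\<lambda>a. F (fst a) = Some (snd a)) xs v \<longleftrightarrow> chain F xs v"
  by (simp add: open_chain_def chain_edges)

text \<open>Stated for arbitrary configurations, because the limit measure lives on all of them.
  Tail and head are the projections, so a simple walk is the list of its vertices.\<close>

lemma past_iff:
  "u \<in> verts (past (config_graph \<omega>) v) \<longleftrightarrow> (\<exists>xs. distinct (xs @ [v]) \<and> hd (xs @ [v]) = u \<and> open_chain \<omega> xs v)"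
proof -
  let ?G = "with_proj (mk_symmetric (config_graph \<omega>))"
  have th: "tail ?G = fst" "head ?G = snd" by simp_all
  have arcs: "{a. \<omega> a} \<subseteq> arcs ?G" by (force simp: parcs_mk_symmetric config_graph_def)
  have V: "verts ?G = UNIV" by (simp add: config_graph_def)
  have "u \<in> verts (past (config_graph \<omega>) v) \<longleftrightarrow> (\<exists>p. pre_digraph.cas ?G u p v \<and> distinct (pre_digraph.awalk_verts ?G u p) \<and> (\<forall>a\<in>set p. \<omega> a))"
    using arcs V by (auto simp: past_def pre_digraph.apath_def pre_digraph.awalk_def config_graph_def)
  also have "\<dots> \<longleftrightarrow> (\<exists>xs. distinct (xs @ [v]) \<and> hd (xs @ [v]) = u \<and> open_chain \<omega> xs v)"
  proof
    assume "\<exists>p. pre_digraph.cas ?G u p v \<and> distinct (pre_digraph.awalk_verts ?G u p) \<and> (\<forall>a\<in>set p. \<omega> a)"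
    then obtain p where p: "pre_digraph.cas ?G u p v" "distinct (pre_digraph.awalk_verts ?G u p)" "\<forall>a\<in>set p. \<omega> a" by blast
    have e: "edges (map fst p) v = p" "hd (map fst p @ [v]) = u" using edges_walk[OF th p(1)] by auto
    have "pre_digraph.awalk_verts ?G u p = map fst p @ [v]" using walk_edges(2)[OF th, of "map fst p" v] unfolding e .
    then show "\<exists>xs. distinct (xs @ [v]) \<and> hd (xs @ [v]) = u \<and> open_chain \<omega> xs v"
      using p e by (intro exI[of _ "map fst p"]) (simp add: open_chain_def)
  next
    assume "\<exists>xs. distinct (xs @ [v]) \<and> hd (xs @ [v]) = u \<and> open_chain \<omega> xs v"
    then obtain xs where xs: "distinct (xs @ [v])" "hd (xs @ [v]) = u" "open_chain \<omega> xs v" by blast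
    then show "\<exists>p. pre_digraph.cas ?G u p v \<and> distinct (pre_digraph.awalk_verts ?G u p) \<and> (\<forall>a\<in>set p. \<omega> a)"
      using walk_edges[OF th, of xs v] by (intro exI[of _ "edges xs v"]) (auto simp: open_chain_def)
  qed
  finally show ?thesis .
qed

section \<open>Open and clopen events, weak limits, exhaustions\<close>

lemma clopen_coordinate: "open {\<omega> :: 'b \<Rightarrow> bool. \<omega> a}" "open {\<omega> :: 'b \<Rightarrow> bool. \<not> \<omega> a}"
proof -
  have c: "continuous_on UNIV (\<lambda>\<omega> :: 'b \<Rightarrow> bool. \<omega> a)" by (rule continuous_on_product_coordinates)
  have "open ((\<lambda>\<omega> :: 'b \<Rightarrow> bool. \<omega> a) -` B)" for B
    using c unfolding continuous_on_open_vimage[OF open_UNIV] by (simp add: Topological_Spaces.open_discrete)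
  from this[of "{True}"] this[of "{False}"]
  show "open {\<omega> :: 'b \<Rightarrow> bool. \<omega> a}" "open {\<omega> :: 'b \<Rightarrow> bool. \<not> \<omega> a}" by (simp_all add: vimage_def)
qed

lemma open_open_chain: "open {\<omega>. open_chain \<omega> xs v}"
proof -
  have "{\<omega>. open_chain \<omega> xs v} = (\<Inter>a\<in>set (edges xs v). {\<omega>. \<omega> a})" by (auto simp: open_chain_def)
  then show ?thesis by (auto intro!: clopen_coordinate)
qed

lemma closed_open_chain: "open {\<omega>. \<not> open_chain \<omega> xs v}"
proof -
  have "{\<omega>. \<not> open_chain \<omega> xs v} = (\<Union>a\<in>set (edges xs v). {\<omega>. \<not> \<omega> a})" by (auto simp: open_chain_def)
  then show ?thesis by (auto intro!: clopen_coordinate)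
qed

lemma open_in_past: "open {\<omega>. u \<in> verts (past (config_graph \<omega>) v)}"
proof -
  have "{\<omega>. u \<in> verts (past (config_graph \<omega>) v)} = (\<Union>xs\<in>{xs. distinct (xs @ [v]) \<and> hd (xs @ [v]) = u}. {\<omega>. open_chain \<omega> xs v})"
    by (auto simp: past_iff)
  then show ?thesis by (auto intro!: open_open_chain)
qed

lemma open_diam_ge: "open {\<omega>. ereal R \<le> diam_ext lattice (past (config_graph \<omega>) (0 :: int ^ 'd))}"
proof -
  have "{\<omega>. ereal R \<le> diam_ext lattice (past (config_graph \<omega>) (0 :: int ^ 'd))} =
    (\<Union>(u, v)\<in>{(u, v). R \<le> ldist u v}. {\<omega>. u \<in> verts (past (config_graph \<omega>) 0)} \<inter> {\<omega>. v \<in> verts (past (config_graph \<omega>) 0)})"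
    by (auto simp: diam_ge_iff)
  then show ?thesis by (auto intro!: open_in_past)
qed

text \<open>The indicator of a clopen set is bounded and continuous. In the product topology the
  events that depend on finitely many arcs are of this kind.\<close>

lemma weak_limit_clopen:
  assumes P: "weak_limit P M" and E: "open E" "open (- E)"
  shows "(\<lambda>n. measure_pmf.expectation (P n) (indicator E)) \<longlonglongrightarrow> measure M E"
proof -
  have M: "prob_space M" "sets M = sets borel" using P by (auto simp: weak_limit_def)
  have sp: "space M = UNIV" using sets_eq_imp_space_eq[OF M(2)] by simp
  have cont: "continuous_on UNIV (indicator E :: _ \<Rightarrow> real)"
    unfolding continuous_on_open_vimage[OF open_UNIV]
  proof (intro allI impI)
    fix B :: "real set"
    have "(indicator E :: _ \<Rightarrow> real) -` B \<inter> UNIV = (if 1 \<in> B then E else {}) \<union> (if 0 \<in> B then - E else {})"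
    proof (rule set_eqI)
      fix x
      show "x \<in> (indicator E :: _ \<Rightarrow> real) -` B \<inter> UNIV \<longleftrightarrow> x \<in> (if 1 \<in> B then E else {}) \<union> (if 0 \<in> B then - E else {})"
        by (cases "x \<in> E") auto
    qed
    then show "open ((indicator E :: _ \<Rightarrow> real) -` B \<inter> UNIV)" using E by auto
  qed
  have bd: "bounded (range (indicator E :: _ \<Rightarrow> real))"
    by (rule boundedI[of _ 1]) (auto simp: indicator_def)
  have lim: "(\<lambda>n. measure_pmf.expectation (P n) f) \<longlonglongrightarrow> (LINT \<omega>|M. f \<omega>)"
    if "continuous_on UNIV f" "bounded (range f)" for f :: "_ \<Rightarrow> real"
    using P that by (simp only: weak_limit_def)
  from lim[OF cont bd] show ?thesis by (simp add: sp)
qed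

lemma filterlim_exhaustion:
  assumes "exhaustion G V" "verts G = UNIV"
  shows "filterlim V (finite_subsets_at_top UNIV) sequentially"
  unfolding filterlim_finite_subsets_at_top
proof (intro allI impI)
  fix X :: "'a set" assume X: "finite X \<and> X \<subseteq> UNIV"
  have V: "\<And>n. finite (V n)" "incseq V" "(\<Union>n. V n) = UNIV" using assms by (auto simp: exhaustion_def)
  obtain N where N: "\<And>x. x \<in> V (N x)" using V(3) by (metis UNIV_I UN_E)
  have "X \<subseteq> V n" if "n \<ge> Max (insert 0 (N ` X))" for n
  proof
    fix x assume "x \<in> X"
    then have "N x \<le> n" using X that by (meson Max_ge finite_imageI finite_insert imageI insertCI order_trans)
    then show "x \<in> V n" using N V(2) by (meson incseqD subsetD)
  qed
  then show "eventually (\<lambda>n. finite (V n) \<and> X \<subseteq> V n \<and> V n \<subseteq> UNIV) sequentially"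
    using V(1) unfolding eventually_sequentially by blast
qed

definition chain_event :: "'a \<Rightarrow> 'a list set \<Rightarrow> ('a \<times> 'a \<Rightarrow> bool) set" where
  "chain_event v L = {\<omega>. \<exists>xs\<in>L. open_chain \<omega> xs v}"

lemma open_chain_event: "open (chain_event v L)"
proof -
  have "chain_event v L = (\<Union>xs\<in>L. {\<omega>. open_chain \<omega> xs v})" by (auto simp: chain_event_def)
  then show ?thesis by (auto intro!: open_open_chain)
qed

lemma closed_chain_event: "finite L \<Longrightarrow> open (- chain_event v L)"
proof -
  assume "finite L"
  have "- chain_event v L = (\<Inter>xs\<in>L. {\<omega>. \<not> open_chain \<omega> xs v})" by (auto simp: chain_event_def)
  then show ?thesis using \<open>finite L\<close> by (auto intro!: closed_open_chain)
qed

theorem theorem1p4: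
  assumes "CARD('d::finite) \<ge> 5"
  shows "\<exists>c C :: real. 0 < c \<and> c \<le> C \<and>
    (\<forall>M :: ((int ^ 'd) \<times> (int ^ 'd) \<Rightarrow> bool) measure. oriented_WUSF lattice M \<longrightarrow>
      (\<forall>R :: real. R \<ge> 1 \<longrightarrow>
        c * R powi (-2)
          \<le> measure M {\<omega>. diam_ext lattice (past (config_graph \<omega>) 0) \<ge> ereal R} \<and>
        measure M {\<omega>. diam_ext lattice (past (config_graph \<omega>) 0) \<ge> ereal R}
          \<le> C * R powi (-2)))"
proof -
  obtain g \<phi> gap \<Phi> where tm: "transient_metric (lnb :: int ^ 'd \<Rightarrow> _) (2 * CARD('d)) g \<phi> gap \<Phi> lray ldist lpsi
      (1 / real (2 * CARD('d))) (real (2 * CARD('d)))"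
    using lattice_transient[where 'd = 'd, OF assms] by blast
  obtain Cb :: real where Cb: "Cb > 0"
    "\<And>R. R \<ge> 1 \<Longrightarrow> \<exists>\<psi> :: int ^ 'd \<Rightarrow> real. (\<forall>x. 0 \<le> \<psi> x \<and> \<psi> x \<le> Cb * R\<^sup>2 \<and>
      (\<Sum>w\<in>lnb x. \<psi> w) + of_bool (ldist x 0 < R) \<le> real (2 * CARD('d)) * \<psi> x)"
    by (rule ball_potential[where 'd = 'd, OF assms]) (rule that)
  interpret transient_metric "lnb :: int ^ 'd \<Rightarrow> _" "2 * CARD('d)" g \<phi> gap \<Phi> lray ldist lpsi
    "1 / real (2 * CARD('d))" "real (2 * CARD('d))" by (rule tm)
  interpret transient_cayley "lnb :: int ^ 'd \<Rightarrow> _" "2 * CARD('d)" g \<phi> gap \<Phi> lray ldist lpsi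
    "1 / real (2 * CARD('d))" "real (2 * CARD('d))" Cb
    by unfold_locales (use Cb in \<open>auto simp: lnb_def ldist_def\<close>)
  obtain c :: real where c: "c > 0"
    "\<And>R. R \<ge> 1 \<Longrightarrow> \<exists>n. eventually (\<lambda>V. c / R\<^sup>2 \<le> ex 0 V (\<lambda>F. of_bool (\<exists>xs\<in>inward n R. chain F xs 0))) (finite_subsets_at_top UNIV)"
    by (rule reach_lower_bound) (rule that)
  obtain C :: real where C: "C > 0"
    "\<And>V R. finite V \<Longrightarrow> 0 \<in> V \<Longrightarrow> R > 0 \<Longrightarrow> ex 0 V (\<lambda>F. of_bool (reach F 0 R)) \<le> C / R\<^sup>2"
    by (rule reach_upper_bound) (rule that)
  have main: "c / R\<^sup>2 \<le> measure M {\<omega>. ereal R \<le> diam_ext lattice (past (config_graph \<omega>) 0)} \<and>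
      measure M {\<omega>. ereal R \<le> diam_ext lattice (past (config_graph \<omega>) 0)} \<le> 4 * C / R\<^sup>2"
    if WM: "oriented_WUSF lattice M" and R: "R \<ge> 1" for M :: "((int ^ 'd) \<times> (int ^ 'd) \<Rightarrow> bool) measure" and R :: real
  proof -
    obtain V where V: "exhaustion lattice V" "weak_limit (\<lambda>n. oriented_UST_wired lattice (V n)) M"
      using WM by (auto simp: oriented_WUSF_def)
    have M: "prob_space M" "sets M = sets borel" using V(2) by (auto simp: weak_limit_def)
    interpret M: prob_space M by (rule M(1))
    have VF: "filterlim V (finite_subsets_at_top UNIV) sequentially"
      by (rule filterlim_exhaustion[OF V(1)]) simp
    have fV: "finite (V n)" for n using V(1) by (auto simp: exhaustion_def)
    have open_sets: "E \<in> sets M" if "open E" for E using that M(2) by simp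
    let ?D = "{\<omega>. ereal R \<le> diam_ext lattice (past (config_graph \<omega>) (0 :: int ^ 'd))}"
    have D: "?D \<in> sets M" by (rule open_sets[OF open_diam_ge])
    have irr: "x \<notin> lnb x" for x :: "int ^ 'd" by (simp add: lnb_def)
    have lim: "(\<lambda>n. ex 0 (V n) (\<lambda>F. of_bool (\<exists>xs\<in>L. chain F xs 0))) \<longlonglongrightarrow> measure M (chain_event 0 L)" if "finite L" for L
    proof -
      have "measure_pmf.expectation (oriented_UST_wired lattice (V n)) (indicator (chain_event 0 L)) =
        ex 0 (V n) (\<lambda>F. of_bool (\<exists>xs\<in>L. chain F xs 0))" for n
        unfolding lattice_eq expectation_oriented_UST[OF irr fV]
        by (simp add: indicator_def chain_event_def open_chain_forest)
      then show ?thesis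
        using weak_limit_clopen[OF V(2) open_chain_event closed_chain_event[OF that], of 0] by simp
    qed
    have lower: "c / R\<^sup>2 \<le> measure M ?D"
    proof -
      obtain n where n: "eventually (\<lambda>V. c / R\<^sup>2 \<le> ex 0 V (\<lambda>F. of_bool (\<exists>xs\<in>inward n R. chain F xs 0))) (finite_subsets_at_top UNIV)"
        using c(2)[OF R] by blast
      have "eventually (\<lambda>k. c / R\<^sup>2 \<le> ex 0 (V k) (\<lambda>F. of_bool (\<exists>xs\<in>inward n R. chain F xs 0))) sequentially"
        by (rule eventually_compose_filterlim[OF n VF])
      then have "c / R\<^sup>2 \<le> measure M (chain_event 0 (inward n R))"
        by (intro tendsto_lowerbound[OF lim[OF finite_inward]]) auto
      also have "\<dots> \<le> measure M ?D"
      proof (rule M.finite_measure_mono[OF _ D], rule subsetI)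
        fix \<omega> assume "\<omega> \<in> chain_event 0 (inward n R)"
        then obtain xs where xs: "xs \<in> inward n R" "open_chain \<omega> xs 0" by (auto simp: chain_event_def)
        have "0 \<in> verts (past (config_graph \<omega>) (0 :: int ^ 'd))"
          unfolding past_iff by (intro exI[of _ "[]"]) (simp add: open_chain_def)
        moreover have "hd xs \<in> verts (past (config_graph \<omega>) 0)"
          unfolding past_iff using xs by (intro exI[of _ xs]) (auto simp: inward_def)
        moreover have "R \<le> ldist 0 (hd xs)" using xs(1) by (simp add: inward_def)
        ultimately show "\<omega> \<in> ?D" by (auto simp: diam_ge_iff)
      qed
      finally show ?thesis .
    qed
    \<comment> \<open>By the triangle inequality through \<open>0\<close>, one of two vertices at
      distance \<open>R\<close> is at distance at least \<open>R / 2\<close> from \<open>0\<close>;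
      this is the origin of the factor 4.\<close>
    define L where "L = {xs :: (int ^ 'd) list. xs \<noteq> [] \<and> R / 2 \<le> ldist (hd xs) 0}"
    have fin: "measure M (chain_event 0 K) \<le> 4 * C / R\<^sup>2" if K: "finite K" "K \<subseteq> L" for K
    proof (rule tendsto_upperbound[OF lim[OF K(1)]])
      have "eventually (\<lambda>n. finite (V n) \<and> {0} \<subseteq> V n \<and> V n \<subseteq> UNIV) sequentially"
        using VF[unfolded filterlim_finite_subsets_at_top, rule_format, of "{0}"] by simp
      then show "eventually (\<lambda>n. ex 0 (V n) (\<lambda>F. of_bool (\<exists>xs\<in>K. chain F xs 0)) \<le> 4 * C / R\<^sup>2) sequentially"
      proof eventually_elim
        case (elim n)
        have "ex 0 (V n) (\<lambda>F. of_bool (\<exists>xs\<in>K. chain F xs 0)) \<le> ex 0 (V n) (\<lambda>F. of_bool (reach F 0 (R / 2)))"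
          using K(2) by (intro ex_mono fV) (auto simp: reach_def L_def)
        also have "\<dots> \<le> C / (R / 2)\<^sup>2" using elim R by (intro C(2)) auto
        finally show ?case by (simp add: power_divide mult.commute)
      qed
    qed simp
    have upper: "measure M ?D \<le> 4 * C / R\<^sup>2"
    proof -
      \<comment> \<open>The event for the infinite family \<open>L\<close> is open, but closedness
        is available only for finite families. It is therefore exhausted by clopen events, whose
        probabilities are limits of finite volume ones.\<close>
      define K where "K n = {xs \<in> L. to_nat xs < n}" for n
      have sub: "K n \<subseteq> from_nat ` {..<n}" for n by (auto simp: K_def image_iff) (metis from_nat_to_nat lessThan_iff)
      have K: "finite (K n)" "K n \<subseteq> L" for n using finite_subset[OF sub[of n]] by (auto simp: K_def)
      have un: "chain_event 0 L = (\<Union>n. chain_event 0 (K n))" by (auto simp: chain_event_def K_def)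
      have "?D \<subseteq> chain_event 0 L"
      proof
        fix \<omega> assume "\<omega> \<in> ?D"
        then obtain u v where uv: "u \<in> verts (past (config_graph \<omega>) (0 :: int ^ 'd))"
          "v \<in> verts (past (config_graph \<omega>) 0)" "R \<le> ldist u v" by (auto simp: diam_ge_iff)
        have "R \<le> ldist u 0 + ldist v 0" using uv(3) ldist_triangle[of u v 0] ldist_sym[of v 0] by linarith
        then have "R / 2 \<le> ldist u 0 \<or> R / 2 \<le> ldist v 0" by linarith
        then obtain w where w: "w \<in> verts (past (config_graph \<omega>) 0)" "R / 2 \<le> ldist w 0" using uv by blast
        then obtain xs where xs: "hd (xs @ [0]) = w" "open_chain \<omega> xs 0" by (auto simp: past_iff)
        have "xs \<noteq> []" using xs(1) w(2) R by (auto simp: ldist_def)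
        then have "xs \<in> L" using xs(1) w(2) by (auto simp: L_def)
        then show "\<omega> \<in> chain_event 0 L" using xs(2) by (auto simp: chain_event_def)
      qed
      then have "measure M ?D \<le> measure M (chain_event 0 L)"
        by (intro M.finite_measure_mono open_sets open_chain_event)
      moreover have "(\<lambda>n. measure M (chain_event 0 (K n))) \<longlonglongrightarrow> measure M (chain_event 0 L)"
        unfolding un
      proof (rule M.finite_Lim_measure_incseq)
        show "range (\<lambda>n. chain_event 0 (K n)) \<subseteq> sets M" by (rule image_subsetI) (rule open_sets[OF open_chain_event])
        show "incseq (\<lambda>n. chain_event 0 (K n))" by (rule incseq_SucI) (auto simp: chain_event_def K_def)
      qed
      then have "measure M (chain_event 0 L) \<le> 4 * C / R\<^sup>2"
        by (rule LIMSEQ_le_const2) (intro exI[of _ 0] allI impI fin K)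
      ultimately show ?thesis by linarith
    qed
    show ?thesis using lower upper by blast
  qed
  have powi: "R powi (-2) = 1 / R\<^sup>2" for R :: real by (simp add: power_int_minus inverse_eq_divide)
  show ?thesis
  proof (rule exI[of _ c], rule exI[of _ "max c (4 * C)"], intro conjI allI impI)
    fix M :: "((int ^ 'd) \<times> (int ^ 'd) \<Rightarrow> bool) measure" and R :: real
    assume M: "oriented_WUSF lattice M" and R: "R \<ge> 1"
    show "c * R powi (-2) \<le> measure M {\<omega>. ereal R \<le> diam_ext lattice (past (config_graph \<omega>) 0)}"
      using main[OF M R] by (simp add: powi)
    have "measure M {\<omega>. ereal R \<le> diam_ext lattice (past (config_graph \<omega>) 0)} \<le> 4 * C / R\<^sup>2"
      using main[OF M R] by blast
    also have "\<dots> \<le> max c (4 * C) * R powi (-2)" unfolding powi by (simp add: divide_right_mono)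
    finally show "measure M {\<omega>. ereal R \<le> diam_ext lattice (past (config_graph \<omega>) 0)} \<le> max c (4 * C) * R powi (-2)" .
  qed (use c in auto)
qed

end
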